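(* Let $n\ge2$, let $\Omega\subset\mathbb R^n$ be open, and let $p\in[1,\infty)$. Let $u\in W^{1,p}_{0,\tau}(\Omega)$, let $\mu$ be the distribution of $u$, and let $v_\mu$ be the circular rearrangement associated with $\mu$. Then $v_\mu|_{\Omega^s}\in W^{1,p}_{0,\tau}(\Omega^s)$.
   Context: Points of $\mathbb R^n$ are written $(x,y)$, $x\in\mathbb R^2$, $y\in\mathbb R^{n-2}$. $\hat x=x/|x|$ for $x\ne 0$; $e_1=(1,0)$; $\partial D(r)=\{x\in\mathbb R^2:|x|=r\}$; $\mathbb S^1=\partial D(1)$. $A\subset\subset B$ means that $A$ is compactly contained in $B$. For $E\subset\mathbb R^n$ measurable, the slice is $E_{(r,y)}=\{x\in\partial D(r):(x,y)\in E\}$. The circular symmetrization of $\Omega$ is the open set $\Omega^s=\{(x,y)\in(\mathbb R^2\setminus\{0\})\times\mathbb R^{n-2}: 2|x|\arccos(\hat x\cdot e_1)<\mathcal H^1(\Omega_{(|x|,y)})\}$. For an open set $U$: $\Pi_{n-1}(U)=\{(r,y)\in(0,\infty)\times\mathbb R^{n-2}:\mathcal H^1(U_{(r,y)})\ne0\}$ and $\Pi^{\rm a}_{n-1}(U)=\{(r,y)\in\Pi_{n-1}(U):\mathcal H^1(U_{(r,y)})=2\pi r\}$. $\Phi_n(r,y,\omega)=(r\omega,y)$ for $(r,y,\omega)\in(0,\infty)\times\mathbb R^{n-2}\times\mathbb S^1$. For $w:U\to\mathbb R$, $w_0:\Phi_n(\Pi_{n-1}(U)\times\mathbb S^1)\to\mathbb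 R$ equals $w$ on $U$ and $0$ on $\Phi_n(\Pi_{n-1}(U)\times\mathbb S^1)\setminus U$. $w\in W^{1,p}_{0,\tau}(U)$ means: $w_0\in W^{1,p}(\Phi_n(A\times\mathbb S^1))$ for every open $A\subset\subset\Pi_{n-1}(U)$, and $w\ge0$ $\mathcal L^n$-a.e. in $U\setminus\Phi_n(\Pi^{\rm a}_{n-1}(U)\times\mathbb S^1)$. The distribution of $u$ is $\mu(r,y,t)=\mathcal H^1(\{u_0>t\}_{(r,y)})$ for $(r,y,t)\in\Pi_{n-1}(\Omega)\times\mathbb R$, and $v_\mu:\Phi_n(\Pi_{n-1}(\Omega)\times\mathbb S^1)\to\overline{\mathbb R}$ is $v_\mu(x,y)=\inf\{t\in\mathbb R:\mu(|x|,y,t)\le 2|x|\arccos(\hat x\cdot e_1)\}$ (finite except possibly on the null set $\{x_2=0\}$; functions are identified when equal a.e.). *)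

theory Defs
  imports "HOL-Analysis.Analysis"
begin

section \<open>One-dimensional Hausdorff measure\<close>

text \<open>As an outer measure, hence defined on every set. The boundedness condition is needed because
  \<^const>\<open>diameter\<close> is unspecified on unbounded sets.\<close>

definition hausdorff1 :: "'a::metric_space set \<Rightarrow> ennreal" where
  "hausdorff1 E =
     (SUP \<delta>\<in>{0::real<..}.
        INF C\<in>{C :: nat \<Rightarrow> 'a set. E \<subseteq> (\<Union>k. C k) \<and> (\<forall>k. bounded (C k) \<and> diameter (C k) \<le> \<delta>)}.
          (\<Sum>k. ennreal (diameter (C k))))"

section \<open>Sobolev spaces\<close>

primrec C_class :: "nat \<Rightarrow> (real ^ 'n::finite \<Rightarrow> real) \<Rightarrow> bool" where
  "C_class 0 f \<longleftrightarrow> continuous_on UNIV f"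
| "C_class (Suc m) f \<longleftrightarrow>
     (\<forall>z. f differentiable (at z)) \<and> (\<forall>k. C_class m (\<lambda>z. frechet_derivative f (at z) (axis k 1)))"

definition test_function :: "(real ^ 'n::finite) set \<Rightarrow> (real ^ 'n \<Rightarrow> real) \<Rightarrow> bool" where
  "test_function V \<phi> \<longleftrightarrow>
     (\<forall>m. C_class m \<phi>) \<and> compact (closure {z. \<phi> z \<noteq> 0}) \<and> closure {z. \<phi> z \<noteq> 0} \<subseteq> V"

definition in_Lp :: "real \<Rightarrow> (real ^ 'n::finite) set \<Rightarrow> (real ^ 'n \<Rightarrow> real) \<Rightarrow> bool" where
  "in_Lp p V w \<longleftrightarrow>
     w \<in> borel_measurable (lebesgue_on V) \<and> integrable (lebesgue_on V) (\<lambda>z. \<bar>w z\<bar> powr p)"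

definition weak_partial ::
  "(real ^ 'n::finite) set \<Rightarrow> 'n \<Rightarrow> (real ^ 'n \<Rightarrow> real) \<Rightarrow> (real ^ 'n \<Rightarrow> real) \<Rightarrow> bool" where
  "weak_partial V k w g \<longleftrightarrow>
     (\<forall>\<phi>. test_function V \<phi> \<longrightarrow>
        integral\<^sup>L (lebesgue_on V) (\<lambda>z. w z * frechet_derivative \<phi> (at z) (axis k 1))
          = - integral\<^sup>L (lebesgue_on V) (\<lambda>z. g z * \<phi> z))"

definition in_W1p :: "real \<Rightarrow> (real ^ 'n::finite) set \<Rightarrow> (real ^ 'n \<Rightarrow> real) \<Rightarrow> bool" where
  "in_W1p p V w \<longleftrightarrow> in_Lp p V w \<and> (\<forall>k. \<exists>g. in_Lp p V g \<and> weak_partial V k w g)"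

section \<open>Cylindrical coordinates\<close>

text \<open>The space \<open>\<real>\<^sup>n\<close> is \<^typ>\<open>real ^ 'n\<close> with \<open>n = CARD('n)\<close>. The factor \<open>\<real>\<^sup>2\<close> is given by two distinct
  coordinates \<open>i\<close>, \<open>j\<close>, in this order. Since a type cannot represent \<open>\<real>\<^sup>n\<^sup>-\<^sup>2\<close> for \<open>n = 2\<close>, this factor is the
  subspace of \<open>\<real>\<^sup>n\<close> on which the coordinates \<open>i\<close> and \<open>j\<close> vanish.\<close>

definition yspace :: "'n::finite \<Rightarrow> 'n \<Rightarrow> (real ^ 'n) set" where
  "yspace i j = {y. y $ i = 0 \<and> y $ j = 0}"

definition emb :: "'n::finite \<Rightarrow> 'n \<Rightarrow> real ^ 2 \<Rightarrow> real ^ 'n \<Rightarrow> real ^ 'n" where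
  "emb i j x y = (\<chi> k. if k = i then x $ 1 else if k = j then x $ 2 else y $ k)"

definition xpart :: "'n::finite \<Rightarrow> 'n \<Rightarrow> real ^ 'n \<Rightarrow> real ^ 2" where
  "xpart i j z = vector [z $ i, z $ j]"

definition ypart :: "'n::finite \<Rightarrow> 'n \<Rightarrow> real ^ 'n \<Rightarrow> real ^ 'n" where
  "ypart i j z = (\<chi> k. if k = i \<or> k = j then 0 else z $ k)"

lemma ypart_in_yspace: "ypart i j z \<in> yspace i j"
  by (simp add: ypart_def yspace_def)

lemma emb_xpart_ypart: "emb i j (xpart i j z) (ypart i j z) = z"
  by (simp add: emb_def xpart_def ypart_def vec_eq_iff)

lemma parts_emb:
  assumes "i \<noteq> j"
  shows "xpart i j (emb i j x y) = x"
    and "y \<in> yspace i j \<Longrightarrow> ypart i j (emb i j x y) = y"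
  using assms by (auto simp: emb_def xpart_def ypart_def yspace_def vec_eq_iff forall_2 vector_2)

definition slice :: "'n::finite \<Rightarrow> 'n \<Rightarrow> (real ^ 'n) set \<Rightarrow> real \<times> (real ^ 'n) \<Rightarrow> (real ^ 2) set" where
  "slice i j E = (\<lambda>(r, y). {x \<in> sphere 0 r. emb i j x y \<in> E})"

definition Phi :: "'n::finite \<Rightarrow> 'n \<Rightarrow> (real \<times> (real ^ 'n)) \<times> (real ^ 2) \<Rightarrow> real ^ 'n" where
  "Phi i j = (\<lambda>((r, y), \<omega>). emb i j (r *\<^sub>R \<omega>) y)"

definition Pi_proj :: "'n::finite \<Rightarrow> 'n \<Rightarrow> (real ^ 'n) set \<Rightarrow> (real \<times> (real ^ 'n)) set" where
  "Pi_proj i j U = {q \<in> {0<..} \<times> yspace i j. hausdorff1 (slice i j U q) \<noteq> 0}"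

definition Pi_full :: "'n::finite \<Rightarrow> 'n \<Rightarrow> (real ^ 'n) set \<Rightarrow> (real \<times> (real ^ 'n)) set" where
  "Pi_full i j U = {q \<in> Pi_proj i j U. hausdorff1 (slice i j U q) = ennreal (2 * pi * fst q)}"

text \<open>The length of the open circular arc centred at \<open>|x| e\<^sub>1\<close> with endpoint \<open>x\<close>;
  here \<^term>\<open>sgn x\<close> is \<open>x / |x|\<close>.\<close>

definition arc_len :: "real ^ 2 \<Rightarrow> real" where
  "arc_len x = 2 * norm x * arccos (sgn x \<bullet> axis 1 1)"

definition circ_sym :: "'n::finite \<Rightarrow> 'n \<Rightarrow> (real ^ 'n) set \<Rightarrow> (real ^ 'n) set" where
  "circ_sym i j \<Omega> =
     {z. xpart i j z \<noteq> 0 \<and>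
         ennreal (arc_len (xpart i j z)) < hausdorff1 (slice i j \<Omega> (norm (xpart i j z), ypart i j z))}"

section \<open>The space \<open>W\<^sup>1\<^sup>,\<^sup>p\<^sub>0\<^sub>,\<^sub>\<tau>\<close> and the circular rearrangement\<close>

text \<open>Only the values of \<open>zero_ext U w\<close> on \<open>\<Phi>\<^sub>n(\<Pi>\<^sub>n\<^sub>-\<^sub>1(U) \<times> S\<^sup>1)\<close> are ever used.\<close>

definition zero_ext :: "(real ^ 'n::finite) set \<Rightarrow> (real ^ 'n \<Rightarrow> real) \<Rightarrow> real ^ 'n \<Rightarrow> real" where
  "zero_ext U w z = (if z \<in> U then w z else 0)"

text \<open>Openness of \<open>A\<close> is relative to \<open>(0,\<infinity>) \<times> \<real>\<^sup>n\<^sup>-\<^sup>2\<close>, in the above representation of \<open>\<real>\<^sup>n\<^sup>-\<^sup>2\<close>.\<close>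

definition in_W1p_0tau ::
  "'n::finite \<Rightarrow> 'n \<Rightarrow> real \<Rightarrow> (real ^ 'n) set \<Rightarrow> (real ^ 'n \<Rightarrow> real) \<Rightarrow> bool" where
  "in_W1p_0tau i j p U w \<longleftrightarrow>
     (\<forall>A. openin (top_of_set ({0<..} \<times> yspace i j)) A \<and> compact (closure A)
            \<and> closure A \<subseteq> Pi_proj i j U
          \<longrightarrow> in_W1p p (Phi i j ` (A \<times> sphere 0 1)) (zero_ext U w)) \<and>
     (AE z in lebesgue. z \<in> U - Phi i j ` (Pi_full i j U \<times> sphere 0 1) \<longrightarrow> 0 \<le> w z)"

definition distribution ::
  "'n::finite \<Rightarrow> 'n \<Rightarrow> (real ^ 'n) set \<Rightarrow> (real ^ 'n \<Rightarrow> real) \<Rightarrow> real \<times> (real ^ 'n) \<Rightarrow> real \<Rightarrow> ennreal" where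
  "distribution i j \<Omega> u q t =
     hausdorff1 (slice i j {z \<in> Phi i j ` (Pi_proj i j \<Omega> \<times> sphere 0 1). zero_ext \<Omega> u z > t} q)"

definition circ_rearr ::
  "'n::finite \<Rightarrow> 'n \<Rightarrow> (real \<times> (real ^ 'n) \<Rightarrow> real \<Rightarrow> ennreal) \<Rightarrow> real ^ 'n \<Rightarrow> ereal" where
  "circ_rearr i j \<mu> z =
     Inf (ereal ` {t. \<mu> (norm (xpart i j z), ypart i j z) t \<le> ennreal (arc_len (xpart i j z))})"

text \<open>Membership for extended-real functions, as almost-everywhere equivalence classes:
  almost everywhere finite on \<open>U\<close>, with a real representative in the space (\<^const>\<open>real_of_ereal\<close>
  sends infinite values to \<open>0\<close>).\<close>

definition ereal_in_W1p_0tau ::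
  "'n::finite \<Rightarrow> 'n \<Rightarrow> real \<Rightarrow> (real ^ 'n) set \<Rightarrow> (real ^ 'n \<Rightarrow> ereal) \<Rightarrow> bool" where
  "ereal_in_W1p_0tau i j p U v \<longleftrightarrow>
     (AE z in lebesgue. z \<in> U \<longrightarrow> \<bar>v z\<bar> \<noteq> \<infinity>) \<and> in_W1p_0tau i j p U (\<lambda>z. real_of_ereal (v z))"

end

theory Submission
  imports Defs
begin

text \<open>
  On almost every circle \<open>|x| = r\<close>, \<open>y\<close> fixed, \<open>u\<close> is replaced by its symmetric decreasing rearrangement.
  Membership in \<open>W\<^sup>1\<^sup>,\<^sup>p\<close> is detected through difference quotients: it suffices that the quotients
  \<open>D\<^sub>h v\<close> along the rotations, the dilations of the plane and the translations in \<open>y\<close> satisfy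
  \<open>\<integral> (|D\<^sub>h v| - M)\<^sup>+ \<le> 4 \<integral> (|G| - M/2)\<^sup>+\<close> for all \<open>M \<ge> 0\<close>, where \<open>G\<close> is the derivative of \<open>u\<close> along the
  flow. This family of inequalities gives equi-integrability, hence a weak \<open>L\<^sup>1\<close> limit for every
  \<open>p \<ge> 1\<close> including \<open>p = 1\<close>, and since \<open>|s|\<^sup>p\<close> is comparable to a superposition of the functions
  \<open>(|s| - k)\<^sup>+\<close>, it also puts the limit into \<open>L\<^sup>p\<close>.

  Dilations and translations map circles to circles, and rearrangement contracts \<open>\<integral> (|v - w| - M)\<^sup>+\<close>
  on them. For rotations, \<open>u\<close> is absolutely continuous on almost every circle; if the rearrangement drops
  from \<open>b\<close> to \<open>a\<close> between two angles at distance at most \<open>h\<close>, then the strip \<open>{a < u < b}\<close> of the circle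
  has angular measure at most \<open>2h\<close> and \<open>u\<close> has to cross it, so that \<open>b - a\<close> is at most the integral of
  \<open>|G|\<close> over the strip, hence at most \<open>hM\<close> plus the integral of \<open>(|G| - M/2)\<^sup>+\<close>. Cartesian derivatives
  are recovered from the radial and the angular one because the cylinders in question stay away from
  \<open>x = 0\<close>.
\<close>

section \<open>Smooth bump functions\<close>

text \<open>Only membership is claimed, so no sharp Polya-Szego inequality is needed and constants
  may be lost. They are lost for rotations: on the strip, of angular measure at most 2h, the modulus
  of \<open>G\<close> is at most M/2 plus its excess over M/2, and the first part integrates to at
  most hM. The factor 4 arises when the drops are integrated over the starting angle, since a given
  point of the circle lies in the strips of a set of starting angles of measure at most 4h.
  Dilations and translations allow constant 1 and level M, and are weakened to the same form.
  Besides giving the sign of the result, the sign condition on \<open>u\<close> makes the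
  rearrangement of the zero extension vanish off the symmetrized set, so that it is itself the zero
  extension of the restricted function. Symmetrization changes no slice length, so the admissible
  cylinders are the same for both sets. Slice lengths are Hausdorff measures by definition and have
  to be computed as radius times angular measure.\<close>

lemma C_class_Suc_has_derivative:
  assumes "C_class (Suc m) f"
  shows "(f has_derivative frechet_derivative f (at z)) (at z)"
  using assms frechet_derivative_works by auto

lemma C_class_continuous: "C_class m f \<Longrightarrow> continuous_on UNIV f"
proof (cases m)
  case (Suc n)
  then show "C_class m f \<Longrightarrow> continuous_on UNIV f"
    by (metis C_class.simps(2) continuous_at_imp_continuous_on differentiable_imp_continuous_within)
qed simp

lemma C_class_SucD: "C_class (Suc m) f \<Longrightarrow> C_class m f"
proof (induction m arbitrary: f)
  case 0
  then show ?case using C_class_continuous[OF 0] by simp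
next
  case (Suc m)
  then show ?case by auto
qed

lemma C_class_SucI:
  assumes "\<And>z. (f has_derivative D z) (at z)" and "\<And>k. C_class m (\<lambda>z. D z (axis k 1))"
  shows "C_class (Suc m) f"
proof -
  have "frechet_derivative f (at z) = D z" for z
    using frechet_derivative_at[OF assms(1)] by simp
  then show ?thesis using assms by (auto simp: differentiable_def)
qed

lemma C_class_const: "C_class m (\<lambda>z. c)"
proof (induction m arbitrary: c)
  case (Suc m)
  show ?case by (rule C_class_SucI[where D="\<lambda>z v. 0"]) (auto intro!: derivative_eq_intros Suc)
qed simp

lemma C_class_add: "C_class m f \<Longrightarrow> C_class m g \<Longrightarrow> C_class m (\<lambda>z. f z + g z)"
proof (induction m arbitrary: f g)
  case 0 then show ?case by (auto intro!: continuous_intros)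
next
  case (Suc m)
  show ?case
    by (rule C_class_SucI[where D="\<lambda>z v. frechet_derivative f (at z) v + frechet_derivative g (at z) v"])
       (use Suc.prems in \<open>auto intro!: has_derivative_add Suc.IH simp del: C_class.simps(2)
         intro: C_class_Suc_has_derivative\<close>, use Suc.prems in auto)
qed

lemma C_class_mult: "C_class m f \<Longrightarrow> C_class m g \<Longrightarrow> C_class m (\<lambda>z. f z * g z)"
proof (induction m arbitrary: f g)
  case 0 then show ?case by (auto intro!: continuous_intros)
next
  case (Suc m)
  have "C_class m (\<lambda>z. f z * frechet_derivative g (at z) (axis k 1) + frechet_derivative f (at z) (axis k 1) * g z)" for k
    using Suc.prems C_class_SucD[OF Suc.prems(1)] C_class_SucD[OF Suc.prems(2)]
    by (intro C_class_add Suc.IH) auto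
  then show ?case
    by (intro C_class_SucI[where D="\<lambda>z v. f z * frechet_derivative g (at z) v + frechet_derivative f (at z) v * g z"]
         has_derivative_mult C_class_Suc_has_derivative[OF Suc.prems(1)]
         C_class_Suc_has_derivative[OF Suc.prems(2)])
qed

lemma C_class_sum: "(\<And>k. k \<in> I \<Longrightarrow> C_class m (f k)) \<Longrightarrow> C_class m (\<lambda>z. \<Sum>k\<in>I. f k z)"
  by (induction I rule: infinite_finite_induct) (auto intro: C_class_const C_class_add)

lemma C_class_prod: "(\<And>k. k \<in> I \<Longrightarrow> C_class m (f k)) \<Longrightarrow> C_class m (\<lambda>z. \<Prod>k\<in>I. f k z)"
  by (induction I rule: infinite_finite_induct) (auto intro: C_class_const C_class_mult)

lemma C_class_nth: "C_class m (\<lambda>z. z $ k)"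
proof (cases m)
  case 0 then show ?thesis by (auto intro!: continuous_intros)
next
  case (Suc m')
  show ?thesis unfolding Suc
    by (rule C_class_SucI[where D="\<lambda>z v. v $ k"])
       (auto intro!: bounded_linear_imp_has_derivative bounded_linear_vec_nth C_class_const)
qed

lemma has_derivative_partials:
  fixes f :: "real ^ 'n::finite \<Rightarrow> real"
  assumes "(f has_derivative D) (at z)"
  shows "D v = (\<Sum>k\<in>UNIV. v $ k * D (axis k 1))"
proof -
  interpret linear D by (rule has_derivative_linear[OF assms])
  have "v = (\<Sum>k\<in>UNIV. v $ k *\<^sub>R axis k 1)"
    by (simp add: vec_eq_iff axis_def if_distrib[of "(*) _"] cong: if_cong)
  then have "D v = D (\<Sum>k\<in>UNIV. v $ k *\<^sub>R axis k 1)" by simp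
  then show ?thesis by (simp add: sum scaleR)
qed

text \<open>Induction over all \<open>f\<close> at once: the derivative of the composite in a
  coordinate direction is a fixed linear combination of partial derivatives of \<open>f\<close>,
  composed with the same affine map.\<close>

lemma C_class_affine_comp:
  fixes A :: "real ^ 'n ^ 'n"
  assumes "C_class m f" shows "C_class m (\<lambda>z. f (A *v z + b))"
  using assms
proof (induction m arbitrary: f)
  case 0
  have "continuous_on UNIV (\<lambda>z. A *v z + b)"
    by (intro continuous_intros linear_continuous_on matrix_vector_mul_bounded_linear)
  then show ?case using 0 by (auto intro: continuous_on_compose2)
next
  case (Suc m)
  have 1: "((\<lambda>z. f (A *v z + b)) has_derivative (\<lambda>v. frechet_derivative f (at (A *v z + b)) (A *v v))) (at z)" for z
    by (rule has_derivative_compose[OF _ C_class_Suc_has_derivative[OF Suc.prems]])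
       (auto intro!: derivative_eq_intros bounded_linear_imp_has_derivative matrix_vector_mul_bounded_linear)
  have 2: "frechet_derivative f (at y) (A *v axis k 1) =
     (\<Sum>l\<in>UNIV. (A *v axis k 1) $ l * frechet_derivative f (at y) (axis l 1))" for y k
    by (rule has_derivative_partials[OF C_class_Suc_has_derivative[OF Suc.prems]])
  have "C_class m (\<lambda>z. frechet_derivative f (at (A *v z + b)) (A *v axis k 1))" for k
    unfolding 2 using Suc.prems
    by (intro C_class_sum C_class_mult C_class_const Suc.IH) auto
  then show ?case using 1 by (rule C_class_SucI[rotated])
qed

text \<open>The whole sequence of derivatives is a parameter because differentiating
  \<open>d n\<close> leads to \<open>d (Suc n)\<close>, so the induction must cover all
  \<open>n\<close>.\<close>

lemma C_class_real_comp:
  fixes d :: "nat \<Rightarrow> real \<Rightarrow> real"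
  assumes "\<And>n x. (d n has_real_derivative d (Suc n) x) (at x)"
    and "\<And>m. C_class m g"
  shows "C_class m (\<lambda>z. d n (g z))"
proof (induction m arbitrary: n)
  case 0
  have "continuous_on UNIV (d n)"
    using assms(1) by (meson DERIV_continuous_on has_field_derivative_at_within)
  then show ?case using C_class_continuous[OF assms(2)]
    by (auto intro: continuous_on_compose2)
next
  case (Suc m)
  have "((\<lambda>z. d n (g z)) has_derivative (\<lambda>v. d (Suc n) (g z) * frechet_derivative g (at z) v)) (at z)" for z
    using has_derivative_compose[OF C_class_Suc_has_derivative[OF assms(2)]
        assms(1)[unfolded has_field_derivative_def]] by simp
  moreover have "C_class m (\<lambda>z. d (Suc n) (g z) * frechet_derivative g (at z) (axis k 1))" for k
    using assms(2)[of "Suc m"] by (intro C_class_mult Suc) simp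
  ultimately show ?case by (rule C_class_SucI)
qed

text \<open>The \<open>n\<close>-th derivative of \<open>exp (-1/x)\<close> is \<open>q\<^sub>n(1/x) exp (-1/x)\<close> with \<open>q\<^sub>n\<^sub>+\<^sub>1 = X\<^sup>2 (q\<^sub>n - q\<^sub>n')\<close>.\<close>

primrec flat_poly :: "nat \<Rightarrow> real poly" where
  "flat_poly 0 = 1"
| "flat_poly (Suc n) = [:0, 0, 1:] * (flat_poly n - pderiv (flat_poly n))"

definition flat :: "nat \<Rightarrow> real \<Rightarrow> real" where
  "flat n x = (if 0 < x then poly (flat_poly n) (1 / x) * exp (- (1 / x)) else 0)"

lemma poly_exp_neg_tendsto_0: "((\<lambda>x::real. poly q x * exp (- x)) \<longlongrightarrow> 0) at_top"
proof -
  have "((\<lambda>x. \<Sum>k\<le>degree q. coeff q k * (x ^ k / exp x)) \<longlongrightarrow> (\<Sum>k\<le>degree q. coeff q k * 0)) at_top"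
    by (intro tendsto_intros tendsto_power_div_exp_0)
  then show ?thesis
    by (simp add: poly_altdef sum_distrib_right exp_minus divide_inverse mult.assoc)
qed

lemma flat_has_derivative: "(flat n has_real_derivative flat (Suc n) x) (at x)"
proof -
  consider "x < 0" | "x = 0" | "0 < x" by linarith
  then show ?thesis
  proof cases
    case 1
    have "((\<lambda>_. 0) has_real_derivative 0) (at x)" by simp
    then have "(flat n has_real_derivative 0) (at x)"
      by (rule DERIV_cong_ev[THEN iffD1, rotated -1])
         (use 1 in \<open>auto simp: flat_def eventually_nhds intro!: exI[of _ "{..<0}"]\<close>)
    then show ?thesis using 1 by (simp add: flat_def)
  next
    case 2
    have "((\<lambda>h. flat n h / h) \<longlongrightarrow> 0) (at_left 0)"
      by (rule Lim_transform_eventually[OF tendsto_const])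
         (auto simp: flat_def eventually_at_filter)
    \<comment> \<open>After substituting 1/h, the extra factor 1/h of the difference quotient
      multiplies the polynomial by X, which is \<open>pCons 0\<close>.\<close>
    moreover have "((\<lambda>h. flat n h / h) \<longlongrightarrow> 0) (at_right 0)"
    proof (rule Lim_transform_eventually)
      show "((\<lambda>h::real. poly (pCons 0 (flat_poly n)) (inverse h) * exp (- inverse h)) \<longlongrightarrow> 0) (at_right 0)"
        by (rule filterlim_compose[OF poly_exp_neg_tendsto_0 filterlim_inverse_at_top_right])
      show "\<forall>\<^sub>F h in at_right 0. poly (pCons 0 (flat_poly n)) (inverse h) * exp (- inverse h) = flat n h / h"
        by (auto simp: flat_def eventually_at_filter field_simps)
    qed
    ultimately have "((\<lambda>h. flat n h / h) \<longlongrightarrow> 0) (at 0)"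
      by (simp add: filterlim_split_at)
    then show ?thesis using 2 by (simp add: DERIV_def flat_def)
  next
    case 3
    have "((\<lambda>x. poly (flat_poly n) (1 / x) * exp (- (1 / x))) has_real_derivative flat (Suc n) x) (at x)"
      by (rule derivative_eq_intros poly_DERIV DERIV_chain2[where f="poly _"] refl | use 3 in force)+
         (use 3 in \<open>simp add: flat_def field_simps power2_eq_square\<close>)
    then show ?thesis
      by (rule DERIV_cong_ev[THEN iffD1, rotated -1])
         (use 3 in \<open>auto simp: flat_def eventually_nhds intro!: exI[of _ "{0<..}"]\<close>)
  qed
qed

lemma flat_0: "flat 0 x = (if 0 < x then exp (- (1 / x)) else 0)"
  by (simp add: flat_def)

text \<open>A smooth substitute for the indicator of \<open>box a b\<close>: larger \<open>m\<close>
  gives steeper flanks while the support stays in the closed box.\<close>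

definition bump :: "real ^ 'n::finite \<Rightarrow> real ^ 'n \<Rightarrow> real \<Rightarrow> real ^ 'n \<Rightarrow> real" where
  "bump a b m z = (\<Prod>k\<in>UNIV. flat 0 (m * (z $ k - a $ k)) * flat 0 (m * (b $ k - z $ k)))"

lemma C_class_bump: "C_class l (bump a b m)"
proof -
  have "C_class l (\<lambda>z. flat 0 (m * (z $ k - a $ k)))" for k l
    by (rule C_class_real_comp[where d=flat, OF flat_has_derivative])
       (use C_class_mult[OF C_class_const C_class_add[OF C_class_nth C_class_const], of _ m k "- (a $ k)"] in simp)
  moreover have "C_class l (\<lambda>z. flat 0 (m * (b $ k - z $ k)))" for k l
  proof (rule C_class_real_comp[where d=flat, OF flat_has_derivative])
    show "C_class l (\<lambda>z. m * (b $ k - z $ k))" for l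
      using C_class_mult[OF C_class_const C_class_add[OF C_class_mult[OF C_class_const C_class_nth] C_class_const],
          of l m "-1" k "b $ k"] by (simp add: algebra_simps)
  qed
  ultimately show ?thesis unfolding bump_def[abs_def] by (intro C_class_prod C_class_mult)
qed

lemma bump_eq_0: "0 \<le> m \<Longrightarrow> z \<notin> box a b \<Longrightarrow> bump a b m z = 0"
proof -
  assume "0 \<le> m" "z \<notin> box a b"
  then obtain k where "m * (z $ k - a $ k) \<le> 0 \<or> m * (b $ k - z $ k) \<le> 0"
    by (force simp: mem_box_cart not_less mult_le_0_iff)
  then show ?thesis by (auto simp: bump_def flat_0 intro!: exI[of _ k])
qed

lemma flat_0_bounds: "0 \<le> flat 0 x" "flat 0 x \<le> 1"
  by (auto simp: flat_0)

lemma bump_bounds: "0 \<le> bump a b m z" "bump a b m z \<le> 1"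
  by (auto simp: bump_def intro!: prod_nonneg prod_le_1 mult_nonneg_nonneg mult_le_one flat_0_bounds)

lemma flat_0_tendsto: "(\<lambda>m. flat 0 (real m * x)) \<longlonglongrightarrow> (if 0 < x then 1 else 0)"
proof (cases "0 < x")
  case True
  have "(\<lambda>m. exp (- (1 / x) * (1 / real m))) \<longlonglongrightarrow> exp (- (1 / x) * 0)"
    by (intro tendsto_intros lim_1_over_n)
  then show ?thesis
    by (rule Lim_transform_eventually[where g="\<lambda>m. flat 0 (real m * x)", THEN tendsto_eq_rhs])
       (use True in \<open>auto simp: flat_0 intro!: eventually_sequentiallyI[of 1]\<close>)
next
  case False
  then have "flat 0 (real m * x) = 0" for m by (auto simp: flat_0 zero_less_mult_iff)
  then show ?thesis using False by simp
qed

lemma bump_tendsto: "(\<lambda>m. bump a b (real m) z) \<longlonglongrightarrow> indicator (box a b) z"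
proof -
  have "(\<lambda>m. bump a b (real m) z) \<longlonglongrightarrow>
    (\<Prod>k\<in>UNIV. (if 0 < z $ k - a $ k then 1 else 0) * (if 0 < b $ k - z $ k then 1 else 0))"
    unfolding bump_def by (intro tendsto_prod tendsto_mult flat_0_tendsto)
  also have "(\<Prod>k\<in>UNIV. (if 0 < z $ k - a $ k then 1 else 0) * (if 0 < b $ k - z $ k then 1 else 0)) =
     (indicator (box a b) z :: real)"
    by (auto simp: indicator_def mem_box_cart intro!: prod.neutral)
  finally show ?thesis .
qed

lemma test_function_bump:
  assumes "cbox a b \<subseteq> V" "0 \<le> m"
  shows "test_function V (bump a b m)"
proof -
  have "closure {z. bump a b m z \<noteq> 0} \<subseteq> cbox a b"
    using bump_eq_0[OF assms(2)] box_subset_cbox by (intro closure_minimal) (auto, blast)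
  then show ?thesis using assms(1)
    by (auto simp: test_function_def C_class_bump compact_eq_bounded_closed
        intro: bounded_subset[OF bounded_cbox])
qed

lemma test_function_bound:
  assumes "test_function V \<phi>"
  obtains B where "\<And>z. \<bar>\<phi> z\<bar> \<le> B"
proof -
  let ?K = "closure {z. \<phi> z \<noteq> 0}"
  note t = assms[unfolded test_function_def]
  have "continuous_on UNIV \<phi>" by (rule C_class_continuous[OF spec[OF conjunct1[OF t]]])
  then have "continuous_on ?K \<phi>" by (rule continuous_on_subset) simp
  moreover have "compact ?K" by (rule conjunct1[OF conjunct2[OF t]])
  ultimately have "bounded (\<phi> ` ?K)" by (intro compact_imp_bounded compact_continuous_image)
  then obtain B where B: "\<And>z. z \<in> ?K \<Longrightarrow> \<bar>\<phi> z\<bar> \<le> B" unfolding bounded_iff by auto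
  have "\<bar>\<phi> z\<bar> \<le> max B 0" for z
  proof (cases "\<phi> z = 0")
    case False
    then have "z \<in> ?K" using closure_subset[of "{z. \<phi> z \<noteq> 0}"] by blast
    from B[OF this] show ?thesis by simp
  qed simp
  then show ?thesis by (rule that)
qed

section \<open>Fundamental lemma of the calculus of variations\<close>

lemma integral_box_eq_0:
  fixes f :: "real ^ 'n::finite \<Rightarrow> real"
  assumes f: "integrable lborel f" and "cbox a b \<subseteq> V"
    and 0: "\<And>\<phi>. test_function V \<phi> \<Longrightarrow> (LINT z|lborel. f z * \<phi> z) = 0"
  shows "(LINT z|lborel. f z * indicator (box a b) z) = 0"
proof -
  have [measurable]: "f \<in> borel_measurable borel" using f by auto
  have [measurable]: "bump a b m \<in> borel_measurable borel" for m
    using C_class_continuous[OF C_class_bump] by (rule borel_measurable_continuous_onI)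
  have "(\<lambda>m. LINT z|lborel. f z * bump a b (real m) z) \<longlonglongrightarrow> (LINT z|lborel. f z * indicator (box a b) z)"
    using integrable_norm[OF f]
    by (intro integral_dominated_convergence[where w="\<lambda>z. norm (f z)"] AE_I2 tendsto_mult bump_tendsto tendsto_const)
       (auto simp: abs_mult bump_bounds intro!: mult_left_le)
  moreover have "(LINT z|lborel. f z * bump a b (real m) z) = 0" for m
    by (intro 0 test_function_bump assms) auto
  ultimately show ?thesis by (simp add: LIMSEQ_const_iff)
qed

text \<open>Boxes are closed under intersection and generate the Borel sets. Since
  \<open>ennreal\<close> cuts off negative values, \<open>?D f\<close> and
  \<open>?D (\<lambda>z. - f z)\<close> have the positive and the negative part of \<open>f\<close>
  as densities; they agree on boxes, hence everywhere.\<close>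

lemma AE_eq_0_if_box_integrals_0:
  fixes f :: "'a::euclidean_space \<Rightarrow> real"
  assumes f: "integrable lborel f" and 0: "\<And>a b. (LINT z|lborel. f z * indicator (box a b) z) = 0"
  shows "AE z in lborel. f z = 0"
proof -
  have [measurable]: "f \<in> borel_measurable borel" using f by auto
  let ?D = "\<lambda>f. density lborel (\<lambda>z. ennreal (f z))"
  have fin: "emeasure (?D g) X \<noteq> \<infinity>" if "integrable lborel g" "X \<in> sets borel" for g X
  proof -
    have [measurable]: "g \<in> borel_measurable borel" using that by auto
    have "emeasure (?D g) X \<le> (\<integral>\<^sup>+z. ennreal (norm (g z)) \<partial>lborel)"
      using that by (auto simp: emeasure_density indicator_def ennreal_leI intro!: nn_integral_mono)
    also have "\<dots> < \<infinity>" using that(1) by (simp add: integrable_iff_bounded)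
    finally show ?thesis by simp
  qed
  have "?D f = ?D (\<lambda>z. - f z)"
  proof (rule measure_eqI_generator_eq[where E="range (\<lambda>(a, b). box a b::'a set)" and \<Omega>=UNIV
        and A="\<lambda>n::nat. box (- real n *\<^sub>R One) (real n *\<^sub>R One)"])
    show "Int_stable (range (\<lambda>(a, b). box a b::'a set))"
      by (auto simp: Int_stable_def box_Int_box)
    show "emeasure (?D f) X = emeasure (?D (\<lambda>z. - f z)) X" if XE: "X \<in> range (\<lambda>(a, b). box a b)" for X
    proof -
      obtain a b where X: "X = box a b" using XE by auto
      let ?g = "\<lambda>z. f z * indicator (box a b) z"
      have i: "integrable lborel ?g" using f by (simp add: integrable_real_mult_indicator)
      have "enn2real (\<integral>\<^sup>+z. ennreal (?g z) \<partial>lborel) = enn2real (\<integral>\<^sup>+z. ennreal (- ?g z) \<partial>lborel)"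
        using 0[of a b] real_lebesgue_integral_def[OF i] by simp
      moreover have "(\<integral>\<^sup>+z. ennreal (?g z) \<partial>lborel) = emeasure (?D f) X"
        unfolding X by (auto simp: emeasure_density indicator_def intro!: nn_integral_cong)
      moreover have "(\<integral>\<^sup>+z. ennreal (- ?g z) \<partial>lborel) = emeasure (?D (\<lambda>z. - f z)) X"
        unfolding X by (auto simp: emeasure_density indicator_def intro!: nn_integral_cong)
      moreover have "emeasure (?D f) X < top" "emeasure (?D (\<lambda>z. - f z)) X < top"
        using fin[OF f, of X] fin[of "\<lambda>z. - f z" X] f by (simp_all add: X less_top)
      ultimately show ?thesis by (metis ennreal_enn2real)
    qed
    show "(\<Union>n. box (- real n *\<^sub>R One) (real n *\<^sub>R One)) = (UNIV::'a set)"
      using UN_box_eq_UNIV by auto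
    show "emeasure (?D f) (box (- real n *\<^sub>R One) (real n *\<^sub>R One)) \<noteq> \<infinity>" for n
      using fin[OF f] by auto
  qed (auto simp: borel_eq_box)
  then have "AE z in lborel. ennreal (f z) = ennreal (- f z)"
    by (subst (asm) sigma_finite_measure.density_unique_iff[OF lborel.sigma_finite_measure_axioms]) auto
  moreover have "x = 0" if "ennreal x = ennreal (- x)" for x :: real
  proof (cases "0 \<le> x")
    case True
    then have "ennreal x = 0" using that by (simp add: ennreal_neg)
    then show ?thesis using True by (simp add: ennreal_eq_0_iff)
  next
    case False
    then have "ennreal (- x) = 0" using that by (simp add: ennreal_neg)
    then show ?thesis using False by (simp add: ennreal_eq_0_iff)
  qed
  ultimately show ?thesis by (auto elim: eventually_mono)
qed

text \<open>Negligibility is a local property. Around each point of \<open>V\<close> there is a box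
  with closure in \<open>V\<close>; cut off to it, \<open>f\<close> has integral 0 over every box,
  because intersections of boxes are boxes.\<close>

lemma AE_eq_0_if_test_integrals_0:
  fixes f :: "real ^ 'n::finite \<Rightarrow> real"
  assumes f: "integrable lborel f" and V: "open V"
    and 0: "\<And>\<phi>. test_function V \<phi> \<Longrightarrow> (LINT z|lborel. f z * \<phi> z) = 0"
  shows "AE z in lborel. z \<in> V \<longrightarrow> f z = 0"
proof -
  have [measurable]: "f \<in> borel_measurable borel" using f by auto
  have "negligible {z \<in> V. f z \<noteq> 0}"
  proof (subst locally_negligible_alt, intro ballI)
    fix x assume "x \<in> {z \<in> V. f z \<noteq> 0}"
    then have "x \<in> V" "f x \<noteq> 0" by auto
    obtain a b where ab: "cbox a b \<subseteq> V" "x \<in> box a b" "\<forall>i\<in>Basis. a \<bullet> i < b \<bullet> i"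
      by (rule open_contains_cbox[OF V \<open>x \<in> V\<close>])
    have "AE z in lborel. f z * indicator (box a b) z = 0"
    proof (rule AE_eq_0_if_box_integrals_0)
      show "integrable lborel (\<lambda>z. f z * indicator (box a b) z)"
        using f by (simp add: integrable_real_mult_indicator)
      fix c d
      obtain p q where pq: "box a b \<inter> box c d = box p q" by (rule that[OF box_Int_box])
      have "(LINT z|lborel. f z * indicator (box p q) z) = 0"
      proof (cases "box p q = {}")
        case False
        then have "cbox p q \<subseteq> cbox a b"
          using pq closure_mono[of "box p q" "box a b"] by (cases "box a b = {}") auto
        then show ?thesis using ab by (intro integral_box_eq_0[OF f _ 0]) auto
      qed simp
      then show "(LINT z|lborel. f z * indicator (box a b) z * indicator (box c d) z) = 0"
        by (simp only: pq[symmetric] indicator_inter_arith mult.assoc)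
    qed
    then have "AE z in lborel. z \<notin> {z \<in> box a b. f z \<noteq> 0}" by (rule AE_mp) (auto simp: indicator_def)
    then have "{z \<in> box a b. f z \<noteq> 0} \<in> null_sets lborel" by (subst AE_iff_null_sets) auto
    then have "negligible {z \<in> box a b. f z \<noteq> 0}"
      by (simp add: negligible_iff_null_sets null_sets_completionI)
    then have "negligible ({z \<in> V. f z \<noteq> 0} \<inter> box a b)"
      by (rule negligible_subset) auto
    then show "\<exists>U. openin (top_of_set {z \<in> V. f z \<noteq> 0}) U \<and> x \<in> U \<and> negligible U"
      using ab \<open>x \<in> V\<close> \<open>f x \<noteq> 0\<close> by (intro exI[of _ "{z \<in> V. f z \<noteq> 0} \<inter> box a b"]) (auto intro!: openin_open_Int)
  qed
  then have "AE z in lebesgue. z \<notin> {z \<in> V. f z \<noteq> 0}"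
    unfolding negligible_iff_null_sets by (rule AE_not_in)
  then have "AE z in lborel. z \<notin> {z \<in> V. f z \<noteq> 0}"
    using V by (subst (asm) AE_completion_iff) auto
  then show ?thesis by simp
qed

section \<open>Weak compactness\<close>

definition excess :: "real \<Rightarrow> real \<Rightarrow> real" where
  "excess M x = max 0 (\<bar>x\<bar> - M)"

lemma excess_nonneg: "0 \<le> excess M x"
  by (simp add: excess_def)

lemma excess_le_abs: "0 \<le> M \<Longrightarrow> excess M x \<le> \<bar>x\<bar>"
  by (simp add: excess_def)

lemma excess_0: "excess 0 x = \<bar>x\<bar>"
  by (simp add: excess_def)

lemma excess_mid: "excess M ((a + b) / 2) \<le> (excess M a + excess M b) / 2"
  unfolding excess_def by (simp add: max_def field_simps abs_if)

lemma continuous_on_excess: "continuous_on A (excess M)"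
  unfolding excess_def[abs_def] by (intro continuous_intros)

lemma borel_measurable_excess[measurable]: "excess M \<in> borel_measurable borel"
  by (intro borel_measurable_continuous_onI continuous_on_excess)

lemma integrable_excess:
  assumes "integrable N f" "0 \<le> M"
  shows "integrable N (\<lambda>x. excess M (f x))"
proof -
  have [measurable]: "f \<in> borel_measurable N" using assms by auto
  show ?thesis
    by (rule Bochner_Integration.integrable_bound[OF assms(1)])
       (use assms in \<open>auto simp: excess_nonneg excess_le_abs\<close>)
qed

text \<open>Midpoints suffice in place of all convex combinations, since near-minimisers are only
  ever compared with the midpoint of two of them. The index \<open>m\<close> restricts to a tail of
  the sequence.\<close>

inductive midhull :: "(nat \<Rightarrow> 'a \<Rightarrow> real) \<Rightarrow> nat \<Rightarrow> ('a \<Rightarrow> real) \<Rightarrow> bool" for g m where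
  base: "m \<le> n \<Longrightarrow> midhull g m (g n)"
| mid: "midhull g m f \<Longrightarrow> midhull g m f' \<Longrightarrow> midhull g m (\<lambda>x. (f x + f' x) / 2)"

lemma midhull_mono: "midhull g n f \<Longrightarrow> m \<le> n \<Longrightarrow> midhull g m f"
  by (induction rule: midhull.induct) (auto intro: midhull.intros)

lemma midhull_integrable: "midhull g m f \<Longrightarrow> (\<And>n. integrable N (g n)) \<Longrightarrow> integrable N f"
  by (induction rule: midhull.induct) auto

lemma midhull_excess:
  assumes "midhull g m f" "\<And>n. integrable N (g n)" "0 \<le> M"
    and "\<And>n. (LINT x|N. excess M (g n x)) \<le> K"
  shows "(LINT x|N. excess M (f x)) \<le> K"
  using assms(1)
proof (induction rule: midhull.induct)
  case (mid f f')
  have i: "integrable N f" "integrable N f'" using mid assms(2) by (auto intro: midhull_integrable)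
  have "(LINT x|N. excess M ((f x + f' x) / 2)) \<le> (LINT x|N. (excess M (f x) + excess M (f' x)) / 2)"
    using i assms(3) by (intro integral_mono excess_mid integrable_excess) (auto intro!: integrable_excess)
  also have "\<dots> \<le> K" using mid i assms(3) by (simp add: integrable_excess)
  finally show ?case .
qed (use assms in auto)

text \<open>Being within \<open>e\<close> of \<open>L\<close> after integration against
  \<open>\<phi>\<close> is a convex condition, hence inherited by midpoints.\<close>

lemma midhull_functional:
  assumes "midhull g m f" "\<And>n. integrable N (\<lambda>x. g n x * \<phi> x)"
    and "\<And>n. m \<le> n \<Longrightarrow> \<bar>(LINT x|N. g n x * \<phi> x) - L\<bar> \<le> e"
  shows "integrable N (\<lambda>x. f x * \<phi> x) \<and> \<bar>(LINT x|N. f x * \<phi> x) - L\<bar> \<le> e"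
  using assms(1)
proof (induction rule: midhull.induct)
  case (mid f f')
  have eq: "(f x + f' x) / 2 * \<phi> x = (f x * \<phi> x) / 2 + (f' x * \<phi> x) / 2" for x
    by (simp add: field_simps)
  show ?case unfolding eq using mid by (simp add: abs_le_iff field_simps)
qed (use assms in auto)

text \<open>Linear growth keeps the functional finite on L1 of a finite measure, and strict
  convexity is quantitative on bounded sets. A power above 1 would fail the first, the absolute
  value the second.\<close>

definition sqrt1 :: "real \<Rightarrow> real" where "sqrt1 s = sqrt (1 + s\<^sup>2)"

lemma sqrt1_bounds: "1 \<le> sqrt1 s" "sqrt1 s \<le> 1 + \<bar>s\<bar>"
proof -
  show "1 \<le> sqrt1 s" by (simp add: sqrt1_def)
  have "sqrt1 s \<le> sqrt ((1 + \<bar>s\<bar>)\<^sup>2)"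
    unfolding sqrt1_def by (rule real_sqrt_le_mono) (simp add: power2_sum)
  then show "sqrt1 s \<le> 1 + \<bar>s\<bar>" by simp
qed

lemma sqrt1_sq: "(sqrt1 s)\<^sup>2 = 1 + s\<^sup>2"
  by (simp add: sqrt1_def)

text \<open>The square roots disappear through \<open>P * Q = (a - b)^2\<close> and
  \<open>(A - B) * (A + B) = P / 2\<close>, so \<open>(a - b)^2\<close> is the gap times
  \<open>2 * (A + B) * Q\<close>. The bounds \<open>A + B <= 2 * (1 + M)\<close> and
  \<open>Q <= 2 * (1 + M)^2\<close> give the constant 8 and the cube.\<close>

lemma sqrt1_gap:
  defines "gap a b \<equiv> (sqrt1 a + sqrt1 b) / 2 - sqrt1 ((a + b) / 2)"
  shows "0 \<le> gap a b"
    and "\<bar>a\<bar> \<le> M \<Longrightarrow> \<bar>b\<bar> \<le> M \<Longrightarrow> (a - b)\<^sup>2 \<le> 8 * (1 + M) ^ 3 * gap a b"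
proof -
  define A B P Q where "A = (sqrt1 a + sqrt1 b) / 2" and "B = sqrt1 ((a + b) / 2)"
    and "P = sqrt1 a * sqrt1 b - (1 + a * b)" and "Q = sqrt1 a * sqrt1 b + (1 + a * b)"
  have "P * Q = (sqrt1 a)\<^sup>2 * (sqrt1 b)\<^sup>2 - (1 + a * b)\<^sup>2"
    by (simp add: P_def Q_def power2_eq_square algebra_simps)
  also have diff: "\<dots> = (a - b)\<^sup>2"
    unfolding sqrt1_sq by (simp add: power2_eq_square algebra_simps)
  finally have PQ: "P * Q = (a - b)\<^sup>2" .
  have "(1 + a * b)\<^sup>2 \<le> (sqrt1 a * sqrt1 b)\<^sup>2"
    unfolding power_mult_distrib using diff zero_le_power2[of "a - b"] by linarith
  moreover have "0 \<le> sqrt1 a * sqrt1 b"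
    by (intro mult_nonneg_nonneg order_trans[OF zero_le_one sqrt1_bounds(1)])
  ultimately have "\<bar>1 + a * b\<bar> \<le> sqrt1 a * sqrt1 b"
    by (simp only: abs_le_square_iff[symmetric] abs_of_nonneg)
  then have PQ0: "0 \<le> P" "0 \<le> Q" unfolding P_def Q_def by linarith+
  have "A\<^sup>2 - B\<^sup>2 = ((sqrt1 a)\<^sup>2 + (sqrt1 b)\<^sup>2 + 2 * (sqrt1 a * sqrt1 b)) / 4 - (1 + ((a + b) / 2)\<^sup>2)"
    unfolding B_def sqrt1_sq[of "(a + b) / 2"] by (simp add: A_def power2_eq_square algebra_simps)
  also have "\<dots> = P / 2" unfolding sqrt1_sq by (simp add: P_def power2_eq_square field_simps)
  finally have AB: "(A - B) * (A + B) = P / 2" by (simp add: power2_eq_square algebra_simps)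
  have pos: "1 \<le> A" "1 \<le> B" using sqrt1_bounds[of a] sqrt1_bounds[of b] sqrt1_bounds(1)[of "(a+b)/2"]
    by (auto simp: A_def B_def)
  show gap0: "0 \<le> gap a b"
  proof -
    have "0 \<le> (A - B) * (A + B)" using AB PQ0 by simp
    then have "0 \<le> A - B" using pos by (simp only: zero_le_mult_iff) linarith
    then show ?thesis by (simp only: gap_def A_def B_def)
  qed
  assume M: "\<bar>a\<bar> \<le> M" "\<bar>b\<bar> \<le> M"
  have s: "sqrt1 a \<le> 1 + M" "sqrt1 b \<le> 1 + M" using sqrt1_bounds(2)[of a] sqrt1_bounds(2)[of b] M by auto
  have "sqrt1 ((a + b) / 2) \<le> 1 + M" using sqrt1_bounds(2)[of "(a + b) / 2"] M abs_triangle_ineq[of a b] by simp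
  then have AB2: "A + B \<le> 2 * (1 + M)" using s unfolding A_def B_def by argo
  have "sqrt1 a * sqrt1 b \<le> (1 + M) * (1 + M)"
    using s sqrt1_bounds(1)[of b] M by (intro mult_mono) auto
  then have Q2: "Q \<le> 2 * (1 + M)\<^sup>2"
    using PQ0(1) by (simp add: Q_def P_def power2_eq_square)
  have "(a - b)\<^sup>2 = 2 * ((A - B) * (A + B)) * Q" unfolding PQ[symmetric] AB by simp
  also have "\<dots> = 2 * (A - B) * ((A + B) * Q)" by simp
  also have "\<dots> \<le> 2 * (A - B) * ((2 * (1 + M)) * (2 * (1 + M)\<^sup>2))"
    using gap0 AB2 Q2 PQ0 pos M by (intro mult_left_mono mult_mono) (auto simp: gap_def A_def B_def)
  also have "\<dots> = 8 * (1 + M) ^ 3 * (A - B)"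
  proof -
    have "2 * x * ((2 * t) * (2 * t\<^sup>2)) = 8 * t ^ 3 * x" for x t :: real
      by (simp add: power2_eq_square power3_eq_cube)
    then show ?thesis by blast
  qed
  also have "A - B = gap a b" by (simp only: gap_def A_def B_def)
  finally show "(a - b)\<^sup>2 \<le> 8 * (1 + M) ^ 3 * gap a b" .
qed

text \<open>Three regimes: a difference up to \<open>d\<close>; a larger one with both values in
  [-M, M], where the gap controls \<open>(a - b)^2 / d\<close>; a value beyond M, where the larger
  modulus is at most twice its excess over M/2.\<close>

lemma abs_diff_le_gap:
  assumes "0 < d" "0 \<le> M"
  shows "\<bar>a - b\<bar> \<le> d + 8 * (1 + M) ^ 3 / d * ((sqrt1 a + sqrt1 b) / 2 - sqrt1 ((a + b) / 2))
     + 4 * excess (M / 2) a + 4 * excess (M / 2) b"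
proof (cases "\<bar>a\<bar> \<le> M \<and> \<bar>b\<bar> \<le> M")
  case True
  have "\<bar>a - b\<bar> \<le> d + (a - b)\<^sup>2 / d"
  proof (cases "\<bar>a - b\<bar> \<le> d")
    case False
    then have "\<bar>a - b\<bar> * d \<le> \<bar>a - b\<bar> * \<bar>a - b\<bar>" by (intro mult_left_mono) auto
    then have "\<bar>a - b\<bar> \<le> (a - b)\<^sup>2 / d" using assms by (simp add: field_simps power2_eq_square)
    then show ?thesis using assms by simp
  qed (use assms in \<open>simp add: add_increasing2\<close>)
  also have "(a - b)\<^sup>2 / d \<le> 8 * (1 + M) ^ 3 / d * ((sqrt1 a + sqrt1 b) / 2 - sqrt1 ((a + b) / 2))"
    using sqrt1_gap(2)[of a M b] True assms by (simp add: divide_right_mono)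
  finally show ?thesis using excess_nonneg[of "M/2" a] excess_nonneg[of "M/2" b] by linarith
next
  case False
  then have "\<bar>a - b\<bar> \<le> 4 * excess (M / 2) a + 4 * excess (M / 2) b"
    using assms unfolding excess_def by (auto simp: max_def abs_if split: if_splits)
  moreover have "0 \<le> 8 * (1 + M) ^ 3 / d * ((sqrt1 a + sqrt1 b) / 2 - sqrt1 ((a + b) / 2))"
    using sqrt1_gap(1)[of a b] assms by (intro mult_nonneg_nonneg) auto
  ultimately show ?thesis using assms by linarith
qed

text \<open>The Riesz-Fischer argument, in the form that also yields an integrable bound
  \<open>D\<close> for a fast subsequence: dominated convergence then applies to several integrands
  along the same subsequence.\<close>

lemma L1_Cauchy_limit:
  fixes c :: "nat \<Rightarrow> 'a \<Rightarrow> real"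
  assumes int: "\<And>n. integrable N (c n)"
    and Cauchy: "\<And>e. 0 < e \<Longrightarrow> \<exists>n0. \<forall>m\<ge>n0. \<forall>n\<ge>n0. (LINT x|N. \<bar>c m x - c n x\<bar>) < e"
  obtains r D h where "\<And>k. k \<le> r k" "integrable N D" "AE x in N. (\<lambda>k. c (r k) x) \<longlonglongrightarrow> h x"
    "\<And>k. AE x in N. \<bar>c (r k) x\<bar> \<le> D x" "h \<in> borel_measurable N"
proof -
  have [measurable]: "c n \<in> borel_measurable N" for n using int by auto
  obtain n0 where n0: "\<And>k m n. n0 k \<le> m \<Longrightarrow> n0 k \<le> n \<Longrightarrow> (LINT x|N. \<bar>c m x - c n x\<bar>) < (1/2) ^ k"
  proof -
    have "\<forall>k. \<exists>n0. \<forall>m\<ge>n0. \<forall>n\<ge>n0. (LINT x|N. \<bar>c m x - c n x\<bar>) < (1/2) ^ k"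
      using Cauchy by simp
    then show ?thesis using that by metis
  qed
  \<comment> \<open>The sum puts \<open>r k\<close> beyond \<open>n0 k\<close> and makes
    \<open>r\<close> increasing; the summand \<open>k\<close> places it in the tail from
    \<open>k\<close> on.\<close>
  define r where "r k = (\<Sum>i\<le>k. n0 i) + k" for k
  have r1: "n0 k \<le> r k" for k by (simp add: r_def atMost_Suc[symmetric] lessThan_Suc_atMost[symmetric])
  have r2: "r k \<le> r (Suc k)" for k by (simp add: r_def)
  define d where "d k x = c (r (Suc k)) x - c (r k) x" for k x
  have [measurable]: "d k \<in> borel_measurable N" for k by (simp add: d_def[abs_def])
  have di: "integrable N (d k)" for k using int by (simp add: d_def[abs_def])
  have dle: "(LINT x|N. \<bar>d k x\<bar>) \<le> (1/2) ^ k" for k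
    unfolding d_def using n0[of k "r (Suc k)" "r k"] r1[of k] r2[of k] by simp
  have "(\<integral>\<^sup>+x. (\<Sum>k. ennreal \<bar>d k x\<bar>) \<partial>N) = (\<Sum>k. \<integral>\<^sup>+x. ennreal \<bar>d k x\<bar> \<partial>N)"
    by (rule nn_integral_suminf) simp
  also have "\<dots> = (\<Sum>k. ennreal (LINT x|N. \<bar>d k x\<bar>))"
    by (intro suminf_cong nn_integral_eq_integral) (auto intro: di integrable_abs)
  also have "\<dots> \<le> (\<Sum>k. ennreal ((1/2) ^ k))"
    by (intro suminf_le ennreal_leI dle) auto
  also have "\<dots> < \<infinity>"
    using summable_geometric[of "1/2::real"] by (simp add: suminf_ennreal2 less_top[symmetric])
  finally have "AE x in N. (\<Sum>k. ennreal \<bar>d k x\<bar>) \<noteq> \<infinity>"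
    by (intro nn_integral_noteq_infinite) (auto simp: less_top)
  then have AEs: "AE x in N. summable (\<lambda>k. \<bar>d k x\<bar>)"
    by (rule AE_mp) (auto intro!: AE_I2 summable_suminf_not_top)
  have s1: "summable (\<lambda>k. LINT x|N. \<bar>d k x\<bar>)"
    by (rule summable_comparison_test'[of "\<lambda>k. (1/2::real) ^ k"]) (auto simp: dle)
  have iS: "integrable N (\<lambda>x. \<Sum>k. \<bar>d k x\<bar>)"
    using AEs s1 di by (intro integrable_suminf) auto
  define D where "D x = \<bar>c (r 0) x\<bar> + (\<Sum>k. \<bar>d k x\<bar>)" for x
  define h where "h x = c (r 0) x + (\<Sum>k. d k x)" for x
  have tel: "c (r k) x = c (r 0) x + (\<Sum>i<k. d i x)" for k x
    by (induction k) (auto simp: d_def)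
  show ?thesis
  proof (rule that[of r D h])
    show "k \<le> r k" for k by (simp add: r_def)
    show "integrable N D" using iS int unfolding D_def[abs_def] by auto
    show "h \<in> borel_measurable N" unfolding h_def[abs_def] by measurable
    show "AE x in N. (\<lambda>k. c (r k) x) \<longlonglongrightarrow> h x"
      using AEs
    proof eventually_elim
      case (elim x)
      have eq: "(\<lambda>k. c (r k) x) = (\<lambda>k. c (r 0) x + (\<Sum>i<k. d i x))" by (intro ext tel)
      show ?case unfolding eq h_def
        by (intro tendsto_intros summable_LIMSEQ) (rule summable_rabs_cancel[OF elim])
    qed
    show "AE x in N. \<bar>c (r k) x\<bar> \<le> D x" for k
      using AEs
    proof eventually_elim
      case (elim x)
      have "\<bar>c (r k) x\<bar> \<le> \<bar>c (r 0) x\<bar> + (\<Sum>i<k. \<bar>d i x\<bar>)"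
        unfolding tel[of k] by (rule order_trans[OF abs_triangle_ineq]) (auto intro: sum_abs)
      also have "(\<Sum>i<k. \<bar>d i x\<bar>) \<le> (\<Sum>i. \<bar>d i x\<bar>)" by (rule sum_le_suminf[OF elim]) auto
      finally show ?case by (simp add: D_def)
    qed
  qed
qed

text \<open>Near-minimisers of the strictly convex
  functional \<open>\<integral> sqrt (1 + f\<^sup>2)\<close> over the convex hulls of the tails form a Cauchy sequence in \<open>L\<^sup>1\<close>.\<close>

proposition equi_integrable_limit:
  fixes g :: "nat \<Rightarrow> 'a \<Rightarrow> real"
  assumes fin: "finite_measure N" and int: "\<And>n. integrable N (g n)"
    and exc: "\<And>n M. 0 \<le> M \<Longrightarrow> (LINT x|N. excess M (g n x)) \<le> K M"
    and K: "(K \<longlongrightarrow> 0) at_top"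
  obtains h where "integrable N h"
    and "\<And>M. 0 \<le> M \<Longrightarrow> (LINT x|N. excess M (h x)) \<le> K M"
    and "\<And>\<phi> B L. \<phi> \<in> borel_measurable N \<Longrightarrow> (\<And>x. \<bar>\<phi> x\<bar> \<le> B) \<Longrightarrow>
      (\<lambda>n. LINT x|N. g n x * \<phi> x) \<longlonglongrightarrow> L \<Longrightarrow> (LINT x|N. h x * \<phi> x) = L"
proof -
  interpret finite_measure N by (rule fin)
  have [measurable]: "g n \<in> borel_measurable N" for n using int by auto
  have [measurable]: "sqrt1 \<in> borel_measurable borel" unfolding sqrt1_def[abs_def] by measurable
  define J where "J f = (LINT x|N. sqrt1 (f x))" for f
  have sqi: "integrable N (\<lambda>x. sqrt1 (f x))" if f: "integrable N f" for f
  proof -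
    have [measurable]: "f \<in> borel_measurable N" using f by auto
    have "integrable N (\<lambda>x. 1 + \<bar>f x\<bar>)" using f by auto
    then show ?thesis
      by (rule Bochner_Integration.integrable_bound)
         (auto intro!: AE_I2 simp: abs_of_nonneg[OF order_trans[OF zero_le_one sqrt1_bounds(1)]] sqrt1_bounds(2))
  qed
  have mi: "integrable N f" if "midhull g m f" for m f using midhull_integrable[OF that int] .
  define C where "C = measure N (space N) + K 0"
  have J0: "0 \<le> J f" for f
    unfolding J_def by (intro Bochner_Integration.integral_nonneg order_trans[OF zero_le_one sqrt1_bounds(1)])
  have JC: "J f \<le> C" if "midhull g m f" for m f
  proof -
    have "J f \<le> (LINT x|N. 1 + excess 0 (f x))"
      unfolding J_def using mi[OF that] sqrt1_bounds(2)
      by (intro integral_mono sqi) (auto simp: excess_0)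
    also have "\<dots> = measure N (space N) + (LINT x|N. excess 0 (f x))"
      using mi[OF that] by (simp add: integrable_excess)
    also have "\<dots> \<le> C" unfolding C_def using midhull_excess[OF that int _ exc] by simp
    finally show ?thesis .
  qed
  define I where "I m = Inf (J ` Collect (midhull g m))" for m
  have bdd: "bdd_below (J ` Collect (midhull g m))" for m using J0 by (auto intro!: bdd_belowI[of _ 0])
  have ne: "J ` Collect (midhull g m) \<noteq> {}" for m using midhull.base[of m m g] by auto
  have IJ: "I m \<le> J f" if "midhull g m f" for m f
    unfolding I_def using that by (intro cInf_lower bdd) auto
  have Imono: "I m \<le> I n" if "m \<le> n" for m n
    unfolding I_def using that by (intro cInf_superset_mono ne bdd) (auto intro: midhull_mono)
  have IC: "I m \<le> C" for m using IJ[OF midhull.base] JC[OF midhull.base] order_trans by blast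
  \<comment> \<open>The infima over the shrinking tails increase and are bounded by
    \<open>C\<close>, so \<open>I n - I m\<close> becomes small.\<close>
  have "incseq I" using Imono by (simp add: incseq_def)
  then have "Cauchy I" using IC incseq_convergent[of I C] LIMSEQ_imp_Cauchy by metis
  have "\<exists>f. midhull g m f \<and> J f < I m + 1 / real (Suc m)" for m
  proof -
    have "\<exists>y\<in>J ` Collect (midhull g m). y < I m + 1 / real (Suc m)"
      unfolding I_def by (rule cInf_lessD[OF ne]) (simp add: I_def)
    then show ?thesis by auto
  qed
  then obtain c where c: "\<And>m. midhull g m (c m)" "\<And>m. J (c m) < I m + 1 / real (Suc m)" by metis
  have ci: "integrable N (c m)" for m using mi[OF c(1)] .
  have ce: "(LINT x|N. excess M (c m x)) \<le> K M" if "0 \<le> M" for m M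
    using midhull_excess[OF c(1) int that exc[OF that]] .
  have diff: "(LINT x|N. \<bar>c m x - c n x\<bar>) \<le> d * measure N (space N)
      + 8 * (1 + M) ^ 3 / d * ((I n - I m) / 2 + 1 / real (Suc m)) + 8 * K (M / 2)"
    if "0 < d" "0 \<le> M" "m \<le> n" for d M m n
  proof -
    let ?G = "\<lambda>x. (sqrt1 (c m x) + sqrt1 (c n x)) / 2 - sqrt1 ((c m x + c n x) / 2)"
    \<comment> \<open>The midpoint of \<open>c m\<close> and \<open>c n\<close> lies in the hull of
      the tail from \<open>m\<close>, so its functional is at least \<open>I m\<close>;
      near-minimality of both functions then bounds the integrated gap.\<close>
    have mn: "midhull g m (c n)" using c(1) midhull_mono that by blast
    have mm: "midhull g m (\<lambda>x. (c m x + c n x) / 2)" by (intro midhull.mid c mn)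
    have iG: "integrable N ?G" using ci by (intro Bochner_Integration.integrable_diff sqi mi[OF mm]
          integrable_divide Bochner_Integration.integrable_add)
    have "(LINT x|N. ?G x) = (J (c m) + J (c n)) / 2 - J (\<lambda>x. (c m x + c n x) / 2)"
      unfolding J_def using sqi[OF ci[of m]] sqi[OF ci[of n]] sqi[OF mi[OF mm]] by simp
    also have "\<dots> \<le> (I n - I m) / 2 + 1 / real (Suc m)"
    proof -
      have "1 / real (Suc n) \<le> 1 / real (Suc m)" using that by (simp add: frac_le)
      moreover have "(x + y) / 2 - z \<le> (i' - i) / 2 + e"
        if "x < i + e" "y < i' + e'" "e' \<le> e" "i \<le> z" for x y z i i' e e' :: real
        using that by (simp add: field_simps)
      ultimately show ?thesis using c(2)[of m] c(2)[of n] IJ[OF mm] by blast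
    qed
    finally have G: "(LINT x|N. ?G x) \<le> (I n - I m) / 2 + 1 / real (Suc m)" .
    have "(LINT x|N. \<bar>c m x - c n x\<bar>) \<le> (LINT x|N. d + 8 * (1 + M) ^ 3 / d * ?G x
        + 4 * excess (M / 2) (c m x) + 4 * excess (M / 2) (c n x))"
    proof (rule integral_mono)
      show "integrable N (\<lambda>x. d + 8 * (1 + M) ^ 3 / d * ?G x
        + 4 * excess (M / 2) (c m x) + 4 * excess (M / 2) (c n x))"
        using that by (intro Bochner_Integration.integrable_add integrable_mult_right integrable_const
            integrable_excess ci iG) auto
    qed (use that abs_diff_le_gap ci in auto)
    also have "\<dots> = d * measure N (space N) + 8 * (1 + M) ^ 3 / d * (LINT x|N. ?G x)
      + 4 * (LINT x|N. excess (M / 2) (c m x)) + 4 * (LINT x|N. excess (M / 2) (c n x))"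
    proof -
      have "(LINT x|N. d + q * G x + 4 * e1 x + 4 * e2 x) =
        d * measure N (space N) + q * (LINT x|N. G x) + 4 * (LINT x|N. e1 x) + 4 * (LINT x|N. e2 x)"
        if "integrable N G" "integrable N e1" "integrable N e2" for G e1 e2 :: "'a \<Rightarrow> real" and q
        using that by (simp add: mult.commute)
      moreover have "0 \<le> M / 2" using that by simp
      ultimately show ?thesis
        using iG integrable_excess[OF ci \<open>0 \<le> M / 2\<close>] by blast
    qed
    also have "\<dots> \<le> d * measure N (space N)
      + 8 * (1 + M) ^ 3 / d * ((I n - I m) / 2 + 1 / real (Suc m)) + 8 * K (M / 2)"
    proof -
      have "8 * (1 + M) ^ 3 / d * (LINT x|N. ?G x) \<le> 8 * (1 + M) ^ 3 / d * ((I n - I m) / 2 + 1 / real (Suc m))"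
        using that by (intro mult_left_mono G) auto
      then show ?thesis using ce[of "M/2" m] ce[of "M/2" n] that by linarith
    qed
    finally show ?thesis .
  qed
  have Cau: "\<exists>n0. \<forall>m\<ge>n0. \<forall>n\<ge>n0. (LINT x|N. \<bar>c m x - c n x\<bar>) < e" if e: "0 < e" for e
  proof -
    \<comment> \<open>Each of the three terms of \<open>diff\<close> is made at most e/4: the first
      by \<open>d\<close>, the excess term by \<open>M\<close>, and, with \<open>Q\<close> then
      fixed, the gap term by the starting index.\<close>
    define V where "V = measure N (space N)"
    define d where "d = e / (4 * (V + 1))"
    have V0: "0 \<le> V" by (simp add: V_def)
    have d: "0 < d" "d * V \<le> e / 4" using e V0 by (auto simp: d_def field_simps)
    have "eventually (\<lambda>M. K M < e / 32) at_top" using K e order_tendstoD(2)[of K 0 at_top "e/32"] by simp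
    then obtain M0 where M0: "\<And>M. M0 \<le> M \<Longrightarrow> K M < e / 32" by (auto simp: eventually_at_top_linorder)
    define M where "M = 2 * max 0 M0"
    have M: "0 \<le> M" "K (M / 2) < e / 32" using M0[of "M/2"] by (auto simp: M_def)
    define Q where "Q = 8 * (1 + M) ^ 3 / d"
    have Q: "0 < Q" using M d by (simp add: Q_def)
    obtain n1 where n1: "\<And>m n. n1 \<le> m \<Longrightarrow> n1 \<le> n \<Longrightarrow> \<bar>I m - I n\<bar> < e / (4 * Q)"
      using \<open>Cauchy I\<close> Q e unfolding Cauchy_def dist_real_def by (metis divide_pos_pos mult_pos_pos zero_less_numeral)
    obtain n2 where n2: "1 / real (Suc n2) < e / (8 * Q)"
      using Q e by (metis divide_pos_pos mult_pos_pos zero_less_numeral nat_approx_posE)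
    have *: "(LINT x|N. \<bar>c m x - c n x\<bar>) < e" if "max n1 n2 \<le> m" "m \<le> n" for m n
    proof -
      have "1 / real (Suc m) \<le> 1 / real (Suc n2)" using that by (simp add: frac_le)
      moreover have "\<bar>I m - I n\<bar> < 2 * (e / (8 * Q))" using n1[of m n] that by simp
      moreover have "(i' - i) / 2 + e1 \<le> 2 * t"
        if "e1 \<le> e2" "e2 < t" "\<bar>i - i'\<bar> < 2 * t" for i i' e1 e2 t :: real
        using that by argo
      ultimately have "(I n - I m) / 2 + 1 / real (Suc m) \<le> 2 * (e / (8 * Q))" using n2 by blast
      then have "(I n - I m) / 2 + 1 / real (Suc m) \<le> e / (4 * Q)" by simp
      then have "Q * ((I n - I m) / 2 + 1 / real (Suc m)) \<le> Q * (e / (4 * Q))"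
        using Q by (intro mult_left_mono) auto
      also have "\<dots> = e / 4" using Q by simp
      finally have "Q * ((I n - I m) / 2 + 1 / real (Suc m)) \<le> e / 4" .
      moreover have "x < e" if "x \<le> a + b + 8 * k" "b \<le> e / 4" "a \<le> e / 4" "k < e / 32" for x a b k
        using that e by argo
      ultimately show ?thesis
        using diff[OF d(1) M(1) that(2), folded V_def Q_def] d(2) M(2) by blast
    qed
    have "(LINT x|N. \<bar>c m x - c n x\<bar>) < e" if "max n1 n2 \<le> m" "max n1 n2 \<le> n" for m n
      using *[of m n] *[of n m] that by (cases "m \<le> n") (auto simp: abs_minus_commute)
    then show ?thesis by blast
  qed
  obtain r h D where r: "\<And>k. k \<le> r k" and D: "integrable N D"
    and lim: "AE x in N. (\<lambda>k. c (r k) x) \<longlonglongrightarrow> h x"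
    and dom: "\<And>k. AE x in N. \<bar>c (r k) x\<bar> \<le> D x" and [measurable]: "h \<in> borel_measurable N"
    by (rule L1_Cauchy_limit[OF ci Cau], assumption) (rule that)
  have [measurable]: "c m \<in> borel_measurable N" for m using ci by auto
  show ?thesis
  proof (rule that)
    show "integrable N h"
      by (rule integrable_dominated_convergence[OF _ _ D lim]) (use dom in auto)
    fix M :: real assume M: "0 \<le> M"
    have "(\<lambda>k. LINT x|N. excess M (c (r k) x)) \<longlonglongrightarrow> (LINT x|N. excess M (h x))"
    proof (rule integral_dominated_convergence[OF _ _ D])
      show "AE x in N. (\<lambda>k. excess M (c (r k) x)) \<longlonglongrightarrow> excess M (h x)"
        using lim by eventually_elim
          (rule continuous_on_tendsto_compose[OF continuous_on_excess[of UNIV]], auto)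
      show "AE x in N. norm (excess M (c (r k) x)) \<le> D x" for k
        using dom[of k] by eventually_elim (use excess_le_abs[OF M] excess_nonneg[of M] in \<open>auto intro: order_trans\<close>)
    qed auto
    then show "(LINT x|N. excess M (h x)) \<le> K M"
      by (rule LIMSEQ_le_const2) (use ce[OF M] in auto)
  next
    fix \<phi> B L
    assume [measurable]: "\<phi> \<in> borel_measurable N" and B: "\<And>x. \<bar>\<phi> x\<bar> \<le> B"
      and L: "(\<lambda>n. LINT x|N. g n x * \<phi> x) \<longlonglongrightarrow> L"
    have B0: "0 \<le> B" using B[of undefined] by linarith
    have gi: "integrable N (\<lambda>x. g n x * \<phi> x)" for n
      by (rule Bochner_Integration.integrable_bound[OF integrable_mult_right[OF int[of n], of B]])
         (use B B0 in \<open>auto simp: abs_mult mult.commute intro!: mult_right_mono\<close>)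
    have "(\<lambda>k. LINT x|N. c (r k) x * \<phi> x) \<longlonglongrightarrow> (LINT x|N. h x * \<phi> x)"
    proof (rule integral_dominated_convergence[where w="\<lambda>x. D x * B"])
      show "integrable N (\<lambda>x. D x * B)" using D by auto
      show "AE x in N. (\<lambda>k. c (r k) x * \<phi> x) \<longlonglongrightarrow> h x * \<phi> x"
        using lim by eventually_elim (intro tendsto_intros)
      show "AE x in N. norm (c (r k) x * \<phi> x) \<le> D x * B" for k
        using dom[of k] by eventually_elim (use B B0 in \<open>auto simp: abs_mult intro!: mult_mono order_trans[OF abs_ge_zero]\<close>)
    qed auto
    \<comment> \<open>\<open>c (r k)\<close> is not a member of the sequence, but lies in the hull
      of a tail on which the tested integrals are already within e/2 of \<open>L\<close>.\<close>
    moreover have "(\<lambda>k. LINT x|N. c (r k) x * \<phi> x) \<longlonglongrightarrow> L"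
    proof (rule LIMSEQ_I)
      fix e :: real assume "0 < e"
      then obtain n0 where n0: "\<And>n. n0 \<le> n \<Longrightarrow> norm ((LINT x|N. g n x * \<phi> x) - L) < e / 2"
        using LIMSEQ_D[OF L, of "e/2"] by auto
      have le: "\<bar>(LINT x|N. g n x * \<phi> x) - L\<bar> \<le> e / 2" if "n0 \<le> n" for n
        using n0[OF that] by simp
      have "norm ((LINT x|N. c (r k) x * \<phi> x) - L) < e" if "n0 \<le> k" for k
      proof -
        have "n0 \<le> r k" using that r[of k] by simp
        then have "\<bar>(LINT x|N. c (r k) x * \<phi> x) - L\<bar> \<le> e / 2"
          using midhull_functional[OF midhull_mono[OF c(1) \<open>n0 \<le> r k\<close>] gi le] by blast
        then show ?thesis using \<open>0 < e\<close> by simp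
      qed
      then show "\<exists>no. \<forall>n\<ge>no. norm ((LINT x|N. c (r n) x * \<phi> x) - L) < e" by blast
    qed
    ultimately show "(LINT x|N. h x * \<phi> x) = L" by (rule LIMSEQ_unique)
  qed
qed

section \<open>From excess integrals to p-th powers\<close>

text \<open>Second differences of \<open>k \<mapsto> k\<^sup>p\<close>: the piecewise linear interpolation of \<open>s\<^sup>p\<close> at the naturals is
  \<open>\<Sum>k. powr_coeff p k * max 0 (s - k)\<close>.\<close>

definition powr_coeff :: "real \<Rightarrow> nat \<Rightarrow> real" where
  "powr_coeff p k = (if k = 0 then 1
     else (real k + 1) powr p - 2 * real k powr p + (real k - 1) powr p)"

lemma powr_coeff_nonneg:
  assumes "1 \<le> p"
  shows "0 \<le> powr_coeff p k"
proof -
  consider "k = 0" | "k = 1" | "2 \<le> k" by linarith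
  then show ?thesis
  proof cases
    case 2
    have "(2::real) powr 1 \<le> 2 powr p" using assms by (intro powr_mono) auto
    then show ?thesis using 2 by (simp add: powr_coeff_def)
  next
    case 3
    have "((1 - 1 / 2) *\<^sub>R (real k - 1) + (1 / 2) *\<^sub>R (real k + 1)) powr p
      \<le> (1 - 1 / 2) * (real k - 1) powr p + (1 / 2) * (real k + 1) powr p"
      by (rule convex_onD[OF powr_convex[OF assms]]) (use 3 in auto)
    moreover have "(1 - 1 / 2) *\<^sub>R (real k - 1) + (1 / 2) *\<^sub>R (real k + 1) = real k" by (simp add: field_simps)
    ultimately show ?thesis using 3 by (simp add: powr_coeff_def)
  qed (simp add: powr_coeff_def)
qed

lemma sum_powr_coeff:
  assumes "1 \<le> p"
  shows "(\<Sum>k<Suc n. powr_coeff p k) = real (Suc n) powr p - real n powr p"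
  using assms by (induction n) (auto simp: powr_coeff_def add.commute)

lemma sum_powr_coeff_times:
  assumes "1 \<le> p"
  shows "(\<Sum>k<n. powr_coeff p k * (real n - real k)) = real n powr p"
proof (induction n)
  case (Suc n)
  have "(\<Sum>k<Suc n. powr_coeff p k * (real (Suc n) - real k))
    = (\<Sum>k<Suc n. powr_coeff p k * (real n - real k)) + (\<Sum>k<Suc n. powr_coeff p k)"
    by (simp add: sum.distrib[symmetric] algebra_simps del: sum.lessThan_Suc)
  then show ?case using Suc sum_powr_coeff[OF assms, of n] by simp
qed (use assms in simp)

text \<open>With \<open>n\<close> the integer part of the modulus s, the sum lies between n^p and (n
  + 1)^p. These are compared with s^p by s <= 2n for n >= 1 and by n + 1 <= 2 max 1 s; the summand 1
  covers s < 1.\<close>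

lemma powr_excess_bounds:
  fixes x :: real
  assumes p: "1 \<le> p"
  defines "F \<equiv> (\<Sum>k. ennreal (powr_coeff p k * excess (real k) x))"
  shows "ennreal (\<bar>x\<bar> powr p) \<le> 1 + ennreal (2 powr p) * F"
    and "F \<le> ennreal (2 powr p * (1 + \<bar>x\<bar> powr p))"
proof -
  define s where "s = \<bar>x\<bar>"
  define n where "n = nat \<lfloor>s\<rfloor>"
  have n: "real n \<le> s" "s < real n + 1" by (auto simp: n_def s_def)
  have nn: "0 \<le> powr_coeff p k * excess (real k) x" for k
    using powr_coeff_nonneg[OF p, of k] excess_nonneg by simp
  have "F = (\<Sum>k<Suc n. ennreal (powr_coeff p k * excess (real k) x))"
    unfolding F_def
  proof (rule suminf_finite)
    fix k assume "k \<notin> {..<Suc n}"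
    then have "real n + 1 \<le> real k" by simp
    then have "excess (real k) x = 0" using n by (simp add: excess_def s_def[symmetric])
    then show "ennreal (powr_coeff p k * excess (real k) x) = 0" by simp
  qed simp
  also have "\<dots> = ennreal (\<Sum>k<Suc n. powr_coeff p k * excess (real k) x)"
    by (rule sum_ennreal) (rule nn)
  finally have F: "F = ennreal (\<Sum>k<Suc n. powr_coeff p k * excess (real k) x)" .
  have "s powr p \<le> 1 + 2 powr p * (\<Sum>k<Suc n. powr_coeff p k * excess (real k) x)"
  proof (cases "n = 0")
    case True
    then have "s powr p \<le> 1 powr p" using n p by (intro powr_mono2) (auto simp: s_def)
    then show ?thesis
      by (auto intro!: add_increasing2 mult_nonneg_nonneg sum_nonneg powr_coeff_nonneg[OF p] excess_nonneg)
  next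
    case False
    have "s powr p \<le> (2 * real n) powr p" using n p False by (intro powr_mono2) (auto simp: s_def)
    also have "\<dots> = 2 powr p * (\<Sum>k<n. powr_coeff p k * (real n - real k))"
      by (simp add: powr_mult sum_powr_coeff_times[OF p])
    also have "\<dots> \<le> 2 powr p * (\<Sum>k<n. powr_coeff p k * excess (real k) x)"
      using n powr_coeff_nonneg[OF p]
      by (intro mult_left_mono sum_mono) (auto simp: excess_def s_def[symmetric])
    also have "\<dots> \<le> 1 + 2 powr p * (\<Sum>k<Suc n. powr_coeff p k * excess (real k) x)"
      using nn[of n] by (simp add: distrib_left add_increasing)
    finally show ?thesis .
  qed
  then show "ennreal (\<bar>x\<bar> powr p) \<le> 1 + ennreal (2 powr p) * F"
    using nn unfolding F s_def[symmetric]
    by (subst ennreal_mult[symmetric]) (auto simp: ennreal_1[symmetric] ennreal_plus[symmetric] sum_nonneg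
        intro!: ennreal_leI simp del: ennreal_1 ennreal_plus sum.lessThan_Suc)
  have "(\<Sum>k<Suc n. powr_coeff p k * excess (real k) x) \<le> (\<Sum>k<Suc n. powr_coeff p k * (real (Suc n) - real k))"
    using n powr_coeff_nonneg[OF p]
    by (intro sum_mono mult_left_mono) (auto simp: excess_def s_def[symmetric])
  also have "\<dots> = real (Suc n) powr p" by (rule sum_powr_coeff_times[OF p])
  also have "\<dots> \<le> (2 * max 1 s) powr p" using n p by (intro powr_mono2) auto
  also have "\<dots> = 2 powr p * (max 1 s powr p)" by (simp add: powr_mult)
  also have "\<dots> \<le> 2 powr p * (1 + s powr p)" by (intro mult_left_mono) (auto simp: max_def)
  finally show "F \<le> ennreal (2 powr p * (1 + \<bar>x\<bar> powr p))"
    unfolding F s_def[symmetric] by (rule ennreal_leI)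
qed

text \<open>The comparisons at the natural levels are summed with the weights
  \<open>powr_coeff p k\<close>; finiteness of the measure absorbs the summand 1 of
  \<open>powr_excess_bounds\<close>.\<close>

lemma integrable_powr_if_excess_le:
  assumes "finite_measure N" and [measurable]: "g \<in> borel_measurable N" "G \<in> borel_measurable N"
    and p: "1 \<le> p" and G: "integrable N (\<lambda>x. \<bar>G x\<bar> powr p)"
    and le: "\<And>k::nat. (\<integral>\<^sup>+x. excess k (g x) \<partial>N) \<le> ennreal c * (\<integral>\<^sup>+x. excess k (G x) \<partial>N)"
  shows "integrable N (\<lambda>x. \<bar>g x\<bar> powr p)"
proof -
  interpret finite_measure N by fact
  let ?F = "\<lambda>x. \<Sum>k. ennreal (powr_coeff p k * excess (real k) x)"
  have eq: "(\<integral>\<^sup>+x. ?F (f x) \<partial>N) = (\<Sum>k. ennreal (powr_coeff p k) * (\<integral>\<^sup>+x. excess (real k) (f x) \<partial>N))"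
    if [measurable]: "f \<in> borel_measurable N" for f
    using powr_coeff_nonneg[OF p]
    by (simp add: nn_integral_suminf ennreal_mult excess_nonneg nn_integral_cmult)
  have "integrable N (\<lambda>x. 2 powr p * (1 + \<bar>G x\<bar> powr p))" using G by auto
  then have "(\<integral>\<^sup>+x. ennreal (2 powr p * (1 + \<bar>G x\<bar> powr p)) \<partial>N) < \<infinity>"
    by (subst nn_integral_eq_integral) auto
  moreover have "(\<integral>\<^sup>+x. ?F (G x) \<partial>N) \<le> (\<integral>\<^sup>+x. ennreal (2 powr p * (1 + \<bar>G x\<bar> powr p)) \<partial>N)"
    by (intro nn_integral_mono powr_excess_bounds p)
  ultimately have fin: "(\<integral>\<^sup>+x. ?F (G x) \<partial>N) < \<infinity>" by (rule order.strict_trans1[rotated])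
  have "(\<integral>\<^sup>+x. ?F (g x) \<partial>N) \<le> (\<Sum>k. ennreal (powr_coeff p k) * (ennreal c * (\<integral>\<^sup>+x. excess (real k) (G x) \<partial>N)))"
    unfolding eq[OF assms(2)] by (intro suminf_le mult_left_mono le) auto
  also have "\<dots> = (\<Sum>k. ennreal c * (ennreal (powr_coeff p k) * (\<integral>\<^sup>+x. excess (real k) (G x) \<partial>N)))"
    by (simp only: mult.left_commute)
  also have "\<dots> = ennreal c * (\<integral>\<^sup>+x. ?F (G x) \<partial>N)"
    unfolding eq[OF assms(3)] by (rule ennreal_suminf_cmult)
  also have "\<dots> < \<infinity>" using fin by (simp add: ennreal_mult_less_top)
  finally have fin2: "(\<integral>\<^sup>+x. ?F (g x) \<partial>N) < \<infinity>" .
  have "(\<integral>\<^sup>+x. \<bar>g x\<bar> powr p \<partial>N) \<le> (\<integral>\<^sup>+x. 1 + ennreal (2 powr p) * ?F (g x) \<partial>N)"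
    by (intro nn_integral_mono powr_excess_bounds p)
  also have "\<dots> = emeasure N (space N) + ennreal (2 powr p) * (\<integral>\<^sup>+x. ?F (g x) \<partial>N)"
    by (subst nn_integral_add) (auto simp: nn_integral_cmult)
  also have "\<dots> < \<infinity>" using fin2 by (simp add: ennreal_mult_less_top emeasure_eq_measure)
  finally have "(\<integral>\<^sup>+x. \<bar>g x\<bar> powr p \<partial>N) < \<infinity>" .
  then show ?thesis by (intro integrableI_bounded) auto
qed

section \<open>Weak derivatives along affine flows\<close>

text \<open>Uniqueness of Haar measure: the integral of
  \<open>indicator A (x + y) * indicator B y\<close> is computed in both orders, removing the shift
  by invariance of \<open>lborel\<close> in one and of \<open>M\<close> in the other. The unit ball
  fixes the normalisation.\<close>

lemma translation_invariant_eq_lborel: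
  fixes M :: "'a::euclidean_space measure"
  assumes M[measurable_cong, simp]: "sets M = sets borel" and sf: "sigma_finite_measure M"
    and trans: "\<And>a. distr M borel ((+) a) = M"
    and ball: "emeasure M (ball 0 1) = emeasure lborel (ball (0::'a) 1)"
  shows "M = lborel"
proof (rule measure_eqI)
  fix A assume "A \<in> sets M"
  then have [measurable]: "A \<in> sets borel" by simp
  interpret M: sigma_finite_measure M by (rule sf)
  interpret P: pair_sigma_finite lborel M ..
  have [simp]: "space M = UNIV" using sets_eq_imp_space_eq[OF M] by simp
  define B where "B = ball (0::'a) 1"
  have [measurable]: "B \<in> sets borel" by (simp add: B_def)
  let ?f = "indicator A :: 'a \<Rightarrow> ennreal" and ?g = "indicator B :: 'a \<Rightarrow> ennreal"
  have ballE: "emeasure lborel (ball y 1) = emeasure lborel (ball (0::'a) 1)" for y :: 'a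
  proof -
    have "emeasure (distr lborel borel ((+) y)) (ball y 1) = emeasure lborel (((+) y) -` ball y 1 \<inter> space lborel)"
      by (rule emeasure_distr) auto
    also have "((+) y) -` ball y 1 \<inter> space lborel = ball 0 1" by (auto simp: dist_norm)
    finally show ?thesis by (simp add: lborel_distr_plus)
  qed
  have "emeasure lborel A * emeasure M B = (\<integral>\<^sup>+y. emeasure lborel A * ?g y \<partial>M)"
    by (simp add: nn_integral_cmult_indicator)
  also have "\<dots> = (\<integral>\<^sup>+y. (\<integral>\<^sup>+x. ?f (x + y) * ?g y \<partial>lborel) \<partial>M)"
  proof (rule nn_integral_cong)
    fix y
    have "(\<integral>\<^sup>+x. ?f (x + y) * ?g y \<partial>lborel) = (\<integral>\<^sup>+x. ?f (y + x) \<partial>lborel) * ?g y"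
      by (subst nn_integral_multc) (auto simp: add.commute)
    also have "(\<integral>\<^sup>+x. ?f (y + x) \<partial>lborel) = (\<integral>\<^sup>+x. ?f x \<partial>distr lborel borel ((+) y))"
      by (subst nn_integral_distr) auto
    finally show "emeasure lborel A * ?g y = (\<integral>\<^sup>+x. ?f (x + y) * ?g y \<partial>lborel)"
      by (simp add: lborel_distr_plus)
  qed
  also have "\<dots> = (\<integral>\<^sup>+x. (\<integral>\<^sup>+y. ?f (x + y) * ?g y \<partial>M) \<partial>lborel)"
    by (rule P.Fubini') measurable
  \<comment> \<open>Substituting \<open>y - x\<close> for \<open>y\<close>, by invariance of
    \<open>M\<close>, leaves a unit ball around \<open>y\<close> for the integral in
    \<open>x\<close>.\<close>
  also have "\<dots> = (\<integral>\<^sup>+x. (\<integral>\<^sup>+y. ?f y * ?g (y - x) \<partial>M) \<partial>lborel)"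
  proof (rule nn_integral_cong)
    fix x
    have "(\<integral>\<^sup>+y. ?f y * ?g (y - x) \<partial>M) = (\<integral>\<^sup>+y. ?f y * ?g (y - x) \<partial>distr M borel ((+) x))"
      by (simp add: trans)
    also have "\<dots> = (\<integral>\<^sup>+y. ?f (x + y) * ?g (x + y - x) \<partial>M)"
      by (subst nn_integral_distr) auto
    finally show "(\<integral>\<^sup>+y. ?f (x + y) * ?g y \<partial>M) = (\<integral>\<^sup>+y. ?f y * ?g (y - x) \<partial>M)" by simp
  qed
  also have "\<dots> = (\<integral>\<^sup>+y. (\<integral>\<^sup>+x. ?f y * ?g (y - x) \<partial>lborel) \<partial>M)"
    by (rule P.Fubini'[symmetric]) measurable
  also have "\<dots> = (\<integral>\<^sup>+y. ?f y * emeasure lborel (ball (0::'a) 1) \<partial>M)"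
  proof (rule nn_integral_cong)
    fix y
    have "?g (y - x) = indicator (ball y 1) x" for x by (simp add: B_def indicator_def dist_norm norm_minus_commute[of x y])
    then have "(\<integral>\<^sup>+x. ?f y * ?g (y - x) \<partial>lborel) = (\<integral>\<^sup>+x. ?f y * indicator (ball y 1) x \<partial>lborel)" by simp
    also have "\<dots> = ?f y * emeasure lborel (ball y 1)" by (rule nn_integral_cmult_indicator) simp
    also have "emeasure lborel (ball y 1) = emeasure lborel (ball (0::'a) 1)" by (rule ballE)
    finally show "(\<integral>\<^sup>+x. ?f y * ?g (y - x) \<partial>lborel) = ?f y * emeasure lborel (ball (0::'a) 1)" .
  qed
  also have "\<dots> = emeasure M A * emeasure lborel (ball (0::'a) 1)"
    by (subst nn_integral_multc) auto
  finally have "emeasure lborel (ball (0::'a) 1) * emeasure lborel A = emeasure lborel (ball (0::'a) 1) * emeasure M A"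
    by (simp add: B_def ball mult.commute)
  moreover have "emeasure lborel (ball (0::'a) 1) \<noteq> 0"
    using emeasure_lborel_ball_finite open_not_negligible[of "ball (0::'a) 1"]
    by (auto simp: negligible_iff_null_sets null_sets_def)
  moreover have "emeasure lborel (ball (0::'a) 1) \<noteq> top"
    using emeasure_lborel_ball_finite[of "0::'a" 1] by simp
  ultimately show "emeasure M A = emeasure lborel A"
    by (simp add: ennreal_mult_cancel_left)
qed simp

section \<open>Gradients, test functions and weak gradients\<close>

definition dpart :: "(real ^ 'n::finite \<Rightarrow> real) \<Rightarrow> real ^ 'n \<Rightarrow> real ^ 'n" where
  "dpart \<phi> z = (\<chi> k. frechet_derivative \<phi> (at z) (axis k 1))"

lemma dpart_nth: "dpart \<phi> z $ k = frechet_derivative \<phi> (at z) (axis k 1)"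
  by (simp add: dpart_def)

lemma has_derivative_dpart:
  assumes "C_class (Suc m) \<phi>"
  shows "(\<phi> has_derivative (\<lambda>v. dpart \<phi> z \<bullet> v)) (at z)"
proof -
  note d = C_class_Suc_has_derivative[OF assms, of z]
  have "frechet_derivative \<phi> (at z) = (\<lambda>v. dpart \<phi> z \<bullet> v)"
    by (rule ext, subst has_derivative_partials[OF d])
       (simp add: inner_vec_def dpart_nth mult.commute)
  then show ?thesis using d by simp
qed

lemma dpart_unique:
  assumes "(\<phi> has_derivative (\<lambda>v. d \<bullet> v)) (at z)"
  shows "dpart \<phi> z = d"
  by (simp add: vec_eq_iff dpart_nth inner_axis frechet_derivative_at[OF assms, symmetric])

lemma test_functionD:
  assumes "test_function V \<phi>"
  shows "C_class m \<phi>" "compact (closure {z. \<phi> z \<noteq> 0})" "closure {z. \<phi> z \<noteq> 0} \<subseteq> V"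
  using assms unfolding test_function_def by blast+

lemma test_functionI:
  assumes "\<And>m. C_class m \<phi>" "compact K" "\<And>z. \<phi> z \<noteq> 0 \<Longrightarrow> z \<in> K" "K \<subseteq> V"
  shows "test_function V \<phi>"
proof -
  have "closure {z. \<phi> z \<noteq> 0} \<subseteq> K"
    by (rule closure_minimal) (use assms compact_imp_closed in auto)
  moreover have "compact (closure {z. \<phi> z \<noteq> 0})"
    unfolding compact_closure by (rule bounded_subset[OF compact_imp_bounded[OF assms(2)]]) (use assms(3) in auto)
  ultimately show ?thesis unfolding test_function_def using assms(1,4) by blast
qed

lemma test_function_eq_0: "test_function V \<phi> \<Longrightarrow> z \<notin> V \<Longrightarrow> \<phi> z = 0"
  using test_functionD(3)[of V \<phi>] closure_subset[of "{z. \<phi> z \<noteq> 0}"] by blast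

lemma test_function_measurable: "test_function V \<phi> \<Longrightarrow> \<phi> \<in> borel_measurable borel"
  by (intro borel_measurable_continuous_onI C_class_continuous[OF test_functionD(1)[where m=0]])

lemma test_function_dpart:
  assumes t: "test_function V \<phi>"
  shows "test_function V (\<lambda>z. dpart \<phi> z $ k)"
proof (rule test_functionI[OF _ test_functionD(2)[OF t] _ test_functionD(3)[OF t]])
  show "C_class m (\<lambda>z. dpart \<phi> z $ k)" for m
    using test_functionD(1)[OF t, of "Suc m"] by (simp add: dpart_nth)
  fix z assume nz: "dpart \<phi> z $ k \<noteq> 0"
  show "z \<in> closure {z. \<phi> z \<noteq> 0}"
  proof (rule ccontr)
    assume z: "z \<notin> closure {z. \<phi> z \<noteq> 0}"
    have "((\<lambda>_. 0) has_derivative (\<lambda>v. 0 \<bullet> v)) (at z)" by simp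
    then have "(\<phi> has_derivative (\<lambda>v. 0 \<bullet> v)) (at z)"
    proof (rule has_derivative_transform_within_open[where s="- closure {z. \<phi> z \<noteq> 0}"])
      show "0 = \<phi> x" if "x \<in> - closure {z. \<phi> z \<noteq> 0}" for x
        using that closure_subset[of "{z. \<phi> z \<noteq> 0}"] by fastforce
    qed (use z in auto)
    then have "dpart \<phi> z = 0" by (rule dpart_unique)
    with nz show False by simp
  qed
qed

lemma integrable_mult_bounded:
  fixes w \<phi> :: "'a \<Rightarrow> real"
  assumes "integrable M w" and [measurable]: "\<phi> \<in> borel_measurable M" and "\<And>z. \<bar>\<phi> z\<bar> \<le> B"
  shows "integrable M (\<lambda>z. w z * \<phi> z)"
proof (rule Bochner_Integration.integrable_bound)
  have [measurable]: "w \<in> borel_measurable M" using assms(1) by auto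
  show "integrable M (\<lambda>z. B * w z)" using assms(1) by auto
  show "(\<lambda>z. w z * \<phi> z) \<in> borel_measurable M" by measurable
  have "norm (w z * \<phi> z) \<le> norm (B * w z)" for z
  proof -
    have "\<bar>w z\<bar> * \<bar>\<phi> z\<bar> \<le> \<bar>w z\<bar> * \<bar>B\<bar>" using assms(3)[of z] by (intro mult_left_mono) auto
    then show ?thesis by (simp add: abs_mult mult.commute)
  qed
  then show "AE z in M. norm (w z * \<phi> z) \<le> norm (B * w z)" by simp
qed

lemma integrable_mult_test:
  assumes "integrable lborel w" "test_function V \<phi>"
  shows "integrable lborel (\<lambda>z. w z * \<phi> z)"
proof -
  obtain B where B: "\<And>z. \<bar>\<phi> z\<bar> \<le> B" by (rule test_function_bound[OF assms(2)]) (rule that)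
  show ?thesis
    by (rule integrable_mult_bounded[OF assms(1) _ B]) (use test_function_measurable[OF assms(2)] in simp)
qed

lemma test_function_mult:
  assumes "test_function V \<phi>" "\<And>m. C_class m f"
  shows "test_function V (\<lambda>z. f z * \<phi> z)"
proof (rule test_functionI[OF _ test_functionD(2)[OF assms(1)] _ test_functionD(3)[OF assms(1)]])
  show "C_class m (\<lambda>z. f z * \<phi> z)" for m by (intro C_class_mult assms test_functionD(1)[OF assms(1)])
  show "z \<in> closure {z. \<phi> z \<noteq> 0}" if "f z * \<phi> z \<noteq> 0" for z
    using that closure_subset[of "{z. \<phi> z \<noteq> 0}"] by auto
qed

text \<open>Integrals over the whole space in place of \<open>lebesgue_on V\<close>: they suit
  functions extended by 0 off \<open>V\<close> and transport by flows that do not preserve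
  \<open>V\<close>.\<close>

definition weak_grad :: "(real ^ 'n::finite) set \<Rightarrow> (real ^ 'n \<Rightarrow> real) \<Rightarrow> ('n \<Rightarrow> real ^ 'n \<Rightarrow> real) \<Rightarrow> bool" where
  "weak_grad V w g \<longleftrightarrow> (\<forall>k \<phi>. test_function V \<phi> \<longrightarrow>
     (LINT z|lborel. w z * dpart \<phi> z $ k) = - (LINT z|lborel. g k z * \<phi> z))"

text \<open>Common features of rotations, dilations and translations. The generating field
  \<open>N *v z + e\<close> has constant divergence \<open>trace N\<close>, so volumes grow by
  \<open>exp (trace N * s)\<close>. By \<open>trace_nonneg\<close>, composition with the flow
  forwards in time does not increase integrals of nonnegative functions.\<close>

locale affine_flow =
  fixes T :: "real \<Rightarrow> real ^ 'n::finite \<Rightarrow> real ^ 'n"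
    and N :: "real ^ 'n ^ 'n" and e :: "real ^ 'n" and A :: "real \<Rightarrow> real ^ 'n ^ 'n" and b :: "real \<Rightarrow> real ^ 'n"
  assumes T_0: "T 0 z = z" and T_add: "T (s + t) z = T s (T t z)"
    and T_affine: "T s z = A s *v z + b s"
    and T_deriv: "((\<lambda>s. T s z) has_vector_derivative (N *v T s z + e)) (at s)"
    and T_cont: "continuous_on UNIV (\<lambda>q. T (fst q) (snd q))"
    and T_distr: "distr lborel borel (T s) = density lborel (\<lambda>_. ennreal (exp (- (trace N * s))))"
    and trace_nonneg: "0 \<le> trace N"
begin

definition X :: "real ^ 'n \<Rightarrow> real ^ 'n" where "X z = N *v z + e"

lemma T_deriv_X: "((\<lambda>s. T s z) has_vector_derivative X (T s z)) (at s)"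
  using T_deriv by (simp add: X_def)

lemma T_inverse: "T s (T (- s) z) = z" "T (- s) (T s z) = z"
  using T_add[of s "- s" z] T_add[of "- s" s z] T_0 by auto

lemma continuous_on_T: "continuous_on UNIV (T s)"
proof -
  have "continuous_on UNIV (\<lambda>z. (s, z))" by (intro continuous_intros)
  from continuous_on_compose2[OF T_cont this] show ?thesis by simp
qed

lemma measurable_T [measurable]: "T s \<in> borel \<rightarrow>\<^sub>M borel"
  by (rule borel_measurable_continuous_onI[OF continuous_on_T])

lemma measurable_T2 [measurable]:
  assumes [measurable]: "f \<in> borel_measurable M" "g \<in> borel_measurable M"
  shows "(\<lambda>x. T (f x) (g x)) \<in> borel_measurable M"
proof -
  have "(\<lambda>q. T (fst q) (snd q)) \<in> borel \<rightarrow>\<^sub>M borel"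
    by (rule borel_measurable_continuous_onI[OF T_cont])
  from measurable_compose[OF borel_measurable_Pair[OF assms] this] show ?thesis by simp
qed

lemma nn_integral_T:
  assumes [measurable]: "f \<in> borel_measurable borel"
  shows "(\<integral>\<^sup>+z. f (T s z) \<partial>lborel) = ennreal (exp (- (trace N * s))) * (\<integral>\<^sup>+z. f z \<partial>lborel)"
proof -
  have "(\<integral>\<^sup>+z. f (T s z) \<partial>lborel) = (\<integral>\<^sup>+z. f z \<partial>distr lborel borel (T s))"
    by (subst nn_integral_distr) auto
  then show ?thesis by (simp add: T_distr nn_integral_density nn_integral_cmult)
qed

lemma integrable_T:
  fixes f :: "real ^ 'n \<Rightarrow> real"
  assumes "integrable lborel f"
  shows "integrable lborel (\<lambda>z. f (T s z))"
proof -
  have [measurable]: "f \<in> borel_measurable borel" using assms by auto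
  have "(\<integral>\<^sup>+z. norm (f (T s z)) \<partial>lborel) < \<infinity>"
    using assms by (subst nn_integral_T) (auto simp: integrable_iff_bounded ennreal_mult_less_top)
  then show ?thesis by (intro integrableI_bounded) auto
qed

lemma integral_T:
  fixes f :: "real ^ 'n \<Rightarrow> real"
  assumes [measurable]: "f \<in> borel_measurable borel"
  shows "(LINT z|lborel. f (T s z)) = exp (- (trace N * s)) * (LINT z|lborel. f z)"
proof -
  have "(LINT z|lborel. f (T s z)) = (LINT z|distr lborel borel (T s). f z)"
    by (subst integral_distr) auto
  then show ?thesis by (simp add: T_distr integral_density)
qed

lemma AE_T:
  assumes "AE z in lborel. P z"
  shows "AE z in lborel. P (T s z)"
proof -
  have "AE z in distr lborel borel (T s). P z"
    unfolding T_distr using assms by (subst AE_density) (auto elim: eventually_mono)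
  then show ?thesis by (rule AE_distrD[rotated]) auto
qed

text \<open>A flow preserves its own field: differentiate
  \<open>T s (T \<sigma> z) = T \<sigma> (T s z)\<close> at \<sigma> = 0.\<close>

lemma X_T: "A s *v X z = X (T s z)"
proof -
  have "((\<lambda>\<sigma>. T \<sigma> z) has_vector_derivative X z) (at 0)" using T_deriv_X[of z 0] by (simp add: T_0)
  then have "((\<lambda>\<sigma>. A s *v T \<sigma> z + b s) has_vector_derivative A s *v X z) (at 0)"
    using bounded_linear.has_vector_derivative[OF matrix_vector_mul_bounded_linear[of "A s"]]
    by (auto intro!: derivative_eq_intros)
  moreover have "A s *v T \<sigma> z + b s = T \<sigma> (T s z)" for \<sigma>
    by (metis T_affine T_add add.commute)
  ultimately have "((\<lambda>\<sigma>. T \<sigma> (T s z)) has_vector_derivative A s *v X z) (at 0)" by simp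
  moreover have "((\<lambda>\<sigma>. T \<sigma> (T s z)) has_vector_derivative X (T s z)) (at 0)"
    using T_deriv_X[of "T s z" 0] by (simp add: T_0)
  ultimately show ?thesis by (rule vector_derivative_unique_at)
qed

lemma C_class_X: "C_class m (\<lambda>z. X z $ k)"
  unfolding X_def matrix_vector_mult_def
  by (simp, intro C_class_add C_class_sum C_class_mult C_class_const C_class_nth)

text \<open>If \<open>d\<close> is the gradient of \<open>\<phi>\<close>, this is the divergence of \<open>\<phi> X\<close>, the test function for the weak
  derivative along \<open>X\<close>.\<close>

definition fder :: "(real ^ 'n \<Rightarrow> real) \<Rightarrow> (real ^ 'n \<Rightarrow> real ^ 'n) \<Rightarrow> real ^ 'n \<Rightarrow> real" where
  "fder \<phi> d z = trace N * \<phi> z + d z \<bullet> X z"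

text \<open>The k-th weak partial derivative is tested against \<open>X z $ k * \<phi> z\<close>;
  summing over \<open>k\<close> produces the divergence of the field.\<close>

lemma weak_flow:
  assumes w: "integrable lborel w" and g: "\<And>k. integrable lborel (g k)"
    and wg: "weak_grad V w g" and t: "test_function V \<phi>"
  shows "(LINT z|lborel. w z * fder \<phi> (dpart \<phi>) z) = - (LINT z|lborel. (\<Sum>k\<in>UNIV. X z $ k * g k z) * \<phi> z)"
proof -
  define \<phi>k where "\<phi>k k z = X z $ k * \<phi> z" for k z
  have tk: "test_function V (\<phi>k k)" for k
    unfolding \<phi>k_def[abs_def] by (rule test_function_mult[OF t C_class_X])
  have dk: "dpart (\<phi>k k) z $ k = N $ k $ k * \<phi> z + X z $ k * dpart \<phi> z $ k" for k z
  proof -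
    have 1: "((\<lambda>z. X z $ k) has_derivative (\<lambda>v. (N *v v) $ k)) (at z)"
      unfolding X_def by (auto intro!: derivative_eq_intros bounded_linear_imp_has_derivative
          bounded_linear_compose[OF bounded_linear_vec_nth matrix_vector_mul_bounded_linear])
    have 2: "(\<phi>k k has_derivative (\<lambda>v. X z $ k * (dpart \<phi> z \<bullet> v) + (N *v v) $ k * \<phi> z)) (at z)"
      unfolding \<phi>k_def[abs_def]
      by (rule has_derivative_mult[OF 1 has_derivative_dpart[OF test_functionD(1)[OF t, of "Suc 0"]]])
    have "(N *v axis k 1) $ k = N $ k $ k"
      by (simp add: matrix_vector_mult_def axis_def if_distrib[of "(*) _"] cong: if_cong)
    then show ?thesis
      using frechet_derivative_at[OF 2, symmetric] by (simp add: dpart_nth inner_axis mult.commute)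
  qed
  have eq: "w z * fder \<phi> (dpart \<phi>) z = (\<Sum>k\<in>UNIV. w z * dpart (\<phi>k k) z $ k)" for z
    unfolding dk fder_def
    by (simp add: trace_def inner_vec_def sum_distrib_left[symmetric] sum_distrib_right[symmetric] sum.distrib mult.commute)
  have "(LINT z|lborel. w z * fder \<phi> (dpart \<phi>) z) = (\<Sum>k\<in>UNIV. LINT z|lborel. w z * dpart (\<phi>k k) z $ k)"
    unfolding eq by (rule Bochner_Integration.integral_sum)
      (rule integrable_mult_test[OF w test_function_dpart[OF tk]])
  also have "\<dots> = (\<Sum>k\<in>UNIV. - (LINT z|lborel. g k z * \<phi>k k z))"
    using wg tk by (simp add: weak_grad_def)
  also have "\<dots> = - (LINT z|lborel. (\<Sum>k\<in>UNIV. g k z * \<phi>k k z))"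
    by (subst Bochner_Integration.integral_sum) (auto simp: sum_negf intro!: integrable_mult_test[OF g tk])
  also have "(\<lambda>z. \<Sum>k\<in>UNIV. g k z * \<phi>k k z) = (\<lambda>z. (\<Sum>k\<in>UNIV. X z $ k * g k z) * \<phi> z)"
    by (rule ext) (simp only: \<phi>k_def sum_distrib_right sum_distrib_left mult_ac)
  finally show ?thesis .
qed

lemma has_derivative_pullback:
  assumes "\<And>z. (\<phi> has_derivative (\<lambda>v. d z \<bullet> v)) (at z)"
  shows "((\<lambda>z. c * \<phi> (T s z)) has_derivative (\<lambda>v. c * (d (T s z) \<bullet> (A s *v v)))) (at z)"
proof -
  have "((\<lambda>z. A s *v z + b s) has_derivative (\<lambda>v. A s *v v)) (at z)"
    by (auto intro!: derivative_eq_intros bounded_linear_imp_has_derivative matrix_vector_mul_bounded_linear)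
  then have "(T s has_derivative (\<lambda>v. A s *v v)) (at z)"
    by (simp add: T_affine[abs_def])
  from has_derivative_compose[OF this assms]
  show ?thesis by (intro has_derivative_mult_right)
qed

text \<open>By \<open>X_T\<close> the derivative along the field commutes with the flow, and the
  divergence of the field is constant.\<close>

lemma fder_pullback:
  assumes d: "\<And>z. (\<phi> has_derivative (\<lambda>v. d z \<bullet> v)) (at z)"
  shows "fder (\<lambda>z. c * \<phi> (T s z)) (dpart (\<lambda>z. c * \<phi> (T s z))) z = c * fder \<phi> d (T s z)"
proof -
  note h = has_derivative_pullback[OF d, of c s z]
  have "dpart (\<lambda>z. c * \<phi> (T s z)) z \<bullet> v = c * (d (T s z) \<bullet> (A s *v v))" for v
  proof -
    have "v = (\<Sum>k\<in>UNIV. v $ k *\<^sub>R axis k 1)"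
      by (simp add: vec_eq_iff axis_def if_distrib[of "(*) _"] cong: if_cong)
    then show ?thesis
      using has_derivative_partials[OF h, of v] frechet_derivative_at[OF h, symmetric]
      by (simp add: inner_vec_def dpart_nth mult.commute)
  qed
  then show ?thesis by (simp add: fder_def X_T distrib_left mult.left_commute)
qed

lemma pullback_has_derivative_s:
  assumes d: "\<And>z. (\<phi> has_derivative (\<lambda>v. d z \<bullet> v)) (at z)"
  shows "((\<lambda>s. exp (- (trace N * s)) * \<phi> (T (- s) z)) has_real_derivative
     - (exp (- (trace N * s)) * fder \<phi> d (T (- s) z))) (at s)"
proof -
  have "((\<lambda>s. T (- s) z) has_vector_derivative - X (T (- s) z)) (at s)"
    using vector_diff_chain_at[of uminus "-1" s "\<lambda>s. T s z" "X (T (- s) z)"] T_deriv_X[of z "- s"]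
    by (simp add: o_def has_vector_derivative_minus[OF has_vector_derivative_id, simplified])
  from has_derivative_compose[OF this[unfolded has_vector_derivative_def] d]
  have 1: "((\<lambda>s. \<phi> (T (- s) z)) has_real_derivative - (d (T (- s) z) \<bullet> X (T (- s) z))) (at s)"
    unfolding has_field_derivative_def by (rule has_derivative_eq_rhs) (simp add: fun_eq_iff)
  show ?thesis
    by (rule derivative_eq_intros 1 refl)+ (simp add: fder_def algebra_simps)
qed

text \<open>The expected increment \<open>w (T h z) - w z\<close>, hence not divided by
  \<open>h\<close>. For integrable \<open>G\<close> the orbits on which the integral takes its
  default value 0 form a null set.\<close>

definition flow_avg :: "(real ^ 'n \<Rightarrow> real) \<Rightarrow> real \<Rightarrow> real ^ 'n \<Rightarrow> real" where
  "flow_avg G h z = (LINT s|lborel. indicator {0..h} s * G (T s z))"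

lemma test_function_pullback:
  assumes t: "test_function U \<phi>" and UV: "\<And>z. z \<in> U \<Longrightarrow> T s z \<in> V"
  shows "test_function V (\<lambda>z. c * \<phi> (T (- s) z))"
proof (rule test_functionI)
  show "C_class m (\<lambda>z. c * \<phi> (T (- s) z))" for m
    unfolding T_affine by (intro C_class_mult C_class_const C_class_affine_comp test_functionD(1)[OF t])
  show "compact (T s ` closure {z. \<phi> z \<noteq> 0})"
    by (rule compact_continuous_image[OF continuous_on_subset[OF continuous_on_T] test_functionD(2)[OF t]]) simp
  show "T s ` closure {z. \<phi> z \<noteq> 0} \<subseteq> V" using test_functionD(3)[OF t] UV by blast
  fix z assume "c * \<phi> (T (- s) z) \<noteq> 0"
  then have "T (- s) z \<in> closure {z. \<phi> z \<noteq> 0}" using closure_subset[of "{z. \<phi> z \<noteq> 0}"] by auto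
  then have "T s (T (- s) z) \<in> T s ` closure {z. \<phi> z \<noteq> 0}" by (rule imageI)
  then show "z \<in> T s ` closure {z. \<phi> z \<noteq> 0}" by (simp add: T_inverse)
qed

lemma test_function_fder:
  assumes t: "test_function U \<phi>"
  shows "test_function U (fder \<phi> (dpart \<phi>))"
proof (rule test_functionI[OF _ test_functionD(2)[OF t] _ test_functionD(3)[OF t]])
  let ?K = "closure {z. \<phi> z \<noteq> 0}"
  have tK: "test_function ?K \<phi>" using t unfolding test_function_def by blast
  have d: "C_class m (\<lambda>z. dpart \<phi> z $ k)" for m k
    using test_functionD(1)[OF test_function_dpart[OF t]] .
  show "C_class m (fder \<phi> (dpart \<phi>))" for m
    unfolding fder_def[abs_def] inner_vec_def inner_real_def
    by (intro C_class_add C_class_mult C_class_const C_class_sum d C_class_X test_functionD(1)[OF t])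
  fix z assume "fder \<phi> (dpart \<phi>) z \<noteq> 0"
  show "z \<in> ?K"
  proof (rule ccontr)
    assume z: "z \<notin> ?K"
    have "\<phi> z = 0" "\<And>k. dpart \<phi> z $ k = 0"
      using test_function_eq_0[OF tK z] test_function_eq_0[OF test_function_dpart[OF tK] z] by auto
    then have "fder \<phi> (dpart \<phi>) z = 0" by (simp add: fder_def inner_vec_def)
    with \<open>fder \<phi> (dpart \<phi>) z \<noteq> 0\<close> show False by simp
  qed
qed

lemma integral_T_mult:
  fixes f \<phi> :: "real ^ 'n \<Rightarrow> real"
  assumes [measurable]: "f \<in> borel_measurable borel" "\<phi> \<in> borel_measurable borel"
  shows "(LINT z|lborel. f (T s z) * \<phi> z) = (LINT z|lborel. f z * (exp (- (trace N * s)) * \<phi> (T (- s) z)))"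
proof -
  have "(LINT z|lborel. f (T s z) * \<phi> (T (- s) (T s z)))
      = exp (- (trace N * s)) * (LINT z|lborel. f z * \<phi> (T (- s) z))"
    by (rule integral_T) measurable
  also have "\<dots> = (LINT z|lborel. exp (- (trace N * s)) * (f z * \<phi> (T (- s) z)))"
    by simp
  finally show ?thesis by (simp add: T_inverse mult.left_commute)
qed

lemma integrable_flow_pair:
  fixes G :: "real ^ 'n \<Rightarrow> real"
  assumes G: "integrable lborel G"
  shows "integrable (lborel \<Otimes>\<^sub>M lborel) (\<lambda>(s, z). indicator {0..h} s * G (T s z))"
proof -
  have [measurable]: "G \<in> borel_measurable borel" using G by auto
  have m: "(\<lambda>(s, z). indicator {0..h} s * G (T s z)) \<in> borel_measurable (lborel \<Otimes>\<^sub>M lborel)" by measurable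
  have "(\<integral>\<^sup>+q. norm ((\<lambda>(s, z). indicator {0..h} s * G (T s z)) q) \<partial>(lborel \<Otimes>\<^sub>M lborel))
    = (\<integral>\<^sup>+s. \<integral>\<^sup>+z. norm (indicator {0..h} s * G (T s z)) \<partial>lborel \<partial>lborel)"
    by (subst lborel.nn_integral_fst[symmetric]) (use m in auto)
  also have "\<dots> = (\<integral>\<^sup>+s. indicator {0..h} s * (\<integral>\<^sup>+z. norm (G (T s z)) \<partial>lborel) \<partial>lborel)"
    by (intro nn_integral_cong) (auto simp: indicator_def)
  also have "\<dots> \<le> (\<integral>\<^sup>+s. (\<integral>\<^sup>+z. norm (G z) \<partial>lborel) * indicator {0..h} s \<partial>lborel)"
  proof (intro nn_integral_mono)
    fix s :: real
    have "(\<integral>\<^sup>+z. norm (G (T s z)) \<partial>lborel) \<le> 1 * (\<integral>\<^sup>+z. norm (G z) \<partial>lborel)" if "0 \<le> s"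
      unfolding nn_integral_T[of "\<lambda>z. ennreal (norm (G z))", simplified]
      using that trace_nonneg by (subst nn_integral_T) (auto intro!: mult_right_mono simp: ennreal_1[symmetric] simp del: ennreal_1)
    then show "indicator {0..h} s * (\<integral>\<^sup>+z. norm (G (T s z)) \<partial>lborel) \<le> (\<integral>\<^sup>+z. norm (G z) \<partial>lborel) * indicator {0..h} s"
      by (auto simp: indicator_def)
  qed
  also have "\<dots> = (\<integral>\<^sup>+z. norm (G z) \<partial>lborel) * emeasure lborel {0..h}"
    by (rule nn_integral_cmult_indicator) auto
  also have "\<dots> < \<infinity>" using G by (auto simp: ennreal_mult_less_top integrable_iff_bounded emeasure_lborel_Icc_eq)
  finally show ?thesis using m by (intro integrableI_bounded) auto
qed

lemma
  fixes G :: "real ^ 'n \<Rightarrow> real"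
  assumes G: "integrable lborel G"
  shows integrable_flow_avg: "integrable lborel (flow_avg G h)"
    and flow_avg_mult_test: "test_function V \<phi> \<Longrightarrow>
      (LINT z|lborel. flow_avg G h z * \<phi> z)
      = (LINT s|lborel. indicator {0..h} s * (LINT z|lborel. G (T s z) * \<phi> z))"
proof -
  have [measurable]: "G \<in> borel_measurable borel" using G by auto
  show "integrable lborel (flow_avg G h)"
    unfolding flow_avg_def[abs_def] using lborel_pair.integrable_snd[OF integrable_flow_pair[OF G]] .
  assume t: "test_function V \<phi>"
  obtain B where B: "\<And>z. \<bar>\<phi> z\<bar> \<le> B" by (rule test_function_bound[OF t]) (rule that)
  have [measurable]: "\<phi> \<in> borel_measurable borel" by (rule test_function_measurable[OF t])
  have "integrable (lborel \<Otimes>\<^sub>M lborel) (\<lambda>q. (\<lambda>(s, z). indicator {0..h} s * G (T s z)) q * \<phi> (snd q))"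
    by (rule integrable_mult_bounded[OF integrable_flow_pair[OF G] _ B]) measurable
  then have "integrable (lborel \<Otimes>\<^sub>M lborel) (\<lambda>(s, z). indicator {0..h} s * G (T s z) * \<phi> z)"
    by (simp add: case_prod_unfold)
  from lborel_pair.Fubini_integral[OF this]
  have "(LINT z|lborel. LINT s|lborel. indicator {0..h} s * G (T s z) * \<phi> z)
    = (LINT s|lborel. LINT z|lborel. indicator {0..h} s * G (T s z) * \<phi> z)" .
  moreover have "(LINT z|lborel. indicator {0..h} s * G (T s z) * \<phi> z)
      = indicator {0..h} s * (LINT z|lborel. G (T s z) * \<phi> z)" for s
    by (simp add: mult.assoc)
  moreover have "(LINT s|lborel. indicator {0..h} s * G (T s z) * \<phi> z) = flow_avg G h z * \<phi> z" for z
    unfolding flow_avg_def by (rule integral_mult_left_zero)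
  ultimately show "(LINT z|lborel. flow_avg G h z * \<phi> z)
      = (LINT s|lborel. indicator {0..h} s * (LINT z|lborel. G (T s z) * \<phi> z))" by (simp only:)
qed

lemma integrable_ind_prod:
  fixes w :: "real ^ 'n \<Rightarrow> real"
  assumes w: "integrable lborel w"
  shows "integrable (lborel \<Otimes>\<^sub>M lborel) (\<lambda>q. indicator {0..h::real} (fst q) * w (snd q))"
proof -
  have [measurable]: "w \<in> borel_measurable borel" using w by auto
  have m: "(\<lambda>q. indicator {0..h::real} (fst q) * w (snd q)) \<in> borel_measurable (lborel \<Otimes>\<^sub>M lborel)" by measurable
  have "(\<integral>\<^sup>+q. norm (indicator {0..h::real} (fst q) * w (snd q)) \<partial>(lborel \<Otimes>\<^sub>M lborel))
    = (\<integral>\<^sup>+s. \<integral>\<^sup>+z. norm (indicator {0..h} s * w z) \<partial>lborel \<partial>lborel)"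
    by (subst lborel.nn_integral_fst[symmetric]) (use m in auto)
  also have "\<dots> = (\<integral>\<^sup>+s. (\<integral>\<^sup>+z. norm (w z) \<partial>lborel) * indicator {0..h} s \<partial>lborel)"
    by (intro nn_integral_cong) (auto simp: indicator_def)
  also have "\<dots> = (\<integral>\<^sup>+z. norm (w z) \<partial>lborel) * emeasure lborel {0..h}"
    by (rule nn_integral_cmult_indicator) auto
  also have "\<dots> < \<infinity>" using w by (auto simp: ennreal_mult_less_top integrable_iff_bounded emeasure_lborel_Icc_eq)
  finally show ?thesis using m by (intro integrableI_bounded) auto
qed

text \<open>The pullback \<open>\<psi>\<^sub>s = exp (- trace N * s) (\<phi> \<circ> T\<^sub>-\<^sub>s)\<close> satisfies \<open>\<partial>\<^sub>s \<psi>\<^sub>s = - div (\<psi>\<^sub>s X)\<close>, so the weak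
  derivative can be tested against every \<open>\<psi>\<^sub>s\<close>.\<close>

lemma flow_increment_test:
  assumes w: "integrable lborel w" and g: "\<And>k. integrable lborel (g k)" and wg: "weak_grad V w g"
    and UV: "\<And>z s. z \<in> U \<Longrightarrow> 0 \<le> s \<Longrightarrow> s \<le> h \<Longrightarrow> T s z \<in> V" and h: "0 \<le> h"
    and t: "test_function U \<phi>"
    and G: "\<And>z. G z = (\<Sum>k\<in>UNIV. X z $ k * g k z)" and Gi: "integrable lborel G"
  shows "(LINT z|lborel. (w (T h z) - w z) * \<phi> z) = (LINT z|lborel. flow_avg G h z * \<phi> z)"
proof -
  have [measurable]: "w \<in> borel_measurable borel" "G \<in> borel_measurable borel" using w Gi by auto
  have [measurable]: "\<phi> \<in> borel_measurable borel" by (rule test_function_measurable[OF t])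
  note d = has_derivative_dpart[OF test_functionD(1)[OF t, of "Suc 0"]]
  define Q where "Q = fder \<phi> (dpart \<phi>)"
  have tQ: "test_function U Q" unfolding Q_def by (rule test_function_fder[OF t])
  have [measurable]: "Q \<in> borel_measurable borel" by (rule test_function_measurable[OF tQ])
  define \<psi> where "\<psi> s z = exp (- (trace N * s)) * \<phi> (T (- s) z)" for s z
  define D where "D s z = - (exp (- (trace N * s)) * Q (T (- s) z))" for s z
  have [measurable]: "(\<lambda>q. D (fst q) (snd q)) \<in> borel_measurable (lborel \<Otimes>\<^sub>M lborel)"
    unfolding D_def by measurable
  have [measurable]: "\<psi> s \<in> borel_measurable borel" for s unfolding \<psi>_def[abs_def] by measurable
  have [measurable]: "D s \<in> borel_measurable borel" for s unfolding D_def[abs_def] by measurable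
  obtain BQ where BQ: "\<And>z. \<bar>Q z\<bar> \<le> BQ" by (rule test_function_bound[OF tQ]) (rule that)
  have DB: "\<bar>indicator {0..h} s * D s z\<bar> \<le> BQ" for s z
  proof (cases "s \<in> {0..h}")
    case True
    then have "exp (- (trace N * s)) \<le> 1" using trace_nonneg by simp
    then have "exp (- (trace N * s)) * \<bar>Q (T (- s) z)\<bar> \<le> 1 * BQ"
      using BQ by (intro mult_mono) auto
    then show ?thesis using True by (simp add: D_def abs_mult)
  next
    case False then show ?thesis using BQ[of 0] by simp
  qed
  have FTC: "\<psi> h z - \<psi> 0 z = (LINT s|lborel. indicator {0..h} s * D s z)" for z
  proof -
    have "(LINT s|lborel. D s z * indicator {0..h} s) = \<psi> h z - \<psi> 0 z"
    proof (rule integral_FTC_Icc_real[OF h])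
      show "DERIV (\<lambda>s. \<psi> s z) s :> D s z" for s
        unfolding \<psi>_def D_def Q_def by (rule pullback_has_derivative_s[OF d])
      have "continuous_on UNIV (\<lambda>s. D s z)"
        unfolding D_def
        by (intro continuous_intros continuous_on_compose2[OF C_class_continuous[OF test_functionD(1)[OF tQ, of 0]]]
          continuous_on_compose2[OF T_cont, of UNIV "\<lambda>s. (- s, z)", simplified] subset_UNIV)
      then show "isCont (\<lambda>s. D s z) s" for s
        by (simp add: continuous_on_eq_continuous_at)
    qed
    then show ?thesis by (simp add: mult.commute)
  qed
  \<comment> \<open>\<open>D s\<close> is minus the divergence of \<open>\<psi> s\<close> times the
    field, so \<open>weak_flow\<close> replaces \<open>w\<close> by \<open>G\<close>; the change of
    variables then moves the flow from \<open>\<phi>\<close> to \<open>G\<close>.\<close>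
  have Dw: "(LINT z|lborel. w z * D s z) = (LINT z|lborel. G (T s z) * \<phi> z)" if s: "s \<in> {0..h}" for s
  proof -
    have ts: "test_function V (\<psi> s)" unfolding \<psi>_def[abs_def]
      by (rule test_function_pullback[OF t]) (use UV s in auto)
    have "fder (\<psi> s) (dpart (\<psi> s)) z = - D s z" for z
      unfolding \<psi>_def[abs_def] D_def Q_def by (simp add: fder_pullback[OF d])
    then have "(LINT z|lborel. w z * D s z) = - (LINT z|lborel. w z * fder (\<psi> s) (dpart (\<psi> s)) z)"
      by simp
    also have "\<dots> = (LINT z|lborel. G z * \<psi> s z)"
      unfolding weak_flow[OF w g wg ts] G by simp
    also have "\<dots> = (LINT z|lborel. G (T s z) * \<phi> z)"
      unfolding \<psi>_def by (rule integral_T_mult[symmetric]) measurable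
    finally show ?thesis .
  qed
  have "integrable (lborel \<Otimes>\<^sub>M lborel)
      (\<lambda>q. indicator {0..h} (fst q) * w (snd q) * (indicator {0..h} (fst q) * D (fst q) (snd q)))"
    by (rule integrable_mult_bounded[OF integrable_ind_prod[OF w]]) (measurable, rule DB)
  moreover have "indicator {0..h} s * w z * (indicator {0..h} s * D s z) = w z * (indicator {0..h} s * D s z)" for s z
    by (simp add: indicator_def)
  ultimately have iP: "integrable (lborel \<Otimes>\<^sub>M lborel) (\<lambda>(s, z). w z * (indicator {0..h} s * D s z))"
    by (simp add: case_prod_unfold)
  have iw: "integrable lborel (\<lambda>z. w z * (c * \<phi> (T s z)))" for c s
  proof -
    obtain B where B: "\<And>z. \<bar>\<phi> z\<bar> \<le> B" by (rule test_function_bound[OF t]) (rule that)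
    have "\<bar>c * \<phi> (T s z)\<bar> \<le> \<bar>c\<bar> * B" for z using B by (auto simp: abs_mult intro: mult_left_mono)
    then show ?thesis by (intro integrable_mult_bounded[OF w]) auto
  qed
  have iw1: "integrable lborel (\<lambda>z. w z * \<psi> s z)" for s unfolding \<psi>_def by (rule iw)
  have "(LINT z|lborel. (w (T h z) - w z) * \<phi> z) = (LINT z|lborel. w (T h z) * \<phi> z) - (LINT z|lborel. w z * \<phi> z)"
    unfolding left_diff_distrib
    by (intro Bochner_Integration.integral_diff integrable_mult_test[OF integrable_T[OF w] t] integrable_mult_test[OF w t])
  also have "\<dots> = (LINT z|lborel. w z * \<psi> h z) - (LINT z|lborel. w z * \<psi> 0 z)"
    by (subst integral_T_mult) (auto simp: \<psi>_def T_0)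
  also have "\<dots> = (LINT z|lborel. w z * (\<psi> h z - \<psi> 0 z))"
    unfolding right_diff_distrib by (rule Bochner_Integration.integral_diff[symmetric, OF iw1 iw1])
  also have "\<dots> = (LINT z|lborel. LINT s|lborel. w z * (indicator {0..h} s * D s z))"
    unfolding FTC by simp
  also have "\<dots> = (LINT s|lborel. LINT z|lborel. w z * (indicator {0..h} s * D s z))"
    by (rule lborel_pair.Fubini_integral[OF iP])
  also have "\<dots> = (LINT s|lborel. indicator {0..h} s * (LINT z|lborel. w z * D s z))"
    by (simp only: mult.left_commute[of "w _" "indicator {0..h} _"] integral_mult_right_zero)
  also have "\<dots> = (LINT s|lborel. indicator {0..h} s * (LINT z|lborel. G (T s z) * \<phi> z))"
    using Dw by (intro Bochner_Integration.integral_cong) (auto simp: indicator_def)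
  also have "\<dots> = (LINT z|lborel. flow_avg G h z * \<phi> z)"
    by (rule flow_avg_mult_test[OF Gi t, symmetric])
  finally show ?thesis .
qed

text \<open>The exceptional null set depends on \<open>h\<close>; for rotations, Fubini's theorem
  later gives almost every time on almost every orbit.\<close>

lemma AE_flow_increment:
  assumes w: "integrable lborel w" and g: "\<And>k. integrable lborel (g k)" and wg: "weak_grad V w g"
    and UV: "\<And>z s. z \<in> U \<Longrightarrow> 0 \<le> s \<Longrightarrow> s \<le> h \<Longrightarrow> T s z \<in> V" and h: "0 \<le> h" and U: "open U"
    and G: "\<And>z. G z = (\<Sum>k\<in>UNIV. X z $ k * g k z)" and Gi: "integrable lborel G"
  shows "AE z in lborel. z \<in> U \<longrightarrow> w (T h z) - w z = flow_avg G h z"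
proof -
  have i: "integrable lborel (\<lambda>z. (w (T h z) - w z) - flow_avg G h z)"
    by (intro Bochner_Integration.integrable_diff integrable_T w integrable_flow_avg Gi)
  have "AE z in lborel. z \<in> U \<longrightarrow> (w (T h z) - w z) - flow_avg G h z = 0"
  proof (rule AE_eq_0_if_test_integrals_0[OF i U])
    fix \<phi> assume t: "test_function U \<phi>"
    have "(LINT z|lborel. ((w (T h z) - w z) - flow_avg G h z) * \<phi> z)
      = (LINT z|lborel. (w (T h z) - w z) * \<phi> z) - (LINT z|lborel. flow_avg G h z * \<phi> z)"
      unfolding left_diff_distrib[of "w (T h _) - w _"]
      by (intro Bochner_Integration.integral_diff integrable_mult_test[OF _ t] Bochner_Integration.integrable_diff
          integrable_T w integrable_flow_avg Gi)
    also have "\<dots> = 0" using flow_increment_test[OF w g wg UV h t G Gi] by simp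
    finally show "(LINT z|lborel. ((w (T h z) - w z) - flow_avg G h z) * \<phi> z) = 0" .
  qed
  then show ?thesis by (auto elim: eventually_mono)
qed

text \<open>Jensen's inequality for the convex function \<open>excess M\<close>, by hand from |G| <=
  M + excess. If \<open>G\<close> is not integrable along the orbit, the left side is 0 by the
  default value of the integral.\<close>

lemma excess_flow_avg:
  assumes [measurable]: "G \<in> borel_measurable borel" and h: "0 < h" and M: "0 \<le> M"
  shows "ennreal (excess M (flow_avg G h z / h))
    \<le> ennreal (1 / h) * (\<integral>\<^sup>+s. indicator {0..h} s * ennreal (excess M (G (T s z))) \<partial>lborel)"
proof (cases "integrable lborel (\<lambda>s. indicator {0..h} s * G (T s z))")
  case True
  let ?i = "indicator {0..h} :: real \<Rightarrow> real"
  have i2: "integrable lborel (\<lambda>s. ?i s * excess M (G (T s z)))"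
  proof (rule Bochner_Integration.integrable_bound[OF True])
    show "AE s in lborel. norm (?i s * excess M (G (T s z))) \<le> norm (?i s * G (T s z))"
      using excess_le_abs[OF M] excess_nonneg[of M] by (auto simp: indicator_def)
  qed measurable
  have i1: "integrable lborel ?i" by (simp add: integrable_indicator_iff emeasure_lborel_Icc_eq)
  have "\<bar>flow_avg G h z\<bar> \<le> (LINT s|lborel. \<bar>?i s * G (T s z)\<bar>)"
    unfolding flow_avg_def by (rule integral_abs_bound)
  also have "\<dots> \<le> (LINT s|lborel. M * ?i s + ?i s * excess M (G (T s z)))"
  proof (rule integral_mono)
    show "integrable lborel (\<lambda>s. M * ?i s + ?i s * excess M (G (T s z)))"
      using i1 i2 by (intro Bochner_Integration.integrable_add integrable_mult_right)
  qed (use True in \<open>auto simp: indicator_def excess_def\<close>)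
  also have "\<dots> = M * h + (LINT s|lborel. ?i s * excess M (G (T s z)))"
    using i1 i2 h by simp
  finally have "\<bar>flow_avg G h z\<bar> / h \<le> (M * h + (LINT s|lborel. ?i s * excess M (G (T s z)))) / h"
    using h by (intro divide_right_mono) auto
  also have "\<dots> = M + 1 / h * (LINT s|lborel. ?i s * excess M (G (T s z)))" using h by (simp add: add_divide_distrib)
  finally have "\<bar>flow_avg G h z / h\<bar> - M \<le> 1 / h * (LINT s|lborel. ?i s * excess M (G (T s z)))"
    using h by simp
  moreover have "0 \<le> 1 / h * (LINT s|lborel. ?i s * excess M (G (T s z)))"
    using h by (intro mult_nonneg_nonneg Bochner_Integration.integral_nonneg excess_nonneg) auto
  ultimately have "excess M (flow_avg G h z / h) \<le> 1 / h * (LINT s|lborel. ?i s * excess M (G (T s z)))"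
    unfolding excess_def[of M "flow_avg G h z / h"] by (rule max.boundedI[rotated])
  then have "ennreal (excess M (flow_avg G h z / h))
      \<le> ennreal (1 / h) * ennreal (LINT s|lborel. ?i s * excess M (G (T s z)))"
    using h by (subst ennreal_mult[symmetric])
      (auto intro!: ennreal_leI Bochner_Integration.integral_nonneg mult_nonneg_nonneg excess_nonneg)
  also have "ennreal (LINT s|lborel. ?i s * excess M (G (T s z))) = (\<integral>\<^sup>+s. ennreal (?i s * excess M (G (T s z))) \<partial>lborel)"
    using i2 by (intro nn_integral_eq_integral[symmetric]) (auto simp: excess_nonneg)
  also have "\<dots> = (\<integral>\<^sup>+s. indicator {0..h} s * ennreal (excess M (G (T s z))) \<partial>lborel)"
    by (intro nn_integral_cong) (auto simp: indicator_def)
  finally show ?thesis .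
next
  case False
  then have "flow_avg G h z = 0" unfolding flow_avg_def by (rule not_integrable_integral_eq)
  then show ?thesis using M by (simp add: excess_def)
qed

lemma excess_flow_increment:
  assumes w: "integrable lborel w" and g: "\<And>k. integrable lborel (g k)" and wg: "weak_grad V w g"
    and UV: "\<And>z s. z \<in> U \<Longrightarrow> 0 \<le> s \<Longrightarrow> s \<le> h \<Longrightarrow> T s z \<in> V" and h: "0 < h" and U: "open U"
    and G: "\<And>z. G z = (\<Sum>k\<in>UNIV. X z $ k * g k z)" and Gi: "integrable lborel G" and M: "0 \<le> M"
  shows "(\<integral>\<^sup>+z. indicator U z * ennreal (excess M ((w (T h z) - w z) / h)) \<partial>lborel)
    \<le> (\<integral>\<^sup>+z. excess M (G z) \<partial>lborel)"
proof -
  have [measurable]: "G \<in> borel_measurable borel" using Gi by auto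
  have incr: "AE z in lborel. z \<in> U \<longrightarrow> w (T h z) - w z = flow_avg G h z"
    by (rule AE_flow_increment[OF w g wg _ less_imp_le[OF h] U G Gi]) (rule UV)
  have "(\<integral>\<^sup>+z. indicator U z * ennreal (excess M ((w (T h z) - w z) / h)) \<partial>lborel)
    \<le> (\<integral>\<^sup>+z. ennreal (1 / h) * (\<integral>\<^sup>+s. indicator {0..h} s * ennreal (excess M (G (T s z))) \<partial>lborel) \<partial>lborel)"
  proof (rule nn_integral_mono_AE)
    show "AE z in lborel. indicator U z * ennreal (excess M ((w (T h z) - w z) / h))
      \<le> ennreal (1 / h) * (\<integral>\<^sup>+s. indicator {0..h} s * ennreal (excess M (G (T s z))) \<partial>lborel)"
      using incr
    proof eventually_elim
      case (elim z)
      then show ?case using excess_flow_avg[OF _ h M, of G z] by (auto simp: indicator_def)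
    qed
  qed
  also have "\<dots> = ennreal (1 / h) * (\<integral>\<^sup>+z. (\<integral>\<^sup>+s. indicator {0..h} s * ennreal (excess M (G (T s z))) \<partial>lborel) \<partial>lborel)"
    by (rule nn_integral_cmult) measurable
  also have "(\<integral>\<^sup>+z. (\<integral>\<^sup>+s. indicator {0..h} s * ennreal (excess M (G (T s z))) \<partial>lborel) \<partial>lborel)
    = (\<integral>\<^sup>+s. (\<integral>\<^sup>+z. indicator {0..h} s * ennreal (excess M (G (T s z))) \<partial>lborel) \<partial>lborel)"
    by (rule lborel_pair.Fubini') measurable
  \<comment> \<open>Each time contributes at most the full integral, since composition with the
    forward flow has a factor at most 1.\<close>
  also have "\<dots> \<le> (\<integral>\<^sup>+s. (\<integral>\<^sup>+z. excess M (G z) \<partial>lborel) * indicator {0..h} s \<partial>lborel)"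
  proof (intro nn_integral_mono)
    fix s :: real
    have "(\<integral>\<^sup>+z. ennreal (excess M (G (T s z))) \<partial>lborel) \<le> 1 * (\<integral>\<^sup>+z. excess M (G z) \<partial>lborel)" if "0 \<le> s"
      using that trace_nonneg by (subst nn_integral_T) (auto intro!: mult_right_mono simp: ennreal_1[symmetric] simp del: ennreal_1)
    then show "(\<integral>\<^sup>+z. indicator {0..h} s * ennreal (excess M (G (T s z))) \<partial>lborel)
      \<le> (\<integral>\<^sup>+z. excess M (G z) \<partial>lborel) * indicator {0..h} s"
      by (auto simp: indicator_def)
  qed
  also have "\<dots> = (\<integral>\<^sup>+z. excess M (G z) \<partial>lborel) * ennreal h"
    using h by (subst nn_integral_cmult_indicator) auto
  finally have "(\<integral>\<^sup>+z. indicator U z * ennreal (excess M ((w (T h z) - w z) / h)) \<partial>lborel)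
    \<le> ennreal (1 / h) * ((\<integral>\<^sup>+z. excess M (G z) \<partial>lborel) * ennreal h)"
    by (simp add: mult_left_mono)
  also have "\<dots> = ennreal (1 / h) * ennreal h * (\<integral>\<^sup>+z. excess M (G z) \<partial>lborel)" by (simp add: mult_ac)
  also have "ennreal (1 / h) * ennreal h = 1" using h by (simp add: ennreal_mult[symmetric])
  finally show ?thesis by simp
qed

section \<open>Difference quotients inside an open set\<close>

definition stay :: "(real ^ 'n) set \<Rightarrow> real \<Rightarrow> (real ^ 'n) set" where
  "stay V h = {z. \<forall>s\<in>{0..h}. T s z \<in> V}"

text \<open>The complement is the projection of a closed set along the compact factor
  \<open>{0..h}\<close>.\<close>

lemma open_stay:
  assumes "open V"
  shows "open (stay V h)"
proof -
  have "closed ((\<lambda>q. T (fst q) (snd q)) -` (- V))"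
    using assms T_cont by (intro closed_vimage) auto
  from closed_compact_projection[OF compact_Icc[of 0 h] this]
  have "closed {z. \<exists>s. s \<in> {0..h} \<and> (s, z) \<in> (\<lambda>q. T (fst q) (snd q)) -` (- V)}" .
  moreover have "stay V h = - {z. \<exists>s. s \<in> {0..h} \<and> (s, z) \<in> (\<lambda>q. T (fst q) (snd q)) -` (- V)}"
    by (auto simp: stay_def)
  ultimately show ?thesis by (simp add: open_Compl)
qed

lemma stay_subset: "0 \<le> h \<Longrightarrow> stay V h \<subseteq> V"
proof
  fix z assume "0 \<le> h" "z \<in> stay V h"
  then have "T 0 z \<in> V" unfolding stay_def by auto
  then show "z \<in> V" by (simp add: T_0)
qed

text \<open>Uniform continuity of the flow on \<open>{0..1} \<times> K\<close> keeps short orbits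
  within the distance \<open>r\<close> from \<open>K\<close> that is still inside
  \<open>V\<close>.\<close>

lemma compact_subset_stay:
  assumes "compact K" "K \<subseteq> V" "open V"
  shows "\<exists>h0>0. \<forall>h\<le>h0. K \<subseteq> stay V h"
proof -
  obtain r where r: "0 < r" "(\<Union>x\<in>K. ball x r) \<subseteq> V"
    using compact_subset_open_imp_ball_epsilon_subset[OF assms(1,3,2)] by metis
  have "compact ({0..1::real} \<times> K)" using assms by (intro compact_Times) auto
  then have "uniformly_continuous_on ({0..1} \<times> K) (\<lambda>q. T (fst q) (snd q))"
    by (intro compact_uniformly_continuous continuous_on_subset[OF T_cont]) auto
  then obtain d where d: "0 < d" "\<And>p q. p \<in> {0..1} \<times> K \<Longrightarrow> q \<in> {0..1} \<times> K \<Longrightarrow> dist q p < d \<Longrightarrow>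
     dist (T (fst q) (snd q)) (T (fst p) (snd p)) < r"
    unfolding uniformly_continuous_on_def using r(1) by metis
  have "K \<subseteq> stay V h" if "h \<le> min 1 (d / 2)" for h
  proof
    fix z assume z: "z \<in> K"
    show "z \<in> stay V h" unfolding stay_def
    proof (intro CollectI ballI)
      fix s assume s: "s \<in> {0..h}"
      have "dist (T (fst (s, z)) (snd (s, z))) (T (fst (0::real, z)) (snd (0::real, z))) < r"
        using z s that d(1) by (intro d(2)) (auto simp: dist_prod_def dist_real_def)
      then have "T s z \<in> ball z r" by (simp add: T_0 dist_commute)
      then show "T s z \<in> V" using r(2) z by blast
    qed
  qed
  then show ?thesis using d(1) by (intro exI[of _ "min 1 (d / 2)"]) auto
qed

text \<open>Class C1 with an explicit gradient \<open>d\<close> is all that the limit of difference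
  quotients uses; it spares a proof that the quotients by |x|^2 occurring later are smooth to every
  order.\<close>

definition c1_test :: "(real ^ 'n) set \<Rightarrow> (real ^ 'n \<Rightarrow> real) \<Rightarrow> (real ^ 'n \<Rightarrow> real ^ 'n) \<Rightarrow> bool" where
  "c1_test V \<phi> d \<longleftrightarrow> (\<forall>z. (\<phi> has_derivative (\<lambda>v. d z \<bullet> v)) (at z)) \<and> continuous_on UNIV d \<and>
     (\<exists>K. compact K \<and> K \<subseteq> V \<and> (\<forall>z. z \<notin> K \<longrightarrow> \<phi> z = 0 \<and> d z = 0))"

lemma bounded_if_compact_support:
  fixes f :: "real ^ 'n \<Rightarrow> real"
  assumes "continuous_on UNIV f" "compact K" "\<And>z. z \<notin> K \<Longrightarrow> f z = 0"
  obtains B where "\<And>z. \<bar>f z\<bar> \<le> B"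
proof -
  have "bounded (f ` K)"
    using assms by (intro compact_imp_bounded compact_continuous_image continuous_on_subset[OF assms(1)]) auto
  then obtain B where B: "\<And>z. z \<in> K \<Longrightarrow> \<bar>f z\<bar> \<le> B" unfolding bounded_iff by auto
  have "\<bar>f z\<bar> \<le> max B 0" for z
    using B[of z] assms(3)[of z] by (cases "z \<in> K") auto
  then show ?thesis by (rule that)
qed

lemma continuous_fder:
  assumes "c1_test V \<phi> d"
  shows "continuous_on UNIV \<phi>" "continuous_on UNIV (fder \<phi> d)"
proof -
  have d: "\<And>z. (\<phi> has_derivative (\<lambda>v. d z \<bullet> v)) (at z)" and c: "continuous_on UNIV d"
    using assms by (auto simp: c1_test_def)
  show 1: "continuous_on UNIV \<phi>"
    using d has_derivative_continuous by (intro continuous_at_imp_continuous_on ballI) blast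
  have "continuous_on UNIV X"
    unfolding X_def[abs_def] by (intro continuous_intros linear_continuous_on matrix_vector_mul_bounded_linear)
  then show "continuous_on UNIV (fder \<phi> d)"
    unfolding fder_def[abs_def] by (intro continuous_intros 1 c)
qed

text \<open>Discrete integration by parts: a change of variables moves the flow from
  \<open>v\<close> to \<open>\<phi>\<close>. The cut-off to \<open>stay V (h n)\<close> is invisible
  once the support of \<open>\<phi>\<close> lies in that set.\<close>

lemma difference_quotient_test_tendsto:
  assumes v: "integrable lborel v" and t: "c1_test V \<phi> d" and V: "open V"
    and h: "\<And>n. 0 < h n" "h \<longlonglongrightarrow> 0"
  shows "(\<lambda>n. LINT z|lborel. indicator (stay V (h n)) z * ((v (T (h n) z) - v z) / h n) * \<phi> z)
    \<longlonglongrightarrow> - (LINT z|lborel. v z * fder \<phi> d z)"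
proof -
  have d: "\<And>z. (\<phi> has_derivative (\<lambda>v. d z \<bullet> v)) (at z)" using t by (simp add: c1_test_def)
  obtain K where K: "compact K" "K \<subseteq> V" "\<And>z. z \<notin> K \<Longrightarrow> \<phi> z = 0" "\<And>z. z \<notin> K \<Longrightarrow> d z = 0"
    using t unfolding c1_test_def by metis
  note cont = continuous_fder[OF t]
  have [measurable]: "v \<in> borel_measurable borel" using v by auto
  have [measurable]: "\<phi> \<in> borel_measurable borel" "fder \<phi> d \<in> borel_measurable borel"
    using cont by (auto intro: borel_measurable_continuous_onI)
  obtain B where B: "\<And>z. \<bar>fder \<phi> d z\<bar> \<le> B"
    by (rule bounded_if_compact_support[OF cont(2) K(1)]) (auto simp: fder_def K)
  obtain B\<phi> where B\<phi>: "\<And>z. \<bar>\<phi> z\<bar> \<le> B\<phi>"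
    by (rule bounded_if_compact_support[OF cont(1) K(1)]) (auto simp: K)
  define \<psi> where "\<psi> s z = exp (- (trace N * s)) * \<phi> (T (- s) z)" for s z
  have [measurable]: "\<psi> s \<in> borel_measurable borel" for s unfolding \<psi>_def[abs_def] by measurable
  have der: "((\<lambda>s. \<psi> s z) has_real_derivative - (exp (- (trace N * s)) * fder \<phi> d (T (- s) z))) (at s)" for s z
    unfolding \<psi>_def by (rule pullback_has_derivative_s[OF d])
  have \<psi>0: "\<psi> 0 z = \<phi> z" for z by (simp add: \<psi>_def T_0)
  \<comment> \<open>The mean value theorem in time bounds the quotients uniformly in
    \<open>n\<close>, as dominated convergence requires.\<close>
  have quot: "\<bar>(\<psi> (h n) z - \<psi> 0 z) / h n\<bar> \<le> B" for n z
  proof -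
    have "\<exists>s. 0 < s \<and> s < h n \<and> \<psi> (h n) z - \<psi> 0 z = (h n - 0) * - (exp (- (trace N * s)) * fder \<phi> d (T (- s) z))"
      by (rule MVT2[OF h(1)]) (rule der)
    then obtain s where s: "0 < s" "\<psi> (h n) z - \<psi> 0 z = h n * - (exp (- (trace N * s)) * fder \<phi> d (T (- s) z))"
      by auto
    have "exp (- (trace N * s)) * \<bar>fder \<phi> d (T (- s) z)\<bar> \<le> 1 * B"
      using s trace_nonneg B by (intro mult_mono) auto
    then show ?thesis using h(1)[of n] by (simp add: s(2) abs_mult)
  qed
  have "(\<lambda>n. LINT z|lborel. v z * ((\<psi> (h n) z - \<psi> 0 z) / h n)) \<longlonglongrightarrow> (LINT z|lborel. v z * - fder \<phi> d z)"
  proof (rule integral_dominated_convergence[where w="\<lambda>z. \<bar>v z\<bar> * B"])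
    show "integrable lborel (\<lambda>z. \<bar>v z\<bar> * B)" using v by auto
    show "AE z in lborel. (\<lambda>n. v z * ((\<psi> (h n) z - \<psi> 0 z) / h n)) \<longlonglongrightarrow> v z * - fder \<phi> d z"
    proof (intro AE_I2 tendsto_mult tendsto_const)
      fix z
      have "((\<lambda>s. (\<psi> s z - \<psi> 0 z) / s) \<longlongrightarrow> - fder \<phi> d z) (at 0)"
        using der[of z 0] by (simp add: DERIV_def T_0)
      moreover have "filterlim h (at 0) sequentially"
        using h by (auto simp: filterlim_at less_imp_neq[symmetric])
      ultimately show "(\<lambda>n. (\<psi> (h n) z - \<psi> 0 z) / h n) \<longlonglongrightarrow> - fder \<phi> d z"
        by (rule filterlim_compose)
    qed
    show "AE z in lborel. norm (v z * ((\<psi> (h n) z - \<psi> 0 z) / h n)) \<le> \<bar>v z\<bar> * B" for n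
      using quot[of n] by (intro AE_I2) (simp only: real_norm_def abs_mult[of "v _"] mult_left_mono abs_ge_zero)
  qed measurable
  moreover have "\<forall>\<^sub>F n in sequentially. (LINT z|lborel. v z * ((\<psi> (h n) z - \<psi> 0 z) / h n))
     = (LINT z|lborel. indicator (stay V (h n)) z * ((v (T (h n) z) - v z) / h n) * \<phi> z)"
  proof -
    obtain h0 where h0: "0 < h0" "\<And>h. h \<le> h0 \<Longrightarrow> K \<subseteq> stay V h"
      using compact_subset_stay[OF K(1,2) V] by blast
    have "\<forall>\<^sub>F n in sequentially. h n < h0" using h(2) h0(1) by (rule order_tendstoD)
    then show ?thesis
    proof eventually_elim
      case (elim n)
      have ind: "indicator (stay V (h n)) z * ((v (T (h n) z) - v z) / h n) * \<phi> z
        = (v (T (h n) z) * \<phi> z - v z * \<phi> z) / h n" for z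
        using h0(2)[of "h n"] elim K(3)[of z] by (cases "z \<in> K") (auto simp: field_simps)
      have i1: "integrable lborel (\<lambda>z. v (T (h n) z) * \<phi> z)"
        by (rule integrable_mult_bounded[OF integrable_T[OF v] _ B\<phi>]) simp
      have i2: "integrable lborel (\<lambda>z. v z * \<phi> z)"
        by (rule integrable_mult_bounded[OF v _ B\<phi>]) simp
      have i3: "integrable lborel (\<lambda>z. v z * \<psi> (h n) z)"
      proof (rule integrable_mult_bounded[OF v])
        show "\<bar>\<psi> (h n) z\<bar> \<le> exp (- (trace N * h n)) * B\<phi>" for z
          unfolding \<psi>_def using B\<phi> by (auto simp: abs_mult intro: mult_left_mono)
      qed simp
      have "(LINT z|lborel. indicator (stay V (h n)) z * ((v (T (h n) z) - v z) / h n) * \<phi> z)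
        = ((LINT z|lborel. v (T (h n) z) * \<phi> z) - (LINT z|lborel. v z * \<phi> z)) / h n"
        unfolding ind using i1 i2 by simp
      also have "\<dots> = ((LINT z|lborel. v z * \<psi> (h n) z) - (LINT z|lborel. v z * \<phi> z)) / h n"
        by (subst integral_T_mult) (auto simp: \<psi>_def)
      also have "\<dots> = (LINT z|lborel. (v z * \<psi> (h n) z - v z * \<phi> z) / h n)"
        using i2 i3 by simp
      also have "\<dots> = (LINT z|lborel. v z * ((\<psi> (h n) z - \<psi> 0 z) / h n))"
        by (rule Bochner_Integration.integral_cong) (auto simp: \<psi>0 right_diff_distrib)
      finally show ?case by (rule sym)
    qed
  qed
  ultimately have "(\<lambda>n. LINT z|lborel. indicator (stay V (h n)) z * ((v (T (h n) z) - v z) / h n) * \<phi> z)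
    \<longlonglongrightarrow> (LINT z|lborel. v z * - fder \<phi> d z)"
    by (rule Lim_transform_eventually)
  then show ?thesis by simp
qed

text \<open>The cut-off quotients live on \<open>V\<close>, a space of finite measure, and
  integrability of \<open>G\<close> sends their common excess bound to 0. So
  \<open>equi_integrable_limit\<close> applies, and \<open>difference_quotient_test_tendsto\<close>
  identifies what its limit does to test functions.\<close>

lemma flow_derivative_exists:
  fixes v G :: "real ^ 'n \<Rightarrow> real"
  assumes v: "integrable lborel v" and V: "open V" "bounded V"
    and G: "integrable lborel G"
    and exc: "\<And>h M. 0 < h \<Longrightarrow> 0 \<le> M \<Longrightarrow>
      (\<integral>\<^sup>+z. indicator (stay V h) z * ennreal (excess M ((v (T h z) - v z) / h)) \<partial>lborel)
       \<le> 4 * (\<integral>\<^sup>+z. excess (M / 2) (G z) \<partial>lborel)"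
  obtains g where "integrable lborel g" "\<And>z. z \<notin> V \<Longrightarrow> g z = 0"
    "\<And>M. 0 \<le> M \<Longrightarrow> (\<integral>\<^sup>+z. excess M (g z) \<partial>lborel) \<le> 4 * (\<integral>\<^sup>+z. excess (M / 2) (G z) \<partial>lborel)"
    "\<And>\<phi> d. c1_test V \<phi> d \<Longrightarrow> (LINT z|lborel. v z * fder \<phi> d z) = - (LINT z|lborel. g z * \<phi> z)"
proof -
  define N' where "N' = restrict_space lborel V"
  have [measurable]: "V \<in> sets borel" using V by auto
  have [measurable]: "v \<in> borel_measurable borel" "G \<in> borel_measurable borel" using v G by auto
  have stay_meas[measurable]: "stay V h \<in> sets borel" for h using open_stay[OF V(1)] by auto
  have fin: "finite_measure N'"
  proof
    have "emeasure lborel V < \<infinity>" using V by (intro emeasure_bounded_finite)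
    then show "emeasure N' (space N') \<noteq> \<infinity>"
      by (simp add: N'_def emeasure_restrict_space space_restrict_space)
  qed
  define h where "h n = 1 / real (Suc n)" for n
  have h: "\<And>n. 0 < h n" by (simp add: h_def)
  have h2: "h \<longlonglongrightarrow> 0" unfolding h_def by (rule LIMSEQ_Suc[OF lim_1_over_n])
  define q where "q n z = indicator (stay V (h n)) z * ((v (T (h n) z) - v z) / h n)" for n z
  have qi: "integrable lborel (q n)" for n
  proof -
    have "integrable lborel (\<lambda>z. (v (T (h n) z) - v z) / h n)" using integrable_T[OF v] v by auto
    from integrable_real_mult_indicator[OF _ this, of "stay V (h n)"] show ?thesis
      by (simp add: q_def[abs_def] mult.commute)
  qed
  have q0: "q n z = 0" if "z \<notin> V" for n z
    using stay_subset[of "h n" V] h[of n] that by (auto simp: q_def indicator_def)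
  have rint: "(LINT z|N'. f z) = (LINT z|lborel. f z)" if "\<And>z. z \<notin> V \<Longrightarrow> f z = 0" for f :: "_ \<Rightarrow> real"
    unfolding N'_def using that
    by (subst integral_restrict_space) (auto intro!: Bochner_Integration.integral_cong simp: indicator_def)
  have rint2: "integrable N' f" if "integrable lborel f" for f :: "_ \<Rightarrow> real"
    unfolding N'_def using integrable_mult_indicator[OF _ that, of V] by (subst integrable_restrict_space) auto
  define K where "K M = 4 * (LINT z|lborel. excess (M / 2) (G z))" for M
  have nnG: "(\<integral>\<^sup>+z. excess M (G z) \<partial>lborel) = ennreal (LINT z|lborel. excess M (G z))" if "0 \<le> M" for M
    using integrable_excess[OF G that] by (intro nn_integral_eq_integral) (auto simp: excess_nonneg)
  have K4: "4 * (\<integral>\<^sup>+z. excess (M / 2) (G z) \<partial>lborel) = ennreal (K M)" if "0 \<le> M" for M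
    using that by (simp add: nnG K_def ennreal_mult Bochner_Integration.integral_nonneg excess_nonneg)
  have excq: "(LINT z|N'. excess M (q n z)) \<le> K M" if M: "0 \<le> M" for n M
  proof -
    have "ennreal (LINT z|N'. excess M (q n z)) = ennreal (LINT z|lborel. excess M (q n z))"
      by (subst rint) (use q0 M in \<open>auto simp: excess_def\<close>)
    also have "\<dots> = (\<integral>\<^sup>+z. excess M (q n z) \<partial>lborel)"
      using integrable_excess[OF qi M] by (intro nn_integral_eq_integral[symmetric]) (auto simp: excess_nonneg)
    also have "\<dots> = (\<integral>\<^sup>+z. indicator (stay V (h n)) z * ennreal (excess M ((v (T (h n) z) - v z) / h n)) \<partial>lborel)"
      using M by (intro nn_integral_cong) (auto simp: q_def indicator_def excess_def)
    also have "\<dots> \<le> ennreal (K M)" using exc[OF h M] K4[OF M] by simp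
    finally show ?thesis
      by (subst (asm) ennreal_le_iff) (auto simp: K_def excess_nonneg intro!: Bochner_Integration.integral_nonneg)
  qed
  have Klim: "(K \<longlongrightarrow> 0) at_top"
  proof -
    \<comment> \<open>\<open>max 0 M\<close> keeps the integrand dominated by |G|; for negative
      levels even the value 0 has positive excess, which is not integrable over the whole
      space.\<close>
    have "((\<lambda>M. LINT z|lborel. excess (max 0 M / 2) (G z)) \<longlongrightarrow> 0) at_top"
    proof (rule tendsto_at_topI_sequentially)
      fix Y :: "nat \<Rightarrow> real" assume Y: "filterlim Y at_top sequentially"
      have "(\<lambda>n. LINT z|lborel. excess (max 0 (Y n) / 2) (G z)) \<longlonglongrightarrow> (LINT z|(lborel :: (real ^ 'n) measure). 0)"
      proof (rule integral_dominated_convergence[where w="\<lambda>z. \<bar>G z\<bar>"])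
        show "AE z in lborel. (\<lambda>n. excess (max 0 (Y n) / 2) (G z)) \<longlonglongrightarrow> 0"
        proof (rule AE_I2)
          fix z
          have "\<forall>\<^sub>F n in sequentially. 2 * \<bar>G z\<bar> \<le> Y n"
            using Y by (simp add: filterlim_at_top)
          then have "\<forall>\<^sub>F n in sequentially. excess (max 0 (Y n) / 2) (G z) = 0"
            by eventually_elim (auto simp: excess_def max_def)
          then show "(\<lambda>n. excess (max 0 (Y n) / 2) (G z)) \<longlonglongrightarrow> 0"
            by (rule tendsto_eventually)
        qed
        show "AE z in lborel. norm (excess (max 0 (Y n) / 2) (G z)) \<le> \<bar>G z\<bar>" for n
          by (intro AE_I2) (simp add: excess_nonneg excess_le_abs)
      qed (use G in auto)
      then show "(\<lambda>n. LINT z|lborel. excess (max 0 (Y n) / 2) (G z)) \<longlonglongrightarrow> 0" by simp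
    qed
    then have "((\<lambda>M. LINT z|lborel. excess (M / 2) (G z)) \<longlongrightarrow> 0) at_top"
      by (rule Lim_transform_eventually)
         (use eventually_ge_at_top[of "0::real"] in \<open>eventually_elim, simp add: max_def\<close>)
    from tendsto_mult_left[OF this, of 4] show ?thesis by (simp add: K_def[abs_def])
  qed
  have "\<exists>g0. integrable N' g0 \<and> (\<forall>M\<ge>0. (LINT z|N'. excess M (g0 z)) \<le> K M) \<and>
    (\<forall>\<phi> B L. \<phi> \<in> borel_measurable N' \<longrightarrow> (\<forall>z. \<bar>\<phi> z\<bar> \<le> B) \<longrightarrow>
      (\<lambda>n. LINT z|N'. q n z * \<phi> z) \<longlonglongrightarrow> L \<longrightarrow> (LINT z|N'. g0 z * \<phi> z) = L)"
    by (rule equi_integrable_limit[where g=q, OF fin rint2[OF qi] excq Klim], assumption) blast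
  then obtain g0 where g0: "integrable N' g0" "\<And>M. 0 \<le> M \<Longrightarrow> (LINT z|N'. excess M (g0 z)) \<le> K M"
    "\<And>\<phi> B L. \<phi> \<in> borel_measurable N' \<Longrightarrow> (\<And>z. \<bar>\<phi> z\<bar> \<le> B) \<Longrightarrow>
      (\<lambda>n. LINT z|N'. q n z * \<phi> z) \<longlonglongrightarrow> L \<Longrightarrow> (LINT z|N'. g0 z * \<phi> z) = L"
    by blast
  define g where "g z = indicator V z * g0 z" for z
  have gi: "integrable lborel g"
    using g0(1) unfolding N'_def g_def[abs_def] by (subst (asm) integrable_restrict_space) auto
  have gg0: "(LINT z|N'. f z (g0 z)) = (LINT z|N'. f z (g z))" for f :: "_ \<Rightarrow> real \<Rightarrow> real"
    by (rule Bochner_Integration.integral_cong) (auto simp: N'_def space_restrict_space g_def)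
  show ?thesis
  proof (rule that)
    show "integrable lborel g" by (rule gi)
    show "g z = 0" if "z \<notin> V" for z using that by (simp add: g_def)
    fix M :: real assume M: "0 \<le> M"
    have "(\<integral>\<^sup>+z. excess M (g z) \<partial>lborel) = ennreal (LINT z|lborel. excess M (g z))"
      using integrable_excess[OF gi M] by (intro nn_integral_eq_integral) (auto simp: excess_nonneg)
    also have "(LINT z|lborel. excess M (g z)) = (LINT z|N'. excess M (g0 z))"
      using M unfolding gg0[of "\<lambda>_. excess M"] by (subst rint) (auto simp: g_def excess_def)
    also have "ennreal (LINT z|N'. excess M (g0 z)) \<le> ennreal (K M)" by (intro ennreal_leI g0(2) M)
    finally show "(\<integral>\<^sup>+z. excess M (g z) \<partial>lborel) \<le> 4 * (\<integral>\<^sup>+z. excess (M / 2) (G z) \<partial>lborel)"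
      using K4[OF M] by simp
  next
    fix \<phi> d assume t: "c1_test V \<phi> d"
    obtain C where C: "compact C" "\<And>z. z \<notin> C \<Longrightarrow> \<phi> z = 0"
      using t unfolding c1_test_def by metis
    obtain B where B: "\<And>z. \<bar>\<phi> z\<bar> \<le> B"
      by (rule bounded_if_compact_support[OF continuous_fder(1)[OF t] C], assumption) (rule that)
    have [measurable]: "\<phi> \<in> borel_measurable borel"
      using continuous_fder(1)[OF t] by (rule borel_measurable_continuous_onI)
    have "(\<lambda>n. LINT z|N'. q n z * \<phi> z) \<longlonglongrightarrow> - (LINT z|lborel. v z * fder \<phi> d z)"
    proof -
      have "(LINT z|N'. q n z * \<phi> z) = (LINT z|lborel. q n z * \<phi> z)" for n
        by (rule rint) (simp add: q0)
      moreover have "(\<lambda>n. LINT z|lborel. q n z * \<phi> z) \<longlonglongrightarrow> - (LINT z|lborel. v z * fder \<phi> d z)"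
        unfolding q_def by (rule difference_quotient_test_tendsto[OF v t V(1) h h2])
      ultimately show ?thesis by simp
    qed
    then have "(LINT z|N'. g0 z * \<phi> z) = - (LINT z|lborel. v z * fder \<phi> d z)"
      by (rule g0(3)[OF _ B, rotated]) (simp add: N'_def measurable_restrict_space1)
    moreover have "(LINT z|N'. g0 z * \<phi> z) = (LINT z|lborel. g z * \<phi> z)"
      unfolding gg0[of "\<lambda>z y. y * \<phi> z"] by (rule rint) (simp add: g_def)
    ultimately show "(LINT z|lborel. v z * fder \<phi> d z) = - (LINT z|lborel. g z * \<phi> z)" by simp
  qed
qed

end

section \<open>Rotations, dilations and translations\<close>

definition plane_part :: "'n::finite \<Rightarrow> 'n \<Rightarrow> real ^ 'n \<Rightarrow> real ^ 'n" where
  "plane_part i j z = (\<chi> k. if k = i \<or> k = j then z $ k else 0)"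

definition quarter_turn :: "'n::finite \<Rightarrow> 'n \<Rightarrow> real ^ 'n \<Rightarrow> real ^ 'n" where
  "quarter_turn i j z = (\<chi> k. if k = i then - z $ j else if k = j then z $ i else 0)"

text \<open>The exponential of \<theta> times \<open>quarter_turn\<close>, whose square is minus
  \<open>plane_part\<close>.\<close>

definition rot :: "'n::finite \<Rightarrow> 'n \<Rightarrow> real \<Rightarrow> real ^ 'n \<Rightarrow> real ^ 'n" where
  "rot i j \<theta> z = z + (cos \<theta> - 1) *\<^sub>R plane_part i j z + sin \<theta> *\<^sub>R quarter_turn i j z"

definition dil :: "'n::finite \<Rightarrow> 'n \<Rightarrow> real \<Rightarrow> real ^ 'n \<Rightarrow> real ^ 'n" where
  "dil i j s z = z + (exp s - 1) *\<^sub>R plane_part i j z"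

definition shift :: "'n::finite \<Rightarrow> real \<Rightarrow> real ^ 'n \<Rightarrow> real ^ 'n" where
  "shift k s z = z + s *\<^sub>R axis k 1"

lemma rot_nth:
  assumes "i \<noteq> j"
  shows "rot i j \<theta> z $ k = (if k = i then cos \<theta> * z $ i - sin \<theta> * z $ j
     else if k = j then sin \<theta> * z $ i + cos \<theta> * z $ j else z $ k)"
  using assms by (simp add: rot_def plane_part_def quarter_turn_def algebra_simps)

lemma dil_nth: "dil i j s z $ k = (if k = i \<or> k = j then exp s * z $ k else z $ k)"
  by (simp add: dil_def plane_part_def algebra_simps)

lemma shift_nth: "shift k s z $ l = z $ l + (if l = k then s else 0)"
  by (simp add: shift_def axis_def)

lemma linear_plane_part: "linear (plane_part i j)"
  by (rule linearI) (auto simp: plane_part_def vec_eq_iff)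

lemma linear_quarter_turn: "linear (quarter_turn i j)"
  by (rule linearI) (auto simp: quarter_turn_def vec_eq_iff)

lemma axis_1_nth: "axis k (1::real) $ l = (if l = k then 1 else 0)"
  by (simp add: axis_def)

lemma matrix_nth_diag: "matrix f $ k $ k = f (axis k 1) $ k"
  by (simp add: matrix_def)

lemma linear_rot: "linear (rot i j \<theta>)"
  using linear_plane_part[of i j] linear_quarter_turn[of i j]
  by (intro linearI) (simp_all add: rot_def linear_add linear_scale algebra_simps)

lemma linear_dil: "linear (dil i j \<theta>)"
  using linear_plane_part[of i j]
  by (intro linearI) (simp_all add: dil_def linear_add linear_scale algebra_simps)

lemma continuous_on_linear_comp:
  assumes "linear (f :: real ^ 'n::finite \<Rightarrow> real ^ 'n)" "continuous_on S g"
  shows "continuous_on S (\<lambda>x. f (g x))"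
  by (rule continuous_on_compose2[OF linear_continuous_on assms(2) subset_UNIV])
     (use assms(1) in \<open>simp add: linear_conv_bounded_linear\<close>)

lemma rot_0: "rot i j 0 z = z"
  by (simp add: rot_def)

lemma rot_add: "i \<noteq> j \<Longrightarrow> rot i j (s + t) z = rot i j s (rot i j t z)"
  by (simp add: vec_eq_iff rot_nth cos_add sin_add algebra_simps)

lemma norm_rot:
  assumes "i \<noteq> j" shows "norm (rot i j \<theta> z) = norm z"
proof -
  have split: "sum f UNIV = f i + (f j + sum f (UNIV - {i} - {j}))" for f :: "'a \<Rightarrow> real"
    using assms by (simp add: sum.remove[of UNIV i f] sum.remove[of "UNIV - {i}" j f])
  have sq: "(cos \<theta> * a - sin \<theta> * b)\<^sup>2 + (sin \<theta> * a + cos \<theta> * b)\<^sup>2 = a\<^sup>2 + b\<^sup>2" for a b :: real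
  proof -
    have "(c * a - s * b)\<^sup>2 + (s * a + c * b)\<^sup>2 = (s\<^sup>2 + c\<^sup>2) * (a\<^sup>2 + b\<^sup>2)" for c s :: real
      by (simp add: power2_eq_square algebra_simps)
    from this[of "cos \<theta>" "sin \<theta>"] show ?thesis by simp
  qed
  have "(\<Sum>k\<in>UNIV - {i} - {j}. (rot i j \<theta> z $ k)\<^sup>2) = (\<Sum>k\<in>UNIV - {i} - {j}. (z $ k)\<^sup>2)"
    by (rule sum.cong) (auto simp: rot_nth[OF assms])
  moreover have "(rot i j \<theta> z $ i)\<^sup>2 + (rot i j \<theta> z $ j)\<^sup>2 = (z $ i)\<^sup>2 + (z $ j)\<^sup>2"
    using assms sq[of "z $ i" "z $ j"] by (simp add: rot_nth)
  ultimately have "(\<Sum>k\<in>UNIV. (rot i j \<theta> z $ k)\<^sup>2) = (\<Sum>k\<in>UNIV. (z $ k)\<^sup>2)"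
    using split[of "\<lambda>k. (rot i j \<theta> z $ k)\<^sup>2"] split[of "\<lambda>k. (z $ k)\<^sup>2"] by linarith
  then show ?thesis by (simp add: norm_vec_def L2_set_def)
qed

lemma continuous_on_rot: "continuous_on UNIV (\<lambda>q. rot i j (fst q) (snd q))"
  unfolding rot_def
  by (intro continuous_intros continuous_on_linear_comp[OF linear_plane_part] continuous_on_linear_comp[OF linear_quarter_turn])

text \<open>No determinants: the image measure is translation invariant, because a rotation
  conjugates translations to translations, and it gives balls around 0 their usual measure.\<close>

lemma distr_rot:
  assumes "i \<noteq> j"
  shows "distr lborel borel (rot i j \<theta>) = (lborel :: (real ^ 'n::finite) measure)"
proof -
  let ?R = "rot i j \<theta> :: real ^ 'n \<Rightarrow> real ^ 'n"
  have [measurable]: "?R \<in> borel \<rightarrow>\<^sub>M borel"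
    by (intro borel_measurable_continuous_onI continuous_on_linear_comp[OF linear_rot continuous_on_id])
  have inv: "?R (rot i j (- \<theta>) a) = a" for a
    using rot_add[OF assms, of \<theta> "- \<theta>" a] by (simp add: rot_0)
  have vim: "?R -` ball 0 r = ball 0 r" for r by (auto simp: norm_rot[OF assms])
  have ballE: "emeasure (distr lborel borel ?R) (ball 0 r) = emeasure lborel (ball (0::real^'n) r)" for r
    by (subst emeasure_distr) (auto simp: vim)
  show ?thesis
  proof (rule translation_invariant_eq_lborel)
    show "sigma_finite_measure (distr lborel borel ?R)"
    proof
      show "\<exists>A. countable A \<and> A \<subseteq> sets (distr lborel borel ?R) \<and> \<Union> A = space (distr lborel borel ?R) \<and>
        (\<forall>a\<in>A. emeasure (distr lborel borel ?R) a \<noteq> \<infinity>)"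
      proof (intro exI[of _ "range (\<lambda>n::nat. ball 0 (real n))"] conjI ballI)
        show "\<Union> (range (\<lambda>n::nat. ball 0 (real n))) = space (distr lborel borel ?R)"
          using reals_Archimedean2 by (auto simp: space_borel)
        fix a assume "a \<in> range (\<lambda>n::nat. ball (0::real^'n) (real n))"
        then show "emeasure (distr lborel borel ?R) a \<noteq> \<infinity>"
          using emeasure_lborel_ball_finite[of "0::real^'n"] by (auto simp: ballE less_top)
      qed auto
    qed
    fix a
    have "distr (distr lborel borel ?R) borel ((+) a) = distr lborel borel ((+) a \<circ> ?R)"
      by (rule distr_distr) auto
    also have "(+) a \<circ> ?R = ?R \<circ> (+) (rot i j (- \<theta>) a)"
      by (simp add: fun_eq_iff linear_add[OF linear_rot] inv)
    also have "distr lborel borel (?R \<circ> (+) (rot i j (- \<theta>) a)) = distr (distr lborel borel ((+) (rot i j (- \<theta>) a))) borel ?R"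
      by (rule distr_distr[symmetric]) auto
    also have "\<dots> = distr lborel borel ?R" by (simp add: lborel_distr_plus)
    finally show "distr (distr lborel borel ?R) borel ((+) a) = distr lborel borel ?R" .
  qed (auto simp: ballE)
qed

lemma affine_flow_rot:
  assumes "i \<noteq> j"
  shows "affine_flow (rot i j) (matrix (quarter_turn i j)) 0 (\<lambda>s. matrix (rot i j s)) (\<lambda>_. 0)"
proof
  have tr: "trace (matrix (quarter_turn i j)) = 0"
  proof -
    have "matrix (quarter_turn i j) $ k $ k = 0" for k
      using assms by (simp add: matrix_nth_diag quarter_turn_def axis_1_nth)
    then show ?thesis by (simp add: trace_def)
  qed
  show "0 \<le> trace (matrix (quarter_turn i j))" by (simp add: tr)
  show "distr lborel borel (rot i j s) = density lborel (\<lambda>_. ennreal (exp (- (trace (matrix (quarter_turn i j)) * s))))" for s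
    unfolding tr by (simp add: distr_rot[OF assms] density_1)
  show "rot i j s z = matrix (rot i j s) *v z + 0" for s z
    by (simp add: linear_rot)
  show "((\<lambda>s. rot i j s z) has_vector_derivative matrix (quarter_turn i j) *v rot i j s z + 0) (at s)" for s z
  proof -
    have "((\<lambda>s. rot i j s z) has_vector_derivative (- sin s) *\<^sub>R plane_part i j z + cos s *\<^sub>R quarter_turn i j z) (at s)"
      unfolding rot_def by (auto intro!: derivative_eq_intros)
    also have "(- sin s) *\<^sub>R plane_part i j z + cos s *\<^sub>R quarter_turn i j z = quarter_turn i j (rot i j s z)"
      using assms by (simp add: vec_eq_iff quarter_turn_def plane_part_def rot_nth)
    finally show ?thesis by (simp add: linear_quarter_turn matrix_works)
  qed
qed (simp_all add: rot_0 rot_add[OF assms] continuous_on_rot)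

lemma distr_dil:
  assumes "i \<noteq> j"
  shows "distr lborel borel (dil i j s) = density (lborel :: (real ^ 'n::finite) measure) (\<lambda>_. ennreal (exp (- (2 * s))))"
proof -
  let ?D = "dil i j s :: real ^ 'n \<Rightarrow> real ^ 'n"
  define c :: "real ^ 'n \<Rightarrow> real" where "c b = (if b = axis i 1 \<or> b = axis j 1 then exp s else 1)" for b
  have Basis: "(Basis :: (real ^ 'n) set) = range (\<lambda>k. axis k 1)" by (auto simp: Basis_vec_def)
  have inj: "inj (\<lambda>k. axis k 1 :: real ^ 'n)" by (auto simp: inj_def axis_eq_axis)
  have "?D = (\<lambda>x. 0 + (\<Sum>b\<in>Basis. (c b * (x \<bullet> b)) *\<^sub>R b))"
  proof
    fix x
    have "(\<Sum>b\<in>Basis. (c b * (x \<bullet> b)) *\<^sub>R b) = (\<Sum>k\<in>UNIV. (c (axis k 1) * x $ k) *\<^sub>R axis k 1)"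
      unfolding Basis by (subst sum.reindex[OF inj]) (simp add: inner_axis)
    also have "\<dots> = ?D x"
    proof -
      have "c (axis k 1) = (if k = i \<or> k = j then exp s else 1)" for k by (simp add: c_def axis_eq_axis)
      then show ?thesis
        by (simp add: vec_eq_iff dil_nth axis_1_nth if_distrib[of "(*) _"] cong: if_cong)
    qed
    finally show "?D x = 0 + (\<Sum>b\<in>Basis. (c b * (x \<bullet> b)) *\<^sub>R b)" by simp
  qed
  moreover have "(\<Prod>b\<in>Basis. \<bar>c b\<bar>) = exp (2 * s)"
  proof -
    have "(\<Prod>b\<in>Basis. \<bar>c b\<bar>) = (\<Prod>k\<in>UNIV. if k \<in> {i, j} then exp s else 1)"
      unfolding Basis by (subst prod.reindex[OF inj]) (auto simp: c_def axis_eq_axis intro!: prod.cong)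
    also have "\<dots> = (\<Prod>k\<in>{i, j}. exp s)" by (simp add: prod.If_cases del: insert_iff)
    also have "\<dots> = exp s * exp s" using assms by simp
    finally show ?thesis by (simp add: exp_add[symmetric])
  qed
  ultimately have lb: "lborel = density (distr lborel borel ?D) (\<lambda>_. ennreal (exp (2 * s)))"
    using lborel_affine_euclidean[of c 0] by (simp add: c_def)
  have "density lborel (\<lambda>_. ennreal (exp (- (2 * s))))
    = density (density (distr lborel borel ?D) (\<lambda>_. ennreal (exp (2 * s)))) (\<lambda>_. ennreal (exp (- (2 * s))))"
    by (simp add: lb[symmetric])
  also have "\<dots> = density (distr lborel borel ?D) (\<lambda>_. ennreal (exp (2 * s)) * ennreal (exp (- (2 * s))))"
    by (rule density_density_eq) auto
  also have "\<dots> = distr lborel borel ?D"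
    by (simp add: ennreal_mult[symmetric] exp_minus density_1)
  finally show ?thesis by (rule sym)
qed

lemma affine_flow_dil:
  assumes "i \<noteq> j"
  shows "affine_flow (dil i j) (matrix (plane_part i j)) 0 (\<lambda>s. matrix (dil i j s)) (\<lambda>_. 0)"
    and "trace (matrix (plane_part i j)) = 2"
proof -
  have "trace (matrix (plane_part i j)) = (\<Sum>k\<in>UNIV. if k \<in> {i, j} then 1 else 0)"
    unfolding trace_def by (rule sum.cong) (auto simp: matrix_nth_diag plane_part_def axis_1_nth)
  also have "\<dots> = (\<Sum>k\<in>{i, j}. 1)" by (simp add: sum.If_cases del: insert_iff)
  also have "\<dots> = 2" using assms by simp
  finally show tr: "trace (matrix (plane_part i j)) = 2" .
  show "affine_flow (dil i j) (matrix (plane_part i j)) 0 (\<lambda>s. matrix (dil i j s)) (\<lambda>_. 0)"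
  proof
    show "distr lborel borel (dil i j s) = density lborel (\<lambda>_. ennreal (exp (- (trace (matrix (plane_part i j)) * s))))" for s
      unfolding tr by (rule distr_dil[OF assms])
    show "dil i j s z = matrix (dil i j s) *v z + 0" for s z
      by (simp add: matrix_works linear_dil)
    show "dil i j (s + t) z = dil i j s (dil i j t z)" for s t z
      by (simp add: vec_eq_iff dil_nth exp_add)
    show "continuous_on UNIV (\<lambda>q. dil i j (fst q) (snd q))"
      unfolding dil_def by (intro continuous_intros continuous_on_linear_comp[OF linear_plane_part])
    show "((\<lambda>s. dil i j s z) has_vector_derivative matrix (plane_part i j) *v dil i j s z + 0) (at s)" for s z
    proof -
      have "((\<lambda>s. dil i j s z) has_vector_derivative exp s *\<^sub>R plane_part i j z) (at s)"
        unfolding dil_def by (auto intro!: derivative_eq_intros)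
      also have "exp s *\<^sub>R plane_part i j z = plane_part i j (dil i j s z)"
        by (simp add: vec_eq_iff plane_part_def dil_nth)
      finally show ?thesis by (simp add: linear_plane_part matrix_works)
    qed
  qed (simp_all add: tr dil_def)
qed

lemma affine_flow_shift:
  "affine_flow (shift k) 0 (axis k 1 :: real ^ 'n::finite) (\<lambda>_. mat 1) (\<lambda>s. s *\<^sub>R axis k 1)"
proof
  have tr: "trace (0 :: real ^ 'n ^ 'n) = 0" by (simp add: trace_def)
  show "0 \<le> trace (0 :: real ^ 'n ^ 'n)" by (simp add: tr)
  have "shift k s = (+) (s *\<^sub>R axis k 1)" for s by (simp add: shift_def fun_eq_iff add.commute)
  then show "distr lborel borel (shift k s) = density lborel (\<lambda>_. ennreal (exp (- (trace (0 :: real ^ 'n ^ 'n) * s))))" for s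
    unfolding tr by (simp add: lborel_distr_plus density_1)
  show "continuous_on UNIV (\<lambda>q. shift k (fst q) (snd q))"
    unfolding shift_def by (intro continuous_intros)
  show "((\<lambda>s. shift k s z) has_vector_derivative 0 *v shift k s z + axis k 1) (at s)" for s z
  proof -
    have "((\<lambda>s. shift k s z) has_vector_derivative axis k 1) (at s)"
      unfolding shift_def by (auto intro!: derivative_eq_intros)
    moreover have "(0 :: real ^ 'n ^ 'n) *v x = 0" for x by (simp add: matrix_vector_mult_def vec_eq_iff)
    ultimately show ?thesis by simp
  qed
qed (simp_all add: shift_def algebra_simps)

section \<open>Rearrangement on circles\<close>

text \<open>A measure on the whole line carried by one period, so that integrands are ordinary
  periodic functions of a real angle.\<close>

definition circle_measure :: "real measure" where
  "circle_measure = density lborel (indicator {0..<2 * pi})"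

lemma sets_circle_measure [measurable_cong, simp]: "sets circle_measure = sets borel"
  by (simp add: circle_measure_def)

lemma space_circle_measure [simp]: "space circle_measure = UNIV"
  by (simp add: circle_measure_def)

lemma emeasure_circle_measure:
  "A \<in> sets borel \<Longrightarrow> emeasure circle_measure A = emeasure lborel ({0..<2 * pi} \<inter> A)"
  by (simp add: circle_measure_def emeasure_density flip: indicator_inter_arith)

lemma emeasure_circle_measure_UNIV: "emeasure circle_measure UNIV = ennreal (2 * pi)"
  by (simp add: emeasure_circle_measure)

interpretation circle: finite_measure circle_measure
  by standard (simp add: emeasure_circle_measure_UNIV)

interpretation circle_pair: pair_sigma_finite circle_measure "lborel :: 'a::euclidean_space measure" ..

lemma nn_integral_circle:
  "f \<in> borel_measurable borel \<Longrightarrow> (\<integral>\<^sup>+x. f x \<partial>circle_measure) = (\<integral>\<^sup>+x. indicator {0..<2 * pi} x * f x \<partial>lborel)"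
  by (simp add: circle_measure_def nn_integral_density)

lemma AE_circle: "AE x in lborel. P x \<Longrightarrow> AE x in circle_measure. P x"
  unfolding circle_measure_def by (subst AE_density) (auto elim: eventually_mono)

text \<open>The position of a window of one period is irrelevant: the part of
  \<open>{a..<a + 2 * pi}\<close> below the multiple \<open>b\<close> of 2 pi in it is moved up by
  one period.\<close>

lemma circle_shift:
  fixes f :: "real \<Rightarrow> ennreal"
  assumes [measurable]: "f \<in> borel_measurable borel"
    and per: "\<And>x k::int. f (x + 2 * pi * of_int k) = f x"
  shows "(\<integral>\<^sup>+x. f (x + a) \<partial>circle_measure) = (\<integral>\<^sup>+x. f x \<partial>circle_measure)"
proof -
  define I where "I A = (\<integral>\<^sup>+x. indicator A x * f x \<partial>lborel)" for A
  have trans: "(\<integral>\<^sup>+x. indicator A (x + c) * f (x + c) \<partial>lborel) = I A" if [measurable]: "A \<in> sets borel" for A c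
    using nn_integral_real_affine[of "\<lambda>x. indicator A x * f x" 1 c] by (simp add: I_def add.commute)
  have split: "I (A \<union> B) = I A + I B" if "A \<inter> B = {}" "A \<in> sets borel" "B \<in> sets borel" for A B
  proof -
    have [measurable]: "A \<in> sets borel" "B \<in> sets borel" by fact+
    have "I (A \<union> B) = (\<integral>\<^sup>+x. indicator A x * f x + indicator B x * f x \<partial>lborel)"
      unfolding I_def using that(1) by (intro nn_integral_cong) (auto simp: indicator_def)
    then show ?thesis unfolding I_def by (simp add: nn_integral_add)
  qed
  have shiftk: "I {l + 2 * pi * of_int k..<u + 2 * pi * of_int k} = I {l..<u}" for l u and k :: int
  proof -
    have "I {l + 2 * pi * of_int k..<u + 2 * pi * of_int k} =
      (\<integral>\<^sup>+x. indicator {l + 2 * pi * of_int k..<u + 2 * pi * of_int k} (x + 2 * pi * of_int k) * f (x + 2 * pi * of_int k) \<partial>lborel)"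
      by (rule trans[symmetric]) simp
    also have "\<dots> = I {l..<u}" unfolding I_def by (intro nn_integral_cong) (auto simp: indicator_def per)
    finally show ?thesis .
  qed
  define k where "k = \<lceil>a / (2 * pi)\<rceil>"
  define b where "b = 2 * pi * real_of_int k"
  have b: "a \<le> b" "b < a + 2 * pi"
  proof -
    have "a / (2 * pi) \<le> of_int k" "of_int k < a / (2 * pi) + 1" unfolding k_def by linarith+
    then show "a \<le> b" "b < a + 2 * pi" unfolding b_def by (simp_all add: field_simps)
  qed
  have "(\<integral>\<^sup>+x. f (x + a) \<partial>circle_measure) = (\<integral>\<^sup>+x. indicator {a..<a + 2 * pi} (x + a) * f (x + a) \<partial>lborel)"
    by (subst nn_integral_circle) (auto intro!: nn_integral_cong simp: indicator_def)
  also have "\<dots> = I {a..<a + 2 * pi}" by (rule trans) simp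
  also have "{a..<a + 2 * pi} = {a..<b} \<union> {b..<a + 2 * pi}" using b by auto
  also have "I \<dots> = I {a..<b} + I {b..<a + 2 * pi}" by (rule split) auto
  also have "I {a..<b} = I {a + 2 * pi..<b + 2 * pi}" using shiftk[of a 1 b] by simp
  also have "I {a + 2 * pi..<b + 2 * pi} + I {b..<a + 2 * pi} = I ({a + 2 * pi..<b + 2 * pi} \<union> {b..<a + 2 * pi})"
    by (rule split[symmetric]) auto
  also have "{a + 2 * pi..<b + 2 * pi} \<union> {b..<a + 2 * pi} = {0 + 2 * pi * real_of_int k..<2 * pi + 2 * pi * real_of_int k}"
    using b by (auto simp: b_def)
  also have "I \<dots> = I {0..<2 * pi}" by (rule shiftk)
  also have "\<dots> = (\<integral>\<^sup>+x. f x \<partial>circle_measure)" by (simp add: nn_integral_circle I_def)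
  finally show ?thesis .
qed

lemma circle_shift_set:
  assumes [measurable]: "Measurable.pred borel P" and "\<And>x k::int. P (x + 2 * pi * of_int k) = P x"
  shows "emeasure circle_measure {x. P (x + a)} = emeasure circle_measure {x. P x}"
proof -
  have "emeasure circle_measure {x. P (x + a)} = (\<integral>\<^sup>+x. indicator {x. P (x + a)} x \<partial>circle_measure)"
    by (rule nn_integral_indicator[symmetric]) measurable
  also have "\<dots> = (\<integral>\<^sup>+x. indicator {x. P x} (x + a) \<partial>circle_measure)"
    by (rule nn_integral_cong) (simp add: indicator_def)
  also have "\<dots> = (\<integral>\<^sup>+x. indicator {x. P x} x \<partial>circle_measure)"
    by (rule circle_shift) (auto simp: indicator_def assms(2))
  finally show ?thesis by simp
qed

section \<open>The unsigned angle \<open>arccos (cos x)\<close>\<close>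

lemma arccos_cos_le_abs: "arccos (cos x) \<le> \<bar>x\<bar>"
  using arccos_cos_eq_abs[of x] arccos_ubound[of "cos x"] by (cases "\<bar>x\<bar> \<le> pi") auto

text \<open>\<open>arccos (cos x)\<close> is the distance a of x from the multiples of 2 pi. Since x
  agrees with a up to sign and full turns, \<open>cos (x + h)\<close> is \<open>cos (a + h)\<close>
  or \<open>cos (a - h)\<close>.\<close>

lemma arccos_cos_add_le: "arccos (cos (x + h)) \<le> arccos (cos x) + \<bar>h\<bar>"
proof -
  define a where "a = arccos (cos x)"
  have a: "0 \<le> a" "cos x = cos a" by (auto simp: a_def arccos_lbound)
  have "sin x = sin a \<or> sin x = - sin a"
  proof -
    have "(sin x)\<^sup>2 = (sin a)\<^sup>2" using a(2) by (simp add: sin_squared_eq)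
    then show ?thesis by (simp add: power2_eq_iff)
  qed
  then have "cos (x + h) = cos (a + h) \<or> cos (x + h) = cos (a - h)"
    using a(2) by (auto simp: cos_add cos_diff)
  then show ?thesis
    using arccos_cos_le_abs[of "a + h"] arccos_cos_le_abs[of "a - h"] a(1) unfolding a_def[symmetric] by auto
qed

lemma arccos_cos_lipschitz: "\<bar>arccos (cos (x + h)) - arccos (cos x)\<bar> \<le> \<bar>h\<bar>"
  using arccos_cos_add_le[of x h] arccos_cos_add_le[of "x + h" "- h"] by simp

lemma cos_add_int: "cos (x + 2 * pi * of_int k) = cos x"
  by (simp add: cos_add)

lemma sin_add_int: "sin (x + 2 * pi * of_int k) = sin x"
  by (simp add: sin_add)

lemma borel_measurable_arccos_cos [measurable]: "(\<lambda>x. arccos (cos x)) \<in> borel_measurable borel"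
  by (intro borel_measurable_continuous_onI continuous_on_arccos continuous_intros; simp)

lemma emeasure_arc:
  assumes "0 \<le> c" "c \<le> pi"
  shows "emeasure circle_measure {\<theta>. arccos (cos (\<theta> + a)) < c} = ennreal (2 * c)"
proof -
  have "emeasure circle_measure {\<theta>. arccos (cos (\<theta> + a)) < c} = emeasure circle_measure {\<theta>. arccos (cos \<theta>) < c}"
    by (rule circle_shift_set) (auto simp: cos_add_int)
  also have "\<dots> = emeasure lborel ({0..<2 * pi} \<inter> {\<theta>. arccos (cos \<theta>) < c})"
    by (rule emeasure_circle_measure) measurable
  \<comment> \<open>The arc is centred at angle 0, where the period is cut, so it appears in two
    pieces.\<close>
  also have "{0..<2 * pi} \<inter> {\<theta>. arccos (cos \<theta>) < c} = {0..<c} \<union> {2 * pi - c<..<2 * pi}"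
  proof -
    have "arccos (cos \<theta>) < c \<longleftrightarrow> \<theta> < c \<or> 2 * pi - c < \<theta>" if "0 \<le> \<theta>" "\<theta> < 2 * pi" for \<theta>
    proof (cases "\<theta> \<le> pi")
      case True
      then show ?thesis using that assms by (simp add: arccos_cos)
    next
      case False
      have "cos \<theta> = cos (2 * pi - \<theta>)" by (simp add: cos_diff)
      then have "arccos (cos \<theta>) = 2 * pi - \<theta>" using False that by (simp add: arccos_cos del: cos_2pi_minus)
      then show ?thesis using False assms by auto
    qed
    then show ?thesis using assms by auto
  qed
  also have "emeasure lborel ({0..<c} \<union> {2 * pi - c<..<2 * pi}) = emeasure lborel {0..<c} + emeasure lborel {2 * pi - c<..<2 * pi}"
    using assms by (intro plus_emeasure[symmetric]) auto
  also have "\<dots> = ennreal (2 * c)" using assms by (simp flip: ennreal_plus)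
  finally show ?thesis .
qed

lemma AE_sin_neq_0: "AE \<theta> in circle_measure. sin (\<theta> + a) \<noteq> 0"
proof (rule AE_circle)
  have "countable {\<theta>. sin (\<theta> + a) = 0}"
  proof (rule countable_subset)
    show "{\<theta>. sin (\<theta> + a) = 0} \<subseteq> range (\<lambda>k::int. of_int k * pi - a)"
      by (auto simp: sin_zero_iff_int2 algebra_simps image_iff)
  qed simp
  then have "{\<theta>. sin (\<theta> + a) = 0} \<in> null_sets lborel" by (rule countable_imp_null_set_lborel)
  then show "AE \<theta> in lborel. sin (\<theta> + a) \<noteq> 0" by (rule AE_I'[of "{\<theta>. sin (\<theta> + a) = 0}"]) auto
qed

text \<open>Layer cake: the integral of the positive part of a - b - c is the integral over
  \<open>t\<close> of the measure of {b <= t, t + c < a}. It therefore suffices to compare measures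
  of differences of superlevel sets.\<close>

lemma nn_integral_excess_contraction:
  assumes sf: "sigma_finite_measure N"
    and [measurable]: "f \<in> borel_measurable N" "g \<in> borel_measurable N" "f' \<in> borel_measurable N" "g' \<in> borel_measurable N"
    and le1: "\<And>s t. emeasure N {x \<in> space N. s < f' x \<and> \<not> t < g' x} \<le> emeasure N {x \<in> space N. s < f x \<and> \<not> t < g x}"
    and le2: "\<And>s t. emeasure N {x \<in> space N. s < g' x \<and> \<not> t < f' x} \<le> emeasure N {x \<in> space N. s < g x \<and> \<not> t < f x}"
    and M: "0 \<le> M" and h: "0 < h"
  shows "(\<integral>\<^sup>+x. excess M ((f' x - g' x) / h) \<partial>N) \<le> (\<integral>\<^sup>+x. excess M ((f x - g x) / h) \<partial>N)"
proof -
  interpret sigma_finite_measure N by (rule sf)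
  interpret Q: pair_sigma_finite N "lborel :: real measure" ..
  have layer: "(\<integral>\<^sup>+x. ennreal (a x - b x - c) \<partial>N) = (\<integral>\<^sup>+t. emeasure N {x \<in> space N. t + c < a x \<and> \<not> t < b x} \<partial>lborel)"
    if [measurable]: "a \<in> borel_measurable N" "b \<in> borel_measurable N" for a b c
  proof -
    have "ennreal (a x - b x - c) = (\<integral>\<^sup>+t. indicator {y \<in> space N. t + c < a y \<and> \<not> t < b y} x \<partial>lborel)" if "x \<in> space N" for x
    proof -
      have "(\<integral>\<^sup>+t. indicator {y \<in> space N. t + c < a y \<and> \<not> t < b y} x \<partial>lborel) = (\<integral>\<^sup>+t. indicator {b x..<a x - c} t \<partial>lborel)"
        using that by (intro nn_integral_cong) (auto simp: indicator_def)
      also have "\<dots> = emeasure lborel {b x..<a x - c}" by simp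
      also have "\<dots> = ennreal (a x - b x - c)"
        by (cases "b x \<le> a x - c") (auto simp: ennreal_neg algebra_simps)
      finally show ?thesis by simp
    qed
    then have "(\<integral>\<^sup>+x. ennreal (a x - b x - c) \<partial>N) = (\<integral>\<^sup>+x. (\<integral>\<^sup>+t. indicator {y \<in> space N. t + c < a y \<and> \<not> t < b y} x \<partial>lborel) \<partial>N)"
      by (intro nn_integral_cong) simp
    also have "\<dots> = (\<integral>\<^sup>+t. (\<integral>\<^sup>+x. indicator {y \<in> space N. t + c < a y \<and> \<not> t < b y} x \<partial>N) \<partial>lborel)"
    proof (rule Q.Fubini'[symmetric])
      have "(\<lambda>(x, t). indicator {y \<in> space N. t + c < a y \<and> \<not> t < b y} x :: ennreal) \<in> borel_measurable (N \<Otimes>\<^sub>M lborel)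
        \<longleftrightarrow> (\<lambda>q. indicator {q \<in> space (N \<Otimes>\<^sub>M lborel). snd q + c < a (fst q) \<and> \<not> snd q < b (fst q)} q :: ennreal) \<in> borel_measurable (N \<Otimes>\<^sub>M lborel)"
        by (rule measurable_cong) (auto simp: indicator_def space_pair_measure)
      then show "(\<lambda>(x, t). indicator {y \<in> space N. t + c < a y \<and> \<not> t < b y} x :: ennreal) \<in> borel_measurable (N \<Otimes>\<^sub>M lborel)"
        by simp
    qed
    also have "\<dots> = (\<integral>\<^sup>+t. emeasure N {x \<in> space N. t + c < a x \<and> \<not> t < b x} \<partial>lborel)"
      by (intro nn_integral_cong nn_integral_indicator) measurable
    finally show ?thesis .
  qed
  have split: "(\<integral>\<^sup>+x. excess M ((a x - b x) / h) \<partial>N) = ennreal (1 / h) *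
      ((\<integral>\<^sup>+x. ennreal (a x - b x - h * M) \<partial>N) + (\<integral>\<^sup>+x. ennreal (b x - a x - h * M) \<partial>N))"
    if [measurable]: "a \<in> borel_measurable N" "b \<in> borel_measurable N" for a b
  proof -
    have "ennreal (excess M (y / h)) = ennreal (1 / h) * (ennreal (y - h * M) + ennreal (- y - h * M))" for y
    proof -
      have hM: "0 \<le> h * M" using h M by simp
      have e: "excess M (y / h) = 1 / h * (max 0 (y - h * M) + max 0 (- y - h * M))"
        using h hM unfolding excess_def by (auto simp: max_def abs_if field_simps)
      have "ennreal (excess M (y / h)) = ennreal (1 / h) * (ennreal (max 0 (y - h * M)) + ennreal (max 0 (- y - h * M)))"
      proof -
        have "ennreal (1 / h * (A + B)) = ennreal (1 / h) * (ennreal A + ennreal B)" if "0 \<le> A" "0 \<le> B" for A B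
          using h that by (subst ennreal_mult) (auto simp: ennreal_plus)
        then show ?thesis unfolding e by simp
      qed
      then show ?thesis by (simp add: max_def ennreal_neg)
    qed
    then have "(\<integral>\<^sup>+x. excess M ((a x - b x) / h) \<partial>N) =
      (\<integral>\<^sup>+x. ennreal (1 / h) * (ennreal (a x - b x - h * M) + ennreal (b x - a x - h * M)) \<partial>N)"
      by (intro nn_integral_cong) simp
    then show ?thesis by (simp add: nn_integral_cmult nn_integral_add)
  qed
  show ?thesis
    unfolding split[OF assms(4,5)] split[OF assms(2,3)] layer[OF assms(4,5)] layer[OF assms(5,4)]
      layer[OF assms(2,3)] layer[OF assms(3,2)]
    by (intro mult_left_mono add_mono nn_integral_mono le1 le2) auto
qed

section \<open>Radius, angle and averages over circles\<close>

locale plane =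
  fixes i j :: "'n::finite"
  assumes ij: "i \<noteq> j"
begin

abbreviation R :: "real \<Rightarrow> real ^ 'n \<Rightarrow> real ^ 'n" where "R \<equiv> rot i j"

definition rad :: "real ^ 'n \<Rightarrow> real" where "rad z = sqrt ((z $ i)\<^sup>2 + (z $ j)\<^sup>2)"

definition ang :: "real ^ 'n \<Rightarrow> real" where "ang z = arccos (z $ i / rad z)"

sublocale rot: affine_flow "rot i j" "matrix (quarter_turn i j)" 0 "\<lambda>s. matrix (rot i j s)" "\<lambda>_. 0"
  by (rule affine_flow_rot[OF ij])

lemma rot_nth_i: "R \<theta> z $ i = cos \<theta> * z $ i - sin \<theta> * z $ j"
  and rot_nth_j: "R \<theta> z $ j = sin \<theta> * z $ i + cos \<theta> * z $ j"
  using ij by (simp_all add: rot_nth)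

lemma rad_pos: "z $ j \<noteq> 0 \<Longrightarrow> 0 < rad z"
  by (simp add: rad_def sum_power2_gt_zero_iff)

lemma polar:
  assumes "0 < rad z"
  obtains \<theta>0 where "z $ i = rad z * cos \<theta>0" "z $ j = rad z * sin \<theta>0"
proof -
  have r2: "(rad z)\<^sup>2 = (z $ i)\<^sup>2 + (z $ j)\<^sup>2" by (simp add: rad_def)
  have "(z $ i / rad z)\<^sup>2 + (z $ j / rad z)\<^sup>2 = 1"
    using assms by (simp add: power_divide add_divide_distrib[symmetric] r2[symmetric])
  then obtain t where "z $ i / rad z = cos t" "z $ j / rad z = sin t" by (rule sincos_total_2pi)
  then show ?thesis using assms by (intro that[of t]) (simp_all add: field_simps)
qed

lemma polar_rot:
  assumes "z $ i = r * cos \<theta>0" "z $ j = r * sin \<theta>0"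
  shows "R \<theta> z $ i = r * cos (\<theta> + \<theta>0)" "R \<theta> z $ j = r * sin (\<theta> + \<theta>0)"
  using assms by (simp_all add: rot_nth_i rot_nth_j cos_add sin_add algebra_simps)

lemma rad_polar: "0 < r \<Longrightarrow> z $ i = r * cos t \<Longrightarrow> z $ j = r * sin t \<Longrightarrow> rad z = r"
  by (simp add: rad_def power_mult_distrib distrib_left[symmetric])

lemma ang_polar: "0 < r \<Longrightarrow> z $ i = r * cos t \<Longrightarrow> z $ j = r * sin t \<Longrightarrow> ang z = arccos (cos t)"
  by (simp add: ang_def rad_polar)

lemma rad_rot: "rad (R \<theta> z) = rad z"
proof -
  have "(c * a - s * b)\<^sup>2 + (s * a + c * b)\<^sup>2 = (s\<^sup>2 + c\<^sup>2) * (a\<^sup>2 + b\<^sup>2)" for a b c s :: real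
    by (simp add: power2_eq_square algebra_simps)
  from this[of "cos \<theta>" "z $ i" "sin \<theta>" "z $ j"] show ?thesis by (simp add: rad_def rot_nth_i rot_nth_j)
qed

lemma abs_ratio_le_1: "\<bar>z $ i / rad z\<bar> \<le> 1"
proof -
  have "\<bar>z $ i\<bar> \<le> rad z" unfolding rad_def by (rule real_le_rsqrt) simp
  moreover have "0 \<le> rad z" by (simp add: rad_def)
  ultimately show ?thesis by (auto simp: divide_le_eq_1)
qed

lemma ang_bounds:
  shows "0 \<le> ang z" "ang z \<le> pi"
    and "z $ j \<noteq> 0 \<Longrightarrow> 0 < ang z" "z $ j \<noteq> 0 \<Longrightarrow> ang z < pi"
proof -
  have b: "-1 \<le> z $ i / rad z" "z $ i / rad z \<le> 1" using abs_ratio_le_1[of z] by linarith+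
  then show "0 \<le> ang z" "ang z \<le> pi" by (auto simp: ang_def arccos_lbound arccos_ubound)
  assume z: "z $ j \<noteq> 0"
  then have "\<bar>z $ i\<bar> < rad z" unfolding rad_def by (intro real_less_rsqrt) simp
  then have b: "-1 < z $ i / rad z" "z $ i / rad z < 1"
    using rad_pos[OF z] by (auto simp: field_simps abs_less_iff)
  show "0 < ang z" "ang z < pi" using arccos_lt_bounded[OF b] by (auto simp: ang_def)
qed

lemma borel_measurable_rad [measurable]: "rad \<in> borel_measurable borel"
  unfolding rad_def[abs_def] by measurable

lemma borel_measurable_ang [measurable]: "ang \<in> borel_measurable borel"
proof -
  \<comment> \<open>Clamping to [-1, 1] changes nothing and makes the outer function continuous on
    the whole line.\<close>
  have "ang = (\<lambda>z. arccos (max (-1) (min 1 (z $ i / rad z))))"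
  proof
    fix z
    have "-1 \<le> z $ i / rad z" "z $ i / rad z \<le> 1" using abs_ratio_le_1[of z] by linarith+
    then show "ang z = arccos (max (-1) (min 1 (z $ i / rad z)))" by (simp add: ang_def)
  qed
  moreover have [measurable]: "(\<lambda>x::real. arccos (max (-1) (min 1 x))) \<in> borel_measurable borel"
    by (intro borel_measurable_continuous_onI continuous_on_arccos continuous_intros) auto
  ultimately show ?thesis by simp
qed

text \<open>Averages over rotations take the place of integration in polar coordinates.\<close>

lemma nn_integral_circle_average:
  assumes [measurable]: "H \<in> borel_measurable borel"
  shows "(\<integral>\<^sup>+z. (\<integral>\<^sup>+\<theta>. H (R \<theta> z) \<partial>circle_measure) \<partial>lborel) = ennreal (2 * pi) * (\<integral>\<^sup>+z. H z \<partial>lborel)"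
proof -
  have "(\<integral>\<^sup>+z. (\<integral>\<^sup>+\<theta>. H (R \<theta> z) \<partial>circle_measure) \<partial>lborel) = (\<integral>\<^sup>+\<theta>. (\<integral>\<^sup>+z. H (R \<theta> z) \<partial>lborel) \<partial>circle_measure)"
    by (rule circle_pair.Fubini') measurable
  also have "\<dots> = (\<integral>\<^sup>+\<theta>. (\<integral>\<^sup>+z. H z \<partial>lborel) \<partial>circle_measure)"
  proof (rule nn_integral_cong)
    fix \<theta>
    have "(\<integral>\<^sup>+z. H (R \<theta> z) \<partial>lborel) = (\<integral>\<^sup>+z. H z \<partial>distr lborel borel (R \<theta>))"
      by (subst nn_integral_distr) auto
    then show "(\<integral>\<^sup>+z. H (R \<theta> z) \<partial>lborel) = (\<integral>\<^sup>+z. H z \<partial>lborel)" by (simp add: distr_rot[OF ij])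
  qed
  finally show ?thesis by (simp add: emeasure_circle_measure_UNIV mult.commute)
qed

lemma nn_integral_le_if_circle_le:
  assumes [measurable]: "H1 \<in> borel_measurable borel" "H2 \<in> borel_measurable borel"
    and le: "AE z in lborel. (\<integral>\<^sup>+\<theta>. H1 (R \<theta> z) \<partial>circle_measure) \<le> c * (\<integral>\<^sup>+\<theta>. H2 (R \<theta> z) \<partial>circle_measure)"
  shows "(\<integral>\<^sup>+z. H1 z \<partial>lborel) \<le> c * (\<integral>\<^sup>+z. H2 z \<partial>lborel)"
proof -
  have "ennreal (2 * pi) * (\<integral>\<^sup>+z. H1 z \<partial>lborel) \<le> (\<integral>\<^sup>+z. c * (\<integral>\<^sup>+\<theta>. H2 (R \<theta> z) \<partial>circle_measure) \<partial>lborel)"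
    unfolding nn_integral_circle_average[OF assms(1), symmetric] by (rule nn_integral_mono_AE[OF le])
  also have "\<dots> = c * (\<integral>\<^sup>+z. (\<integral>\<^sup>+\<theta>. H2 (R \<theta> z) \<partial>circle_measure) \<partial>lborel)"
    by (rule nn_integral_cmult) measurable
  also have "\<dots> = ennreal (2 * pi) * (c * (\<integral>\<^sup>+z. H2 z \<partial>lborel))"
    by (simp add: nn_integral_circle_average mult_ac)
  finally show ?thesis by (subst (asm) ennreal_mult_le_mult_iff) auto
qed

text \<open>Rotations preserve null sets, so the property holds at almost every point for each fixed
  angle; then the two quantifiers are exchanged. The Borel null set \<open>S\<close> supplies the
  measurability needed for that.\<close>

lemma AE_circle_if_AE:
  assumes "AE z in lborel. P z"
  shows "AE z in lborel. AE \<theta> in circle_measure. P (R \<theta> z)"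
proof -
  obtain S where S: "S \<in> null_sets lborel" "{z. \<not> P z} \<subseteq> S"
    using assms unfolding eventually_ae_filter by auto
  have [measurable]: "S \<in> sets borel" using S by auto
  have "AE z in lborel. R \<theta> z \<notin> S" for \<theta>
    by (rule rot.AE_T) (use AE_not_in[OF S(1)] in simp)
  then have "AE \<theta> in circle_measure. AE z in lborel. R \<theta> z \<notin> S" by simp
  then have "AE z in lborel. AE \<theta> in circle_measure. R \<theta> z \<notin> S"
    by (subst (asm) circle_pair.AE_commute) measurable
  then show ?thesis
  proof eventually_elim
    case (elim z)
    then show ?case by (rule eventually_mono) (use S(2) in blast)
  qed
qed

definition circ_m :: "(real ^ 'n \<Rightarrow> real) \<Rightarrow> real ^ 'n \<Rightarrow> real \<Rightarrow> real" where
  "circ_m w z t = measure circle_measure {\<theta>. t < w (R \<theta> z)}"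

text \<open>On \<open>{z. z $ j = 0}\<close> the level set may be empty or unbounded below, so its infimum would be unspecified.\<close>

definition rearr :: "(real ^ 'n \<Rightarrow> real) \<Rightarrow> real ^ 'n \<Rightarrow> real" where
  "rearr w z = (if z $ j = 0 then 0 else Inf {t. circ_m w z t \<le> 2 * ang z})"

lemma R_int: "R (\<theta> + 2 * pi * of_int k) z = R \<theta> z"
  by (simp add: rot_def cos_add_int sin_add_int)

lemma circ_m_rot:
  assumes [measurable]: "w \<in> borel_measurable borel"
  shows "circ_m w (R a z) t = circ_m w z t"
proof -
  have "emeasure circle_measure {\<theta>. t < w (R (\<theta> + a) z)} = emeasure circle_measure {\<theta>. t < w (R \<theta> z)}"
    by (rule circle_shift_set[of "\<lambda>\<theta>. t < w (R \<theta> z)"]) (measurable, simp add: R_int)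
  then show ?thesis by (simp add: circ_m_def measure_def rot_add[OF ij])
qed

lemma emeasure_circ_m: "emeasure circle_measure {\<theta>. t < w (R \<theta> z)} = ennreal (circ_m w z t)"
  by (simp add: circ_m_def circle.emeasure_eq_measure)

lemma circ_m_bounds: "0 \<le> circ_m w z t" "circ_m w z t \<le> 2 * pi"
proof -
  have "emeasure circle_measure {\<theta>. t < w (R \<theta> z)} \<le> emeasure circle_measure UNIV"
    by (rule emeasure_mono) auto
  then show "circ_m w z t \<le> 2 * pi" by (simp add: emeasure_circ_m emeasure_circle_measure_UNIV)
qed (simp add: circ_m_def)

lemma borel_measurable_circ_m [measurable]:
  assumes [measurable]: "w \<in> borel_measurable borel"
  shows "(\<lambda>z. circ_m w z t) \<in> borel_measurable borel"
proof -
  have "(\<lambda>z. enn2real (\<integral>\<^sup>+\<theta>. indicator {t<..} (w (R \<theta> z)) \<partial>circle_measure)) \<in> borel_measurable borel"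
    by measurable
  moreover have "(\<integral>\<^sup>+\<theta>. indicator {t<..} (w (R \<theta> z)) \<partial>circle_measure) = ennreal (circ_m w z t)" for z
  proof -
    have "(\<integral>\<^sup>+\<theta>. indicator {t<..} (w (R \<theta> z)) \<partial>circle_measure) = (\<integral>\<^sup>+\<theta>. indicator {\<theta>. t < w (R \<theta> z)} \<theta> \<partial>circle_measure)"
      by (intro nn_integral_cong) (auto simp: indicator_def)
    also have "\<dots> = emeasure circle_measure {\<theta>. t < w (R \<theta> z)}" by (rule nn_integral_indicator) measurable
    finally show ?thesis by (simp add: emeasure_circ_m)
  qed
  ultimately show ?thesis by (simp add: enn2real_ennreal[OF circ_m_bounds(1)])
qed

lemma
  assumes [measurable]: "w \<in> borel_measurable borel"
  shows circ_m_antimono: "s \<le> t \<Longrightarrow> circ_m w z t \<le> circ_m w z s"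
    and circ_m_right: "(\<lambda>n. circ_m w z (s + 1 / real (Suc n))) \<longlonglongrightarrow> circ_m w z s"
    and circ_m_bot: "(\<lambda>n. circ_m w z (- real n)) \<longlonglongrightarrow> 2 * pi"
    and circ_m_top: "(\<lambda>n. circ_m w z (real n)) \<longlonglongrightarrow> 0"
proof -
  have [measurable]: "{\<theta>. t < w (R \<theta> z)} \<in> sets circle_measure" for t by measurable
  have meas: "range (\<lambda>n. {\<theta>. c n < w (R \<theta> z)}) \<subseteq> sets circle_measure" for c :: "nat \<Rightarrow> real"
    by (intro image_subsetI) measurable
  show "s \<le> t \<Longrightarrow> circ_m w z t \<le> circ_m w z s"
    unfolding circ_m_def by (intro circle.finite_measure_mono) auto
  have "(\<Union>n. {\<theta>. s + 1 / real (Suc n) < w (R \<theta> z)}) = {\<theta>. s < w (R \<theta> z)}"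
  proof (intro set_eqI iffI)
    fix \<theta> assume "\<theta> \<in> {\<theta>. s < w (R \<theta> z)}"
    then have "0 < w (R \<theta> z) - s" by simp
    then obtain n where "1 / real (Suc n) < w (R \<theta> z) - s" by (rule nat_approx_posE)
    then show "\<theta> \<in> (\<Union>n. {\<theta>. s + 1 / real (Suc n) < w (R \<theta> z)})" by (auto intro!: exI[of _ n])
  next
    fix \<theta> assume "\<theta> \<in> (\<Union>n. {\<theta>. s + 1 / real (Suc n) < w (R \<theta> z)})"
    then obtain n where "s + 1 / real (Suc n) < w (R \<theta> z)" by auto
    moreover have "0 < 1 / real (Suc n)" by simp
    ultimately have "s < w (R \<theta> z)" by linarith
    then show "\<theta> \<in> {\<theta>. s < w (R \<theta> z)}" by simp
  qed
  moreover have "incseq (\<lambda>n. {\<theta>. s + 1 / real (Suc n) < w (R \<theta> z)})"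
  proof (rule incseq_SucI)
    fix n
    have "1 / real (Suc (Suc n)) \<le> 1 / real (Suc n)" by (simp add: frac_le)
    then show "{\<theta>. s + 1 / real (Suc n) < w (R \<theta> z)} \<subseteq> {\<theta>. s + 1 / real (Suc (Suc n)) < w (R \<theta> z)}" by auto
  qed
  ultimately show "(\<lambda>n. circ_m w z (s + 1 / real (Suc n))) \<longlonglongrightarrow> circ_m w z s"
    using circle.finite_Lim_measure_incseq[OF meas[of "\<lambda>n. s + 1 / real (Suc n)"]]
    by (auto simp: circ_m_def)
  have "(\<Union>n. {\<theta>. - real n < w (R \<theta> z)}) = UNIV"
  proof -
    have "\<exists>n. - real n < w (R \<theta> z)" for \<theta> using reals_Archimedean2[of "- w (R \<theta> z)"] by (auto simp: minus_less_iff)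
    then show ?thesis by auto
  qed
  moreover have "incseq (\<lambda>n. {\<theta>. - real n < w (R \<theta> z)})"
    by (rule incseq_SucI) auto
  moreover have "measure circle_measure UNIV = 2 * pi"
    by (simp add: measure_def emeasure_circle_measure_UNIV)
  ultimately show "(\<lambda>n. circ_m w z (- real n)) \<longlonglongrightarrow> 2 * pi"
    using circle.finite_Lim_measure_incseq[OF meas[of "\<lambda>n. - real n"]]
    by (auto simp: circ_m_def)
  have "(\<Inter>n. {\<theta>. real n < w (R \<theta> z)}) = {}"
  proof -
    have "\<exists>n. \<not> real n < w (R \<theta> z)" for \<theta> using reals_Archimedean2[of "w (R \<theta> z)"] by (metis less_imp_le not_less)
    then show ?thesis by auto
  qed
  moreover have "decseq (\<lambda>n. {\<theta>. real n < w (R \<theta> z)})"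
    by (rule decseq_SucI) auto
  ultimately show "(\<lambda>n. circ_m w z (real n)) \<longlonglongrightarrow> 0"
    using circle.finite_Lim_measure_decseq[OF meas[of real]]
    by (auto simp: circ_m_def)
qed

text \<open>For 0 < a < 2 pi the limits at both ends make the level set nonempty and bounded below.
  The equivalence rests on right-continuity: a value above \<open>a\<close> at \<open>s\<close>
  persists slightly to the right of \<open>s\<close>.\<close>

lemma circ_m_level_set:
  assumes w: "w \<in> borel_measurable borel" and a: "0 < a" "a < 2 * pi"
  shows "{t. circ_m w z t \<le> a} \<noteq> {}" "bdd_below {t. circ_m w z t \<le> a}"
    and "s < Inf {t. circ_m w z t \<le> a} \<longleftrightarrow> a < circ_m w z s"
proof -
  have "\<forall>\<^sub>F n in sequentially. circ_m w z (real n) < a" using circ_m_top[OF w] a(1) by (rule order_tendstoD)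
  then obtain n where "circ_m w z (real n) < a" by (auto simp: eventually_sequentially)
  then show ne: "{t. circ_m w z t \<le> a} \<noteq> {}" by (auto intro: less_imp_le)
  have "\<forall>\<^sub>F n in sequentially. a < circ_m w z (- real n)" using circ_m_bot[OF w] a(2) by (rule order_tendstoD)
  then obtain m where m: "a < circ_m w z (- real m)" by (auto simp: eventually_sequentially)
  have lower: "x < t" if "a < circ_m w z x" "circ_m w z t \<le> a" for x t
    using circ_m_antimono[OF w, of t x z] that by (cases "x < t") auto
  show bdd: "bdd_below {t. circ_m w z t \<le> a}"
    using lower[OF m] by (intro bdd_belowI[of _ "- real m"]) (auto intro: less_imp_le)
  show "s < Inf {t. circ_m w z t \<le> a} \<longleftrightarrow> a < circ_m w z s"
  proof
    assume "s < Inf {t. circ_m w z t \<le> a}"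
    then show "a < circ_m w z s" using cInf_lower[OF _ bdd, of s] by (auto simp: not_less[symmetric])
  next
    assume "a < circ_m w z s"
    then have "\<forall>\<^sub>F n in sequentially. a < circ_m w z (s + 1 / real (Suc n))"
      by (rule order_tendstoD[OF circ_m_right[OF w]])
    then obtain n where n: "a < circ_m w z (s + 1 / real (Suc n))" by (auto simp: eventually_sequentially)
    have "s < s + 1 / real (Suc n)" by simp
    also have "\<dots> \<le> Inf {t. circ_m w z t \<le> a}"
      using lower[OF n] by (intro cInf_greatest[OF ne]) (auto intro: less_imp_le)
    finally show "s < Inf {t. circ_m w z t \<le> a}" .
  qed
qed

text \<open>The working form of the definition: off the axis, superlevel sets on a circle are arcs
  of half-opening \<open>circ_m w z s / 2\<close>.\<close>

lemma less_rearr_iff: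
  assumes "w \<in> borel_measurable borel" "z $ j \<noteq> 0"
  shows "s < rearr w z \<longleftrightarrow> 2 * ang z < circ_m w z s"
  using circ_m_level_set(3)[OF assms(1), of "2 * ang z" s z] ang_bounds(3,4)[OF assms(2)] assms(2)
  by (simp add: rearr_def)

lemma borel_measurable_rearr [measurable]:
  assumes w[measurable]: "w \<in> borel_measurable borel"
  shows "rearr w \<in> borel_measurable borel"
proof -
  have "{z \<in> space borel. s < rearr w z} = {z. (z $ j = 0 \<and> s < 0) \<or> (z $ j \<noteq> 0 \<and> 2 * ang z < circ_m w z s)}" for s
    using less_rearr_iff[OF w] by (auto simp: rearr_def[of w "_"])
  moreover have "{z. (z $ j = 0 \<and> s < 0) \<or> (z $ j \<noteq> 0 \<and> 2 * ang z < circ_m w z s)} \<in> sets borel" for s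
    by measurable
  ultimately show ?thesis by (simp add: borel_measurable_iff_greater)
qed

lemma AE_circle_off_axis:
  assumes "0 < rad z"
  shows "AE \<theta> in circle_measure. R \<theta> z $ j \<noteq> 0"
proof -
  obtain t where "z $ i = rad z * cos t" "z $ j = rad z * sin t" by (rule polar[OF assms])
  from polar_rot(2)[OF this] show ?thesis using AE_sin_neq_0[of t] assms by simp
qed

lemma emeasure_ang_less:
  assumes "0 < rad z" "0 \<le> c" "c \<le> pi"
  shows "emeasure circle_measure {\<theta>. ang (R \<theta> z) < c} = ennreal (2 * c)"
proof -
  obtain t where t: "z $ i = rad z * cos t" "z $ j = rad z * sin t" by (rule polar[OF assms(1)])
  have "ang (R \<theta> z) = arccos (cos (\<theta> + t))" for \<theta>
    using ang_polar[OF assms(1) polar_rot[OF t]] .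
  then show ?thesis using emeasure_arc[OF assms(2,3)] by simp
qed

lemma ang_lipschitz:
  assumes "0 < rad z"
  shows "\<bar>ang (R h z) - ang z\<bar> \<le> \<bar>h\<bar>"
proof -
  obtain t where t: "z $ i = rad z * cos t" "z $ j = rad z * sin t" by (rule polar[OF assms])
  show ?thesis
    using arccos_cos_lipschitz[of t h] ang_polar[OF assms t] ang_polar[OF assms polar_rot[OF t, of h]]
    by (simp add: add.commute)
qed

text \<open>Up to null sets both superlevel sets are arcs with the same centre, hence nested, and
  their difference has the least measure that their sizes allow; \<open>ennreal\<close> gives 0 when
  the first arc is the smaller one.\<close>

lemma emeasure_rearr_levels:
  assumes w: "w \<in> borel_measurable borel" "w' \<in> borel_measurable borel"
    and z: "0 < rad z" and ang: "\<And>\<theta>. ang (R \<theta> z') = ang (R \<theta> z)"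
    and ax: "\<And>\<theta>. R \<theta> z $ j = 0 \<longleftrightarrow> R \<theta> z' $ j = 0"
  shows "emeasure circle_measure {\<theta>. s < rearr w (R \<theta> z) \<and> \<not> t < rearr w' (R \<theta> z')}
     = ennreal (circ_m w z s - circ_m w' z' t)"
proof -
  note [measurable] = w
  define a b where "a = circ_m w z s / 2" and "b = circ_m w' z' t / 2"
  have ab: "0 \<le> a" "a \<le> pi" "0 \<le> b" "b \<le> pi"
    using circ_m_bounds[of w z s] circ_m_bounds[of w' z' t] by (auto simp: a_def b_def)
  have m: "{\<theta>. ang (R \<theta> z) < c} \<in> sets circle_measure" for c by measurable
  have "emeasure circle_measure {\<theta>. s < rearr w (R \<theta> z) \<and> \<not> t < rearr w' (R \<theta> z')}
    = emeasure circle_measure ({\<theta>. ang (R \<theta> z) < a} - {\<theta>. ang (R \<theta> z) < b})"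
  proof (rule emeasure_eq_AE)
    show "AE \<theta> in circle_measure. (\<theta> \<in> {\<theta>. s < rearr w (R \<theta> z) \<and> \<not> t < rearr w' (R \<theta> z')})
      = (\<theta> \<in> {\<theta>. ang (R \<theta> z) < a} - {\<theta>. ang (R \<theta> z) < b})"
      using AE_circle_off_axis[OF z]
    proof eventually_elim
      case (elim \<theta>)
      then have "R \<theta> z' $ j \<noteq> 0" using ax by simp
      then show ?case
        using elim by (auto simp: less_rearr_iff w circ_m_rot ang a_def b_def)
    qed
    show "{\<theta>. s < rearr w (R \<theta> z) \<and> \<not> t < rearr w' (R \<theta> z')} \<in> sets circle_measure" by measurable
    show "{\<theta>. ang (R \<theta> z) < a} - {\<theta>. ang (R \<theta> z) < b} \<in> sets circle_measure" using m by auto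
  qed
  also have "\<dots> = ennreal (2 * a - 2 * b)"
  proof (cases "b \<le> a")
    case True
    then have "emeasure circle_measure ({\<theta>. ang (R \<theta> z) < a} - {\<theta>. ang (R \<theta> z) < b})
      = emeasure circle_measure {\<theta>. ang (R \<theta> z) < a} - emeasure circle_measure {\<theta>. ang (R \<theta> z) < b}"
      using m by (intro emeasure_Diff) auto
    then show ?thesis using ab by (simp add: emeasure_ang_less[OF z] ennreal_minus)
  next
    case False
    then have e: "{\<theta>. ang (R \<theta> z) < a} - {\<theta>. ang (R \<theta> z) < b} = {}" by auto
    show ?thesis unfolding e using False by (simp add: ennreal_neg)
  qed
  finally show ?thesis by (simp add: a_def b_def)
qed

text \<open>Without nesting, the same number is only a lower bound.\<close>

lemma emeasure_levels_ge:
  assumes w: "w \<in> borel_measurable borel" "w' \<in> borel_measurable borel"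
  shows "ennreal (circ_m w z s - circ_m w' z' t)
    \<le> emeasure circle_measure {\<theta>. s < w (R \<theta> z) \<and> \<not> t < w' (R \<theta> z')}"
proof -
  note [measurable] = w
  let ?A = "{\<theta>. s < w (R \<theta> z)}" and ?B = "{\<theta>. t < w' (R \<theta> z')}"
  let ?D = "{\<theta>. s < w (R \<theta> z) \<and> \<not> t < w' (R \<theta> z')}"
  have m: "?A \<in> sets circle_measure" "?B \<in> sets circle_measure" "?D \<in> sets circle_measure" by measurable
  have "measure circle_measure ?A \<le> measure circle_measure (?D \<union> ?B)"
    using m by (intro circle.finite_measure_mono) auto
  also have "\<dots> \<le> measure circle_measure ?D + measure circle_measure ?B"
    using m by (intro measure_Un_le)
  finally show ?thesis
    by (simp add: circ_m_def circle.emeasure_eq_measure ennreal_leI)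
qed

text \<open>The circles through \<open>z\<close> and \<open>z'\<close> may differ in radius and
  position; comparing the arcs only requires equal angles after equal rotations.\<close>

lemma rearr_contraction:
  assumes w: "w \<in> borel_measurable borel" "w' \<in> borel_measurable borel"
    and z: "0 < rad z" "0 < rad z'" and ang: "\<And>\<theta>. ang (R \<theta> z') = ang (R \<theta> z)"
    and ax: "\<And>\<theta>. R \<theta> z $ j = 0 \<longleftrightarrow> R \<theta> z' $ j = 0"
    and M: "0 \<le> M" and h: "0 < h"
  shows "(\<integral>\<^sup>+\<theta>. excess M ((rearr w' (R \<theta> z') - rearr w (R \<theta> z)) / h) \<partial>circle_measure)
    \<le> (\<integral>\<^sup>+\<theta>. excess M ((w' (R \<theta> z') - w (R \<theta> z)) / h) \<partial>circle_measure)"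
proof -
  note [measurable] = w
  show ?thesis
  proof (rule nn_integral_excess_contraction[OF circle.sigma_finite_measure_axioms _ _ _ _ _ _ M h])
    show "emeasure circle_measure {\<theta> \<in> space circle_measure. s < rearr w' (R \<theta> z') \<and> \<not> t < rearr w (R \<theta> z)}
      \<le> emeasure circle_measure {\<theta> \<in> space circle_measure. s < w' (R \<theta> z') \<and> \<not> t < w (R \<theta> z)}" for s t
      using emeasure_levels_ge[OF w(2,1), of z' s z t] emeasure_rearr_levels[OF w(2,1) z(2), of z s t] ang ax by simp
    show "emeasure circle_measure {\<theta> \<in> space circle_measure. s < rearr w (R \<theta> z) \<and> \<not> t < rearr w' (R \<theta> z')}
      \<le> emeasure circle_measure {\<theta> \<in> space circle_measure. s < w (R \<theta> z) \<and> \<not> t < w' (R \<theta> z')}" for s t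
      using emeasure_levels_ge[OF w, of z s z' t] emeasure_rearr_levels[OF w z(1), of z' s t] ang ax by simp
  qed measurable
qed

lemma AE_off_axis: "AE z :: real ^ 'n in lborel. z $ j \<noteq> 0"
proof -
  have "negligible {z :: real ^ 'n. axis j 1 \<bullet> z = 0}"
    by (rule negligible_hyperplane) (simp add: axis_eq_0_iff)
  then have "negligible {z :: real ^ 'n. z $ j = 0}" by (simp add: inner_axis' )
  then have "{z :: real ^ 'n. z $ j = 0} \<in> null_sets lborel"
    by (simp add: negligible_iff_null_sets null_sets_def emeasure_completion main_part_sets)
  then show ?thesis by (rule AE_I') blast
qed

lemma AE_rad_pos: "AE z in lborel. 0 < rad z"
  using AE_off_axis by eventually_elim (rule rad_pos)

text \<open>The layer-cake comparison is applied with the zero function as second argument, where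
  equimeasurability of \<open>w\<close> and \<open>rearr w\<close> settles the level sets.\<close>

lemma rearr_excess:
  assumes w[measurable]: "w \<in> borel_measurable borel" and M: "0 \<le> M"
  shows "(\<integral>\<^sup>+z. ennreal (excess M (rearr w z)) \<partial>lborel) \<le> (\<integral>\<^sup>+z. ennreal (excess M (w z)) \<partial>lborel)"
proof -
  have "(\<integral>\<^sup>+z. ennreal (excess M (rearr w z)) \<partial>lborel) \<le> 1 * (\<integral>\<^sup>+z. ennreal (excess M (w z)) \<partial>lborel)"
  proof (rule nn_integral_le_if_circle_le)
    show "AE z in lborel. (\<integral>\<^sup>+\<theta>. ennreal (excess M (rearr w (R \<theta> z))) \<partial>circle_measure) \<le> 1 * (\<integral>\<^sup>+\<theta>. ennreal (excess M (w (R \<theta> z))) \<partial>circle_measure)"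
      using AE_rad_pos
    proof eventually_elim
      case (elim z)
      have c0: "circ_m (\<lambda>_. 0) z t = (if t < 0 then 2 * pi else 0)" for z t
        by (simp add: circ_m_def measure_def emeasure_circle_measure_UNIV)
      have e0: "emeasure circle_measure {\<theta>. t < 0} = ennreal (if t < 0 then 2 * pi else 0)" for t :: real
        by (simp add: emeasure_circle_measure_UNIV)
      have "(\<integral>\<^sup>+\<theta>. excess M ((rearr w (R \<theta> z) - (\<lambda>_. 0) \<theta>) / 1) \<partial>circle_measure)
        \<le> (\<integral>\<^sup>+\<theta>. excess M ((w (R \<theta> z) - (\<lambda>_. 0) \<theta>) / 1) \<partial>circle_measure)"
      proof (rule nn_integral_excess_contraction[where f="\<lambda>\<theta>. w (R \<theta> z)" and g="\<lambda>_. 0" and g'="\<lambda>_. 0"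
            and f'="\<lambda>\<theta>. rearr w (R \<theta> z)", OF circle.sigma_finite_measure_axioms _ _ _ _ _ _ M zero_less_one])
        have lev: "emeasure circle_measure {\<theta>. s < rearr w (R \<theta> z)} = emeasure circle_measure {\<theta>. s < w (R \<theta> z)}" for s
        proof -
          have "emeasure circle_measure {\<theta>. s < rearr w (R \<theta> z)} = emeasure circle_measure {\<theta>. ang (R \<theta> z) < circ_m w z s / 2}"
            using AE_circle_off_axis[OF elim]
            by (intro emeasure_eq_AE) (auto simp: less_rearr_iff w circ_m_rot elim!: eventually_mono)
          also have "\<dots> = ennreal (circ_m w z s)"
            using circ_m_bounds[of w z s] by (subst emeasure_ang_less[OF elim]) auto
          finally show ?thesis by (simp add: emeasure_circ_m)
        qed
        have cmpl: "emeasure circle_measure {\<theta>. \<not> s < f \<theta>} = emeasure circle_measure UNIV - emeasure circle_measure {\<theta>. s < f \<theta>}"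
          if [measurable]: "f \<in> borel_measurable borel" for s and f :: "real \<Rightarrow> real"
        proof -
          have "{\<theta>. \<not> s < f \<theta>} = UNIV - {\<theta>. s < f \<theta>}" by auto
          moreover have "{\<theta>. s < f \<theta>} \<in> sets circle_measure" by measurable
          ultimately show ?thesis using emeasure_Diff[of circle_measure "{\<theta>. s < f \<theta>}" UNIV] by simp
        qed
        have lev': "emeasure circle_measure {\<theta>. \<not> s < rearr w (R \<theta> z)} = emeasure circle_measure {\<theta>. \<not> s < w (R \<theta> z)}" for s
        proof -
          have "(\<lambda>\<theta>. rearr w (R \<theta> z)) \<in> borel_measurable borel" "(\<lambda>\<theta>. w (R \<theta> z)) \<in> borel_measurable borel"
            by measurable
          then show ?thesis by (simp only: cmpl lev)
        qed
        show "emeasure circle_measure {\<theta> \<in> space circle_measure. s < rearr w (R \<theta> z) \<and> \<not> t < 0}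
          \<le> emeasure circle_measure {\<theta> \<in> space circle_measure. s < w (R \<theta> z) \<and> \<not> t < 0}" for s t
          by (cases "t < 0") (auto simp: lev)
        show "emeasure circle_measure {\<theta> \<in> space circle_measure. s < 0 \<and> \<not> t < rearr w (R \<theta> z)}
          \<le> emeasure circle_measure {\<theta> \<in> space circle_measure. s < 0 \<and> \<not> t < w (R \<theta> z)}" for s t
          using lev'[of t] by (cases "s < 0") auto
      qed measurable
      then show ?case by simp
    qed
  qed measurable
  then show ?thesis by simp
qed

text \<open>Translations of the other coordinates and dilations of the plane map circles to circles.\<close>

lemma circle_flow_contraction:
  assumes w[measurable]: "w \<in> borel_measurable borel"
    and T[measurable]: "T \<in> borel \<rightarrow>\<^sub>M borel" and comm: "\<And>\<theta> z. T (R \<theta> z) = R \<theta> (T z)"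
    and c: "0 < c" "\<And>z. T z $ i = c * z $ i" "\<And>z. T z $ j = c * z $ j"
    and U[measurable]: "U \<in> sets borel" and inv: "\<And>\<theta> z. R \<theta> z \<in> U \<longleftrightarrow> z \<in> U"
    and M: "0 \<le> M" and h: "0 < h"
  shows "(\<integral>\<^sup>+z. indicator U z * ennreal (excess M ((rearr w (T z) - rearr w z) / h)) \<partial>lborel)
     \<le> (\<integral>\<^sup>+z. indicator U z * ennreal (excess M ((w (T z) - w z) / h)) \<partial>lborel)"
proof -
  have "(\<integral>\<^sup>+z. indicator U z * ennreal (excess M ((rearr w (T z) - rearr w z) / h)) \<partial>lborel)
     \<le> 1 * (\<integral>\<^sup>+z. indicator U z * ennreal (excess M ((w (T z) - w z) / h)) \<partial>lborel)"
  proof (rule nn_integral_le_if_circle_le)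
    show "AE z in lborel. (\<integral>\<^sup>+\<theta>. indicator U (R \<theta> z) * ennreal (excess M ((rearr w (T (R \<theta> z)) - rearr w (R \<theta> z)) / h)) \<partial>circle_measure)
      \<le> 1 * (\<integral>\<^sup>+\<theta>. indicator U (R \<theta> z) * ennreal (excess M ((w (T (R \<theta> z)) - w (R \<theta> z)) / h)) \<partial>circle_measure)"
      using AE_rad_pos
    proof eventually_elim
      case (elim z)
      have rT: "rad (T z) = c * rad z" for z
      proof -
        have "(c * z $ i)\<^sup>2 + (c * z $ j)\<^sup>2 = c\<^sup>2 * ((z $ i)\<^sup>2 + (z $ j)\<^sup>2)" by (simp add: power_mult_distrib distrib_left)
        then show ?thesis using c(1) by (simp add: rad_def c(2,3) real_sqrt_mult)
      qed
      have aT: "ang (R \<theta> (T z)) = ang (R \<theta> z)" for \<theta>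
        using c(1) by (simp add: ang_def comm[symmetric] rT c(2,3))
      have "(\<integral>\<^sup>+\<theta>. excess M ((rearr w (R \<theta> (T z)) - rearr w (R \<theta> z)) / h) \<partial>circle_measure)
        \<le> (\<integral>\<^sup>+\<theta>. excess M ((w (R \<theta> (T z)) - w (R \<theta> z)) / h) \<partial>circle_measure)"
        using c(1) elim by (intro rearr_contraction[OF w w _ _ aT _ M h]) (auto simp: rT comm[symmetric] c(2,3))
      then show ?case
        by (cases "z \<in> U") (simp_all add: inv comm)
    qed
  qed measurable
  then show ?thesis by simp
qed

text \<open>A drop of the decreasing rearrangement is paid for by the variation of the
  function on a level strip of controlled measure.\<close>

lemma drop_le_strip_integral:
  fixes F g :: "real \<Rightarrow> real"
  assumes P: "0 < P" and g: "integrable lborel (\<lambda>s. indicator {0..P} s * g s)"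
    and F: "\<And>\<theta>. \<theta> \<in> {0..P} \<Longrightarrow> F \<theta> = c + (LINT s|lborel. indicator {0..\<theta>} s * g s)"
    and hi: "\<And>y. y < b \<Longrightarrow> \<exists>\<theta>\<in>{0..P}. y < F \<theta>" and lo: "\<exists>\<theta>\<in>{0..P}. F \<theta> \<le> a" and ab: "a < b"
  shows "b - a \<le> (LINT s|lborel. indicator {s. s \<in> {0..P} \<and> a < F s \<and> F s < b} s * \<bar>g s\<bar>)"
proof -
  have inc: "integrable lborel (\<lambda>s. indicator {x..y} s * g s)" if "{x..y} \<subseteq> {0..P}" for x y
  proof -
    have "integrable lborel (\<lambda>s. indicator {x..y} s *\<^sub>R (indicator {0..P} s * g s))"
      by (rule integrable_mult_indicator[OF _ g]) simp
    moreover have "(\<lambda>s. indicator {x..y} s *\<^sub>R (indicator {0..P} s * g s)) = (\<lambda>s. indicator {x..y} s * g s)"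
      using that by (auto simp: fun_eq_iff indicator_def)
    ultimately show ?thesis by (simp only:)
  qed
  have diff: "F y - F x = (LINT s|lborel. indicator {x..y} s * g s)" if "0 \<le> x" "x \<le> y" "y \<le> P" for x y
  proof -
    have "(LINT s|lborel. indicator {0..y} s * g s) = (LINT s|lborel. indicator {0..x} s * g s + indicator {x..y} s * g s)"
    proof (rule integral_cong_AE)
      have "AE s in lborel. s \<noteq> x" by (rule AE_lborel_singleton)
      then show "AE s in lborel. indicator {0..y} s * g s = indicator {0..x} s * g s + indicator {x..y} s * g s"
        by eventually_elim (use that in \<open>auto simp: indicator_def\<close>)
    qed (use inc[of 0 y] inc[of 0 x] inc[of x y] that in auto)
    also have "\<dots> = (LINT s|lborel. indicator {0..x} s * g s) + (LINT s|lborel. indicator {x..y} s * g s)"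
      using inc[of 0 x] inc[of x y] that by (intro Bochner_Integration.integral_add) auto
    finally show ?thesis using F[of x] F[of y] that by simp
  qed
  \<comment> \<open>The integral is identified with a gauge integral, for which continuity of the
    primitive is known.\<close>
  have contF: "continuous_on {0..P} F"
  proof -
    have "set_integrable lborel {0..P} g" using g by (simp add: set_integrable_def)
    then have "set_integrable lebesgue {0..P} g"
      unfolding set_integrable_def using borel_measurable_integrable[OF g]
      by (subst integrable_completion) auto
    then have ai: "g absolutely_integrable_on {0..P}" by simp
    have ci: "continuous_on {0..P} (\<lambda>x. integral {0..x} g)"
      by (rule indefinite_integral_continuous_1) (rule set_lebesgue_integral_eq_integral(1)[OF ai])
    have Fe: "F x = c + integral {0..x} g" if "x \<in> {0..P}" for x
    proof -
      have si: "set_integrable lborel {0..x} g"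
        unfolding set_integrable_def using inc[of 0 x] that by simp
      show ?thesis using set_borel_integral_eq_integral(2)[OF si] F[OF that]
        by (simp add: set_lebesgue_integral_def)
    qed
    have "continuous_on {0..P} (\<lambda>x. c + integral {0..x} g)" by (intro continuous_intros ci)
    then show ?thesis by (rule continuous_on_eq) (simp add: Fe)
  qed
  define S where "S = {s. s \<in> {0..P} \<and> a < F s \<and> F s < b}"
  have "compact {0..P}" "{0..P} \<noteq> {}" using P by auto
  then obtain \<theta>1 where \<theta>1: "\<theta>1 \<in> {0..P}" "\<And>\<theta>. \<theta> \<in> {0..P} \<Longrightarrow> F \<theta> \<le> F \<theta>1"
    using continuous_attains_sup[OF _ _ contF] by blast
  \<comment> \<open>\<open>hi\<close> only provides values above each \<open>y < b\<close>; the
    maximum, attained by continuity, reaches \<open>b\<close> itself.\<close>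
  have b1: "b \<le> F \<theta>1"
  proof (rule ccontr)
    assume "\<not> b \<le> F \<theta>1"
    then obtain \<theta> where "\<theta> \<in> {0..P}" "F \<theta>1 < F \<theta>" using hi[of "F \<theta>1"] by auto
    with \<theta>1(2)[of \<theta>] show False by simp
  qed
  obtain \<theta>2 where \<theta>2: "\<theta>2 \<in> {0..P}" "F \<theta>2 \<le> a" using lo by auto
  text \<open>The last exit point from one side before the first hit of the other.\<close>
  have "\<exists>x y. 0 \<le> x \<and> x \<le> y \<and> y \<le> P \<and> b - a \<le> \<bar>F y - F x\<bar> \<and> {x<..<y} \<subseteq> S"
  proof -
    have cross: "\<exists>x y. u \<le> x \<and> x \<le> y \<and> y \<le> v \<and> H x \<le> 0 \<and> 1 \<le> H y \<and> (\<forall>s\<in>{x<..<y}. 0 < H s \<and> H s < 1)"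
      if "u \<le> v" "continuous_on {u..v} H" "H u \<le> 0" "1 \<le> H v" for u v and H :: "real \<Rightarrow> real"
    proof -
      define Y where "Y = {u..v} \<inter> H -` {1..}"
      have "closed Y" unfolding Y_def by (rule continuous_closed_preimage[OF that(2)]) auto
      then have "compact Y" unfolding Y_def by (metis Y_def Int_lower1 bounded_closed_interval bounded_subset compact_eq_bounded_closed)
      moreover have "v \<in> Y" using that by (auto simp: Y_def)
      ultimately obtain y where y: "y \<in> Y" "\<And>t. t \<in> Y \<Longrightarrow> y \<le> t"
        using compact_attains_inf[of Y] by blast
      define Z where "Z = {u..y} \<inter> H -` {..0}"
      have yv: "u \<le> y" "y \<le> v" "1 \<le> H y" using y(1) by (auto simp: Y_def)
      have "closed Z" unfolding Z_def
        by (rule continuous_closed_preimage[OF continuous_on_subset[OF that(2)]]) (use yv in auto)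
      then have "compact Z" unfolding Z_def by (metis Z_def Int_lower1 bounded_closed_interval bounded_subset compact_eq_bounded_closed)
      moreover have "u \<in> Z" using that yv by (auto simp: Z_def)
      ultimately obtain x where x: "x \<in> Z" "\<And>t. t \<in> Z \<Longrightarrow> t \<le> x"
        using compact_attains_sup[of Z] by blast
      have "0 < H s \<and> H s < 1" if s: "s \<in> {x<..<y}" for s
      proof
        have xu: "u \<le> x" using x(1) by (auto simp: Z_def)
        show "0 < H s"
        proof (rule ccontr)
          assume "\<not> 0 < H s"
          then have "s \<in> Z" using s xu by (auto simp: Z_def)
          then show False using x(2)[of s] s by auto
        qed
        show "H s < 1"
        proof (rule ccontr)
          assume "\<not> H s < 1"
          then have "s \<in> Y" using s xu yv by (auto simp: Y_def)
          then show False using y(2)[of s] s by auto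
        qed
      qed
      then show ?thesis using x(1) yv by (intro exI[of _ x] exI[of _ y]) (auto simp: Z_def)
    qed
    \<comment> \<open>Rescaling sends the strip to (0, 1), so that a downward crossing is an upward
      crossing of 1 - \<open>H\<close>.\<close>
    define H where "H s = (F s - a) / (b - a)" for s
    have Hc: "continuous_on {0..P} H" unfolding H_def by (intro continuous_intros contF) (use ab in auto)
    have H: "H s \<le> 0 \<longleftrightarrow> F s \<le> a" "1 \<le> H s \<longleftrightarrow> b \<le> F s" "0 < H s \<longleftrightarrow> a < F s" "H s < 1 \<longleftrightarrow> F s < b" for s
      using ab by (auto simp: H_def divide_le_0_iff zero_less_divide_iff le_divide_eq divide_less_eq)
    show ?thesis
    proof (cases "\<theta>2 \<le> \<theta>1")
      case True
      have "continuous_on {\<theta>2..\<theta>1} H" by (rule continuous_on_subset[OF Hc]) (use \<theta>1 \<theta>2 in auto)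
      from cross[OF True this] obtain x y where xy: "\<theta>2 \<le> x" "x \<le> y" "y \<le> \<theta>1" "H x \<le> 0" "1 \<le> H y"
        "\<forall>s\<in>{x<..<y}. 0 < H s \<and> H s < 1" using b1 \<theta>2 H by blast
      then show ?thesis using \<theta>1(1) \<theta>2(1) H[of x] H[of y] H
        by (intro exI[of _ x] exI[of _ y]) (auto simp: S_def subset_eq)
    next
      case False
      define H' where "H' s = 1 - H s" for s
      have "continuous_on {\<theta>1..\<theta>2} H'" unfolding H'_def
        by (intro continuous_intros continuous_on_subset[OF Hc]) (use \<theta>1 \<theta>2 in auto)
      moreover have "H' \<theta>1 \<le> 0" "1 \<le> H' \<theta>2" using b1 \<theta>2 H[of \<theta>1] H[of \<theta>2] by (auto simp: H'_def)
      ultimately obtain x y where xy: "\<theta>1 \<le> x" "x \<le> y" "y \<le> \<theta>2" "H' x \<le> 0" "1 \<le> H' y"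
        "\<forall>s\<in>{x<..<y}. 0 < H' s \<and> H' s < 1" using cross[of \<theta>1 \<theta>2 H'] False by auto
      have "b \<le> F x" "F y \<le> a" "\<forall>s\<in>{x<..<y}. a < F s \<and> F s < b"
        using xy(4-6) H[of x] H[of y] H by (auto simp: H'_def)
      then show ?thesis using \<theta>1(1) \<theta>2(1) xy(1-3) ab
        by (intro exI[of _ x] exI[of _ y]) (auto simp: S_def subset_eq)
    qed
  qed
  then obtain x y where xy: "0 \<le> x" "x \<le> y" "y \<le> P" "b - a \<le> \<bar>F y - F x\<bar>" "{x<..<y} \<subseteq> S" by blast
  have Sm: "S \<in> sets borel"
  proof -
    have "openin (top_of_set {0..P}) ({0..P} \<inter> F -` {a<..<b})"
      by (rule continuous_openin_preimage_gen[OF contF]) auto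
    then obtain O' where "open O'" "{0..P} \<inter> F -` {a<..<b} = {0..P} \<inter> O'" by (auto simp: openin_open)
    moreover have "S = {0..P} \<inter> F -` {a<..<b}" by (auto simp: S_def)
    ultimately show ?thesis by auto
  qed
  have iS: "integrable lborel (\<lambda>s. indicator S s * \<bar>g s\<bar>)"
  proof -
    have "integrable lborel (\<lambda>s. indicator S s *\<^sub>R \<bar>indicator {0..P} s * g s\<bar>)"
      by (rule integrable_mult_indicator) (use Sm g in auto)
    moreover have "(\<lambda>s. indicator S s *\<^sub>R \<bar>indicator {0..P} s * g s\<bar>) = (\<lambda>s. indicator S s * \<bar>g s\<bar>)"
      by (auto simp: fun_eq_iff indicator_def S_def)
    ultimately show ?thesis by (simp only:)
  qed
  have "b - a \<le> \<bar>LINT s|lborel. indicator {x..y} s * g s\<bar>" using xy(4) diff[OF xy(1-3)] by simp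
  also have "\<dots> \<le> (LINT s|lborel. \<bar>indicator {x..y} s * g s\<bar>)" by (rule integral_abs_bound)
  also have "\<dots> \<le> (LINT s|lborel. indicator S s * \<bar>g s\<bar>)"
  proof (rule integral_mono_AE)
    show "integrable lborel (\<lambda>s. \<bar>indicator {x..y} s * g s\<bar>)" using inc[of x y] xy by auto
    have "AE s in lborel. s \<noteq> x \<and> s \<noteq> y" by (intro AE_conjI AE_lborel_singleton)
    then show "AE s in lborel. \<bar>indicator {x..y} s * g s\<bar> \<le> indicator S s * \<bar>g s\<bar>"
    proof eventually_elim
      case (elim s)
      then have "s \<in> {x..y} \<Longrightarrow> s \<in> S" using xy(5) by auto
      then show ?case by (auto simp: indicator_def abs_mult)
    qed
  qed (rule iS)
  finally show ?thesis by (simp only: S_def)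
qed

text \<open>At each fixed angle the increment formula holds for almost every point; Fubini's theorem
  turns this into almost every angle for almost every point, which is absolute continuity of a
  representative along the circle.\<close>

lemma AE_circle_absolutely_continuous:
  assumes w: "integrable lborel w" and g: "\<And>k. integrable lborel (g k)" and wg: "weak_grad V w g"
    and V: "open V" "\<And>\<theta> z. z \<in> V \<Longrightarrow> R \<theta> z \<in> V"
    and G: "\<And>z. G z = (\<Sum>k\<in>UNIV. rot.X z $ k * g k z)" and Gi: "integrable lborel G"
  shows "AE z in lborel. z \<in> V \<longrightarrow> integrable lborel (\<lambda>s. indicator {0..2 * pi} s * G (R s z)) \<and>
    (AE \<theta> in circle_measure. w (R \<theta> z) = w z + (LINT s|lborel. indicator {0..\<theta>} s * G (R s z)))"
proof -
  have [measurable]: "w \<in> borel_measurable borel" "G \<in> borel_measurable borel" using w Gi by auto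
  have [measurable]: "V \<in> sets borel" using V by auto
  have 1: "AE z in lborel. integrable lborel (\<lambda>s. indicator {0..2 * pi} s * G (R s z))"
    using lborel_pair.AE_integrable_snd[OF rot.integrable_flow_pair[OF Gi]] .
  have 2: "AE z in lborel. z \<in> V \<longrightarrow> w (R \<theta> z) - w z = rot.flow_avg G \<theta> z" if "0 \<le> \<theta>" for \<theta>
    by (rule rot.AE_flow_increment[OF w g wg _ that V(1) G Gi]) (rule V(2))
  have 3: "AE \<theta> in circle_measure. AE z in lborel. z \<in> V \<longrightarrow> w (R \<theta> z) - w z = rot.flow_avg G \<theta> z"
    unfolding circle_measure_def by (subst AE_density) (auto simp: indicator_def intro!: AE_I2 2)
  \<comment> \<open>The interval of integration depends on the first variable; its indicator is
    written as a product of sign conditions to obtain joint measurability.\<close>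
  have [measurable]: "(\<lambda>q. rot.flow_avg G (fst q) (snd q)) \<in> borel_measurable (circle_measure \<Otimes>\<^sub>M lborel)"
    unfolding rot.flow_avg_def
  proof (rule lborel.borel_measurable_lebesgue_integral)
    have "(\<lambda>p. indicator {s. 0 \<le> s} (snd p) * indicator {q. 0 \<le> q} (fst (fst p) - snd p) * G (R (snd p) (snd (fst p))))
      \<in> borel_measurable ((circle_measure \<Otimes>\<^sub>M lborel) \<Otimes>\<^sub>M lborel)"
      by measurable
    moreover have "(\<lambda>(q, s). indicator {0..fst q} s * G (R s (snd q))) =
      (\<lambda>p. indicator {s. 0 \<le> s} (snd p) * indicator {q. 0 \<le> q} (fst (fst p) - snd p) * G (R (snd p) (snd (fst p))))"
      by (auto simp: fun_eq_iff indicator_def)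
    ultimately show "(\<lambda>(q, s). indicator {0..fst q} s * G (R s (snd q))) \<in> borel_measurable ((circle_measure \<Otimes>\<^sub>M lborel) \<Otimes>\<^sub>M lborel)"
      by simp
  qed
  have 4: "AE z in lborel. AE \<theta> in circle_measure. z \<in> V \<longrightarrow> w (R \<theta> z) - w z = rot.flow_avg G \<theta> z"
    using 3 by (subst (asm) circle_pair.AE_commute) measurable
  show ?thesis
    using 1 4
  proof eventually_elim
    case (elim z)
    show ?case
    proof (intro impI conjI)
      assume "z \<in> V"
      then show "AE \<theta> in circle_measure. w (R \<theta> z) = w z + (LINT s|lborel. indicator {0..\<theta>} s * G (R s z))"
        using elim(2) by (auto simp: rot.flow_avg_def elim!: eventually_mono)
    qed (use elim in auto)
  qed
qed

text \<open>The values strictly between the two levels are taken on a set of angular measure at most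
  twice the difference of the two angles, and the continuous representative has to cross this range.
  The level M/2 is chosen so that M/2 times 2h is hM.\<close>

lemma rearr_drop:
  assumes w[measurable]: "w \<in> borel_measurable borel" and G[measurable]: "G \<in> borel_measurable borel"
    and Gi: "integrable lborel (\<lambda>s. indicator {0..2 * pi} s * G (R s z))"
    and ac: "AE \<theta> in circle_measure. w (R \<theta> z) = w z + (LINT s|lborel. indicator {0..\<theta>} s * G (R s z))"
    and a: "R a z $ j \<noteq> 0" "R b z $ j \<noteq> 0" and h: "\<bar>ang (R a z) - ang (R b z)\<bar> \<le> h" and M: "0 \<le> M"
  defines "B \<equiv> {\<phi>. rearr w (R b z) < w (R \<phi> z) \<and> w (R \<phi> z) < rearr w (R a z)}"
  shows "ennreal (rearr w (R a z) - rearr w (R b z) - h * M)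
    \<le> (\<integral>\<^sup>+\<phi>. indicator B \<phi> * ennreal (excess (M / 2) (G (R \<phi> z))) \<partial>circle_measure)"
proof (cases "rearr w (R b z) < rearr w (R a z)")
  case False
  then have "rearr w (R a z) - rearr w (R b z) - h * M \<le> 0"
    using h M mult_nonneg_nonneg[of h M] by linarith
  then show ?thesis by (simp add: ennreal_neg)
next
  case True
  define va vb where "va = rearr w (R a z)" and "vb = rearr w (R b z)"
  have [measurable]: "B \<in> sets borel" unfolding B_def by measurable
  define F where "F \<theta> = w z + (LINT s|lborel. indicator {0..\<theta>} s * G (R s z))" for \<theta>
  have va: "s < va \<longleftrightarrow> 2 * ang (R a z) < circ_m w z s" for s
    unfolding va_def by (simp add: less_rearr_iff[OF w a(1)] circ_m_rot)
  have vb: "s < vb \<longleftrightarrow> 2 * ang (R b z) < circ_m w z s" for s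
    unfolding vb_def by (simp add: less_rearr_iff[OF w a(2)] circ_m_rot)
  have angs: "0 < ang (R a z)" "ang (R b z) < pi" using ang_bounds a by auto
  have acI: "AE \<theta> in circle_measure. \<theta> \<in> {0..<2 * pi} \<and> w (R \<theta> z) = F \<theta>"
  proof -
    have "AE \<theta> in circle_measure. \<theta> \<in> {0..<2 * pi}"
      unfolding circle_measure_def by (subst AE_density) (auto simp: indicator_def)
    then show ?thesis using ac by eventually_elim (simp add: F_def)
  qed
  \<comment> \<open>Link between \<open>w\<close>, known up to null sets, and the continuous
    \<open>F\<close>: a set of values taken with positive measure is also met by
    \<open>F\<close>.\<close>
  have pos: "\<exists>\<theta>\<in>{0..2 * pi}. F \<theta> \<in> A" if "emeasure circle_measure {\<theta>. w (R \<theta> z) \<in> A} \<noteq> 0" for A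
  proof (rule ccontr)
    assume no: "\<not> ?thesis"
    from acI have "AE \<theta> in circle_measure. \<not> w (R \<theta> z) \<in> A"
      by eventually_elim (use no in auto)
    then have "emeasure circle_measure {\<theta> \<in> space circle_measure. w (R \<theta> z) \<in> A} = 0"
      by (rule emeasure_eq_0_AE)
    with that show False by simp
  qed
  have hi: "\<exists>\<theta>\<in>{0..2 * pi}. y < F \<theta>" if "y < va" for y
  proof -
    have "0 < circ_m w z y" using va[of y] that angs(1) by linarith
    then show ?thesis using pos[of "{y<..}"] by (simp add: emeasure_circ_m)
  qed
  have lo: "\<exists>\<theta>\<in>{0..2 * pi}. F \<theta> \<le> vb"
  proof -
    have "circ_m w z vb \<le> 2 * ang (R b z)" using vb[of vb] by simp
    then have c: "circ_m w z vb < 2 * pi" using angs by linarith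
    have "{\<theta>. w (R \<theta> z) \<in> {..vb}} = space circle_measure - {\<theta>. vb < w (R \<theta> z)}" by auto
    moreover have "{\<theta>. vb < w (R \<theta> z)} \<in> sets circle_measure" by measurable
    ultimately have "emeasure circle_measure {\<theta>. w (R \<theta> z) \<in> {..vb}} = ennreal (2 * pi) - ennreal (circ_m w z vb)"
      using emeasure_compl[of "{\<theta>. vb < w (R \<theta> z)}" circle_measure]
      by (simp add: emeasure_circ_m emeasure_circle_measure_UNIV)
    also have "\<dots> = ennreal (2 * pi - circ_m w z vb)" by (simp add: ennreal_minus circ_m_bounds)
    finally show ?thesis using pos[of "{..vb}"] c by (simp add: ennreal_eq_0_iff)
  qed
  have strip: "va - vb \<le> (LINT s|lborel. indicator {s. s \<in> {0..2 * pi} \<and> vb < F s \<and> F s < va} s * \<bar>G (R s z)\<bar>)"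
    by (rule drop_le_strip_integral[OF _ Gi _ hi lo]) (use True in \<open>auto simp: F_def va_def vb_def\<close>)
  \<comment> \<open>\<open>B\<close> is the set above \<open>vb\<close> without the set at or above
    \<open>va\<close>. The first has measure at most twice the angle at \<open>b\<close>; the
    second, by continuity from above along levels increasing to \<open>va\<close>, at least twice
    the angle at \<open>a\<close>.\<close>
  have Bm: "emeasure circle_measure B \<le> ennreal (2 * h)"
  proof -
    have "circ_m w z vb \<le> 2 * ang (R b z)" using vb[of vb] by simp
    moreover have "2 * ang (R a z) \<le> measure circle_measure {\<theta>. va \<le> w (R \<theta> z)}"
    proof -
      have "(\<lambda>n. measure circle_measure {\<theta>. va - 1 / real (Suc n) < w (R \<theta> z)}) \<longlonglongrightarrow>
        measure circle_measure (\<Inter>n. {\<theta>. va - 1 / real (Suc n) < w (R \<theta> z)})"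
      proof (rule circle.finite_Lim_measure_decseq)
        show "range (\<lambda>n. {\<theta>. va - 1 / real (Suc n) < w (R \<theta> z)}) \<subseteq> sets circle_measure"
          by (intro image_subsetI) measurable
        show "decseq (\<lambda>n. {\<theta>. va - 1 / real (Suc n) < w (R \<theta> z)})"
        proof (rule decseq_SucI)
          fix n
          have "1 / real (Suc (Suc n)) \<le> 1 / real (Suc n)" by (simp add: frac_le)
          then show "{\<theta>. va - 1 / real (Suc (Suc n)) < w (R \<theta> z)} \<subseteq> {\<theta>. va - 1 / real (Suc n) < w (R \<theta> z)}" by auto
        qed
      qed
      moreover have "(\<Inter>n. {\<theta>. va - 1 / real (Suc n) < w (R \<theta> z)}) = {\<theta>. va \<le> w (R \<theta> z)}"
      proof (intro set_eqI iffI)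
        fix \<theta> assume A: "\<theta> \<in> (\<Inter>n. {\<theta>. va - 1 / real (Suc n) < w (R \<theta> z)})"
        show "\<theta> \<in> {\<theta>. va \<le> w (R \<theta> z)}"
        proof (rule ccontr)
          assume "\<theta> \<notin> {\<theta>. va \<le> w (R \<theta> z)}"
          then have "0 < va - w (R \<theta> z)" by simp
          then obtain n where n: "1 / real (Suc n) < va - w (R \<theta> z)" by (rule nat_approx_posE)
          have "va - 1 / real (Suc n) < w (R \<theta> z)" using A by blast
          with n show False by linarith
        qed
      next
        fix \<theta> assume A: "\<theta> \<in> {\<theta>. va \<le> w (R \<theta> z)}"
        have "va - 1 / real (Suc n) < w (R \<theta> z)" for n
        proof -
          have "0 < 1 / real (Suc n)" by simp
          moreover have "va \<le> w (R \<theta> z)" using A by simp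
          ultimately show ?thesis by linarith
        qed
        then show "\<theta> \<in> (\<Inter>n. {\<theta>. va - 1 / real (Suc n) < w (R \<theta> z)})" by blast
      qed
      ultimately have lim: "(\<lambda>n. circ_m w z (va - 1 / real (Suc n))) \<longlonglongrightarrow> measure circle_measure {\<theta>. va \<le> w (R \<theta> z)}"
        by (simp only: circ_m_def)
      have "2 * ang (R a z) \<le> circ_m w z (va - 1 / real (Suc n))" for n
        using va[of "va - 1 / real (Suc n)"] by simp
      then show ?thesis by (intro LIMSEQ_le_const[OF lim]) auto
    qed
    moreover have "measure circle_measure B = measure circle_measure {\<theta>. vb < w (R \<theta> z)} - measure circle_measure {\<theta>. va \<le> w (R \<theta> z)}"
    proof -
      have "B = {\<theta>. vb < w (R \<theta> z)} - {\<theta>. va \<le> w (R \<theta> z)}" by (auto simp: B_def va_def vb_def)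
      moreover have "{\<theta>. vb < w (R \<theta> z)} \<in> sets circle_measure" "{\<theta>. va \<le> w (R \<theta> z)} \<in> sets circle_measure" by measurable
      moreover have "{\<theta>. va \<le> w (R \<theta> z)} \<subseteq> {\<theta>. vb < w (R \<theta> z)}" using True by (auto simp: va_def vb_def)
      ultimately show ?thesis by (simp only: circle.finite_measure_Diff)
    qed
    ultimately have "measure circle_measure B \<le> 2 * h" using h unfolding circ_m_def by linarith
    then show ?thesis by (simp add: circle.emeasure_eq_measure ennreal_leI)
  qed
  let ?e = "\<lambda>\<phi>. ennreal (excess (M / 2) (G (R \<phi> z)))"
  have "ennreal (va - vb) \<le> (\<integral>\<^sup>+s. indicator {s. s \<in> {0..2 * pi} \<and> vb < F s \<and> F s < va} s * ennreal \<bar>G (R s z)\<bar> \<partial>lborel)"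
  proof -
    have "ennreal (va - vb) \<le> ennreal (LINT s|lborel. indicator {s. s \<in> {0..2 * pi} \<and> vb < F s \<and> F s < va} s * \<bar>G (R s z)\<bar>)"
      by (rule ennreal_leI[OF strip])
    also have "\<dots> \<le> (\<integral>\<^sup>+s. ennreal (indicator {s. s \<in> {0..2 * pi} \<and> vb < F s \<and> F s < va} s * \<bar>G (R s z)\<bar>) \<partial>lborel)"
    proof (cases "integrable lborel (\<lambda>s. indicator {s. s \<in> {0..2 * pi} \<and> vb < F s \<and> F s < va} s * \<bar>G (R s z)\<bar>)")
      case True
      then show ?thesis by (subst nn_integral_eq_integral) auto
    qed (simp add: not_integrable_integral_eq)
    also have "\<dots> = (\<integral>\<^sup>+s. indicator {s. s \<in> {0..2 * pi} \<and> vb < F s \<and> F s < va} s * ennreal \<bar>G (R s z)\<bar> \<partial>lborel)"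
      by (intro nn_integral_cong) (auto simp: indicator_def)
    finally show ?thesis .
  qed
  also have "\<dots> \<le> (\<integral>\<^sup>+s. indicator {0..<2 * pi} s * (indicator B s * ennreal \<bar>G (R s z)\<bar>) \<partial>lborel)"
  proof (rule nn_integral_mono_AE)
    have "AE s in lborel. s \<noteq> 2 * pi" by (rule AE_lborel_singleton)
    moreover have "AE s in lborel. s \<in> {0..<2 * pi} \<longrightarrow> w (R s z) = F s"
      using ac unfolding circle_measure_def by (subst (asm) AE_density) (auto simp: indicator_def F_def elim!: eventually_mono)
    ultimately show "AE s in lborel. indicator {s. s \<in> {0..2 * pi} \<and> vb < F s \<and> F s < va} s * ennreal \<bar>G (R s z)\<bar>
      \<le> indicator {0..<2 * pi} s * (indicator B s * ennreal \<bar>G (R s z)\<bar>)"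
      by eventually_elim (auto simp: indicator_def B_def va_def vb_def)
  qed
  also have "\<dots> = (\<integral>\<^sup>+s. indicator B s * ennreal \<bar>G (R s z)\<bar> \<partial>circle_measure)"
    by (subst nn_integral_circle) auto
  also have "\<dots> \<le> (\<integral>\<^sup>+s. ennreal (M / 2) * indicator B s + indicator B s * ?e s \<partial>circle_measure)"
    using M by (intro nn_integral_mono) (auto simp: indicator_def excess_def ennreal_plus[symmetric] simp del: ennreal_plus intro!: ennreal_leI)
  also have "\<dots> = ennreal (M / 2) * emeasure circle_measure B + (\<integral>\<^sup>+s. indicator B s * ?e s \<partial>circle_measure)"
    by (subst nn_integral_add) (auto simp: nn_integral_cmult_indicator)
  also have "ennreal (M / 2) * emeasure circle_measure B \<le> ennreal (M / 2) * ennreal (2 * h)"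
    by (intro mult_left_mono Bm) auto
  also have "ennreal (M / 2) * ennreal (2 * h) = ennreal (h * M)"
    using M h by (subst ennreal_mult[symmetric]) auto
  finally have "ennreal (va - vb) \<le> ennreal (h * M) + (\<integral>\<^sup>+s. indicator B s * ?e s \<partial>circle_measure)"
    by (simp add: add_right_mono)
  then have "ennreal (va - vb) - ennreal (h * M) \<le> (\<integral>\<^sup>+s. indicator B s * ?e s \<partial>circle_measure)"
    by (simp add: ennreal_minus_le_iff)
  moreover have "ennreal (va - vb) - ennreal (h * M) = ennreal (va - vb - h * M)"
    using M h by (intro ennreal_minus) (auto intro!: mult_nonneg_nonneg)
  ultimately show ?thesis by (simp add: va_def vb_def)
qed

section \<open>The rotation quotient on a single circle\<close>

lemma measure_ang_less:
  assumes "0 < rad z"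
  shows "measure circle_measure {\<theta>. ang (R \<theta> z) < c} = 2 * max 0 (min pi c)"
proof -
  consider "c < 0" | "0 \<le> c" "c \<le> pi" | "pi < c" by linarith
  then show ?thesis
  proof cases
    case 1
    then have "{\<theta>. ang (R \<theta> z) < c} = {}" using ang_bounds(1) by (auto simp: not_less intro: order_trans[OF less_imp_le])
    then show ?thesis using 1 by simp
  next
    case 2
    then show ?thesis using emeasure_ang_less[OF assms 2] by (simp add: measure_def)
  next
    case 3
    then have "{\<theta>. ang (R \<theta> z) < c} = UNIV" using ang_bounds(2) by (auto intro: le_less_trans)
    then show ?thesis using 3 by (simp add: measure_def emeasure_circle_measure_UNIV)
  qed
qed

text \<open>Two arcs of length at most 2h, one on either side of the axis of symmetry.\<close>

lemma emeasure_ang_between: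
  assumes "0 < rad z" "0 \<le> h"
  shows "emeasure circle_measure {\<theta>. k - h \<le> ang (R \<theta> z) \<and> ang (R \<theta> z) < k + h} \<le> ennreal (4 * h)"
proof -
  have m: "{\<theta>. ang (R \<theta> z) < c} \<in> sets circle_measure" for c by measurable
  have "{\<theta>. k - h \<le> ang (R \<theta> z) \<and> ang (R \<theta> z) < k + h} = {\<theta>. ang (R \<theta> z) < k + h} - {\<theta>. ang (R \<theta> z) < k - h}"
    by auto
  moreover have "{\<theta>. ang (R \<theta> z) < k - h} \<subseteq> {\<theta>. ang (R \<theta> z) < k + h}" using assms by auto
  ultimately have "measure circle_measure {\<theta>. k - h \<le> ang (R \<theta> z) \<and> ang (R \<theta> z) < k + h}
    = 2 * max 0 (min pi (k + h)) - 2 * max 0 (min pi (k - h))"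
    using m by (simp only: circle.finite_measure_Diff measure_ang_less[OF assms(1)])
  also have "\<dots> \<le> 4 * h" using assms(2) by (auto simp: max_def min_def)
  finally show ?thesis by (simp add: circle.emeasure_eq_measure ennreal_leI)
qed

text \<open>The angle \<open>circ_m w z c / 2\<close> bounds the arc where the rearrangement exceeds
  \<open>c\<close>, so it separates the angles at \<open>\<theta>\<close> and
  \<open>\<theta> + h\<close>, which differ by at most \<open>h\<close>.\<close>

lemma ang_between:
  assumes w: "w \<in> borel_measurable borel" and z: "0 < rad z" and h: "0 \<le> h"
    and ax: "R \<theta> z $ j \<noteq> 0" "R (\<theta> + h) z $ j \<noteq> 0"
    and c: "(rearr w (R \<theta> z) < c \<and> c < rearr w (R (\<theta> + h) z)) \<or> (rearr w (R (\<theta> + h) z) < c \<and> c < rearr w (R \<theta> z))"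
  shows "circ_m w z c / 2 - h \<le> ang (R \<theta> z) \<and> ang (R \<theta> z) < circ_m w z c / 2 + h"
proof -
  have l: "c < rearr w (R a z) \<longleftrightarrow> ang (R a z) < circ_m w z c / 2" if "R a z $ j \<noteq> 0" for a
    by (simp add: less_rearr_iff[OF w that] circ_m_rot[OF w] mult.commute[of 2])
  have "\<bar>ang (R (\<theta> + h) z) - ang (R \<theta> z)\<bar> \<le> h"
    using ang_lipschitz[of "R \<theta> z" h] h z by (simp add: rad_rot rot_add[OF ij, symmetric] add.commute)
  then show ?thesis using c l[OF ax(1)] l[OF ax(2)] by linarith
qed

text \<open>Fubini on pairs of angles: the change of the rearrangement at \<theta> is paid by the
  excess at the angles \<phi> of its strip, and a given \<phi> is charged only by starting angles
  within \<open>h\<close> of a fixed unsigned angle, a set of measure at most 4h.\<close>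

lemma rearr_rotation_circle:
  assumes w[measurable]: "w \<in> borel_measurable borel" and G[measurable]: "G \<in> borel_measurable borel"
    and Gi: "integrable lborel (\<lambda>s. indicator {0..2 * pi} s * G (R s z))"
    and ac: "AE \<theta> in circle_measure. w (R \<theta> z) = w z + (LINT s|lborel. indicator {0..\<theta>} s * G (R s z))"
    and z: "0 < rad z" and h: "0 < h" and M: "0 \<le> M"
  shows "(\<integral>\<^sup>+\<theta>. excess M ((rearr w (R (\<theta> + h) z) - rearr w (R \<theta> z)) / h) \<partial>circle_measure)
    \<le> 4 * (\<integral>\<^sup>+\<theta>. excess (M / 2) (G (R \<theta> z)) \<partial>circle_measure)"
proof -
  define e where "e \<phi> = ennreal (excess (M / 2) (G (R \<phi> z)))" for \<phi>
  have [measurable]: "e \<in> borel_measurable borel" unfolding e_def[abs_def] by measurable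
  \<comment> \<open>The two summands record a rise and a drop; they exclude each other, so
    \<open>K\<close> only takes the values 0 and 1.\<close>
  define K where "K \<theta> \<phi> = indicator {\<phi>. rearr w (R \<theta> z) < w (R \<phi> z) \<and> w (R \<phi> z) < rearr w (R (\<theta> + h) z)} \<phi>
    + (indicator {\<phi>. rearr w (R (\<theta> + h) z) < w (R \<phi> z) \<and> w (R \<phi> z) < rearr w (R \<theta> z)} \<phi> :: ennreal)" for \<theta> \<phi>
  have K2: "K \<theta> \<phi> = (if (rearr w (R \<theta> z) < w (R \<phi> z) \<and> w (R \<phi> z) < rearr w (R (\<theta> + h) z)) \<or>
      (rearr w (R (\<theta> + h) z) < w (R \<phi> z) \<and> w (R \<phi> z) < rearr w (R \<theta> z)) then 1 else 0)" for \<theta> \<phi>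
    by (auto simp: K_def indicator_def)
  have [measurable]: "(\<lambda>p. K (fst p) (snd p)) \<in> borel_measurable (circle_measure \<Otimes>\<^sub>M circle_measure)"
    unfolding K2 by measurable
  have off: "AE \<theta> in circle_measure. R \<theta> z $ j \<noteq> 0 \<and> R (\<theta> + h) z $ j \<noteq> 0"
  proof (intro AE_conjI)
    show "AE \<theta> in circle_measure. R \<theta> z $ j \<noteq> 0" by (rule AE_circle_off_axis[OF z])
    have "0 < rad (R h z)" using z by (simp add: rad_rot)
    from AE_circle_off_axis[OF this] show "AE \<theta> in circle_measure. R (\<theta> + h) z $ j \<noteq> 0"
      by (simp add: rot_add[OF ij])
  qed
  have "(\<integral>\<^sup>+\<theta>. excess M ((rearr w (R (\<theta> + h) z) - rearr w (R \<theta> z)) / h) \<partial>circle_measure)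
    \<le> (\<integral>\<^sup>+\<theta>. ennreal (1 / h) * (\<integral>\<^sup>+\<phi>. K \<theta> \<phi> * e \<phi> \<partial>circle_measure) \<partial>circle_measure)"
  proof (rule nn_integral_mono_AE)
    show "AE \<theta> in circle_measure. ennreal (excess M ((rearr w (R (\<theta> + h) z) - rearr w (R \<theta> z)) / h))
      \<le> ennreal (1 / h) * (\<integral>\<^sup>+\<phi>. K \<theta> \<phi> * e \<phi> \<partial>circle_measure)"
      using off
    proof eventually_elim
      case (elim \<theta>)
      define d where "d = rearr w (R (\<theta> + h) z) - rearr w (R \<theta> z)"
      have "\<bar>ang (R (\<theta> + h) z) - ang (R \<theta> z)\<bar> \<le> h"
        using ang_lipschitz[of "R \<theta> z" h] h z by (simp add: rad_rot rot_add[OF ij, symmetric] add.commute)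
      then have lip: "\<bar>ang (R (\<theta> + h) z) - ang (R \<theta> z)\<bar> \<le> h" "\<bar>ang (R \<theta> z) - ang (R (\<theta> + h) z)\<bar> \<le> h"
        by linarith+
      have 1: "ennreal (d - h * M) \<le> (\<integral>\<^sup>+\<phi>. indicator {\<phi>. rearr w (R \<theta> z) < w (R \<phi> z) \<and> w (R \<phi> z) < rearr w (R (\<theta> + h) z)} \<phi> * e \<phi> \<partial>circle_measure)"
        unfolding d_def e_def using rearr_drop[OF w G Gi ac _ _ lip(1) M] elim by simp
      have 2: "ennreal (- d - h * M) \<le> (\<integral>\<^sup>+\<phi>. indicator {\<phi>. rearr w (R (\<theta> + h) z) < w (R \<phi> z) \<and> w (R \<phi> z) < rearr w (R \<theta> z)} \<phi> * e \<phi> \<partial>circle_measure)"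
        unfolding d_def e_def using rearr_drop[OF w G Gi ac _ _ lip(2) M] elim by simp
      have hM: "0 \<le> h * M" using h M by simp
      have "excess M (d / h) = 1 / h * (max 0 (d - h * M) + max 0 (- d - h * M))"
        using h hM unfolding excess_def by (auto simp: max_def abs_if field_simps)
      moreover have "ennreal (1 / h * (A + B)) = ennreal (1 / h) * (ennreal A + ennreal B)" if "0 \<le> A" "0 \<le> B" for A B
        using h that by (subst ennreal_mult) (auto simp: ennreal_plus)
      ultimately have "ennreal (excess M (d / h)) = ennreal (1 / h) * (ennreal (max 0 (d - h * M)) + ennreal (max 0 (- d - h * M)))"
        by simp
      also have "\<dots> = ennreal (1 / h) * (ennreal (d - h * M) + ennreal (- d - h * M))"
        by (simp add: max_def ennreal_neg)
      also have "\<dots> \<le> ennreal (1 / h) * (\<integral>\<^sup>+\<phi>. K \<theta> \<phi> * e \<phi> \<partial>circle_measure)"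
      proof (intro mult_left_mono)
        have "(\<integral>\<^sup>+\<phi>. K \<theta> \<phi> * e \<phi> \<partial>circle_measure) =
          (\<integral>\<^sup>+\<phi>. indicator {\<phi>. rearr w (R \<theta> z) < w (R \<phi> z) \<and> w (R \<phi> z) < rearr w (R (\<theta> + h) z)} \<phi> * e \<phi> \<partial>circle_measure)
          + (\<integral>\<^sup>+\<phi>. indicator {\<phi>. rearr w (R (\<theta> + h) z) < w (R \<phi> z) \<and> w (R \<phi> z) < rearr w (R \<theta> z)} \<phi> * e \<phi> \<partial>circle_measure)"
          unfolding K_def distrib_right by (rule nn_integral_add) measurable
        then show "ennreal (d - h * M) + ennreal (- d - h * M) \<le> (\<integral>\<^sup>+\<phi>. K \<theta> \<phi> * e \<phi> \<partial>circle_measure)"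
          using add_mono[OF 1 2] by simp
      qed auto
      finally show ?case by (simp add: d_def)
    qed
  qed
  also have "\<dots> = ennreal (1 / h) * (\<integral>\<^sup>+\<theta>. (\<integral>\<^sup>+\<phi>. K \<theta> \<phi> * e \<phi> \<partial>circle_measure) \<partial>circle_measure)"
    by (rule nn_integral_cmult) measurable
  also have "(\<integral>\<^sup>+\<theta>. (\<integral>\<^sup>+\<phi>. K \<theta> \<phi> * e \<phi> \<partial>circle_measure) \<partial>circle_measure)
    = (\<integral>\<^sup>+\<phi>. (\<integral>\<^sup>+\<theta>. K \<theta> \<phi> * e \<phi> \<partial>circle_measure) \<partial>circle_measure)"
  proof -
    interpret CC: pair_sigma_finite circle_measure circle_measure ..
    show ?thesis by (rule CC.Fubini'[symmetric]) measurable
  qed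
  also have "\<dots> \<le> (\<integral>\<^sup>+\<phi>. ennreal (4 * h) * e \<phi> \<partial>circle_measure)"
  proof (rule nn_integral_mono)
    fix \<phi>
    let ?S = "{\<theta>. circ_m w z (w (R \<phi> z)) / 2 - h \<le> ang (R \<theta> z) \<and> ang (R \<theta> z) < circ_m w z (w (R \<phi> z)) / 2 + h}"
    have [measurable]: "?S \<in> sets borel" by measurable
    have "(\<integral>\<^sup>+\<theta>. K \<theta> \<phi> * e \<phi> \<partial>circle_measure) \<le> (\<integral>\<^sup>+\<theta>. e \<phi> * indicator ?S \<theta> \<partial>circle_measure)"
    proof (rule nn_integral_mono_AE)
      show "AE \<theta> in circle_measure. K \<theta> \<phi> * e \<phi> \<le> e \<phi> * indicator ?S \<theta>"
        using off
      proof eventually_elim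
        case (elim \<theta>)
        then show ?case
          using ang_between[OF w z less_imp_le[OF h], of \<theta> "w (R \<phi> z)"] by (auto simp: K2)
      qed
    qed
    also have "\<dots> = e \<phi> * emeasure circle_measure ?S" by (rule nn_integral_cmult_indicator) simp
    also have "\<dots> \<le> e \<phi> * ennreal (4 * h)"
      using h by (intro mult_left_mono emeasure_ang_between[OF z]) auto
    finally show "(\<integral>\<^sup>+\<theta>. K \<theta> \<phi> * e \<phi> \<partial>circle_measure) \<le> ennreal (4 * h) * e \<phi>" by (simp add: mult.commute)
  qed
  also have "\<dots> = ennreal (4 * h) * (\<integral>\<^sup>+\<phi>. e \<phi> \<partial>circle_measure)" by (rule nn_integral_cmult) measurable
  finally have "(\<integral>\<^sup>+\<theta>. excess M ((rearr w (R (\<theta> + h) z) - rearr w (R \<theta> z)) / h) \<partial>circle_measure)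
    \<le> ennreal (1 / h) * (ennreal (4 * h) * (\<integral>\<^sup>+\<phi>. e \<phi> \<partial>circle_measure))"
    by (simp add: mult_left_mono)
  also have "\<dots> = 4 * (\<integral>\<^sup>+\<phi>. e \<phi> \<partial>circle_measure)"
    using h by (simp add: mult.assoc[symmetric] ennreal_mult[symmetric])
  finally show ?thesis by (simp add: e_def)
qed

lemma rearr_rotation_excess:
  assumes w: "integrable lborel w" and g: "\<And>k. integrable lborel (g k)" and wg: "weak_grad V w g"
    and V: "open V" "\<And>\<theta> z. R \<theta> z \<in> V \<longleftrightarrow> z \<in> V"
    and G: "\<And>z. G z = (\<Sum>k\<in>UNIV. rot.X z $ k * g k z)" and Gi: "integrable lborel G"
    and h: "0 < h" and M: "0 \<le> M"
  shows "(\<integral>\<^sup>+z. indicator V z * ennreal (excess M ((rearr w (R h z) - rearr w z) / h)) \<partial>lborel)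
     \<le> 4 * (\<integral>\<^sup>+z. excess (M / 2) (G z) \<partial>lborel)"
proof (rule nn_integral_le_if_circle_le)
  have wm[measurable]: "w \<in> borel_measurable borel" and Gm[measurable]: "G \<in> borel_measurable borel" using w Gi by auto
  have [measurable]: "V \<in> sets borel" using V by auto
  show "(\<lambda>z. indicator V z * ennreal (excess M ((rearr w (R h z) - rearr w z) / h))) \<in> borel_measurable borel"
    "(\<lambda>z. ennreal (excess (M / 2) (G z))) \<in> borel_measurable borel" by measurable
  have ac: "AE z in lborel. z \<in> V \<longrightarrow> integrable lborel (\<lambda>s. indicator {0..2 * pi} s * G (R s z)) \<and>
    (AE \<theta> in circle_measure. w (R \<theta> z) = w z + (LINT s|lborel. indicator {0..\<theta>} s * G (R s z)))"
    by (rule AE_circle_absolutely_continuous[OF w g wg V(1) _ G Gi]) (simp add: V(2))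
  show "AE z in lborel. (\<integral>\<^sup>+\<theta>. indicator V (R \<theta> z) * ennreal (excess M ((rearr w (R h (R \<theta> z)) - rearr w (R \<theta> z)) / h)) \<partial>circle_measure)
      \<le> 4 * (\<integral>\<^sup>+\<theta>. ennreal (excess (M / 2) (G (R \<theta> z))) \<partial>circle_measure)"
    using ac AE_rad_pos
  proof eventually_elim
    case (elim z)
    show ?case
    proof (cases "z \<in> V")
      case True
      have "R h (R \<theta> z) = R (\<theta> + h) z" for \<theta> by (simp add: rot_add[OF ij, symmetric] add.commute)
      then show ?thesis
        using rearr_rotation_circle[OF wm Gm _ _ elim(2) h M] elim(1) True by (simp add: V(2))
    qed (simp add: V(2))
  qed
qed

end

section \<open>Hausdorff measure on circles\<close>

definition circ_pt :: "real \<Rightarrow> real \<Rightarrow> real ^ 2" where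
  "circ_pt r \<theta> = vector [r * cos \<theta>, r * sin \<theta>]"

lemma dist_circ_pt:
  assumes "0 < r"
  shows "dist (circ_pt r s) (circ_pt r t) = 2 * r * \<bar>sin ((s - t) / 2)\<bar>"
proof -
  have "(r * a - r * b)\<^sup>2 + (r * c - r * d)\<^sup>2 = r\<^sup>2 * ((c\<^sup>2 + a\<^sup>2) + (d\<^sup>2 + b\<^sup>2) - 2 * (a * b + c * d))" for a b c d
    by (simp add: power2_eq_square algebra_simps)
  from this[of "cos s" "cos t" "sin s" "sin t"]
  have "(r * cos s - r * cos t)\<^sup>2 + (r * sin s - r * sin t)\<^sup>2
    = r\<^sup>2 * (((sin s)\<^sup>2 + (cos s)\<^sup>2) + ((sin t)\<^sup>2 + (cos t)\<^sup>2) - 2 * (cos s * cos t + sin s * sin t))" .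
  also have "\<dots> = r\<^sup>2 * (2 - 2 * cos (s - t))" by (simp add: cos_diff)
  also have "cos (s - t) = 1 - 2 * (sin ((s - t) / 2))\<^sup>2"
  proof -
    have "2 * ((s - t) / 2) = s - t" by simp
    then show ?thesis using cos_double_sin[of "(s - t) / 2"] by (simp only:)
  qed
  also have "r\<^sup>2 * (2 - 2 * (1 - 2 * (sin ((s - t) / 2))\<^sup>2)) = (2 * r * \<bar>sin ((s - t) / 2)\<bar>)\<^sup>2"
    by (simp add: power_mult_distrib)
  finally have "(r * cos s - r * cos t)\<^sup>2 + (r * sin s - r * sin t)\<^sup>2 = (2 * r * \<bar>sin ((s - t) / 2)\<bar>)\<^sup>2" .
  then show ?thesis using assms
    by (simp add: dist_vec_def L2_set_def sum_2 circ_pt_def vector_2 dist_real_def)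
qed

lemma dist_circ_pt_le: "0 < r \<Longrightarrow> dist (circ_pt r s) (circ_pt r t) \<le> r * \<bar>s - t\<bar>"
  using abs_sin_x_le_abs_x[of "(s - t) / 2"] by (simp add: dist_circ_pt)

text \<open>Outer regularity gives an open set slightly larger than \<open>A\<close>, in which a
  gauge selects nonoverlapping intervals covering \<open>A\<close>. Lengths are measured through
  interiors, since the intervals may share endpoints.\<close>

lemma small_interval_cover:
  fixes A :: "real set"
  assumes A: "A \<in> sets borel" "A \<subseteq> {0..2 * pi}" and d: "0 < d" and e: "0 < e"
  obtains C :: "nat \<Rightarrow> real set" where "A \<subseteq> (\<Union>n. C n)" "\<And>n s t. s \<in> C n \<Longrightarrow> t \<in> C n \<Longrightarrow> \<bar>s - t\<bar> \<le> d"
    "\<And>n s t. s \<in> C n \<Longrightarrow> t \<in> C n \<Longrightarrow> ennreal \<bar>s - t\<bar> \<le> emeasure lborel (interior (C n))"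
    "(\<Sum>n. emeasure lborel (interior (C n))) \<le> emeasure lborel A + ennreal e"
proof -
  obtain U where U: "open U" "A \<subseteq> U" "emeasure lborel (U - A) < ennreal e"
    by (rule outer_regular_lborel[OF A(1) e])
  \<comment> \<open>Radius d/2 and the intersection with \<open>U\<close> make the pieces short and
    keep them in \<open>U\<close>; off \<open>U\<close> any radius serves, because every piece is
    selected at a point of \<open>A\<close>.\<close>
  define g where "g x = (if x \<in> U then U \<inter> ball x (d / 2) else ball x 1)" for x
  have "gauge g" unfolding gauge_def g_def using U(1) d by auto
  moreover have "box 0 (2 * pi) \<noteq> {}" by (simp add: not_le)
  ultimately obtain D where D: "countable D" "\<Union>D \<subseteq> cbox 0 (2 * pi)"
    "\<And>K. K \<in> D \<Longrightarrow> interior K \<noteq> {} \<and> (\<exists>c d. K = cbox c d)"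
    "pairwise (\<lambda>A B. interior A \<inter> interior B = {}) D"
    "\<And>K. K \<in> D \<Longrightarrow> \<exists>x \<in> A \<inter> K. K \<subseteq> g x" "A \<subseteq> \<Union>D"
    using covering_lemma[of A 0 "2 * pi" g] A(2) by (metis cbox_interval)
  \<comment> \<open>The countable family is enumerated by all naturals, padded with empty
    sets.\<close>
  define C where "C n = (if n \<in> to_nat_on D ` D then from_nat_into D n else {})" for n
  have CD: "C n \<in> D \<or> C n = {}" for n
    using D(1) by (auto simp: C_def)
  have CU: "C n \<subseteq> U" "s \<in> C n \<Longrightarrow> t \<in> C n \<Longrightarrow> \<bar>s - t\<bar> \<le> d" for n s t
  proof -
    have "C n \<subseteq> U \<and> (s \<in> C n \<longrightarrow> t \<in> C n \<longrightarrow> \<bar>s - t\<bar> \<le> d)"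
    proof (cases "C n = {}")
      case False
      then obtain x where x: "x \<in> A" "C n \<subseteq> g x" using CD[of n] D(5)[of "C n"] by auto
      have "x \<in> U" using x(1) U(2) by blast
      then have "C n \<subseteq> U \<inter> ball x (d / 2)" using x(2) by (simp add: g_def)
      moreover have "\<bar>s - t\<bar> \<le> d" if "dist x s < d / 2" "dist x t < d / 2"
        using that unfolding dist_real_def by linarith
      ultimately show ?thesis by (auto simp: subset_eq)
    qed auto
    then show "C n \<subseteq> U" "s \<in> C n \<Longrightarrow> t \<in> C n \<Longrightarrow> \<bar>s - t\<bar> \<le> d" by auto
  qed
  show ?thesis
  proof (rule that)
    show "A \<subseteq> (\<Union>n. C n)"
    proof
      fix x assume "x \<in> A"
      then obtain K where "K \<in> D" "x \<in> K" using D(6) by auto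
      then have "C (to_nat_on D K) = K" using D(1) by (simp add: C_def)
      then show "x \<in> (\<Union>n. C n)" using \<open>x \<in> K\<close> by blast
    qed
    show "\<bar>s - t\<bar> \<le> d" if "s \<in> C n" "t \<in> C n" for n s t using CU(2)[OF that] .
    show "ennreal \<bar>s - t\<bar> \<le> emeasure lborel (interior (C n))" if st: "s \<in> C n" "t \<in> C n" for n s t
    proof -
      obtain c k where "C n = {c..k}" using CD[of n] D(3)[of "C n"] st by (auto simp: cbox_interval)
      then show ?thesis using st by (auto simp: interior_atLeastAtMost_real intro!: ennreal_leI)
    qed
    have "disjoint_family (\<lambda>n. interior (C n))"
      unfolding disjoint_family_on_def
    proof (intro ballI impI)
      fix m n :: nat assume mn: "m \<noteq> n"
      show "interior (C m) \<inter> interior (C n) = {}"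
      proof (cases "C m = {} \<or> C n = {}")
        case False
        then have "m \<in> to_nat_on D ` D" "n \<in> to_nat_on D ` D" by (auto simp: C_def split: if_splits)
        then have "C m \<noteq> C n" using mn D(1) by (auto simp: C_def)
        then show ?thesis using D(4) CD[of m] CD[of n] False by (auto simp: pairwise_def)
      qed auto
    qed
    then have "(\<Sum>n. emeasure lborel (interior (C n))) = emeasure lborel (\<Union>n. interior (C n))"
      by (intro suminf_emeasure) auto
    also have "\<dots> \<le> emeasure lborel (A \<union> (U - A))"
      using CU(1) interior_subset A(1) U(1) by (intro emeasure_mono) (blast, auto)
    also have "\<dots> \<le> emeasure lborel A + emeasure lborel (U - A)"
      using A(1) U(1) by (intro emeasure_subadditive) auto
    also have "\<dots> \<le> emeasure lborel A + ennreal e" using U(3) by (intro add_left_mono) simp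
    finally show "(\<Sum>n. emeasure lborel (interior (C n))) \<le> emeasure lborel A + ennreal e" .
  qed
qed

text \<open>The parametrisation of the circle multiplies distances by at most \<open>r\<close>, so
  short intervals covering \<open>A\<close> become an admissible cover of \<open>S\<close>.\<close>

lemma hausdorff1_circle_le:
  assumes r: "0 < r" and A: "A \<in> sets borel" "A \<subseteq> {0..2 * pi}"
    and cover: "\<And>x. x \<in> S \<Longrightarrow> \<exists>\<theta>\<in>A. x = circ_pt r (\<theta> + a)"
  shows "hausdorff1 S \<le> ennreal r * emeasure lborel A"
  unfolding hausdorff1_def
proof (rule SUP_least)
  fix \<delta> :: real assume "\<delta> \<in> {0<..}"
  then have \<delta>: "0 < \<delta>" by simp
  let ?I = "INF C\<in>{C :: nat \<Rightarrow> (real^2) set. S \<subseteq> (\<Union>k. C k) \<and> (\<forall>k. bounded (C k) \<and> diameter (C k) \<le> \<delta>)}.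
          (\<Sum>k. ennreal (diameter (C k)))"
  show "?I \<le> ennreal r * emeasure lborel A"
  proof (rule ennreal_le_epsilon)
    fix e :: real assume e: "0 < e"
    obtain C where C: "A \<subseteq> (\<Union>n. C n)" "\<And>n s t. s \<in> C n \<Longrightarrow> t \<in> C n \<Longrightarrow> \<bar>s - t\<bar> \<le> \<delta> / r"
      "\<And>n s t. s \<in> C n \<Longrightarrow> t \<in> C n \<Longrightarrow> ennreal \<bar>s - t\<bar> \<le> emeasure lborel (interior (C n))"
      "(\<Sum>n. emeasure lborel (interior (C n))) \<le> emeasure lborel A + ennreal (e / r)"
      using small_interval_cover[OF A, of "\<delta> / r" "e / r"] \<delta> r e by (metis divide_pos_pos)
    define B where "B n = (\<lambda>\<theta>. circ_pt r (\<theta> + a)) ` C n" for n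
    have d: "dist x y \<le> \<delta>" "ennreal (dist x y) \<le> ennreal r * emeasure lborel (interior (C n))"
      if xy: "x \<in> B n" "y \<in> B n" for n x y
    proof -
      obtain s t where st: "s \<in> C n" "t \<in> C n" "x = circ_pt r (s + a)" "y = circ_pt r (t + a)"
        using xy by (auto simp: B_def)
      have 1: "dist x y \<le> r * \<bar>s - t\<bar>" using dist_circ_pt_le[OF r, of "s + a" "t + a"] st by simp
      also have "\<dots> \<le> \<delta>" using C(2)[OF st(1,2)] r by (simp add: field_simps)
      finally show "dist x y \<le> \<delta>" .
      have "ennreal (dist x y) \<le> ennreal r * ennreal \<bar>s - t\<bar>" using 1 r by (simp add: ennreal_mult[symmetric] ennreal_leI)
      also have "\<dots> \<le> ennreal r * emeasure lborel (interior (C n))" using C(3)[OF st(1,2)] by (rule mult_left_mono) simp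
      finally show "ennreal (dist x y) \<le> ennreal r * emeasure lborel (interior (C n))" .
    qed
    have bd: "bounded (B n)" for n
      unfolding bounded_two_points using d(1) by blast
    have dia: "diameter (B n) \<le> \<delta>" for n
      using d(1) \<delta> by (intro diameter_le) (auto simp: dist_norm)
    have dia2: "ennreal (diameter (B n)) \<le> ennreal r * emeasure lborel (interior (C n))" for n
    proof (cases "ennreal r * emeasure lborel (interior (C n)) = top")
      case False
      then obtain y where y: "0 \<le> y" "ennreal r * emeasure lborel (interior (C n)) = ennreal y"
        by (metis ennreal_cases infinity_ennreal_def)
      have "diameter (B n) \<le> y"
        using d(2)[of _ n] y by (intro diameter_le) (auto simp: dist_norm)
      then show ?thesis unfolding y(2) by (rule ennreal_leI)
    qed simp
    have "S \<subseteq> (\<Union>n. B n)"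
    proof
      fix x assume x: "x \<in> S"
      then obtain \<theta> where \<theta>: "\<theta> \<in> A" "x = circ_pt r (\<theta> + a)" using cover by blast
      then obtain n where "\<theta> \<in> C n" using C(1) by blast
      then have "x \<in> B n" using \<theta>(2) by (simp add: B_def)
      then show "x \<in> (\<Union>n. B n)" by blast
    qed
    then have "?I \<le> (\<Sum>k. ennreal (diameter (B k)))"
      using bd dia by (intro INF_lower) auto
    also have "\<dots> \<le> (\<Sum>k. ennreal r * emeasure lborel (interior (C k)))" by (intro suminf_le dia2) auto
    also have "\<dots> = ennreal r * (\<Sum>k. emeasure lborel (interior (C k)))" by (rule ennreal_suminf_cmult)
    also have "\<dots> \<le> ennreal r * (emeasure lborel A + ennreal (e / r))" by (intro mult_left_mono C(4)) auto
    also have "\<dots> = ennreal r * emeasure lborel A + ennreal e"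
      using r e by (simp add: distrib_left ennreal_mult[symmetric])
    finally show "?I \<le> ennreal r * emeasure lborel A + ennreal e" .
  qed
qed

lemma small_angle:
  fixes e :: real
  assumes e: "0 < e"
  obtains \<eta> where "0 < \<eta>" "\<And>x. 0 \<le> x \<Longrightarrow> x \<le> \<eta> \<Longrightarrow> x \<le> (1 + e) * sin x"
proof -
  have "((\<lambda>x. sin x / x) \<longlongrightarrow> (1::real)) (at 0)" using DERIV_sin[of 0] by (simp add: DERIV_def)
  moreover have "1 / (1 + e) < 1" using e by simp
  ultimately have "\<forall>\<^sub>F x in at 0. 1 / (1 + e) < sin x / x" by (rule order_tendstoD)
  then obtain d where d: "0 < d" "\<And>x. x \<noteq> 0 \<Longrightarrow> dist x 0 < d \<Longrightarrow> 1 / (1 + e) < sin x / x"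
    unfolding eventually_at by blast
  have "x \<le> (1 + e) * sin x" if x: "0 \<le> x" "x \<le> d / 2" for x
  proof (cases "x = 0")
    case False
    then have "1 / (1 + e) < sin x / x" using d x by (intro d(2)) (auto simp: dist_real_def)
    then show ?thesis using x False e by (simp add: field_simps)
  qed simp
  then show ?thesis using d(1) by (intro that[of "d / 2"]) auto
qed

text \<open>At small scale an arc is at most 1 + e times its chord, so fine covers of
  \<open>S\<close> pull back to covers of the angles by short intervals. A small chord forces a
  small difference of angles only away from the cut of the circle, hence the trimmed sets
  \<open>A c\<close>. At the end e and then c tend to 0.\<close>

lemma hausdorff1_circle_ge:
  assumes r: "0 < r" and A0: "A0 \<in> sets borel" "A0 \<subseteq> {0..<2 * pi}"
    and sub: "\<And>\<theta>. \<theta> \<in> A0 \<Longrightarrow> circ_pt r (\<theta> + a) \<in> S"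
  shows "ennreal r * emeasure lborel A0 \<le> hausdorff1 S"
proof -
  define A where "A c = {c..2 * pi - c} \<inter> A0" for c
  have Am: "A c \<in> sets borel" for c using A0 by (auto simp: A_def)
  have main: "ennreal r * emeasure lborel (A c) \<le> ennreal (1 + e) * hausdorff1 S" if c: "0 < c" and e: "0 < e" for c e
  proof -
    obtain \<eta> where \<eta>: "0 < \<eta>" "\<And>x. 0 \<le> x \<Longrightarrow> x \<le> \<eta> \<Longrightarrow> x \<le> (1 + e) * sin x"
      by (rule small_angle[OF e]) (rule that)
    \<comment> \<open>With \<open>k <= c\<close> and \<open>k <= pi / 2\<close>, the sine is at
      least \<open>sin k\<close> on [k, pi - c]; a chord below \<open>2 * r * sin k\<close>
      therefore has half-angle below \<open>k\<close>.\<close>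
    define k where "k = min (min \<eta> c) (pi / 2)"
    have k: "0 < k" "k \<le> \<eta>" "k \<le> c" "k \<le> pi / 2" using \<eta>(1) c by (auto simp: k_def)
    have sk: "0 < sin k" using k by (intro sin_gt_zero) auto
    define \<delta> where "\<delta> = r * sin k"
    have \<delta>: "0 < \<delta>" "\<delta> < 2 * r * sin k" using r sk by (auto simp: \<delta>_def)
    let ?I = "INF C\<in>{C :: nat \<Rightarrow> (real^2) set. S \<subseteq> (\<Union>k. C k) \<and> (\<forall>k. bounded (C k) \<and> diameter (C k) \<le> \<delta>)}.
          (\<Sum>k. ennreal (diameter (C k)))"
    have close: "\<bar>s - t\<bar> \<le> (1 + e) * (dist (circ_pt r (s + a)) (circ_pt r (t + a)) / r)"
      if st: "s \<in> {c..2 * pi - c}" "t \<in> {c..2 * pi - c}" and dd: "dist (circ_pt r (s + a)) (circ_pt r (t + a)) \<le> \<delta>" for s t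
    proof -
      define x where "x = \<bar>s - t\<bar> / 2"
      have x: "0 \<le> x" "x \<le> pi - c" using st by (auto simp: x_def)
      have "0 \<le> sin x" using x c by (intro sin_ge_zero) auto
      moreover have "\<bar>sin ((s + a - (t + a)) / 2)\<bar> = \<bar>sin x\<bar>"
      proof -
        have "\<bar>sin \<bar>y\<bar>\<bar> = \<bar>sin y\<bar>" for y :: real by (cases "0 \<le> y") auto
        then have "\<bar>sin x\<bar> = \<bar>sin ((s - t) / 2)\<bar>" unfolding x_def by (metis abs_divide abs_numeral)
        then show ?thesis by simp
      qed
      ultimately have dx: "dist (circ_pt r (s + a)) (circ_pt r (t + a)) = 2 * r * sin x"
        by (simp add: dist_circ_pt[OF r])
      have "x < k"
      proof (rule ccontr)
        assume "\<not> x < k"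
        then have kx: "k \<le> x" by simp
        have "sin k \<le> sin x"
        proof (cases "x \<le> pi / 2")
          case True
          then show ?thesis using kx k by (intro sin_monotone_2pi_le) auto
        next
          case False
          have "sin k \<le> sin (pi - x)" using x k False by (intro sin_monotone_2pi_le) auto
          then show ?thesis by simp
        qed
        then have "2 * r * sin k \<le> 2 * r * sin x" using r by simp
        then show False using dd dx \<delta>(2) by linarith
      qed
      then have "x \<le> (1 + e) * sin x" using \<eta>(2)[of x] x k by auto
      then have "2 * x \<le> (1 + e) * (2 * sin x)" by simp
      then show ?thesis using dx r by (simp add: x_def)
    qed
    have "ennreal r * emeasure lborel (A c) \<le> ennreal (1 + e) * (\<Sum>n. ennreal (diameter (C n)))"
      if C: "S \<subseteq> (\<Union>n. C n)" "\<And>n. bounded (C n)" "\<And>n. diameter (C n) \<le> \<delta>" for C :: "nat \<Rightarrow> (real^2) set"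
    proof -
      \<comment> \<open>The angles mapped into the n-th covering set fit into an interval
        \<open>J n\<close> of length \<open>D n\<close> that starts at their infimum. If there are
        none, the position of \<open>J n\<close> is arbitrary and harmless.\<close>
      define Q where "Q n = {\<theta> \<in> {c..2 * pi - c}. circ_pt r (\<theta> + a) \<in> C n}" for n
      define D where "D n = (1 + e) * (diameter (C n) / r)" for n
      have D0: "0 \<le> D n" for n using e r diameter_ge_0[OF C(2)] by (simp add: D_def)
      have Qd: "\<bar>s - t\<bar> \<le> D n" if "s \<in> Q n" "t \<in> Q n" for n s t
      proof -
        have b: "dist (circ_pt r (s + a)) (circ_pt r (t + a)) \<le> diameter (C n)"
          using that C(2) by (intro diameter_bounded_bound) (auto simp: Q_def)
        then have "\<bar>s - t\<bar> \<le> (1 + e) * (dist (circ_pt r (s + a)) (circ_pt r (t + a)) / r)"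
          using that C(3)[of n] by (intro close) (auto simp: Q_def)
        also have "\<dots> \<le> D n" unfolding D_def using b e r by (intro mult_left_mono divide_right_mono) auto
        finally show ?thesis .
      qed
      define J where "J n = {Inf (Q n)..Inf (Q n) + D n}" for n
      have QJ: "Q n \<subseteq> J n" for n
      proof
        fix s assume s: "s \<in> Q n"
        have bdd: "bdd_below (Q n)" by (rule bdd_belowI[of _ c]) (auto simp: Q_def)
        have "s - D n \<le> Inf (Q n)"
        proof (rule cInf_greatest)
          show "Q n \<noteq> {}" using s by auto
          show "s - D n \<le> x" if "x \<in> Q n" for x using Qd[OF s that] by linarith
        qed
        then show "s \<in> J n" using cInf_lower[OF s bdd] by (auto simp: J_def)
      qed
      have "A c \<subseteq> (\<Union>n. J n)"
      proof
        fix \<theta> assume "\<theta> \<in> A c"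
        then have "circ_pt r (\<theta> + a) \<in> S" "\<theta> \<in> {c..2 * pi - c}" using sub by (auto simp: A_def)
        then obtain n where "circ_pt r (\<theta> + a) \<in> C n" "\<theta> \<in> {c..2 * pi - c}" using C(1) by auto
        then have "\<theta> \<in> Q n" by (simp add: Q_def)
        then show "\<theta> \<in> (\<Union>n. J n)" using QJ by blast
      qed
      then have "emeasure lborel (A c) \<le> emeasure lborel (\<Union>n. J n)" by (intro emeasure_mono) (auto simp: J_def)
      also have "\<dots> \<le> (\<Sum>n. emeasure lborel (J n))" by (intro emeasure_subadditive_countably) (auto simp: J_def)
      also have "\<dots> = (\<Sum>n. ennreal (D n))" using D0 by (simp add: J_def)
      finally have "ennreal r * emeasure lborel (A c) \<le> ennreal r * (\<Sum>n. ennreal (D n))" by (rule mult_left_mono) simp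
      also have "\<dots> = (\<Sum>n. ennreal r * ennreal (D n))" by (rule ennreal_suminf_cmult[symmetric])
      also have "\<dots> = (\<Sum>n. ennreal (1 + e) * ennreal (diameter (C n)))"
      proof (rule suminf_cong)
        fix n
        have "r * D n = (1 + e) * diameter (C n)" using r by (simp add: D_def)
        moreover have "ennreal r * ennreal (D n) = ennreal (r * D n)" using r D0 by (intro ennreal_mult[symmetric]) auto
        moreover have "ennreal (1 + e) * ennreal (diameter (C n)) = ennreal ((1 + e) * diameter (C n))"
          using e diameter_ge_0[OF C(2)] by (intro ennreal_mult[symmetric]) auto
        ultimately show "ennreal r * ennreal (D n) = ennreal (1 + e) * ennreal (diameter (C n))" by (simp only:)
      qed
      also have "\<dots> = ennreal (1 + e) * (\<Sum>n. ennreal (diameter (C n)))" by (rule ennreal_suminf_cmult)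
      finally show ?thesis .
    qed
    moreover have "0 < ennreal (1 + e)" using e by (subst ennreal_less_zero_iff) simp
    ultimately have "ennreal r * emeasure lborel (A c) / ennreal (1 + e) \<le> ?I"
      by (intro INF_greatest divide_le_posI_ennreal) auto
    also have "\<dots> \<le> hausdorff1 S" unfolding hausdorff1_def using \<delta>(1) by (intro SUP_upper) auto
    finally have "ennreal (1 + e) * (ennreal r * emeasure lborel (A c) / ennreal (1 + e)) \<le> ennreal (1 + e) * hausdorff1 S"
      by (rule mult_left_mono) simp
    moreover have "ennreal (1 + e) * (y / ennreal (1 + e)) = y" for y
      using e by (metis ennreal_mult_divide_eq ennreal_neq_top ennreal_times_divide mult.commute ennreal_eq_0_iff add_pos_pos not_le zero_less_one)
    ultimately show ?thesis by simp
  qed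
  have lim1: "ennreal r * emeasure lborel (A c) \<le> hausdorff1 S" if c: "0 < c" for c
  proof (cases "hausdorff1 S")
    case (real y)
    have "emeasure lborel (A c) \<le> emeasure lborel {c..2 * pi - c}" by (intro emeasure_mono) (auto simp: A_def)
    also have "\<dots> < top" by (simp add: emeasure_lborel_Icc_eq)
    finally obtain x where x: "0 \<le> x" "emeasure lborel (A c) = ennreal x" by (metis ennreal_cases less_irrefl infinity_ennreal_def)
    have "r * x \<le> y + e" if "0 < e" for e
    proof -
      \<comment> \<open>With e/(y + 1) in place of e the error is at most e, also for y = 0.\<close>
      have "0 < e / (y + 1)" using that real by simp
      from main[OF c this] have "ennreal r * ennreal x \<le> ennreal (1 + e / (y + 1)) * ennreal y"
        unfolding x(2) real .
      moreover have "ennreal r * ennreal x = ennreal (r * x)" using r x by (intro ennreal_mult[symmetric]) auto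
      moreover have "ennreal (1 + e / (y + 1)) * ennreal y = ennreal ((1 + e / (y + 1)) * y)"
        using real that by (intro ennreal_mult[symmetric]) auto
      moreover have "0 \<le> (1 + e / (y + 1)) * y" using real that by simp
      ultimately have "r * x \<le> (1 + e / (y + 1)) * y" by (simp only: ennreal_le_iff)
      also have "\<dots> = y + e * (y / (y + 1))" by (simp add: field_simps)
      also have "\<dots> \<le> y + e * 1" using that real by (intro add_left_mono mult_left_mono) auto
      finally show ?thesis by simp
    qed
    then have "r * x \<le> y" by (rule field_le_epsilon)
    then show ?thesis using r x real by (simp add: ennreal_mult[symmetric])
  qed simp
  have "(\<lambda>n. emeasure lborel (A (1 / real (Suc n)))) \<longlonglongrightarrow> emeasure lborel (\<Union>n. A (1 / real (Suc n)))"
  proof (rule Lim_emeasure_incseq)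
    show "incseq (\<lambda>n. A (1 / real (Suc n)))"
    proof (rule incseq_SucI)
      fix n
      have "1 / real (Suc (Suc n)) \<le> 1 / real (Suc n)" by (simp add: frac_le)
      then show "A (1 / real (Suc n)) \<subseteq> A (1 / real (Suc (Suc n)))" by (auto simp: A_def)
    qed
  qed (use Am in auto)
  then have "(\<lambda>n. ennreal r * emeasure lborel (A (1 / real (Suc n)))) \<longlonglongrightarrow> ennreal r * emeasure lborel (\<Union>n. A (1 / real (Suc n)))"
    by (intro ennreal_tendsto_cmult) auto
  then have le: "ennreal r * emeasure lborel (\<Union>n. A (1 / real (Suc n))) \<le> hausdorff1 S"
    by (rule LIMSEQ_le_const2) (auto intro!: exI[of _ 0] lim1)
  have "emeasure lborel A0 \<le> emeasure lborel (\<Union>n. A (1 / real (Suc n)))"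
  proof (rule emeasure_mono_AE)
    show "AE \<theta> in lborel. \<theta> \<in> A0 \<longrightarrow> \<theta> \<in> (\<Union>n. A (1 / real (Suc n)))"
      using AE_lborel_singleton[of "0::real"]
    proof eventually_elim
      case (elim \<theta>)
      show ?case
      proof
        assume \<theta>: "\<theta> \<in> A0"
        then have "0 < min \<theta> (2 * pi - \<theta>)" using elim A0(2) by (auto simp: subset_eq less_le)
        then obtain n where "1 / real (Suc n) < min \<theta> (2 * pi - \<theta>)" by (rule nat_approx_posE)
        then have "\<theta> \<in> A (1 / real (Suc n))" using \<theta> by (auto simp: A_def)
        then show "\<theta> \<in> (\<Union>n. A (1 / real (Suc n)))" by blast
      qed
    qed
  qed (use Am in auto)
  then have "ennreal r * emeasure lborel A0 \<le> ennreal r * emeasure lborel (\<Union>n. A (1 / real (Suc n)))"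
    by (rule mult_left_mono) simp
  also note le
  finally show ?thesis .
qed

section \<open>The weak gradient of the rearrangement\<close>

lemma integrable_powr_comb:
  fixes a b c :: "'a \<Rightarrow> real"
  assumes p: "1 \<le> p" and a: "integrable M (\<lambda>x. \<bar>a x\<bar> powr p)" and b: "integrable M (\<lambda>x. \<bar>b x\<bar> powr p)"
    and [measurable]: "c \<in> borel_measurable M" and le: "\<And>x. x \<in> space M \<Longrightarrow> \<bar>c x\<bar> \<le> C * (\<bar>a x\<bar> + \<bar>b x\<bar>)" and C: "0 \<le> C"
  shows "integrable M (\<lambda>x. \<bar>c x\<bar> powr p)"
proof (rule Bochner_Integration.integrable_bound)
  show "integrable M (\<lambda>x. (2 * C) powr p * (\<bar>a x\<bar> powr p + \<bar>b x\<bar> powr p))" using a b by auto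
  have "\<bar>c x\<bar> powr p \<le> (2 * C) powr p * (\<bar>a x\<bar> powr p + \<bar>b x\<bar> powr p)" if x: "x \<in> space M" for x
  proof -
    have "\<bar>a x\<bar> + \<bar>b x\<bar> \<le> 2 * max \<bar>a x\<bar> \<bar>b x\<bar>" by auto
    then have "C * (\<bar>a x\<bar> + \<bar>b x\<bar>) \<le> C * (2 * max \<bar>a x\<bar> \<bar>b x\<bar>)" using C by (rule mult_left_mono)
    then have "\<bar>c x\<bar> \<le> (2 * C) * max \<bar>a x\<bar> \<bar>b x\<bar>" using le[OF x] by simp
    then have "\<bar>c x\<bar> powr p \<le> ((2 * C) * max \<bar>a x\<bar> \<bar>b x\<bar>) powr p" using p by (intro powr_mono2) auto
    also have "\<dots> = (2 * C) powr p * (max \<bar>a x\<bar> \<bar>b x\<bar>) powr p" using C by (simp add: powr_mult)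
    also have "\<dots> \<le> (2 * C) powr p * (\<bar>a x\<bar> powr p + \<bar>b x\<bar> powr p)" by (intro mult_left_mono) (auto simp: max_def)
    finally show ?thesis .
  qed
  then show "AE x in M. norm (\<bar>c x\<bar> powr p) \<le> norm ((2 * C) powr p * (\<bar>a x\<bar> powr p + \<bar>b x\<bar> powr p))"
    by (intro AE_I2) (simp add: abs_mult)
qed measurable

lemma excess_half: "excess (M / 2) x = excess M (2 * x) / 2"
  by (simp add: excess_def max_def abs_mult)

text \<open>By \<open>excess_half\<close> the excess of \<open>G\<close> over M/2 is half the excess
  of twice \<open>G\<close> over M, which brings the hypothesis to the form of
  \<open>integrable_powr_if_excess_le\<close> with constant 2.\<close>

lemma integrable_powr_if_excess_half:
  fixes g G :: "'a::euclidean_space \<Rightarrow> real"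
  assumes V: "open V" "bounded V" and g: "integrable lborel g" and G: "integrable lborel G"
    and zero: "\<And>z. z \<notin> V \<Longrightarrow> g z = 0" "\<And>z. z \<notin> V \<Longrightarrow> G z = 0" and p: "1 \<le> p"
    and Gp: "integrable lborel (\<lambda>z. \<bar>G z\<bar> powr p)"
    and le: "\<And>M. 0 \<le> M \<Longrightarrow> (\<integral>\<^sup>+z. excess M (g z) \<partial>lborel) \<le> 4 * (\<integral>\<^sup>+z. excess (M / 2) (G z) \<partial>lborel)"
  shows "integrable lborel (\<lambda>z. \<bar>g z\<bar> powr p)"
proof -
  have [measurable]: "V \<in> sets borel" "g \<in> borel_measurable borel" "G \<in> borel_measurable borel" using V g G by auto
  define N where "N = restrict_space lborel V"
  have fin: "finite_measure N"
  proof
    have "emeasure lborel V < \<infinity>" using V by (intro emeasure_bounded_finite)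
    then show "emeasure N (space N) \<noteq> \<infinity>"
      by (simp add: N_def emeasure_restrict_space space_restrict_space)
  qed
  have nn: "(\<integral>\<^sup>+z. f z \<partial>N) = (\<integral>\<^sup>+z. f z \<partial>lborel)" if "\<And>z. z \<notin> V \<Longrightarrow> f z = 0" for f :: "'a \<Rightarrow> ennreal"
    unfolding N_def using that by (subst nn_integral_restrict_space) (auto intro!: nn_integral_cong simp: indicator_def)
  have int: "integrable N f \<longleftrightarrow> integrable lborel f" if "\<And>z. z \<notin> V \<Longrightarrow> f z = 0" for f :: "'a \<Rightarrow> real"
  proof -
    have "(\<lambda>z. indicator V z *\<^sub>R f z) = f" using that by (auto simp: fun_eq_iff indicator_def)
    then show ?thesis unfolding N_def by (subst integrable_restrict_space) auto
  qed
  have "integrable N (\<lambda>z. \<bar>g z\<bar> powr p)"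
  proof (rule integrable_powr_if_excess_le[OF fin _ _ p])
    show "g \<in> borel_measurable N" "(\<lambda>z. 2 * G z) \<in> borel_measurable N" by (auto simp: N_def measurable_restrict_space1)
    have "(\<lambda>z. \<bar>2 * G z\<bar> powr p) = (\<lambda>z. 2 powr p * \<bar>G z\<bar> powr p)" by (simp add: abs_mult powr_mult fun_eq_iff)
    then show "integrable N (\<lambda>z. \<bar>2 * G z\<bar> powr p)" using Gp p zero(2) by (subst int) auto
    fix k :: nat
    have "(\<integral>\<^sup>+z. excess k (g z) \<partial>N) = (\<integral>\<^sup>+z. excess k (g z) \<partial>lborel)" by (rule nn) (simp add: zero excess_def)
    also have "\<dots> \<le> 4 * (\<integral>\<^sup>+z. excess (k / 2) (G z) \<partial>lborel)" by (rule le) simp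
    also have "(\<integral>\<^sup>+z. excess (k / 2) (G z) \<partial>lborel) = ennreal (1 / 2) * (\<integral>\<^sup>+z. excess k (2 * G z) \<partial>lborel)"
    proof -
      have "ennreal (excess (real k / 2) (G z)) = ennreal (1 / 2) * ennreal (excess k (2 * G z))" for z
        by (subst ennreal_mult[symmetric]) (auto simp: excess_nonneg excess_half)
      then show ?thesis by (simp only:) (rule nn_integral_cmult, measurable)
    qed
    also have "4 * (ennreal (1 / 2) * (\<integral>\<^sup>+z. excess k (2 * G z) \<partial>lborel)) = ennreal 2 * (\<integral>\<^sup>+z. excess k (2 * G z) \<partial>lborel)"
    proof -
      have "4 * ennreal (1 / 2) = ennreal 4 * ennreal (1 / 2)" by simp
      also have "\<dots> = ennreal 2" by (subst ennreal_mult[symmetric]) auto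
      finally show ?thesis by (simp only: mult.assoc[symmetric])
    qed
    also have "(\<integral>\<^sup>+z. excess k (2 * G z) \<partial>lborel) = (\<integral>\<^sup>+z. excess k (2 * G z) \<partial>N)"
      by (rule nn[symmetric]) (simp add: zero excess_def)
    finally show "(\<integral>\<^sup>+z. excess k (g z) \<partial>N) \<le> ennreal 2 * (\<integral>\<^sup>+z. excess k (2 * G z) \<partial>N)" .
  qed
  then show ?thesis using p zero(1) by (subst (asm) int) auto
qed

context affine_flow begin

lemma c1_test_if_test_function:
  assumes t: "test_function V \<phi>"
  shows "c1_test V \<phi> (dpart \<phi>)"
  unfolding c1_test_def
proof (intro conjI allI exI[of _ "closure {z. \<phi> z \<noteq> 0}"] impI)
  let ?K = "closure {z. \<phi> z \<noteq> 0}"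
  show "(\<phi> has_derivative (\<lambda>v. dpart \<phi> z \<bullet> v)) (at z)" for z
    by (rule has_derivative_dpart[OF test_functionD(1)[OF t, of "Suc 0"]])
  have "continuous_on UNIV (\<lambda>z. dpart \<phi> z $ k)" for k
    by (rule C_class_continuous[OF test_functionD(1)[OF test_function_dpart[OF t], of 0]])
  then have "continuous_on UNIV (\<lambda>z. \<chi> k. dpart \<phi> z $ k)" by (intro continuous_on_vec_lambda)
  then show "continuous_on UNIV (dpart \<phi>)" by simp
  show "compact ?K" "?K \<subseteq> V" using test_functionD[OF t] by auto
  have tK: "test_function ?K \<phi>" using t unfolding test_function_def by blast
  fix z assume z: "z \<notin> ?K"
  show "\<phi> z = 0" by (rule test_function_eq_0[OF tK z])
  show "dpart \<phi> z = 0" using test_function_eq_0[OF test_function_dpart[OF tK] z] by (simp add: vec_eq_iff)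
qed

lemma integrable_mult_c1_test:
  assumes "integrable lborel w" "c1_test V \<phi> d"
  shows "integrable lborel (\<lambda>z. w z * \<phi> z)" "integrable lborel (\<lambda>z. w z * fder \<phi> d z)"
proof -
  obtain K where K: "compact K" "\<And>z. z \<notin> K \<Longrightarrow> \<phi> z = 0" "\<And>z. z \<notin> K \<Longrightarrow> d z = 0"
    using assms(2) unfolding c1_test_def by metis
  note c = continuous_fder[OF assms(2)]
  obtain B1 where B1: "\<And>z. \<bar>\<phi> z\<bar> \<le> B1" by (rule bounded_if_compact_support[OF c(1) K(1,2)], assumption) (rule that)
  obtain B2 where B2: "\<And>z. \<bar>fder \<phi> d z\<bar> \<le> B2"
    by (rule bounded_if_compact_support[OF c(2) K(1)]) (auto simp: fder_def K)
  show "integrable lborel (\<lambda>z. w z * \<phi> z)"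
    by (rule integrable_mult_bounded[OF assms(1) _ B1]) (use borel_measurable_continuous_onI[OF c(1)] in simp)
  show "integrable lborel (\<lambda>z. w z * fder \<phi> d z)"
    by (rule integrable_mult_bounded[OF assms(1) _ B2]) (use borel_measurable_continuous_onI[OF c(2)] in simp)
qed

end

section \<open>Cartesian derivatives from the radial and the angular one\<close>

context plane begin

sublocale dil: affine_flow "dil i j" "matrix (plane_part i j)" 0 "\<lambda>s. matrix (dil i j s)" "\<lambda>_. 0"
  by (rule affine_flow_dil[OF ij])

lemma c1_test_dil_rot: "dil.c1_test V \<phi> d \<longleftrightarrow> rot.c1_test V \<phi> d"
  by (simp add: dil.c1_test_def rot.c1_test_def)

lemma rot_X: "rot.X z = quarter_turn i j z"
  by (simp add: rot.X_def linear_quarter_turn)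

lemma dil_X: "dil.X z = plane_part i j z"
  by (simp add: dil.X_def linear_plane_part)

lemma inner_plane_part: "d \<bullet> plane_part i j z = d $ i * z $ i + d $ j * z $ j"
proof -
  have "(\<Sum>k\<in>UNIV. d $ k * (if k = i \<or> k = j then z $ k else 0)) = (\<Sum>k\<in>UNIV. if k \<in> {i, j} then d $ k * z $ k else 0)"
    by (rule sum.cong) auto
  also have "\<dots> = (\<Sum>k\<in>{i, j}. d $ k * z $ k)" by (simp add: sum.If_cases del: insert_iff)
  finally show ?thesis using ij by (simp add: inner_vec_def plane_part_def)
qed

lemma inner_quarter_turn: "d \<bullet> quarter_turn i j z = d $ j * z $ i - d $ i * z $ j"
proof -
  have "(\<Sum>k\<in>UNIV. d $ k * (if k = i then - z $ j else if k = j then z $ i else 0))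
     = (\<Sum>k\<in>UNIV. if k \<in> {i, j} then d $ k * (if k = i then - z $ j else z $ i) else 0)"
    by (rule sum.cong) auto
  also have "\<dots> = (\<Sum>k\<in>{i, j}. d $ k * (if k = i then - z $ j else z $ i))" by (simp add: sum.If_cases del: insert_iff)
  finally show ?thesis using ij by (simp add: inner_vec_def quarter_turn_def)
qed

lemma rot_fder: "rot.fder \<phi> d z = d z $ j * z $ i - d z $ i * z $ j"
proof -
  have "matrix (quarter_turn i j) $ k $ k = 0" for k
    using ij by (simp add: matrix_nth_diag quarter_turn_def axis_1_nth)
  then have "trace (matrix (quarter_turn i j)) = 0" by (simp add: trace_def)
  then show ?thesis by (simp add: rot.fder_def rot_X inner_quarter_turn)
qed

lemma dil_fder: "dil.fder \<phi> d z = 2 * \<phi> z + d z $ i * z $ i + d z $ j * z $ j"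
  by (simp add: dil.fder_def dil_X inner_plane_part affine_flow_dil(2)[OF ij])

text \<open>Solving for the Cartesian derivatives in terms of the radial and the angular one divides by \<open>|x|\<^sup>2\<close>.\<close>

definition radial_test :: "'n \<Rightarrow> (real ^ 'n \<Rightarrow> real) \<Rightarrow> real ^ 'n \<Rightarrow> real" where
  "radial_test k \<phi> z = z $ k * \<phi> z / (rad z)\<^sup>2"

text \<open>The quotient rule for \<open>radial_test k \<phi>\<close>. Where
  \<open>rad z = 0\<close>, division by zero gives 0, the correct value for \<open>\<phi>\<close>
  supported away from such points.\<close>

definition radial_test_grad :: "'n \<Rightarrow> (real ^ 'n \<Rightarrow> real) \<Rightarrow> real ^ 'n \<Rightarrow> real ^ 'n" where
  "radial_test_grad k \<phi> z = (\<phi> z / (rad z)\<^sup>2) *\<^sub>R axis k 1 + (z $ k / (rad z)\<^sup>2) *\<^sub>R dpart \<phi> z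
     - (2 * (z $ k * \<phi> z) / ((rad z)\<^sup>2)\<^sup>2) *\<^sub>R plane_part i j z"

lemma rad_sq: "(rad z)\<^sup>2 = (z $ i)\<^sup>2 + (z $ j)\<^sup>2"
  by (simp add: rad_def)

text \<open>Two open sets cover the space: where |x| > 0 the quotient rule applies, and off the
  compact support everything is 0.\<close>

lemma c1_test_radial:
  assumes t: "test_function V \<phi>" and V: "\<And>z. z \<in> V \<Longrightarrow> 0 < rad z"
  shows "rot.c1_test V (radial_test k \<phi>) (radial_test_grad k \<phi>)"
proof -
  have c: "rot.c1_test V \<phi> (dpart \<phi>)" by (rule rot.c1_test_if_test_function[OF t])
  obtain K where K: "compact K" "K \<subseteq> V" "\<And>z. z \<notin> K \<Longrightarrow> \<phi> z = 0" "\<And>z. z \<notin> K \<Longrightarrow> dpart \<phi> z = 0"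
    using c unfolding rot.c1_test_def by metis
  have d\<phi>: "(\<phi> has_derivative (\<lambda>v. dpart \<phi> z \<bullet> v)) (at z)" for z
    using c unfolding rot.c1_test_def by blast
  have zero: "radial_test k \<phi> z = 0" "radial_test_grad k \<phi> z = 0" if "z \<notin> K" for z
    using K that by (simp_all add: radial_test_def radial_test_grad_def)
  have oK: "open (- K)" using K(1) by (simp add: compact_imp_closed open_Compl)
  have D1: "(radial_test k \<phi> has_derivative (\<lambda>v. radial_test_grad k \<phi> z \<bullet> v)) (at z)" for z
  proof (cases "z \<in> K")
    case True
    then have r: "0 < rad z" using K V by auto
    then have q: "(z $ i)\<^sup>2 + (z $ j)\<^sup>2 \<noteq> 0" using rad_sq[of z] by auto
    have nth: "((\<lambda>z. z $ l) has_derivative (\<lambda>v. v $ l)) (at z)" for l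
      by (rule bounded_linear_imp_has_derivative[OF bounded_linear_vec_nth])
    have "((\<lambda>z. z $ k * \<phi> z / ((z $ i)\<^sup>2 + (z $ j)\<^sup>2)) has_derivative (\<lambda>v.
      ((z $ k * (dpart \<phi> z \<bullet> v) + v $ k * \<phi> z) * ((z $ i)\<^sup>2 + (z $ j)\<^sup>2)
        - z $ k * \<phi> z * (2 * z $ i * v $ i + 2 * z $ j * v $ j)) / (((z $ i)\<^sup>2 + (z $ j)\<^sup>2) * ((z $ i)\<^sup>2 + (z $ j)\<^sup>2)))) (at z)"
      by (rule has_derivative_eq_rhs, rule has_derivative_divide'[OF has_derivative_mult[OF nth d\<phi>]
          has_derivative_add[OF has_derivative_power[OF nth] has_derivative_power[OF nth]] q])
         (simp add: fun_eq_iff algebra_simps)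
    moreover have "((z $ k * (dpart \<phi> z \<bullet> v) + v $ k * \<phi> z) * ((z $ i)\<^sup>2 + (z $ j)\<^sup>2)
        - z $ k * \<phi> z * (2 * z $ i * v $ i + 2 * z $ j * v $ j)) / (((z $ i)\<^sup>2 + (z $ j)\<^sup>2) * ((z $ i)\<^sup>2 + (z $ j)\<^sup>2))
        = radial_test_grad k \<phi> z \<bullet> v" for v
    proof -
      have alg: "((a * D + vk * f) * Q - a * f * (2 * x * vi + 2 * y * vj)) / (Q * Q)
        = f / Q * vk + a / Q * D - 2 * (a * f) / Q\<^sup>2 * (x * vi + y * vj)" if "Q \<noteq> 0" for a D vk f Q x y vi vj :: real
        using that by (simp add: field_simps power2_eq_square)
      show ?thesis unfolding alg[OF q]
        unfolding radial_test_grad_def inner_diff_left inner_add_left inner_scaleR_left rad_sq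
        by (simp add: inner_axis' inner_commute[of "plane_part i j z"] inner_plane_part mult.commute)
    qed
    ultimately show ?thesis by (simp add: radial_test_def[abs_def] rad_sq)
  next
    case False
    have "((\<lambda>_. 0) has_derivative (\<lambda>v. 0 \<bullet> v)) (at z)" by simp
    then have "(radial_test k \<phi> has_derivative (\<lambda>v. 0 \<bullet> v)) (at z)"
      by (rule has_derivative_transform_within_open[OF _ oK]) (use False zero in auto)
    then show ?thesis using zero(2)[OF False] by simp
  qed
  have D2: "continuous_on UNIV (radial_test_grad k \<phi>)"
  proof -
    define W where "W = {z :: real ^ 'n. 0 < (z $ i)\<^sup>2 + (z $ j)\<^sup>2}"
    have "open W" unfolding W_def by (intro open_Collect_less continuous_intros)
    have "continuous_on UNIV (dpart \<phi>)" "continuous_on UNIV \<phi>"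
      using c rot.continuous_fder(1)[OF c] unfolding rot.c1_test_def by blast+
    then have cd: "continuous_on W (dpart \<phi>)" "continuous_on W \<phi>" using continuous_on_subset by blast+
    have "continuous_on W (plane_part i j)"
      by (rule linear_continuous_on) (use linear_plane_part in \<open>simp add: linear_conv_bounded_linear\<close>)
    then have 1: "continuous_on W (radial_test_grad k \<phi>)"
      unfolding radial_test_grad_def rad_sq by (intro continuous_intros cd) (auto simp: W_def)
    have 2: "continuous_on (- K) (radial_test_grad k \<phi>)"
      using zero(2) by (intro continuous_on_eq[OF continuous_on_const[of _ 0]]) auto
    have "UNIV = W \<union> - K"
    proof -
      have "z \<in> W" if "z \<in> K" for z
      proof -
        have "0 < rad z" using V K(2) that by blast
        then have "0 < (rad z)\<^sup>2" by simp
        then show ?thesis by (simp only: W_def rad_sq mem_Collect_eq)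
      qed
      then show ?thesis by blast
    qed
    then show ?thesis using continuous_on_open_Un[OF \<open>open W\<close> oK 1 2] by simp
  qed
  show ?thesis unfolding rot.c1_test_def
    by (intro conjI allI exI[of _ K] impI D1 D2 K(1,2) zero)
qed

text \<open>With D the dilation field and Q the rotation field, |x|^2 e_i = z_i D - z_j Q and |x|^2
  e_j = z_j D + z_i Q. Multiplying by \<phi>/|x|^2 and taking divergences gives the two
  identities.\<close>

lemma radial_test_identity:
  assumes t: "test_function V \<phi>" and V: "\<And>z. z \<in> V \<Longrightarrow> 0 < rad z"
  shows "dpart \<phi> z $ i = dil.fder (radial_test i \<phi>) (radial_test_grad i \<phi>) z - rot.fder (radial_test j \<phi>) (radial_test_grad j \<phi>) z"
    and "dpart \<phi> z $ j = dil.fder (radial_test j \<phi>) (radial_test_grad j \<phi>) z + rot.fder (radial_test i \<phi>) (radial_test_grad i \<phi>) z"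
proof -
  define a b f x y q where "a = z $ i" and "b = z $ j" and "f = \<phi> z" and "x = dpart \<phi> z $ i" and "y = dpart \<phi> z $ j"
    and "q = a * a + b * b"
  have q: "(rad z)\<^sup>2 = q" unfolding rad_sq q_def a_def b_def by (simp add: power2_eq_square)
  have pi: "plane_part i j z $ i = a" "plane_part i j z $ j = b" by (simp_all add: plane_part_def a_def b_def)
  have ax: "axis i (1::real) $ i = 1" "axis i (1::real) $ j = 0" "axis j (1::real) $ j = 1" "axis j (1::real) $ i = 0"
    using ij by (auto simp: axis_1_nth)
  have g: "radial_test_grad i \<phi> z $ i = f / q + a / q * x - 2 * (a * f) / q\<^sup>2 * a"
    "radial_test_grad i \<phi> z $ j = a / q * y - 2 * (a * f) / q\<^sup>2 * b"
    "radial_test_grad j \<phi> z $ j = f / q + b / q * y - 2 * (b * f) / q\<^sup>2 * b"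
    "radial_test_grad j \<phi> z $ i = b / q * x - 2 * (b * f) / q\<^sup>2 * a"
    by (simp_all add: radial_test_grad_def q pi ax a_def[symmetric] b_def[symmetric] f_def[symmetric] x_def[symmetric] y_def[symmetric])
  have r: "radial_test i \<phi> z = a * f / q" "radial_test j \<phi> z = b * f / q"
    by (simp_all add: radial_test_def q a_def b_def f_def)
  have "x = (2 * (a * f / q) + (f / q + a / q * x - 2 * (a * f) / q\<^sup>2 * a) * a + (a / q * y - 2 * (a * f) / q\<^sup>2 * b) * b)
      - ((f / q + b / q * y - 2 * (b * f) / q\<^sup>2 * b) * a - (b / q * x - 2 * (b * f) / q\<^sup>2 * a) * b) \<and>
     y = (2 * (b * f / q) + (b / q * x - 2 * (b * f) / q\<^sup>2 * a) * a + (f / q + b / q * y - 2 * (b * f) / q\<^sup>2 * b) * b)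
      + ((a / q * y - 2 * (a * f) / q\<^sup>2 * b) * a - (f / q + a / q * x - 2 * (a * f) / q\<^sup>2 * a) * b)"
  proof (cases "q = 0")
    case True
    then have "z \<notin> V" using V[of z] q by auto
    then have "f = 0" "x = 0" "y = 0"
      using test_function_eq_0[OF t] test_function_eq_0[OF test_function_dpart[OF t]] by (simp_all add: f_def x_def y_def)
    then show ?thesis by simp
  next
    case False
    \<comment> \<open>With \<open>u\<close> for 1/q the identities become polynomial modulo
      \<open>u * a * a + u * b * b = 1\<close>; this relation is multiplied in where it is
      needed.\<close>
    define u where "u = 1 / q"
    have "u * a * a + u * b * b = u * q" unfolding q_def by (simp only: distrib_left mult.assoc)
    then have u: "u * a * a + u * b * b = 1" using False by (simp add: u_def)
    have d: "c / q = c * u" "c / q\<^sup>2 = c * u * u" for c by (simp_all add: u_def power2_eq_square)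
    have "x = (u * a * a + u * b * b) * x" "y = (u * a * a + u * b * b) * y" by (simp_all add: u)
    moreover have "a * f * u = (u * a * a + u * b * b) * (a * f * u)" "b * f * u = (u * a * a + u * b * b) * (b * f * u)"
      by (simp_all add: u)
    ultimately show ?thesis unfolding d by (simp add: algebra_simps)
  qed
  then show "dpart \<phi> z $ i = dil.fder (radial_test i \<phi>) (radial_test_grad i \<phi>) z - rot.fder (radial_test j \<phi>) (radial_test_grad j \<phi>) z"
    "dpart \<phi> z $ j = dil.fder (radial_test j \<phi>) (radial_test_grad j \<phi>) z + rot.fder (radial_test i \<phi>) (radial_test_grad i \<phi>) z"
    unfolding rot_fder dil_fder g r by (simp_all add: a_def[symmetric] b_def[symmetric] x_def[symmetric] y_def[symmetric])
qed

lemma cartesian_from_polar: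
  assumes v: "integrable lborel v" and gr: "integrable lborel gr" and gt: "integrable lborel gt"
    and V: "\<And>z. z \<in> V \<Longrightarrow> 0 < rad z"
    and dr: "\<And>\<phi> d. dil.c1_test V \<phi> d \<Longrightarrow> (LINT z|lborel. v z * dil.fder \<phi> d z) = - (LINT z|lborel. gr z * \<phi> z)"
    and dt: "\<And>\<phi> d. rot.c1_test V \<phi> d \<Longrightarrow> (LINT z|lborel. v z * rot.fder \<phi> d z) = - (LINT z|lborel. gt z * \<phi> z)"
    and t: "test_function V \<phi>"
  shows "(LINT z|lborel. v z * dpart \<phi> z $ i) = - (LINT z|lborel. (gr z * z $ i - gt z * z $ j) / (rad z)\<^sup>2 * \<phi> z)"
    and "(LINT z|lborel. v z * dpart \<phi> z $ j) = - (LINT z|lborel. (gr z * z $ j + gt z * z $ i) / (rad z)\<^sup>2 * \<phi> z)"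
proof -
  have c: "rot.c1_test V (radial_test k \<phi>) (radial_test_grad k \<phi>)" for k by (rule c1_test_radial[OF t V])
  have cd: "dil.c1_test V (radial_test k \<phi>) (radial_test_grad k \<phi>)" for k using c c1_test_dil_rot by blast
  have id: "dpart \<phi> z $ i = dil.fder (radial_test i \<phi>) (radial_test_grad i \<phi>) z - rot.fder (radial_test j \<phi>) (radial_test_grad j \<phi>) z"
    "dpart \<phi> z $ j = dil.fder (radial_test j \<phi>) (radial_test_grad j \<phi>) z + rot.fder (radial_test i \<phi>) (radial_test_grad i \<phi>) z" for z
    using radial_test_identity[OF t] V by blast+
  note iv = dil.integrable_mult_c1_test(2)[OF v cd] rot.integrable_mult_c1_test(2)[OF v c]
  note ig = rot.integrable_mult_c1_test(1)[OF gr c] rot.integrable_mult_c1_test(1)[OF gt c]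
  have "(LINT z|lborel. v z * dpart \<phi> z $ i) = (LINT z|lborel. v z * dil.fder (radial_test i \<phi>) (radial_test_grad i \<phi>) z)
    - (LINT z|lborel. v z * rot.fder (radial_test j \<phi>) (radial_test_grad j \<phi>) z)"
    unfolding id(1) right_diff_distrib by (rule Bochner_Integration.integral_diff[OF iv])
  also have "\<dots> = - ((LINT z|lborel. gr z * radial_test i \<phi> z) - (LINT z|lborel. gt z * radial_test j \<phi> z))"
    using dr[OF cd] dt[OF c] by simp
  also have "\<dots> = - (LINT z|lborel. gr z * radial_test i \<phi> z - gt z * radial_test j \<phi> z)"
    using ig by simp
  also have "(\<lambda>z. gr z * radial_test i \<phi> z - gt z * radial_test j \<phi> z) = (\<lambda>z. (gr z * z $ i - gt z * z $ j) / (rad z)\<^sup>2 * \<phi> z)"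
    by (simp add: fun_eq_iff radial_test_def diff_divide_distrib left_diff_distrib)
  finally show "(LINT z|lborel. v z * dpart \<phi> z $ i) = - (LINT z|lborel. (gr z * z $ i - gt z * z $ j) / (rad z)\<^sup>2 * \<phi> z)" .
  have "(LINT z|lborel. v z * dpart \<phi> z $ j) = (LINT z|lborel. v z * dil.fder (radial_test j \<phi>) (radial_test_grad j \<phi>) z)
    + (LINT z|lborel. v z * rot.fder (radial_test i \<phi>) (radial_test_grad i \<phi>) z)"
    unfolding id(2) distrib_left by (rule Bochner_Integration.integral_add[OF iv])
  also have "\<dots> = - ((LINT z|lborel. gr z * radial_test j \<phi> z) + (LINT z|lborel. gt z * radial_test i \<phi> z))"
    using dr[OF cd] dt[OF c] by simp
  also have "\<dots> = - (LINT z|lborel. gr z * radial_test j \<phi> z + gt z * radial_test i \<phi> z)"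
    using ig by simp
  also have "(\<lambda>z. gr z * radial_test j \<phi> z + gt z * radial_test i \<phi> z) = (\<lambda>z. (gr z * z $ j + gt z * z $ i) / (rad z)\<^sup>2 * \<phi> z)"
    by (simp add: fun_eq_iff radial_test_def add_divide_distrib distrib_right)
  finally show "(LINT z|lborel. v z * dpart \<phi> z $ j) = - (LINT z|lborel. (gr z * z $ j + gt z * z $ i) / (rad z)\<^sup>2 * \<phi> z)" .
qed

end

text \<open>Weakens the sharper bound for dilations and translations to the form of the rotation
  bound, so that one existence lemma serves all flows.\<close>

lemma nn_integral_excess_half: "(\<integral>\<^sup>+z. excess M (G z) \<partial>N) \<le> 4 * (\<integral>\<^sup>+z. excess (M / 2) (G z) \<partial>N)" if "0 \<le> M"
proof -
  have "(\<integral>\<^sup>+z. excess M (G z) \<partial>N) \<le> (\<integral>\<^sup>+z. excess (M / 2) (G z) \<partial>N)"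
    using that by (intro nn_integral_mono ennreal_leI) (auto simp: excess_def)
  also have "\<dots> = 1 * (\<integral>\<^sup>+z. excess (M / 2) (G z) \<partial>N)" by simp
  also have "\<dots> \<le> 4 * (\<integral>\<^sup>+z. excess (M / 2) (G z) \<partial>N)" by (intro mult_right_mono) auto
  finally show ?thesis .
qed

lemma integrable_comb:
  fixes a b c :: "'a \<Rightarrow> real"
  assumes a: "integrable M a" and b: "integrable M b" and c: "c \<in> borel_measurable M"
    and le: "\<And>x. x \<in> space M \<Longrightarrow> \<bar>c x\<bar> \<le> C * (\<bar>a x\<bar> + \<bar>b x\<bar>)" and C: "0 \<le> C"
  shows "integrable M c"
proof -
  have "integrable M (\<lambda>x. \<bar>c x\<bar> powr 1)"
    by (rule integrable_powr_comb[OF _ _ _ c le C]) (use a b in auto)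
  then show ?thesis using c by (simp add: integrable_abs_iff)
qed

context plane begin

lemma rearr_outside:
  assumes w: "w \<in> borel_measurable borel" and 0: "\<And>\<theta>. w (R \<theta> z) = 0"
  shows "rearr w z = 0"
proof (cases "z $ j = 0")
  case False
  have "circ_m w z t = (if t < 0 then 2 * pi else 0)" for t
    by (simp add: circ_m_def 0 measure_def emeasure_circle_measure_UNIV)
  then have "s < rearr w z \<longleftrightarrow> s < 0" for s
    using less_rearr_iff[OF w False, of s] ang_bounds(3,4)[OF False] by simp
  then show ?thesis by (metis less_irrefl linorder_neqE)
qed (simp add: rearr_def)

lemma dil_rot_commute: "dil i j s (R \<theta> z) = R \<theta> (dil i j s z)"
  using ij by (simp add: vec_eq_iff dil_nth rot_nth algebra_simps)

lemma shift_rot_commute: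
  assumes "k \<noteq> i" "k \<noteq> j"
  shows "shift k s (R \<theta> z) = R \<theta> (shift k s z)"
  using ij assms by (simp add: vec_eq_iff shift_nth rot_nth)

lemma abs_nth_le_rad: "\<bar>z $ i\<bar> \<le> rad z" "\<bar>z $ j\<bar> \<le> rad z"
  unfolding rad_def by (rule real_le_rsqrt, simp)+

text \<open>Boundedness of \<open>V\<close> bounds the rotation and dilation fields and makes the
  measure finite, \<open>r0\<close> allows division by |x|, and rotation invariance keeps whole
  circles inside \<open>V\<close>.\<close>

proposition rearr_weak_gradient:
  assumes p: "1 \<le> p" and V: "open V" "bounded V" and inv: "\<And>\<theta> z. R \<theta> z \<in> V \<longleftrightarrow> z \<in> V"
    and r0: "0 < r0" "\<And>z. z \<in> V \<Longrightarrow> r0 \<le> rad z"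
    and w: "integrable lborel w" "integrable lborel (\<lambda>z. \<bar>w z\<bar> powr p)" "\<And>z. z \<notin> V \<Longrightarrow> w z = 0"
    and g: "\<And>k. integrable lborel (g k)" "\<And>k. integrable lborel (\<lambda>z. \<bar>g k z\<bar> powr p)"
      "\<And>k z. z \<notin> V \<Longrightarrow> g k z = 0"
    and wg: "weak_grad V w g"
  shows "integrable lborel (rearr w)" "integrable lborel (\<lambda>z. \<bar>rearr w z\<bar> powr p)"
    and "\<exists>g'. integrable lborel g' \<and> integrable lborel (\<lambda>z. \<bar>g' z\<bar> powr p) \<and>
      (\<forall>\<phi>. test_function V \<phi> \<longrightarrow> (LINT z|lborel. rearr w z * dpart \<phi> z $ k) = - (LINT z|lborel. g' z * \<phi> z))"
proof -
  have wm[measurable]: "w \<in> borel_measurable borel" using w by auto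
  have gm[measurable]: "g k \<in> borel_measurable borel" for k using g(1)[of k] by auto
  have [measurable]: "V \<in> sets borel" using V by auto
  have Vpos: "0 < rad z" if "z \<in> V" for z using r0 that by (meson less_le_trans)
  show iv: "integrable lborel (rearr w)"
  proof (rule integrableI_bounded)
    have "(\<integral>\<^sup>+z. ennreal (norm (rearr w z)) \<partial>lborel) \<le> (\<integral>\<^sup>+z. ennreal (norm (w z)) \<partial>lborel)"
      using rearr_excess[OF wm, of 0] by (simp add: excess_0)
    also have "\<dots> < \<infinity>" using w(1) by (simp add: integrable_iff_bounded)
    finally show "(\<integral>\<^sup>+z. ennreal (norm (rearr w z)) \<partial>lborel) < \<infinity>" .
  qed measurable
  show "integrable lborel (\<lambda>z. \<bar>rearr w z\<bar> powr p)"
  proof (rule integrable_powr_if_excess_half[OF V iv w(1) _ w(3) p w(2)])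
    show "rearr w z = 0" if "z \<notin> V" for z
      using that inv w(3) by (intro rearr_outside wm) blast
    show "(\<integral>\<^sup>+z. excess M (rearr w z) \<partial>lborel) \<le> 4 * (\<integral>\<^sup>+z. excess (M / 2) (w z) \<partial>lborel)" if "0 \<le> M" for M
      using rearr_excess[OF wm that] nn_integral_excess_half[OF that, where G=w and N=lborel] by (rule order_trans)
  qed
  obtain B where B: "\<And>z. z \<in> V \<Longrightarrow> norm z \<le> B" and B0: "0 \<le> B"
  proof -
    obtain B where "\<forall>z\<in>V. norm z \<le> B" using V(2) unfolding bounded_iff by blast
    then show ?thesis by (intro that[of "max B 0"]) (auto intro: order_trans[OF _ max.cobounded1])
  qed
  have comp: "\<bar>z $ k\<bar> \<le> B" if "z \<in> V" for z k
    using B[OF that] component_le_norm_cart[of z k] by linarith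
  have field: "integrable lborel G \<and> integrable lborel (\<lambda>z. \<bar>G z\<bar> powr p)"
    if G: "\<And>z. G z = a z * g k z + b z * g l z" and ab: "\<And>z. z \<in> V \<Longrightarrow> \<bar>a z\<bar> \<le> C" "\<And>z. z \<in> V \<Longrightarrow> \<bar>b z\<bar> \<le> C" "0 \<le> C"
      and [measurable]: "a \<in> borel_measurable borel" "b \<in> borel_measurable borel" for G a b k l C
  proof -
    have Gm: "G \<in> borel_measurable lborel" unfolding G[abs_def] by measurable
    have le: "\<bar>G z\<bar> \<le> C * (\<bar>g k z\<bar> + \<bar>g l z\<bar>)" for z
    proof (cases "z \<in> V")
      case True
      have "\<bar>G z\<bar> \<le> \<bar>a z\<bar> * \<bar>g k z\<bar> + \<bar>b z\<bar> * \<bar>g l z\<bar>" unfolding G by (metis abs_mult abs_triangle_ineq)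
      also have "\<dots> \<le> C * \<bar>g k z\<bar> + C * \<bar>g l z\<bar>" using ab True by (intro add_mono mult_right_mono) auto
      finally show ?thesis by (simp add: distrib_left)
    next
      case False
      then show ?thesis by (simp add: G g(3))
    qed
    show ?thesis
      using integrable_comb[OF g(1) g(1) Gm le ab(3)] integrable_powr_comb[OF p g(2) g(2) Gm le ab(3)] by blast
  qed
  define Gt where "Gt z = (\<Sum>k\<in>UNIV. rot.X z $ k * g k z)" for z
  have Gt2: "Gt z = z $ i * g j z + (- z $ j) * g i z" for z
    using inner_quarter_turn[of "\<chi> k. g k z" z] by (simp add: Gt_def rot_X inner_vec_def mult.commute)
  have Gt3: "integrable lborel Gt \<and> integrable lborel (\<lambda>z. \<bar>Gt z\<bar> powr p)"
    by (rule field[OF Gt2 _ _ B0]) (use comp in auto)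
  \<comment> \<open>Rotations never leave \<open>V\<close>, so the cut-off removes no
    points.\<close>
  have stay_rot: "rot.stay V h = V" if "0 < h" for h
  proof
    show "rot.stay V h \<subseteq> V" using rot.stay_subset that by (simp add: less_imp_le)
    show "V \<subseteq> rot.stay V h" using inv by (auto simp: rot.stay_def)
  qed
  have exc_rot: "(\<integral>\<^sup>+z. indicator (rot.stay V h) z * ennreal (excess M ((rearr w (R h z) - rearr w z) / h)) \<partial>lborel)
       \<le> 4 * (\<integral>\<^sup>+z. excess (M / 2) (Gt z) \<partial>lborel)" if "0 < h" "0 \<le> M" for h M
    unfolding stay_rot[OF that(1)]
    by (rule rearr_rotation_excess[OF w(1) g(1) wg V(1) inv Gt_def conjunct1[OF Gt3] that])
  have "\<exists>gt. integrable lborel gt \<and> (\<forall>z. z \<notin> V \<longrightarrow> gt z = 0) \<and>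
    (\<forall>M\<ge>0. (\<integral>\<^sup>+z. excess M (gt z) \<partial>lborel) \<le> 4 * (\<integral>\<^sup>+z. excess (M / 2) (Gt z) \<partial>lborel)) \<and>
    (\<forall>\<phi> d. rot.c1_test V \<phi> d \<longrightarrow> (LINT z|lborel. rearr w z * rot.fder \<phi> d z) = - (LINT z|lborel. gt z * \<phi> z))"
    by (rule rot.flow_derivative_exists[OF iv V conjunct1[OF Gt3] exc_rot], assumption, assumption) blast
  then obtain gt where gt: "integrable lborel gt" "\<And>z. z \<notin> V \<Longrightarrow> gt z = 0"
    "\<And>M. 0 \<le> M \<Longrightarrow> (\<integral>\<^sup>+z. excess M (gt z) \<partial>lborel) \<le> 4 * (\<integral>\<^sup>+z. excess (M / 2) (Gt z) \<partial>lborel)"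
    "\<And>\<phi> d. rot.c1_test V \<phi> d \<Longrightarrow> (LINT z|lborel. rearr w z * rot.fder \<phi> d z) = - (LINT z|lborel. gt z * \<phi> z)"
    by blast
  have gtp: "integrable lborel (\<lambda>z. \<bar>gt z\<bar> powr p)"
    by (rule integrable_powr_if_excess_half[OF V gt(1) conjunct1[OF Gt3] gt(2) _ p conjunct2[OF Gt3] gt(3)])
       (auto simp: Gt2 g(3))
  define Gr where "Gr z = (\<Sum>k\<in>UNIV. dil.X z $ k * g k z)" for z
  have Gr2: "Gr z = z $ i * g i z + z $ j * g j z" for z
    using inner_plane_part[of "\<chi> k. g k z" z] by (simp add: Gr_def dil_X inner_vec_def mult.commute)
  have Gr3: "integrable lborel Gr \<and> integrable lborel (\<lambda>z. \<bar>Gr z\<bar> powr p)"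
    by (rule field[OF Gr2 _ _ B0]) (use comp in auto)
  \<comment> \<open>Circle by circle the quotient of the rearrangement is contracted to that of
    \<open>w\<close>, which Jensen's inequality along the flow bounds by \<open>Gr\<close>.\<close>
  have exc_dil: "(\<integral>\<^sup>+z. indicator (dil.stay V h) z * ennreal (excess M ((rearr w (dil i j h z) - rearr w z) / h)) \<partial>lborel)
       \<le> 4 * (\<integral>\<^sup>+z. excess (M / 2) (Gr z) \<partial>lborel)" if h: "0 < h" and M: "0 \<le> M" for h M
  proof -
    have "(\<integral>\<^sup>+z. indicator (dil.stay V h) z * ennreal (excess M ((rearr w (dil i j h z) - rearr w z) / h)) \<partial>lborel)
      \<le> (\<integral>\<^sup>+z. indicator (dil.stay V h) z * ennreal (excess M ((w (dil i j h z) - w z) / h)) \<partial>lborel)"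
    proof (rule circle_flow_contraction[OF wm _ _ _ _ _ _ _ M h])
      show "dil.stay V h \<in> sets borel" using dil.open_stay[OF V(1)] by auto
      show "R \<theta> z \<in> dil.stay V h \<longleftrightarrow> z \<in> dil.stay V h" for \<theta> z
        by (simp add: dil.stay_def dil_rot_commute inv)
      show "dil i j h z $ i = exp h * z $ i" "dil i j h z $ j = exp h * z $ j" for z by (simp_all add: dil_nth)
    qed (simp_all add: dil_rot_commute)
    also have "\<dots> \<le> (\<integral>\<^sup>+z. excess M (Gr z) \<partial>lborel)"
      by (rule dil.excess_flow_increment[OF w(1) g(1) wg _ h dil.open_stay[OF V(1)] Gr_def conjunct1[OF Gr3] M])
         (simp add: dil.stay_def)
    also have "\<dots> \<le> 4 * (\<integral>\<^sup>+z. excess (M / 2) (Gr z) \<partial>lborel)" by (rule nn_integral_excess_half[OF M])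
    finally show ?thesis .
  qed
  have "\<exists>gr. integrable lborel gr \<and> (\<forall>z. z \<notin> V \<longrightarrow> gr z = 0) \<and>
    (\<forall>M\<ge>0. (\<integral>\<^sup>+z. excess M (gr z) \<partial>lborel) \<le> 4 * (\<integral>\<^sup>+z. excess (M / 2) (Gr z) \<partial>lborel)) \<and>
    (\<forall>\<phi> d. dil.c1_test V \<phi> d \<longrightarrow> (LINT z|lborel. rearr w z * dil.fder \<phi> d z) = - (LINT z|lborel. gr z * \<phi> z))"
    by (rule dil.flow_derivative_exists[OF iv V conjunct1[OF Gr3] exc_dil], assumption, assumption) blast
  then obtain gr where gr: "integrable lborel gr" "\<And>z. z \<notin> V \<Longrightarrow> gr z = 0"
    "\<And>M. 0 \<le> M \<Longrightarrow> (\<integral>\<^sup>+z. excess M (gr z) \<partial>lborel) \<le> 4 * (\<integral>\<^sup>+z. excess (M / 2) (Gr z) \<partial>lborel)"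
    "\<And>\<phi> d. dil.c1_test V \<phi> d \<Longrightarrow> (LINT z|lborel. rearr w z * dil.fder \<phi> d z) = - (LINT z|lborel. gr z * \<phi> z)"
    by blast
  have grp: "integrable lborel (\<lambda>z. \<bar>gr z\<bar> powr p)"
    by (rule integrable_powr_if_excess_half[OF V gr(1) conjunct1[OF Gr3] gr(2) _ p conjunct2[OF Gr3] gr(3)])
       (auto simp: Gr2 g(3))
  have [measurable]: "gr \<in> borel_measurable borel" "gt \<in> borel_measurable borel" using gr(1) gt(1) by auto
  \<comment> \<open>The coordinates of x are at most |x|, so division by |x|^2 leaves one factor
    1/|x|, at most 1/r0 on \<open>V\<close>.\<close>
  have polar_int: "integrable lborel G' \<and> integrable lborel (\<lambda>z. \<bar>G' z\<bar> powr p)"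
    if G': "\<And>z. G' z = (gr z * a z + gt z * b z) / (rad z)\<^sup>2"
      and ab: "\<And>z. \<bar>a z\<bar> \<le> rad z" "\<And>z. \<bar>b z\<bar> \<le> rad z"
      and [measurable]: "a \<in> borel_measurable borel" "b \<in> borel_measurable borel" for G' a b
  proof -
    have m: "G' \<in> borel_measurable lborel" unfolding G'[abs_def] by measurable
    have le: "\<bar>G' z\<bar> \<le> (1 / r0) * (\<bar>gr z\<bar> + \<bar>gt z\<bar>)" for z
    proof (cases "z \<in> V")
      case True
      note rz = Vpos[OF True]
      have "\<bar>gr z * a z + gt z * b z\<bar> \<le> \<bar>gr z\<bar> * \<bar>a z\<bar> + \<bar>gt z\<bar> * \<bar>b z\<bar>" by (metis abs_mult abs_triangle_ineq)
      also have "\<dots> \<le> \<bar>gr z\<bar> * rad z + \<bar>gt z\<bar> * rad z" using ab by (intro add_mono mult_left_mono) auto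
      also have "\<dots> = (\<bar>gr z\<bar> + \<bar>gt z\<bar>) * rad z" by (simp add: distrib_right)
      finally have "\<bar>G' z\<bar> \<le> ((\<bar>gr z\<bar> + \<bar>gt z\<bar>) * rad z) / (rad z)\<^sup>2"
        unfolding G' abs_divide by (simp add: divide_right_mono)
      also have "\<dots> = (\<bar>gr z\<bar> + \<bar>gt z\<bar>) / rad z" using rz by (simp add: power2_eq_square)
      also have "\<dots> \<le> (\<bar>gr z\<bar> + \<bar>gt z\<bar>) / r0" using r0 True rz by (intro divide_left_mono) auto
      finally show ?thesis by simp
    next
      case False
      then show ?thesis by (simp add: G' gr(2) gt(2))
    qed
    have C: "0 \<le> 1 / r0" using r0 by simp
    show ?thesis
      using integrable_comb[OF gr(1) gt(1) m le C] integrable_powr_comb[OF p grp gtp m le C] by blast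
  qed
  note cart = cartesian_from_polar[OF iv gr(1) gt(1) Vpos gr(4) gt(4)]
  show "\<exists>g'. integrable lborel g' \<and> integrable lborel (\<lambda>z. \<bar>g' z\<bar> powr p) \<and>
      (\<forall>\<phi>. test_function V \<phi> \<longrightarrow> (LINT z|lborel. rearr w z * dpart \<phi> z $ k) = - (LINT z|lborel. g' z * \<phi> z))"
  proof -
    consider "k = i" | "k = j" | "k \<noteq> i" "k \<noteq> j" by blast
    then show ?thesis
    proof cases
      case 1
      have "integrable lborel (\<lambda>z. (gr z * z $ i - gt z * z $ j) / (rad z)\<^sup>2) \<and>
        integrable lborel (\<lambda>z. \<bar>(gr z * z $ i - gt z * z $ j) / (rad z)\<^sup>2\<bar> powr p)"
        by (rule polar_int[where a="\<lambda>z. z $ i" and b="\<lambda>z. - z $ j"]) (use abs_nth_le_rad in auto)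
      then show ?thesis unfolding 1 using cart(1) by blast
    next
      case 2
      have "integrable lborel (\<lambda>z. (gr z * z $ j + gt z * z $ i) / (rad z)\<^sup>2) \<and>
        integrable lborel (\<lambda>z. \<bar>(gr z * z $ j + gt z * z $ i) / (rad z)\<^sup>2\<bar> powr p)"
        by (rule polar_int[where a="\<lambda>z. z $ j" and b="\<lambda>z. z $ i"]) (use abs_nth_le_rad in auto)
      then show ?thesis unfolding 2 using cart(2) by blast
    next
      case 3
      interpret sh: affine_flow "shift k" 0 "axis k 1 :: real ^ 'n" "\<lambda>_. mat 1" "\<lambda>s. s *\<^sub>R axis k 1"
        by (rule affine_flow_shift)
      have Xk: "sh.X z = axis k 1" for z
        by (simp add: sh.X_def matrix_vector_mult_def vec_eq_iff)
      have Gk: "g k z = (\<Sum>l\<in>UNIV. sh.X z $ l * g l z)" for z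
        by (simp add: Xk axis_1_nth if_distrib[of "\<lambda>x. x * _"] cong: if_cong)
      have fk: "sh.fder \<phi> d z = d z $ k" for \<phi> d z
        by (simp add: sh.fder_def Xk inner_axis trace_def)
      have exc_sh: "(\<integral>\<^sup>+z. indicator (sh.stay V h) z * ennreal (excess M ((rearr w (shift k h z) - rearr w z) / h)) \<partial>lborel)
         \<le> 4 * (\<integral>\<^sup>+z. excess (M / 2) (g k z) \<partial>lborel)" if h: "0 < h" and M: "0 \<le> M" for h M
      proof -
        have "(\<integral>\<^sup>+z. indicator (sh.stay V h) z * ennreal (excess M ((rearr w (shift k h z) - rearr w z) / h)) \<partial>lborel)
          \<le> (\<integral>\<^sup>+z. indicator (sh.stay V h) z * ennreal (excess M ((w (shift k h z) - w z) / h)) \<partial>lborel)"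
        proof (rule circle_flow_contraction[OF wm _ _ _ _ _ _ _ M h])
          show "sh.stay V h \<in> sets borel" using sh.open_stay[OF V(1)] by auto
          show "R \<theta> z \<in> sh.stay V h \<longleftrightarrow> z \<in> sh.stay V h" for \<theta> z
            by (simp add: sh.stay_def shift_rot_commute 3 inv)
          show "shift k h z $ i = 1 * z $ i" "shift k h z $ j = 1 * z $ j" for z using 3 by (simp_all add: shift_nth)
        qed (simp_all add: shift_rot_commute 3)
        also have "\<dots> \<le> (\<integral>\<^sup>+z. excess M (g k z) \<partial>lborel)"
          by (rule sh.excess_flow_increment[OF w(1) g(1) wg _ h sh.open_stay[OF V(1)] Gk g(1) M])
             (simp add: sh.stay_def)
        also have "\<dots> \<le> 4 * (\<integral>\<^sup>+z. excess (M / 2) (g k z) \<partial>lborel)" by (rule nn_integral_excess_half[OF M])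
        finally show ?thesis .
      qed
      have "\<exists>gs. integrable lborel gs \<and> (\<forall>z. z \<notin> V \<longrightarrow> gs z = 0) \<and>
        (\<forall>M\<ge>0. (\<integral>\<^sup>+z. excess M (gs z) \<partial>lborel) \<le> 4 * (\<integral>\<^sup>+z. excess (M / 2) (g k z) \<partial>lborel)) \<and>
        (\<forall>\<phi> d. sh.c1_test V \<phi> d \<longrightarrow> (LINT z|lborel. rearr w z * sh.fder \<phi> d z) = - (LINT z|lborel. gs z * \<phi> z))"
        by (rule sh.flow_derivative_exists[OF iv V g(1) exc_sh], assumption, assumption) blast
      then obtain gs where gs: "integrable lborel gs" "\<And>z. z \<notin> V \<Longrightarrow> gs z = 0"
        "\<And>M. 0 \<le> M \<Longrightarrow> (\<integral>\<^sup>+z. excess M (gs z) \<partial>lborel) \<le> 4 * (\<integral>\<^sup>+z. excess (M / 2) (g k z) \<partial>lborel)"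
        "\<And>\<phi> d. sh.c1_test V \<phi> d \<Longrightarrow> (LINT z|lborel. rearr w z * sh.fder \<phi> d z) = - (LINT z|lborel. gs z * \<phi> z)"
        by blast
      have "integrable lborel (\<lambda>z. \<bar>gs z\<bar> powr p)"
        by (rule integrable_powr_if_excess_half[OF V gs(1) g(1) gs(2) g(3) p g(2) gs(3)])
      moreover have "(LINT z|lborel. rearr w z * dpart \<phi> z $ k) = - (LINT z|lborel. gs z * \<phi> z)" if "test_function V \<phi>" for \<phi>
        using gs(4)[OF sh.c1_test_if_test_function[OF that]] by (simp add: fk)
      ultimately show ?thesis using gs(1) by blast
    qed
  qed
qed

end

section \<open>Sobolev spaces on cylinders\<close>

text \<open>Bridge between the definitions, stated with \<open>lebesgue_on V\<close>, and the
  argument, which works with Borel functions on the whole space that vanish off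
  \<open>V\<close>.\<close>

lemma lebesgue_on_transfer:
  fixes f f' :: "real ^ 'n::finite \<Rightarrow> real"
  assumes V: "V \<in> sets borel" and f': "f' \<in> borel_measurable borel" "\<And>z. z \<notin> V \<Longrightarrow> f' z = 0"
    and eq: "AE z in lborel. z \<in> V \<longrightarrow> f z = f' z"
  shows "f \<in> borel_measurable (lebesgue_on V)"
    and "integrable (lebesgue_on V) f \<longleftrightarrow> integrable lborel f'"
    and "integral\<^sup>L (lebesgue_on V) f = integral\<^sup>L lborel f'"
proof -
  have VL: "V \<in> sets lebesgue" using V by auto
  have f'L: "f' \<in> borel_measurable lebesgue" using f'(1) by (simp add: measurable_completion)
  have eq': "AE z in lebesgue. f' z = (if z \<in> V then f z else 0)"
    using AE_completion[OF eq] by eventually_elim (use f'(2) in auto)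
  have m: "(\<lambda>z. if z \<in> V then f z else 0) \<in> borel_measurable lebesgue"
    by (rule borel_measurable_AE[OF f'L eq'])
  then show "f \<in> borel_measurable (lebesgue_on V)" using borel_measurable_if[OF VL] by blast
  have ind: "(\<lambda>z. indicator V z * f z) = (\<lambda>z. if z \<in> V then f z else 0)"
    by (auto simp: indicator_def)
  have "integrable (lebesgue_on V) f \<longleftrightarrow> integrable lebesgue (\<lambda>z. if z \<in> V then f z else 0)"
    using integrable_restrict_space[of V lebesgue f] VL by (simp add: ind)
  also have "\<dots> \<longleftrightarrow> integrable lebesgue f'"
    by (rule integrable_cong_AE[OF m f'L]) (use eq' in eventually_elim, simp)
  also have "\<dots> \<longleftrightarrow> integrable lborel f'" using f'(1) by (simp add: integrable_completion)
  finally show "integrable (lebesgue_on V) f \<longleftrightarrow> integrable lborel f'" .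
  have "integral\<^sup>L (lebesgue_on V) f = integral\<^sup>L lebesgue (\<lambda>z. if z \<in> V then f z else 0)"
    using integral_restrict_space[of V lebesgue f] VL by (simp add: ind)
  also have "\<dots> = integral\<^sup>L lebesgue f'"
    by (rule integral_cong_AE[OF m f'L]) (use eq' in eventually_elim, simp)
  also have "\<dots> = integral\<^sup>L lborel f'" using f'(1) by (simp add: integral_completion)
  finally show "integral\<^sup>L (lebesgue_on V) f = integral\<^sup>L lborel f'" .
qed

text \<open>A Borel function agreeing almost everywhere is cut off to \<open>V\<close>; |x| <= 1 +
  |x|^p and boundedness of \<open>V\<close> make it integrable to the first power as well.\<close>

lemma in_Lp_borel_representative:
  fixes w :: "real ^ 'n::finite \<Rightarrow> real"
  assumes V: "open V" "bounded V" and p: "1 \<le> p" and w: "in_Lp p V w"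
  obtains w' where "w' \<in> borel_measurable borel" "\<And>z. z \<notin> V \<Longrightarrow> w' z = 0"
    "AE z in lborel. z \<in> V \<longrightarrow> w z = w' z"
    "integrable lborel w'" "integrable lborel (\<lambda>z. \<bar>w' z\<bar> powr p)"
proof -
  have VB: "V \<in> sets borel" using V by auto
  have VL: "V \<in> sets lebesgue" using V by auto
  have "(\<lambda>z. if z \<in> V then w z else 0) \<in> borel_measurable lebesgue"
    using w borel_measurable_if[OF VL] unfolding in_Lp_def by blast
  then obtain w1 where w1: "w1 \<in> borel_measurable lborel" "AE z in lborel. (if z \<in> V then w z else 0) = w1 z"
    using completion_ex_borel_measurable_real by blast
  define w' where "w' z = indicator V z * w1 z" for z
  have m[measurable]: "w' \<in> borel_measurable borel" unfolding w'_def[abs_def] using w1(1) VB by measurable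
  have out: "w' z = 0" if "z \<notin> V" for z using that by (simp add: w'_def)
  have eq: "AE z in lborel. z \<in> V \<longrightarrow> w z = w' z"
    using w1(2) by eventually_elim (auto simp: w'_def)
  have pw: "integrable lborel (\<lambda>z. \<bar>w' z\<bar> powr p)"
  proof -
    have eqp: "AE z in lborel. z \<in> V \<longrightarrow> \<bar>w z\<bar> powr p = \<bar>w' z\<bar> powr p" using eq by eventually_elim simp
    show ?thesis
      using lebesgue_on_transfer(2)[OF VB _ _ eqp] w out by (simp add: in_Lp_def)
  qed
  have "integrable lborel (\<lambda>z. indicator V z + \<bar>w' z\<bar> powr p)"
    by (intro Bochner_Integration.integrable_add pw integrable_real_indicator emeasure_bounded_finite V)
      (use VB in auto)
  then have "integrable lborel w'"
  proof (rule Bochner_Integration.integrable_bound)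
    show "AE z in lborel. norm (w' z) \<le> norm (indicator V z + \<bar>w' z\<bar> powr p)"
    proof (rule AE_I2)
      fix z
      have "\<bar>x\<bar> \<le> 1 + \<bar>x\<bar> powr p" for x :: real
      proof (cases "\<bar>x\<bar> \<le> 1")
        case False
        then have "\<bar>x\<bar> powr 1 \<le> \<bar>x\<bar> powr p" using p by (intro powr_mono) auto
        then show ?thesis using False by simp
      qed (simp add: add.commute add_increasing2)
      then show "norm (w' z) \<le> norm (indicator V z + \<bar>w' z\<bar> powr p)"
        using out[of z] p by (cases "z \<in> V") auto
    qed
  qed simp
  then show ?thesis using that[OF m out eq _ pw] by blast
qed

lemma in_LpI_borel:
  assumes "V \<in> sets borel" "integrable lborel (\<lambda>z. \<bar>f' z\<bar> powr p)" "1 \<le> p" "f' \<in> borel_measurable borel"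
    "\<And>z. z \<notin> V \<Longrightarrow> f' z = 0" "AE z in lborel. z \<in> V \<longrightarrow> f z = f' z"
  shows "in_Lp p V f"
proof -
  have eqp: "AE z in lborel. z \<in> V \<longrightarrow> \<bar>f z\<bar> powr p = \<bar>f' z\<bar> powr p" using assms(6) by eventually_elim simp
  have "(\<lambda>z. \<bar>f' z\<bar> powr p) \<in> borel_measurable borel" using assms(4) by measurable
  then have "integrable (lebesgue_on V) (\<lambda>z. \<bar>f z\<bar> powr p)"
    using lebesgue_on_transfer(2)[OF assms(1) _ _ eqp] assms by simp
  then show ?thesis unfolding in_Lp_def using lebesgue_on_transfer(1)[OF assms(1,4,5,6)] by blast
qed

section \<open>Circles, slices and cylinders\<close>

context plane begin

text \<open>The label (r, y) of the circle through \<open>z\<close>. Images of cylinders under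
  \<open>Phi\<close> become preimages under this continuous, rotation-invariant map.\<close>

definition base :: "real ^ 'n \<Rightarrow> real \<times> (real ^ 'n)" where
  "base z = (rad z, ypart i j z)"

lemma norm_xpart: "norm (xpart i j z) = rad z"
  by (simp add: norm_vec_def L2_set_def sum_2 xpart_def vector_2 rad_def)

lemma arc_len_xpart: "arc_len (xpart i j z) = 2 * rad z * ang z"
proof -
  have "sgn (xpart i j z) \<bullet> axis 1 1 = z $ i / rad z"
    unfolding sgn_div_norm norm_xpart by (simp add: inner_axis xpart_def vector_2 divide_inverse mult.commute)
  then show ?thesis by (simp add: arc_len_def norm_xpart ang_def)
qed

lemma rad_pos_iff: "0 < rad z \<longleftrightarrow> xpart i j z \<noteq> 0"
  by (simp add: norm_xpart[symmetric])

lemma base_rot: "base (R \<theta> z) = base z"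
  by (simp add: base_def rad_rot ypart_def rot_nth[OF ij] vec_eq_iff)

lemma circ_sym_iff:
  "z \<in> circ_sym i j E \<longleftrightarrow> 0 < rad z \<and> ennreal (2 * rad z * ang z) < hausdorff1 (slice i j E (base z))"
  by (simp add: circ_sym_def rad_pos_iff arc_len_xpart norm_xpart base_def)

lemma base_emb: "y \<in> yspace i j \<Longrightarrow> base (emb i j x y) = (norm x, y)"
  by (simp add: base_def norm_xpart[symmetric] parts_emb[OF ij])

lemma base_surj:
  assumes "q \<in> {0<..} \<times> yspace i j" obtains z where "base z = q" "0 < rad z"
proof
  show "base (emb i j (vector [fst q, 0]) (snd q)) = q"
    using assms by (subst base_emb) (auto simp: norm_vec_def L2_set_def sum_2 vector_2)
  then show "0 < rad (emb i j (vector [fst q, 0]) (snd q))" using assms by (auto simp: base_def)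
qed

lemma Phi_image:
  assumes "A \<subseteq> {0<..} \<times> yspace i j"
  shows "Phi i j ` (A \<times> sphere 0 1) = {z. base z \<in> A}"
proof safe
  fix r y and \<omega> :: "real ^ 2"
  assume ry: "(r, y) \<in> A" and \<omega>: "\<omega> \<in> sphere 0 1"
  have "base (Phi i j ((r, y), \<omega>)) = (norm (r *\<^sub>R \<omega>), y)"
    unfolding Phi_def split using assms ry by (intro base_emb) auto
  also have "\<dots> = (r, y)" using assms ry \<omega> by auto
  finally show "base (Phi i j ((r, y), \<omega>)) \<in> A" using ry by simp
next
  fix z assume z: "base z \<in> A"
  then have r: "0 < rad z" using assms by (auto simp: base_def)
  have "z = Phi i j (base z, (1 / rad z) *\<^sub>R xpart i j z)"
    using r by (simp add: Phi_def base_def emb_xpart_ypart)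
  moreover have "(1 / rad z) *\<^sub>R xpart i j z \<in> sphere 0 1" using r by (simp add: norm_xpart)
  ultimately show "z \<in> Phi i j ` (A \<times> sphere 0 1)" using z by blast
qed

lemma emb_circ_pt:
  assumes "z $ i = rad z * cos a" "z $ j = rad z * sin a"
  shows "emb i j (circ_pt (rad z) (\<theta> + a)) (ypart i j z) = R \<theta> z"
  using polar_rot[OF assms, of \<theta>] ij
  by (auto simp: vec_eq_iff emb_def circ_pt_def vector_2 ypart_def rot_nth[OF ij])

lemma norm_circ_pt: "0 \<le> r \<Longrightarrow> norm (circ_pt r t) = r"
  by (simp add: norm_vec_def L2_set_def sum_2 circ_pt_def vector_2 power_mult_distrib distrib_left[symmetric])

text \<open>\<open>E\<close> may be nonmeasurable: the null set of angles where the hypothesis fails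
  is removed from \<open>B\<close>, and the remaining angles parametrise a subset of the
  slice.\<close>

lemma hausdorff1_slice_ge:
  assumes z: "0 < rad z" and B: "B \<in> sets borel"
    and AE: "AE \<theta> in circle_measure. \<theta> \<in> B \<longrightarrow> R \<theta> z \<in> E"
  shows "ennreal (rad z) * emeasure circle_measure B \<le> hausdorff1 (slice i j E (base z))"
proof -
  obtain a where a: "z $ i = rad z * cos a" "z $ j = rad z * sin a" by (rule polar[OF z])
  obtain N where N: "N \<in> null_sets circle_measure" "{\<theta>. \<not> (\<theta> \<in> B \<longrightarrow> R \<theta> z \<in> E)} \<subseteq> N"
    using AE unfolding eventually_ae_filter by auto
  have Nb: "N \<in> sets borel" using N(1) by auto
  have "emeasure circle_measure B = emeasure circle_measure (B - N)"
    using emeasure_Diff_null_set[OF N(1), of B] B by simp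
  also have "\<dots> = emeasure lborel ((B - N) \<inter> {0..<2 * pi})"
    using B Nb by (simp add: emeasure_circle_measure Int_commute)
  finally have e: "emeasure circle_measure B = emeasure lborel ((B - N) \<inter> {0..<2 * pi})" .
  show ?thesis unfolding e
  proof (rule hausdorff1_circle_ge[OF z])
    fix \<theta> assume "\<theta> \<in> (B - N) \<inter> {0..<2 * pi}"
    then have "R \<theta> z \<in> E" using N(2) by blast
    then show "circ_pt (rad z) (\<theta> + a) \<in> slice i j E (base z)"
      using z by (simp add: slice_def base_def emb_circ_pt[OF a] norm_circ_pt)
  qed (use B Nb in auto)
qed

text \<open>Here the null set is added to \<open>B\<close>, so that the enlarged set of angles
  covers the slice.\<close>

lemma hausdorff1_slice_le:
  assumes z: "0 < rad z" and B: "B \<in> sets borel"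
    and AE: "AE \<theta> in circle_measure. R \<theta> z \<in> E \<longrightarrow> \<theta> \<in> B"
  shows "hausdorff1 (slice i j E (base z)) \<le> ennreal (rad z) * emeasure circle_measure B"
proof -
  obtain a where a: "z $ i = rad z * cos a" "z $ j = rad z * sin a" by (rule polar[OF z])
  obtain N where N: "N \<in> null_sets circle_measure" "{\<theta>. \<not> (R \<theta> z \<in> E \<longrightarrow> \<theta> \<in> B)} \<subseteq> N"
    using AE unfolding eventually_ae_filter by auto
  have Nb: "N \<in> sets borel" using N(1) by auto
  have "emeasure circle_measure B = emeasure circle_measure (B \<union> N)"
    using emeasure_Un_null_set[OF _ N(1), of B] B by simp
  also have "\<dots> = emeasure lborel ((B \<union> N) \<inter> {0..<2 * pi})"
    using B Nb by (simp add: emeasure_circle_measure Int_commute)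
  finally have e: "emeasure circle_measure B = emeasure lborel ((B \<union> N) \<inter> {0..<2 * pi})" .
  show ?thesis unfolding e
  proof (rule hausdorff1_circle_le[OF z])
    fix x assume "x \<in> slice i j E (base z)"
    then have x: "norm x = rad z" "emb i j x (ypart i j z) \<in> E" by (auto simp: slice_def base_def)
    have "(x $ 1 / rad z)\<^sup>2 + (x $ 2 / rad z)\<^sup>2 = 1"
    proof -
      have "(x $ 1)\<^sup>2 + (x $ 2)\<^sup>2 = (rad z)\<^sup>2"
        unfolding x(1)[symmetric] by (simp add: norm_vec_def L2_set_def sum_2)
      then show ?thesis using z by (simp add: power_divide add_divide_distrib[symmetric])
    qed
    then obtain t where t: "x $ 1 / rad z = cos t" "x $ 2 / rad z = sin t" by (rule sincos_total_2pi)
    \<comment> \<open>The number of full turns to be subtracted to bring \<open>t - a\<close> into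
      [0, 2 pi).\<close>
    define k where "k = \<lfloor>(t - a) / (2 * pi)\<rfloor>"
    define \<theta> where "\<theta> = t - a + 2 * pi * of_int (- k)"
    have "of_int k \<le> (t - a) / (2 * pi)" "(t - a) / (2 * pi) < of_int k + 1" unfolding k_def by linarith+
    then have \<theta>: "0 \<le> \<theta>" "\<theta> < 2 * pi" unfolding \<theta>_def by (simp_all add: field_simps)
    have ta: "\<theta> + a = t + 2 * pi * of_int (- k)" by (simp add: \<theta>_def)
    have xc: "x = circ_pt (rad z) (\<theta> + a)"
      unfolding ta circ_pt_def cos_add_int sin_add_int using t z
      by (simp add: vec_eq_iff forall_2 vector_2 field_simps)
    then have "R \<theta> z \<in> E" using x(2) emb_circ_pt[OF a, of \<theta>] by simp
    then have "\<theta> \<in> (B \<union> N) \<inter> {0..<2 * pi}" using N(2) \<theta> by auto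
    then show "\<exists>\<theta>\<in>(B \<union> N) \<inter> {0..<2 * pi}. x = circ_pt (rad z) (\<theta> + a)" using xc by blast
  qed (use B Nb in auto)
qed

lemma hausdorff1_slice_eq:
  assumes z: "0 < rad z" and B: "B \<in> sets borel"
    and AE: "AE \<theta> in circle_measure. R \<theta> z \<in> E \<longleftrightarrow> \<theta> \<in> B"
  shows "hausdorff1 (slice i j E (base z)) = ennreal (rad z * measure circle_measure B)"
proof -
  have "hausdorff1 (slice i j E (base z)) = ennreal (rad z) * emeasure circle_measure B"
    by (intro antisym hausdorff1_slice_le hausdorff1_slice_ge z B) (use AE in \<open>eventually_elim, simp\<close>)+
  then show ?thesis using z by (simp add: circle.emeasure_eq_measure ennreal_mult)
qed

definition arc :: "(real ^ 'n) set \<Rightarrow> real ^ 'n \<Rightarrow> real" where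
  "arc E z = measure circle_measure {\<theta>. R \<theta> z \<in> E}"

lemma arc_bounds: "0 \<le> arc E z" "arc E z \<le> 2 * pi"
proof -
  have "emeasure circle_measure {\<theta>. R \<theta> z \<in> E} \<le> emeasure circle_measure (space circle_measure)"
    by (rule emeasure_space)
  then have "ennreal (arc E z) \<le> ennreal (2 * pi)"
    by (simp add: arc_def emeasure_circle_measure_UNIV flip: circle.emeasure_eq_measure)
  then show "arc E z \<le> 2 * pi" by simp
qed (simp add: arc_def)

lemma continuous_on_circle: "continuous_on S (\<lambda>\<theta>. R \<theta> z)"
  unfolding rot_def by (intro continuous_intros)

lemma borel_measurable_circle [measurable]: "(\<lambda>\<theta>. R \<theta> z) \<in> borel_measurable borel"
  by (rule borel_measurable_continuous_onI[OF continuous_on_circle])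

lemma open_circle:
  assumes "open E" shows "open {\<theta>. R \<theta> z \<in> E}"
proof -
  have "open ((\<lambda>\<theta>. R \<theta> z) -` E)" using assms continuous_on_circle[of UNIV z] by (simp add: continuous_on_open_vimage)
  then show ?thesis by (simp add: vimage_def)
qed

lemma sets_circle: "open E \<Longrightarrow> {\<theta>. R \<theta> z \<in> E} \<in> sets borel"
  using open_circle by auto

lemma hausdorff1_slice_open: "open E \<Longrightarrow> 0 < rad z \<Longrightarrow> hausdorff1 (slice i j E (base z)) = ennreal (rad z * arc E z)"
  unfolding arc_def by (rule hausdorff1_slice_eq[OF _ sets_circle]) auto

lemma circ_sym_open_iff:
  assumes "open E" shows "z \<in> circ_sym i j E \<longleftrightarrow> 0 < rad z \<and> 2 * ang z < arc E z"
proof (cases "0 < rad z")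
  case True
  have "ennreal (2 * rad z * ang z) < ennreal (rad z * arc E z) \<longleftrightarrow> rad z * (2 * ang z) < rad z * arc E z"
    using True ang_bounds(1)[of z] by (subst ennreal_less_iff) (auto simp: ac_simps)
  then show ?thesis using True by (simp add: circ_sym_iff hausdorff1_slice_open[OF assms True])
qed (simp add: circ_sym_iff)

lemma arc_rot: "open E \<Longrightarrow> arc E (R a z) = arc E z"
proof -
  assume "open E"
  then have "open E" "(indicator E :: real ^ 'n \<Rightarrow> real) \<in> borel_measurable borel" by auto
  moreover have "arc E z = circ_m (indicator E) z 0" for z by (simp add: arc_def circ_m_def indicator_def)
  ultimately show ?thesis using circ_m_rot[of "indicator E" a z 0] by simp
qed

text \<open>On each circle the symmetrized slice is the arc of half-opening
  \<open>arc E z / 2\<close>, whose total angle is again \<open>arc E z\<close>.\<close>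

lemma hausdorff1_slice_circ_sym:
  assumes E: "open E" and z: "0 < rad z"
  shows "hausdorff1 (slice i j (circ_sym i j E) (base z)) = hausdorff1 (slice i j E (base z))"
proof -
  have B: "{\<theta>. ang (R \<theta> z) < arc E z / 2} \<in> sets borel" by measurable
  have "hausdorff1 (slice i j (circ_sym i j E) (base z))
      = ennreal (rad z * measure circle_measure {\<theta>. ang (R \<theta> z) < arc E z / 2})"
    by (rule hausdorff1_slice_eq[OF z B])
      (use z in \<open>auto simp: circ_sym_open_iff[OF E] rad_rot arc_rot[OF E]\<close>)
  also have "measure circle_measure {\<theta>. ang (R \<theta> z) < arc E z / 2} = arc E z"
    using measure_ang_less[OF z, of "arc E z / 2"] arc_bounds[of E z] by simp
  finally show ?thesis by (simp add: hausdorff1_slice_open[OF E z])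
qed

text \<open>This lets the defining conditions for the symmetrized set be checked on the cylinders of
  \<open>E\<close>, where the hypothesis on \<open>u\<close> is available.\<close>

lemma Pi_circ_sym:
  assumes E: "open E"
  shows "Pi_proj i j (circ_sym i j E) = Pi_proj i j E" "Pi_full i j (circ_sym i j E) = Pi_full i j E"
proof -
  have eq: "hausdorff1 (slice i j (circ_sym i j E) q) = hausdorff1 (slice i j E q)" if q: "q \<in> {0<..} \<times> yspace i j" for q
  proof -
    obtain z where z: "base z = q" "0 < rad z" by (rule base_surj[OF q])
    show ?thesis using hausdorff1_slice_circ_sym[OF E z(2)] z(1) by simp
  qed
  then show 1: "Pi_proj i j (circ_sym i j E) = Pi_proj i j E" unfolding Pi_proj_def by auto
  show "Pi_full i j (circ_sym i j E) = Pi_full i j E" unfolding Pi_full_def 1 using eq by (auto simp: Pi_proj_def)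
qed

lemma continuous_on_base: "continuous_on S base"
proof -
  have y: "continuous_on S (\<lambda>z. if k = i \<or> k = j then 0 else z $ k :: real)" for k :: 'n and S :: "(real ^ 'n) set"
    by (cases "k = i \<or> k = j") (auto intro!: continuous_intros)
  show ?thesis
    unfolding base_def[abs_def] rad_def ypart_def
    by (intro continuous_intros continuous_on_vec_lambda y)
qed

lemma base_mem_iff: "base z \<in> {0<..} \<times> yspace i j \<longleftrightarrow> 0 < rad z"
  by (simp add: base_def ypart_in_yspace)

text \<open>The lower bound for the radius is its minimum over the compact closure, which lies in r
  > 0.\<close>

lemma cylinder:
  assumes A: "openin (top_of_set ({0<..} \<times> yspace i j)) A" and c: "compact (closure A)"
    and sub: "closure A \<subseteq> {0<..} \<times> yspace i j"
  shows "open {z. base z \<in> A}" "bounded {z. base z \<in> A}"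
    and "\<exists>r0>0. \<forall>z. base z \<in> A \<longrightarrow> r0 \<le> rad z"
proof -
  obtain T where T: "open T" "A = ({0<..} \<times> yspace i j) \<inter> T" using A by (auto simp: openin_open)
  have "{z. base z \<in> A} = base -` T \<inter> {z. 0 < rad z}" using base_mem_iff by (auto simp: T(2))
  moreover have "open (base -` T)" using T(1) continuous_on_base[of UNIV] by (simp add: continuous_on_open_vimage)
  moreover have "open {z. 0 < rad z}"
    unfolding rad_def by (intro open_Collect_less continuous_intros)
  ultimately show "open {z. base z \<in> A}" by auto
  obtain M where M: "\<And>q. q \<in> closure A \<Longrightarrow> norm q \<le> M" using compact_imp_bounded[OF c] by (auto simp: bounded_iff)
  show "bounded {z. base z \<in> A}"
    unfolding bounded_iff
  proof (intro exI ballI)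
    fix z assume "z \<in> {z. base z \<in> A}"
    then have n: "norm (base z) \<le> M" using M closure_subset[of A] by blast
    have "\<bar>z $ k\<bar> \<le> M" for k
    proof -
      have "\<bar>rad z\<bar> \<le> norm (base z)" "norm (ypart i j z) \<le> norm (base z)"
        using norm_fst_le[of "rad z" "ypart i j z"] norm_snd_le[of "ypart i j z" "rad z"]
        by (simp_all add: base_def)
      moreover have "\<bar>ypart i j z $ k\<bar> \<le> norm (ypart i j z)" by (rule component_le_norm_cart)
      moreover have "k = i \<or> k = j \<or> ypart i j z $ k = z $ k" by (auto simp: ypart_def)
      ultimately show ?thesis using abs_nth_le_rad[of z] n by fastforce
    qed
    then have "(\<Sum>k\<in>UNIV. \<bar>z $ k\<bar>) \<le> (\<Sum>k\<in>(UNIV :: 'n set). M)" by (intro sum_mono)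
    then show "norm z \<le> (\<Sum>k\<in>(UNIV :: 'n set). M)" using norm_le_l1_cart[of z] by linarith
  qed
  show "\<exists>r0>0. \<forall>z. base z \<in> A \<longrightarrow> r0 \<le> rad z"
  proof (cases "A = {}")
    case False
    then have "closure A \<noteq> {}" by simp
    then obtain q where q: "q \<in> closure A" "\<And>q'. q' \<in> closure A \<Longrightarrow> fst q \<le> fst q'"
      using continuous_attains_inf[OF c, of fst] continuous_on_fst[OF continuous_on_id] by blast
    have "0 < fst q" using q(1) sub by auto
    moreover have "fst q \<le> rad z" if "base z \<in> A" for z
      using q(2)[of "base z"] that closure_subset[of A] by (auto simp: base_def)
    ultimately show ?thesis by blast
  qed (auto intro: exI[of _ 1])
qed

text \<open>Openness of \<open>Pi_proj i j E\<close> with local compactness: a point of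
  \<open>E\<close> on the circle stays in \<open>E\<close> when radius and y vary slightly, and an
  open set that meets a circle meets it in positive length.\<close>

lemma cylinder_neighbourhood:
  assumes E: "open E" and z: "0 < rad z" "0 < arc E z"
  obtains A where "openin (top_of_set ({0<..} \<times> yspace i j)) A" "compact (closure A)"
    "closure A \<subseteq> Pi_proj i j E" "base z \<in> A"
proof -
  have "{\<theta>. R \<theta> z \<in> E} \<noteq> {}" using z(2) unfolding arc_def by (metis measure_empty less_irrefl)
  then obtain a where x: "R a z \<in> E" by auto
  define x where "x = R a z"
  have rx: "0 < rad x" "base x = base z" using z(1) by (simp_all add: x_def rad_rot base_rot)
  \<comment> \<open>A continuous section of \<open>base\<close> through \<open>x\<close>: the
    direction of the planar part of \<open>x\<close> is kept, while radius and y-part are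
    prescribed.\<close>
  define e where "e q = (fst q / rad x) *\<^sub>R plane_part i j x + snd q" for q
  have ce: "continuous_on UNIV e" unfolding e_def[abs_def] by (intro continuous_intros) (use rx in auto)
  have be: "base (e q) = q" if q: "q \<in> {0<..} \<times> yspace i j" for q
  proof -
    have y: "snd q $ i = 0" "snd q $ j = 0" "0 < fst q" using q by (auto simp: yspace_def)
    have nth: "e q $ i = fst q / rad x * x $ i" "e q $ j = fst q / rad x * x $ j"
      using ij by (simp_all add: e_def plane_part_def y)
    have "(rad (e q))\<^sup>2 = (fst q / rad x)\<^sup>2 * (rad x)\<^sup>2"
      unfolding rad_sq nth by (simp only: power_mult_distrib distrib_left)
    also have "\<dots> = (fst q)\<^sup>2" using rx by (simp add: power_divide)
    finally have "rad (e q) = fst q" using y by (simp add: rad_def)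
    moreover have "ypart i j (e q) = snd q"
      using y by (auto simp: vec_eq_iff ypart_def e_def plane_part_def)
    ultimately show ?thesis by (simp add: base_def)
  qed
  have ex: "e (base z) = x"
    using rx(1) unfolding rx(2)[symmetric] by (auto simp: e_def base_def vec_eq_iff plane_part_def ypart_def)
  have proj: "q \<in> Pi_proj i j E" if q: "q \<in> {0<..} \<times> yspace i j" "e q \<in> E" for q
  proof -
    have "open {\<theta>. R \<theta> (e q) \<in> E}" by (rule open_circle[OF E])
    moreover have "0 \<in> {\<theta>. R \<theta> (e q) \<in> E}" using q(2) by (simp add: rot_0)
    ultimately obtain d where d: "0 < d" "ball 0 d \<subseteq> {\<theta>. R \<theta> (e q) \<in> E}"
      unfolding open_contains_ball by blast
    define b where "b = min d (2 * pi)"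
    have b: "0 < b" "b \<le> 2 * pi" using d by (auto simp: b_def)
    have "ennreal b = emeasure circle_measure {0<..<b}"
    proof -
      have "{0..<2 * pi} \<inter> {0<..<b} = {0<..<b}" using b by auto
      then show ?thesis using b by (simp add: emeasure_circle_measure)
    qed
    also have "\<dots> \<le> emeasure circle_measure {\<theta>. R \<theta> (e q) \<in> E}"
    proof (rule emeasure_mono)
      have "{0<..<b} \<subseteq> ball 0 d" by (simp add: b_def subset_eq dist_real_def)
      then show "{0<..<b} \<subseteq> {\<theta>. R \<theta> (e q) \<in> E}" using d(2) by (rule subset_trans)
    qed (use sets_circle[OF E] in simp)
    finally have "ennreal b \<le> ennreal (arc E (e q))" unfolding arc_def circle.emeasure_eq_measure .
    then have "b \<le> arc E (e q)" using arc_bounds(1)[of E "e q"] by (simp only: ennreal_le_iff)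
    then have "0 < arc E (e q)" using b(1) by linarith
    moreover have "0 < rad (e q)" using be[OF q(1)] q(1) base_mem_iff[of "e q"] by simp
    ultimately have "hausdorff1 (slice i j E (base (e q))) \<noteq> 0"
      by (simp add: hausdorff1_slice_open[OF E])
    then show ?thesis using q(1) be[OF q(1)] by (simp add: Pi_proj_def)
  qed
  have "open (e -` E)" using ce E by (simp add: continuous_on_open_vimage)
  then have "open (e -` E \<inter> {0<..} \<times> UNIV)" by (intro open_Int open_Times) auto
  moreover have "base z \<in> e -` E \<inter> {0<..} \<times> UNIV" using ex x z(1) by (simp add: x_def base_def)
  ultimately obtain \<delta> where \<delta>: "0 < \<delta>" "cball (base z) \<delta> \<subseteq> e -` E \<inter> {0<..} \<times> UNIV"
    using open_contains_cball_eq[of "e -` E \<inter> {0<..} \<times> UNIV"] by metis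
  let ?S = "cball (base z) \<delta> \<inter> UNIV \<times> yspace i j"
  define A where "A = ({0<..} \<times> yspace i j) \<inter> ball (base z) \<delta>"
  have "closed (yspace i j)"
  proof -
    have "yspace i j = {y. y $ i = 0} \<inter> {y. y $ j = 0}" by (auto simp: yspace_def)
    then show ?thesis by (auto intro!: closed_Int closed_Collect_eq continuous_intros)
  qed
  then have cS: "closed ?S" by (intro closed_Int closed_Times) auto
  have "A \<subseteq> ?S" by (auto simp: A_def)
  then have cl: "closure A \<subseteq> ?S" using cS by (rule closure_minimal)
  show ?thesis
  proof (rule that)
    show "openin (top_of_set ({0<..} \<times> yspace i j)) A" unfolding A_def by (rule openin_open_Int) simp
    show "compact (closure A)"
      unfolding compact_eq_bounded_closed using bounded_subset[OF bounded_cball, of "closure A" "base z" \<delta>] cl by auto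
    show "closure A \<subseteq> Pi_proj i j E"
    proof
      fix q assume "q \<in> closure A"
      then have q: "q \<in> ?S" using cl by blast
      then have "q \<in> e -` E \<inter> {0<..} \<times> UNIV" using \<delta>(2) by blast
      then show "q \<in> Pi_proj i j E" using q by (intro proj) auto
    qed
    show "base z \<in> A" using \<delta>(1) z(1) by (simp add: A_def base_mem_iff del: mem_Sigma_iff)
  qed
qed

lemma Pi_subset: "Pi_proj i j E \<subseteq> {0<..} \<times> yspace i j" "Pi_full i j E \<subseteq> {0<..} \<times> yspace i j"
  by (auto simp: Pi_proj_def Pi_full_def)

section \<open>The circular rearrangement on cylinders\<close>

lemma circ_rearr_base:
  "circ_rearr i j (distribution i j E u) z =
     Inf (ereal ` {t. hausdorff1 (slice i j {x. base x \<in> Pi_proj i j E \<and> t < zero_ext E u x} (base z))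
       \<le> ennreal (2 * rad z * ang z)})"
  by (simp add: circ_rearr_def distribution_def norm_xpart arc_len_xpart Phi_image[OF Pi_subset(1)] base_def[of z, symmetric])

text \<open>The factor \<open>rad z\<close> cancels in the defining inequality; off the axis the
  level set is nonempty and bounded below, so the extended infimum is the real one.\<close>

lemma circ_rearr_eq_rearr:
  assumes w: "w \<in> borel_measurable borel" and z: "z $ j \<noteq> 0" "base z \<in> Pi_proj i j E"
    and AE: "AE \<theta> in circle_measure. zero_ext E u (R \<theta> z) = w (R \<theta> z)"
  shows "circ_rearr i j (distribution i j E u) z = ereal (rearr w z)"
proof -
  note r = rad_pos[OF z(1)]
  note w[measurable]
  have "hausdorff1 (slice i j {x. base x \<in> Pi_proj i j E \<and> t < zero_ext E u x} (base z))
      = ennreal (rad z * circ_m w z t)" for t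
    unfolding circ_m_def
    by (rule hausdorff1_slice_eq[OF r]) (measurable, use AE z(2) in \<open>auto simp: base_rot elim: eventually_mono\<close>)
  moreover have "ennreal (rad z * circ_m w z t) \<le> ennreal (2 * rad z * ang z) \<longleftrightarrow> circ_m w z t \<le> 2 * ang z" for t
  proof -
    have "ennreal (rad z * circ_m w z t) \<le> ennreal (2 * rad z * ang z) \<longleftrightarrow> rad z * circ_m w z t \<le> rad z * (2 * ang z)"
      using r ang_bounds(1)[of z] by (subst ennreal_le_iff) (auto simp: ac_simps)
    then show ?thesis using r by simp
  qed
  ultimately have "circ_rearr i j (distribution i j E u) z = Inf (ereal ` {t. circ_m w z t \<le> 2 * ang z})"
    unfolding circ_rearr_base by simp
  also have "\<dots> = ereal (Inf {t. circ_m w z t \<le> 2 * ang z})"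
    using circ_m_level_set[OF w, of "2 * ang z"] ang_bounds(3,4)[OF z(1)] by (intro ereal_Inf'[symmetric]) auto
  finally show ?thesis using z(1) by (simp add: rearr_def)
qed

text \<open>A circle of full measure keeps all its points under symmetrization except the one at
  angle pi, which lies on the excluded axis.\<close>

lemma not_full:
  assumes "open E" "z $ j \<noteq> 0" "z \<notin> circ_sym i j E"
  shows "base z \<notin> Pi_full i j E"
proof
  assume "base z \<in> Pi_full i j E"
  then have "ennreal (rad z * arc E z) = ennreal (2 * pi * rad z)"
    using hausdorff1_slice_open[OF assms(1) rad_pos[OF assms(2)]] by (simp add: Pi_full_def base_def)
  then have "rad z * arc E z = rad z * (2 * pi)"
    using rad_pos[OF assms(2)] arc_bounds(1)[of E z] by (subst (asm) ennreal_inj) (auto simp: ac_simps)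
  then have "arc E z = 2 * pi" using rad_pos[OF assms(2)] by simp
  then show False using assms(3) rad_pos[OF assms(2)] ang_bounds(4)[OF assms(2)]
    by (simp add: circ_sym_open_iff[OF assms(1)])
qed

text \<open>For levels s >= 0 the superlevel set lies, up to a null set, in the slice of
  \<open>E\<close>, of angular measure at most \<open>2 * ang z\<close>; for s < 0 nonnegativity
  makes it almost the whole circle.\<close>

lemma rearr_eq_0_outside_circ_sym:
  assumes w: "w \<in> borel_measurable borel" and E: "open E" and z: "z $ j \<noteq> 0" "z \<notin> circ_sym i j E"
    and AE: "AE \<theta> in circle_measure. zero_ext E u (R \<theta> z) = w (R \<theta> z)"
    and pos: "AE \<theta> in circle_measure. 0 \<le> zero_ext E u (R \<theta> z)"
  shows "rearr w z = 0"
proof -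
  note w[measurable]
  have le: "circ_m w z s \<le> 2 * ang z" if "0 \<le> s" for s
  proof -
    have "circ_m w z s \<le> arc E z"
      unfolding circ_m_def arc_def
    proof (rule circle.finite_measure_mono_AE)
      show "AE \<theta> in circle_measure. \<theta> \<in> {\<theta>. s < w (R \<theta> z)} \<longrightarrow> \<theta> \<in> {\<theta>. R \<theta> z \<in> E}"
        using AE by eventually_elim (use that in \<open>auto simp: zero_ext_def split: if_splits\<close>)
    qed (use sets_circle[OF E] in auto)
    also have "\<dots> \<le> 2 * ang z" using z rad_pos[OF z(1)] by (simp add: circ_sym_open_iff[OF E])
    finally show ?thesis .
  qed
  have gt: "2 * ang z < circ_m w z s" if "s < 0" for s
  proof -
    have "circ_m w z s = measure circle_measure UNIV"
      unfolding circ_m_def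
    proof (rule measure_eq_AE)
      show "AE \<theta> in circle_measure. \<theta> \<in> {\<theta>. s < w (R \<theta> z)} \<longleftrightarrow> \<theta> \<in> UNIV"
        using AE pos by eventually_elim (use that in auto)
      have "{\<theta>. s < w (R \<theta> z)} \<in> sets borel" by measurable
      then show "{\<theta>. s < w (R \<theta> z)} \<in> sets circle_measure" by simp
    qed simp
    also have "\<dots> = 2 * pi" by (simp add: measure_def emeasure_circle_measure_UNIV)
    finally show ?thesis using ang_bounds(4)[OF z(1)] by simp
  qed
  have "s < rearr w z \<longleftrightarrow> s < 0" for s
    using less_rearr_iff[OF w z(1), of s] le[of s] gt[of s] by fastforce
  then show ?thesis by (metis less_irrefl linorder_neqE)
qed

end

lemma in_W1p_borel_representative:
  fixes f :: "real ^ 'n::finite \<Rightarrow> real"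
  assumes V: "open V" "bounded V" and p: "1 \<le> p" and f: "in_W1p p V f"
  obtains w g where "w \<in> borel_measurable borel" "\<And>z. z \<notin> V \<Longrightarrow> w z = 0"
    "AE z in lborel. z \<in> V \<longrightarrow> f z = w z"
    "integrable lborel w" "integrable lborel (\<lambda>z. \<bar>w z\<bar> powr p)"
    "\<And>k. integrable lborel (g k)" "\<And>k. integrable lborel (\<lambda>z. \<bar>g k z\<bar> powr p)"
    "\<And>k z. z \<notin> V \<Longrightarrow> g k z = 0" "weak_grad V w g"
proof -
  have VB: "V \<in> sets borel" using V by auto
  have fL: "in_Lp p V f" using f by (simp add: in_W1p_def)
  obtain w where w: "w \<in> borel_measurable borel" "\<And>z. z \<notin> V \<Longrightarrow> w z = 0"
    "AE z in lborel. z \<in> V \<longrightarrow> f z = w z"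
    "integrable lborel w" "integrable lborel (\<lambda>z. \<bar>w z\<bar> powr p)"
    by (rule in_Lp_borel_representative[OF V p fL]) (rule that)
  have "\<exists>g :: real ^ 'n \<Rightarrow> real. integrable lborel g \<and> integrable lborel (\<lambda>z. \<bar>g z\<bar> powr p) \<and> (\<forall>z. z \<notin> V \<longrightarrow> g z = 0) \<and>
      (\<forall>\<phi>. test_function V \<phi> \<longrightarrow> (LINT z|lborel. w z * dpart \<phi> z $ k) = - (LINT z|lborel. g z * \<phi> z))" for k
  proof -
    obtain h where h: "in_Lp p V h" "weak_partial V k f h" using f unfolding in_W1p_def by blast
    obtain g where g: "g \<in> borel_measurable borel" "\<And>z. z \<notin> V \<Longrightarrow> g z = 0"
      "AE z in lborel. z \<in> V \<longrightarrow> h z = g z"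
      "integrable lborel g" "integrable lborel (\<lambda>z. \<bar>g z\<bar> powr p)"
      by (rule in_Lp_borel_representative[OF V p h(1)]) (rule that)
    have "(LINT z|lborel. w z * dpart \<phi> z $ k) = - (LINT z|lborel. g z * \<phi> z)" if t: "test_function V \<phi>" for \<phi>
    proof -
      have [measurable]: "\<phi> \<in> borel_measurable borel" "(\<lambda>z. dpart \<phi> z $ k) \<in> borel_measurable borel"
        using test_function_measurable[OF t] test_function_measurable[OF test_function_dpart[OF t]] .
      note w(1)[measurable] g(1)[measurable]
      have "(LINT z|lborel. w z * dpart \<phi> z $ k)
          = integral\<^sup>L (lebesgue_on V) (\<lambda>z. f z * frechet_derivative \<phi> (at z) (axis k 1))"
      proof (rule lebesgue_on_transfer(3)[OF VB, symmetric])
        show "AE z in lborel. z \<in> V \<longrightarrow> f z * frechet_derivative \<phi> (at z) (axis k 1) = w z * dpart \<phi> z $ k"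
          using w(3) by eventually_elim (simp add: dpart_nth)
      qed (use w(2) in auto)
      also have "\<dots> = - integral\<^sup>L (lebesgue_on V) (\<lambda>z. h z * \<phi> z)"
        using h(2) t unfolding weak_partial_def by blast
      also have "integral\<^sup>L (lebesgue_on V) (\<lambda>z. h z * \<phi> z) = (LINT z|lborel. g z * \<phi> z)"
      proof (rule lebesgue_on_transfer(3)[OF VB])
        show "AE z in lborel. z \<in> V \<longrightarrow> h z * \<phi> z = g z * \<phi> z" using g(3) by eventually_elim simp
      qed (use g(2) in auto)
      finally show ?thesis .
    qed
    then show ?thesis using g by blast
  qed
  then obtain g :: "'n \<Rightarrow> real ^ 'n \<Rightarrow> real" where
    "\<forall>k. integrable lborel (g k) \<and> integrable lborel (\<lambda>z. \<bar>g k z\<bar> powr p) \<and> (\<forall>z. z \<notin> V \<longrightarrow> g k z = 0) \<and>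
      (\<forall>\<phi>. test_function V \<phi> \<longrightarrow> (LINT z|lborel. w z * dpart \<phi> z $ k) = - (LINT z|lborel. g k z * \<phi> z))"
    using choice[of "\<lambda>k g. integrable lborel g \<and> integrable lborel (\<lambda>z. \<bar>g z\<bar> powr p) \<and> (\<forall>z. z \<notin> V \<longrightarrow> g z = 0) \<and>
      (\<forall>\<phi>. test_function V \<phi> \<longrightarrow> (LINT z|lborel. w z * dpart \<phi> z $ k) = - (LINT z|lborel. g z * \<phi> z))"] by blast
  then show ?thesis by (intro that[OF w, of g]) (unfold weak_grad_def, blast+)
qed

lemma in_W1pI_borel:
  fixes f :: "real ^ 'n::finite \<Rightarrow> real"
  assumes V: "open V" and p: "1 \<le> p"
    and w: "integrable lborel w" "integrable lborel (\<lambda>z. \<bar>w z\<bar> powr p)" "\<And>z. z \<notin> V \<Longrightarrow> w z = 0"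
    and fw: "AE z in lborel. z \<in> V \<longrightarrow> f z = w z"
    and g: "\<And>k. \<exists>g'. integrable lborel g' \<and> integrable lborel (\<lambda>z. \<bar>g' z\<bar> powr p) \<and>
      (\<forall>\<phi>. test_function V \<phi> \<longrightarrow> (LINT z|lborel. w z * dpart \<phi> z $ k) = - (LINT z|lborel. g' z * \<phi> z))"
  shows "in_W1p p V f"
proof -
  have VB[measurable]: "V \<in> sets borel" using V by auto
  have wm[measurable]: "w \<in> borel_measurable borel" using w(1) by auto
  have "\<exists>h. in_Lp p V h \<and> weak_partial V k f h" for k
  proof -
    obtain g' where g': "integrable lborel g'" "integrable lborel (\<lambda>z. \<bar>g' z\<bar> powr p)"
      "\<And>\<phi>. test_function V \<phi> \<Longrightarrow> (LINT z|lborel. w z * dpart \<phi> z $ k) = - (LINT z|lborel. g' z * \<phi> z)"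
      using g[of k] by blast
    have [measurable]: "g' \<in> borel_measurable borel" using g'(1) by auto
    \<comment> \<open>\<open>g'\<close> need not vanish off \<open>V\<close>; cutting it off leaves
      the integrals against test functions unchanged.\<close>
    define h where "h z = indicator V z * g' z" for z
    have [measurable]: "h \<in> borel_measurable borel" unfolding h_def[abs_def] by measurable
    have "integrable lborel (\<lambda>z. \<bar>h z\<bar> powr p)"
    proof (rule Bochner_Integration.integrable_bound[OF g'(2)])
      show "AE z in lborel. norm (\<bar>h z\<bar> powr p) \<le> norm (\<bar>g' z\<bar> powr p)"
        using p by (intro AE_I2) (auto simp: h_def indicator_def)
    qed simp
    then have "in_Lp p V h" by (rule in_LpI_borel[OF VB _ p]) (auto simp: h_def)
    moreover have "weak_partial V k f h"
      unfolding weak_partial_def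
    proof (intro allI impI)
      fix \<phi> assume t: "test_function V \<phi>"
      have [measurable]: "\<phi> \<in> borel_measurable borel" "(\<lambda>z. dpart \<phi> z $ k) \<in> borel_measurable borel"
        using test_function_measurable[OF t] test_function_measurable[OF test_function_dpart[OF t]] .
      have "integral\<^sup>L (lebesgue_on V) (\<lambda>z. f z * frechet_derivative \<phi> (at z) (axis k 1))
          = (LINT z|lborel. w z * dpart \<phi> z $ k)"
      proof (rule lebesgue_on_transfer(3)[OF VB])
        show "AE z in lborel. z \<in> V \<longrightarrow> f z * frechet_derivative \<phi> (at z) (axis k 1) = w z * dpart \<phi> z $ k"
          using fw by eventually_elim (simp add: dpart_nth)
      qed (use w(3) in auto)
      also have "\<dots> = - (LINT z|lborel. g' z * \<phi> z)" by (rule g'(3)[OF t])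
      also have "(LINT z|lborel. g' z * \<phi> z) = integral\<^sup>L (lebesgue_on V) (\<lambda>z. h z * \<phi> z)"
        by (rule lebesgue_on_transfer(3)[OF VB, symmetric]) (auto simp: h_def test_function_eq_0[OF t])
      finally show "integral\<^sup>L (lebesgue_on V) (\<lambda>z. f z * frechet_derivative \<phi> (at z) (axis k 1))
          = - integral\<^sup>L (lebesgue_on V) (\<lambda>z. h z * \<phi> z)" .
    qed
    ultimately show ?thesis by blast
  qed
  moreover have "in_Lp p V f" by (rule in_LpI_borel[OF VB w(2) p wm w(3) fw])
  ultimately show ?thesis unfolding in_W1p_def by blast
qed

context plane begin

text \<open>On a circle that is not full, points of \<open>E\<close> are subject to the sign
  condition and all other points carry the value 0 of the extension.\<close>

lemma AE_nonneg_on_circles: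
  assumes "AE z in lebesgue. z \<in> E - Phi i j ` (Pi_full i j E \<times> sphere 0 1) \<longrightarrow> 0 \<le> u z"
  shows "AE z in lborel. base z \<notin> Pi_full i j E \<longrightarrow> (AE \<theta> in circle_measure. 0 \<le> zero_ext E u (R \<theta> z))"
proof -
  have "AE z in lborel. z \<in> E - {z. base z \<in> Pi_full i j E} \<longrightarrow> 0 \<le> u z"
    using assms unfolding AE_completion_iff Phi_image[OF Pi_subset(2)] .
  from AE_circle_if_AE[OF this] show ?thesis
  proof eventually_elim
    case (elim z)
    show ?case
    proof
      assume nf: "base z \<notin> Pi_full i j E"
      show "AE \<theta> in circle_measure. 0 \<le> zero_ext E u (R \<theta> z)"
        using elim by eventually_elim (use nf in \<open>auto simp: zero_ext_def base_rot\<close>)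
    qed
  qed
qed

lemma circ_rearr_on_cylinder:
  assumes p: "1 \<le> p" and E: "open E" and u: "in_W1p_0tau i j p E u"
    and A: "openin (top_of_set ({0<..} \<times> yspace i j)) A" "compact (closure A)" "closure A \<subseteq> Pi_proj i j E"
  shows "AE z in lborel. base z \<in> A \<longrightarrow> \<bar>circ_rearr i j (distribution i j E u) z\<bar> \<noteq> \<infinity>"
    and "in_W1p p {z. base z \<in> A} (zero_ext (circ_sym i j E)
      (\<lambda>z. real_of_ereal (circ_rearr i j (distribution i j E u) z)))"
proof -
  let ?V = "{z. base z \<in> A}"
  have A0: "A \<subseteq> Pi_proj i j E" "A \<subseteq> {0<..} \<times> yspace i j" "closure A \<subseteq> {0<..} \<times> yspace i j"
    using A(3) closure_subset[of A] Pi_subset(1)[of E] by blast+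
  note V = cylinder(1,2)[OF A(1,2) A0(3)]
  obtain r0 where r0: "0 < r0" "\<And>z. z \<in> ?V \<Longrightarrow> r0 \<le> rad z"
    using cylinder(3)[OF A(1,2) A0(3)] by blast
  have inv: "R \<theta> z \<in> ?V \<longleftrightarrow> z \<in> ?V" for \<theta> z by (simp add: base_rot)
  have "in_W1p p ?V (zero_ext E u)"
    using u A unfolding in_W1p_0tau_def Phi_image[OF A0(2), symmetric] by blast
  then obtain w g where w: "w \<in> borel_measurable borel" "\<And>z. z \<notin> ?V \<Longrightarrow> w z = 0"
    "AE z in lborel. z \<in> ?V \<longrightarrow> zero_ext E u z = w z"
    "integrable lborel w" "integrable lborel (\<lambda>z. \<bar>w z\<bar> powr p)"
    and g: "\<And>k. integrable lborel (g k)" "\<And>k. integrable lborel (\<lambda>z. \<bar>g k z\<bar> powr p)"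
    "\<And>k z. z \<notin> ?V \<Longrightarrow> g k z = 0" and wg: "weak_grad ?V w g"
    by (rule in_W1p_borel_representative[OF V p]) (rule that)
  have pos: "AE z in lborel. base z \<notin> Pi_full i j E \<longrightarrow> (AE \<theta> in circle_measure. 0 \<le> zero_ext E u (R \<theta> z))"
    using u unfolding in_W1p_0tau_def by (intro AE_nonneg_on_circles) blast
  have circ: "AE z in lborel. z \<in> ?V \<longrightarrow> (AE \<theta> in circle_measure. zero_ext E u (R \<theta> z) = w (R \<theta> z))"
    using AE_circle_if_AE[OF w(3)]
  proof eventually_elim
    case (elim z)
    show ?case
    proof
      assume z: "z \<in> ?V"
      show "AE \<theta> in circle_measure. zero_ext E u (R \<theta> z) = w (R \<theta> z)"
        using elim by eventually_elim (use z in \<open>simp add: base_rot\<close>)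
    qed
  qed
  have eq: "AE z in lborel. z \<in> ?V \<longrightarrow> circ_rearr i j (distribution i j E u) z = ereal (rearr w z)"
    using circ AE_off_axis
  proof eventually_elim
    case (elim z)
    then show ?case using circ_rearr_eq_rearr[OF w(1), of z E u] A0(1) by blast
  qed
  then show "AE z in lborel. base z \<in> A \<longrightarrow> \<bar>circ_rearr i j (distribution i j E u) z\<bar> \<noteq> \<infinity>"
    by eventually_elim auto
  \<comment> \<open>Inside the symmetrized set this is \<open>eq\<close>. Outside it the extension
    is 0, and off the axis the circle is not full, so the sign of \<open>u\<close> makes
    \<open>rearr w\<close> vanish as well.\<close>
  have ext: "AE z in lborel. z \<in> ?V \<longrightarrow>
      zero_ext (circ_sym i j E) (\<lambda>z. real_of_ereal (circ_rearr i j (distribution i j E u) z)) z = rearr w z"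
    using eq circ AE_off_axis pos
  proof eventually_elim
    case (elim z)
    show ?case
    proof
      assume z: "z \<in> ?V"
      show "zero_ext (circ_sym i j E) (\<lambda>z. real_of_ereal (circ_rearr i j (distribution i j E u) z)) z = rearr w z"
      proof (cases "z \<in> circ_sym i j E")
        case True
        then show ?thesis using elim(1) z by (simp add: zero_ext_def)
      next
        case False
        have "base z \<notin> Pi_full i j E" by (rule not_full[OF E elim(3) False])
        then have "rearr w z = 0"
          using elim(2,4) z by (intro rearr_eq_0_outside_circ_sym[OF w(1) E elim(3) False, of u]) auto
        then show ?thesis using False by (simp add: zero_ext_def)
      qed
    qed
  qed
  note rw = rearr_weak_gradient[OF p V inv r0 w(4,5,2) g wg]
  show "in_W1p p ?V (zero_ext (circ_sym i j E)
      (\<lambda>z. real_of_ereal (circ_rearr i j (distribution i j E u) z)))"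
  proof (rule in_W1pI_borel[OF V(1) p _ _ _ ext])
    show "integrable lborel (rearr w)" by (rule rw(1)) (assumption | rule refl)+
    show "integrable lborel (\<lambda>z. \<bar>rearr w z\<bar> powr p)" by (rule rw(2)) (assumption | rule refl)+
    show "rearr w z = 0" if "z \<notin> ?V" for z
      by (rule rearr_outside[OF w(1)]) (use w(2) inv that in blast)
    show "\<exists>g'. integrable lborel g' \<and> integrable lborel (\<lambda>z. \<bar>g' z\<bar> powr p) \<and>
      (\<forall>\<phi>. test_function ?V \<phi> \<longrightarrow> (LINT z|lborel. rearr w z * dpart \<phi> z $ k) = - (LINT z|lborel. g' z * \<phi> z))" for k
      by (rule rw(3)) (assumption | rule refl)+
  qed
qed

text \<open>Every point of the symmetrized set has an open cylinder around it on which the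
  exceptional set is null, and local negligibility implies negligibility.\<close>

lemma circ_rearr_AE_finite:
  assumes p: "1 \<le> p" and E: "open E" and u: "in_W1p_0tau i j p E u"
  shows "AE z in lebesgue. z \<in> circ_sym i j E \<longrightarrow> \<bar>circ_rearr i j (distribution i j E u) z\<bar> \<noteq> \<infinity>"
proof -
  let ?N = "{z \<in> circ_sym i j E. \<bar>circ_rearr i j (distribution i j E u) z\<bar> = \<infinity>}"
  have "negligible ?N"
    unfolding locally_negligible_alt[of ?N]
  proof
    fix z assume "z \<in> ?N"
    then have "0 < rad z" "2 * ang z < arc E z" using circ_sym_open_iff[OF E] by auto
    then have z: "0 < rad z" "0 < arc E z" using ang_bounds(1)[of z] by linarith+
    obtain A where A: "openin (top_of_set ({0<..} \<times> yspace i j)) A" "compact (closure A)"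
      "closure A \<subseteq> Pi_proj i j E" "base z \<in> A"
      by (rule cylinder_neighbourhood[OF E z])
    have "AE z in lborel. base z \<in> A \<longrightarrow> \<bar>circ_rearr i j (distribution i j E u) z\<bar> \<noteq> \<infinity>"
      by (rule circ_rearr_on_cylinder(1)[OF p E u A(1-3)])
    then have "AE z in lebesgue. \<not> (base z \<in> A \<and> \<bar>circ_rearr i j (distribution i j E u) z\<bar> = \<infinity>)"
      unfolding AE_completion_iff by eventually_elim simp
    then obtain N where N: "N \<in> null_sets lebesgue"
      "{z. base z \<in> A \<and> \<bar>circ_rearr i j (distribution i j E u) z\<bar> = \<infinity>} \<subseteq> N"
      unfolding eventually_ae_filter by auto
    have "negligible (?N \<inter> {z. base z \<in> A})"
    proof (rule negligible_subset)
      show "negligible N" using N(1) unfolding negligible_iff_null_sets .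
      have "?N \<inter> {z. base z \<in> A} \<subseteq> {z. base z \<in> A \<and> \<bar>circ_rearr i j (distribution i j E u) z\<bar> = \<infinity>}" by auto
      then show "?N \<inter> {z. base z \<in> A} \<subseteq> N" using N(2) by (rule subset_trans)
    qed
    moreover have "z \<in> ?N \<inter> {z. base z \<in> A}" using \<open>z \<in> ?N\<close> A(4) by (rule IntI[OF _ CollectI])
    moreover have "open {z. base z \<in> A}"
      using A(3) Pi_subset(1)[of E] by (intro cylinder(1)[OF A(1,2)]) blast
    then have "openin (top_of_set ?N) (?N \<inter> {z. base z \<in> A})" by (rule openin_open_Int)
    ultimately show "\<exists>U. openin (top_of_set ?N) U \<and> z \<in> U \<and> negligible U"
      by (intro exI[of _ "?N \<inter> {z. base z \<in> A}"] conjI)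
  qed
  then have "?N \<in> null_sets lebesgue" by (simp add: negligible_iff_null_sets)
  then show ?thesis by (rule AE_I') auto
qed

text \<open>For negative \<open>t\<close> the superlevel slice is almost the whole circle, so
  \<open>t\<close> in the level set would force \<open>ang z\<close> to be at least pi. Passing to
  real values sends infinity to 0 and keeps the sign.\<close>

lemma circ_rearr_AE_nonneg:
  assumes E: "open E"
    and "AE z in lebesgue. z \<in> E - Phi i j ` (Pi_full i j E \<times> sphere 0 1) \<longrightarrow> 0 \<le> u z"
  shows "AE z in lebesgue. z \<in> circ_sym i j E - Phi i j ` (Pi_full i j E \<times> sphere 0 1)
    \<longrightarrow> 0 \<le> real_of_ereal (circ_rearr i j (distribution i j E u) z)"
  unfolding AE_completion_iff Phi_image[OF Pi_subset(2)]
  using AE_nonneg_on_circles[OF assms(2)] AE_off_axis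
proof eventually_elim
  case (elim z)
  show ?case
  proof
    assume z: "z \<in> circ_sym i j E - {z. base z \<in> Pi_full i j E}"
    note r = rad_pos[OF elim(2)]
    have pos: "AE \<theta> in circle_measure. 0 \<le> zero_ext E u (R \<theta> z)" using elim(1) z by blast
    have P: "base z \<in> Pi_proj i j E"
      using z r by (auto simp: Pi_proj_def base_mem_iff circ_sym_iff simp del: mem_Sigma_iff)
    have "0 \<le> t" if t: "hausdorff1 (slice i j {x. base x \<in> Pi_proj i j E \<and> t < zero_ext E u x} (base z))
       \<le> ennreal (2 * rad z * ang z)" for t
    proof (rule ccontr)
      assume "\<not> 0 \<le> t"
      then have "AE \<theta> in circle_measure. \<theta> \<in> UNIV \<longrightarrow> R \<theta> z \<in> {x. base x \<in> Pi_proj i j E \<and> t < zero_ext E u x}"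
        using pos by eventually_elim (use P \<open>\<not> 0 \<le> t\<close> in \<open>simp add: base_rot\<close>)
      then have "ennreal (rad z) * emeasure circle_measure UNIV
          \<le> hausdorff1 (slice i j {x. base x \<in> Pi_proj i j E \<and> t < zero_ext E u x} (base z))"
        by (intro hausdorff1_slice_ge[OF r]) auto
      then have "ennreal (rad z * (2 * pi)) \<le> ennreal (2 * rad z * ang z)"
        using t r by (simp add: emeasure_circle_measure_UNIV ennreal_mult[symmetric])
      then have "rad z * (2 * pi) \<le> rad z * (2 * ang z)"
        using r ang_bounds(1)[of z] by (subst (asm) ennreal_le_iff) (auto simp: ac_simps)
      then have "pi \<le> ang z" using r by simp
      then show False using ang_bounds(4)[OF elim(2)] by simp
    qed
    then have "0 \<le> circ_rearr i j (distribution i j E u) z"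
      unfolding circ_rearr_base by (intro Inf_greatest) auto
    then show "0 \<le> real_of_ereal (circ_rearr i j (distribution i j E u) z)" by (rule real_of_ereal_pos)
  qed
qed

end

theorem corollary4p4:
  fixes i j :: "'n::finite" and \<Omega> :: "(real ^ 'n) set" and p :: real and u :: "real ^ 'n \<Rightarrow> real"
  assumes "i \<noteq> j"
    and "open \<Omega>"
    and "1 \<le> p"
    and "in_W1p_0tau i j p \<Omega> u"
  shows "ereal_in_W1p_0tau i j p (circ_sym i j \<Omega>) (circ_rearr i j (distribution i j \<Omega> u))"
proof -
  interpret plane i j by unfold_locales (rule assms(1))
  show ?thesis
    unfolding ereal_in_W1p_0tau_def in_W1p_0tau_def Pi_circ_sym[OF assms(2)]
  proof (intro conjI allI impI)
    show "AE z in lebesgue. z \<in> circ_sym i j \<Omega> \<longrightarrow> \<bar>circ_rearr i j (distribution i j \<Omega> u) z\<bar> \<noteq> \<infinity>"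
      by (rule circ_rearr_AE_finite[OF assms(3,2,4)])
    show "AE z in lebesgue. z \<in> circ_sym i j \<Omega> - Phi i j ` (Pi_full i j \<Omega> \<times> sphere 0 1)
        \<longrightarrow> 0 \<le> real_of_ereal (circ_rearr i j (distribution i j \<Omega> u) z)"
      using assms(4) unfolding in_W1p_0tau_def by (intro circ_rearr_AE_nonneg[OF assms(2)]) blast
    fix A
    assume "openin (top_of_set ({0<..} \<times> yspace i j)) A \<and> compact (closure A) \<and> closure A \<subseteq> Pi_proj i j \<Omega>"
    then have A: "openin (top_of_set ({0<..} \<times> yspace i j)) A" "compact (closure A)" "closure A \<subseteq> Pi_proj i j \<Omega>"
      by auto
    have "A \<subseteq> {0<..} \<times> yspace i j" using A(3) closure_subset[of A] Pi_subset(1)[of \<Omega>] by blast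
    then show "in_W1p p (Phi i j ` (A \<times> sphere 0 1))
        (zero_ext (circ_sym i j \<Omega>) (\<lambda>z. real_of_ereal (circ_rearr i j (distribution i j \<Omega> u) z)))"
      using circ_rearr_on_cylinder(2)[OF assms(3,2,4) A] by (simp only: Phi_image)
  qed
qed

end
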